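(* Let $\mathcal{A}$ be an AB4*-category, let $X:\Box^{op}\to\mathrm{Set}$ be a cubical set, and let $F:\Box/X\to\mathcal{A}$ be a covariant system of objects in $\mathcal{A}$ on $X$. Then there are isomorphisms $H^n(C_N^*(X,F))\cong\varprojlim^n_{\Box/X}F$ for all $n\ge 0$.
   Context: **AB4*-category.** An Abelian category with all small products in which products are exact (Grothendieck's axioms AB3*, AB4* ). **Satellites of the limit.** For a small category $\mathscr{C}$ and an AB4*-category $\mathcal{A}$, $\varprojlim^n_{\mathscr{C}}:\mathcal{A}^{\mathscr{C}}\to\mathcal{A}$, $n\ge0$, denote the right satellites (universal cohomological $\partial$-functor) of $\varprojlim_{\mathscr{C}}:\mathcal{A}^{\mathscr{C}}\to\mathcal{A}$; they exist and are computed by the cochain complex $\prod_{c_0\to\cdots\to c_n}F(c_n)$ with the usual alternating-sum differentials. **Cube category.** $\Box$ has objects $\mathbb{I}^n=\{0,1\}^n$, $n\ge 0$ (with the product order); its morphisms are all compositions of the maps $\delta_i^{k,\varepsilon}:\mathbb{I}^{k-1}\to\mathbb{I}^k$, $\delta_i^{k,\varepsilon}(x_1,\dots,x_{k-1})=(x_1,\dots,x_{i-1},\varepsilon,x_i,\dots,x_{k-1})$ and $\sigma_i^k:\mathbb{I}^k\to\mathbb{I}^{k-1}$, $\sigma^k_i(x_1,\dots,x_k)=(x_1,\dots,x_{i-1},x_{i+1},\dots,x_k)$ ($k\ge1$, $1\le i\le k$, $\varepsilon\in\{0,1\}$) (and identities). A cubical set is a functor $X:\Box^{op}\to\mathrm{Set}$,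 $X_n=X(\mathbb{I}^n)$. **Category $\Box/X$.** Objects: elements $x\in\coprod_n X_n$. For $y\in X_m$, $x\in X_n$, morphisms $y\to x$ are the $\alpha\in\Box(\mathbb{I}^m,\mathbb{I}^n)$ with $X(\alpha)(x)=y$. So $F:\Box/X\to\mathcal{A}$ gives morphisms $F(\alpha):F(X(\alpha)x)\to F(x)$. **Normalized cochain complex $C^*_N(X,F)$.** Put $C^n(X,F)=\prod_{x\in X_n}F(x)$ with projections $pr_x$. Define $d^i_{n,\varepsilon}:C^{n-1}(X,F)\to C^n(X,F)$ by $pr_x\circ d^i_{n,\varepsilon}=F(\delta_i^{n,\varepsilon})\circ pr_{X(\delta_i^{n,\varepsilon})x}$ for $x\in X_n$, and $s^i_n:C^n(X,F)\to C^{n-1}(X,F)$ by $pr_x\circ s^i_n=F(\sigma^n_i)\circ pr_{X(\sigma^n_i)x}$ for $x\in X_{n-1}$. Then $C^n_N(X,F)$ is the kernel of the morphism $C^n(X,F)\to C^{n-1}(X,F)^n$ with components $s^1_n,\dots,s^n_n$, and the differential $C^{n-1}_N(X,F)\to C^n_N(X,F)$ is the restriction of $\sum_{i=1}^n(-1)^i(d^i_{n,0}-d^i_{n,1})$. *)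

theory Defs
  imports "HOL-Algebra.FiniteProduct" "HOL-Library.FuncSet"
begin

section \<open>Categories and functors\<close>

record ('o, 'm) cat =
  Obj :: "'o set"
  Arr :: "'m set"
  Dom :: "'m \<Rightarrow> 'o"
  Cod :: "'m \<Rightarrow> 'o"
  Ident :: "'o \<Rightarrow> 'm"
  Comp :: "'m \<Rightarrow> 'm \<Rightarrow> 'm" (infixl "\<cdot>\<index>" 70)

definition Hom :: "('o, 'm, 'z) cat_scheme \<Rightarrow> 'o \<Rightarrow> 'o \<Rightarrow> 'm set" where
  "Hom C a b = {f \<in> Arr C. Dom C f = a \<and> Cod C f = b}"

locale category =
  fixes C :: "('o, 'm, 'z) cat_scheme" (structure)
  assumes dom_obj: "f \<in> Arr C \<Longrightarrow> Dom C f \<in> Obj C"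
    and cod_obj: "f \<in> Arr C \<Longrightarrow> Cod C f \<in> Obj C"
    and ident_hom: "a \<in> Obj C \<Longrightarrow> Ident C a \<in> Hom C a a"
    and comp_hom: "\<lbrakk>f \<in> Hom C a b; g \<in> Hom C b c\<rbrakk> \<Longrightarrow> g \<cdot> f \<in> Hom C a c"
    and ident_left: "f \<in> Hom C a b \<Longrightarrow> Ident C b \<cdot> f = f"
    and ident_right: "f \<in> Hom C a b \<Longrightarrow> f \<cdot> Ident C a = f"
    and comp_assoc: "\<lbrakk>f \<in> Hom C a b; g \<in> Hom C b c; h \<in> Hom C c d\<rbrakk>
      \<Longrightarrow> (h \<cdot> g) \<cdot> f = h \<cdot> (g \<cdot> f)"

definition op_cat :: "('o, 'm) cat \<Rightarrow> ('o, 'm) cat" where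
  "op_cat C = \<lparr>Obj = Obj C, Arr = Arr C, Dom = Cod C, Cod = Dom C, Ident = Ident C,
     Comp = (\<lambda>g f. f \<cdot>\<^bsub>C\<^esub> g)\<rparr>"

definition isomorphic :: "('o, 'm, 'z) cat_scheme \<Rightarrow> 'o \<Rightarrow> 'o \<Rightarrow> bool" where
  "isomorphic C a b \<longleftrightarrow> a \<in> Obj C \<and> b \<in> Obj C \<and>
     (\<exists>f \<in> Hom C a b. \<exists>g \<in> Hom C b a. g \<cdot>\<^bsub>C\<^esub> f = Ident C a \<and> f \<cdot>\<^bsub>C\<^esub> g = Ident C b)"

definition mono_arr :: "('o, 'm, 'z) cat_scheme \<Rightarrow> 'm \<Rightarrow> bool" where
  "mono_arr C m \<longleftrightarrow> m \<in> Arr C \<and>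
     (\<forall>a. \<forall>f \<in> Hom C a (Dom C m). \<forall>g \<in> Hom C a (Dom C m). m \<cdot>\<^bsub>C\<^esub> f = m \<cdot>\<^bsub>C\<^esub> g \<longrightarrow> f = g)"

definition epi_arr :: "('o, 'm, 'z) cat_scheme \<Rightarrow> 'm \<Rightarrow> bool" where
  "epi_arr C e \<longleftrightarrow> e \<in> Arr C \<and>
     (\<forall>a. \<forall>f \<in> Hom C (Cod C e) a. \<forall>g \<in> Hom C (Cod C e) a. f \<cdot>\<^bsub>C\<^esub> e = g \<cdot>\<^bsub>C\<^esub> e \<longrightarrow> f = g)"

record ('o1, 'm1, 'o2, 'm2) ftor =
  FObj :: "'o1 \<Rightarrow> 'o2"
  FArr :: "'m1 \<Rightarrow> 'm2"

text \<open>Functors and natural transformations are extensional outside their source category, so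
  that equality in HOL is equality of functors and of natural transformations.\<close>

definition is_functor ::
  "('o1, 'm1, 'z1) cat_scheme \<Rightarrow> ('o2, 'm2, 'z2) cat_scheme \<Rightarrow> ('o1, 'm1, 'o2, 'm2) ftor \<Rightarrow> bool"
where
  "is_functor C D F \<longleftrightarrow>
     FObj F \<in> Obj C \<rightarrow>\<^sub>E Obj D \<and> FArr F \<in> Arr C \<rightarrow>\<^sub>E Arr D \<and>
     (\<forall>a b. \<forall>f \<in> Hom C a b. FArr F f \<in> Hom D (FObj F a) (FObj F b)) \<and>
     (\<forall>a \<in> Obj C. FArr F (Ident C a) = Ident D (FObj F a)) \<and>
     (\<forall>a b c. \<forall>f \<in> Hom C a b. \<forall>g \<in> Hom C b c. FArr F (g \<cdot>\<^bsub>C\<^esub> f) = FArr F g \<cdot>\<^bsub>D\<^esub> FArr F f)"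

definition is_nattrans ::
  "('o1, 'm1, 'z1) cat_scheme \<Rightarrow> ('o2, 'm2, 'z2) cat_scheme \<Rightarrow> ('o1, 'm1, 'o2, 'm2) ftor
   \<Rightarrow> ('o1, 'm1, 'o2, 'm2) ftor \<Rightarrow> ('o1 \<Rightarrow> 'm2) \<Rightarrow> bool"
where
  "is_nattrans C D F G \<eta> \<longleftrightarrow>
     is_functor C D F \<and> is_functor C D G \<and> \<eta> \<in> extensional (Obj C) \<and>
     (\<forall>a \<in> Obj C. \<eta> a \<in> Hom D (FObj F a) (FObj G a)) \<and>
     (\<forall>a b. \<forall>f \<in> Hom C a b. \<eta> b \<cdot>\<^bsub>D\<^esub> FArr F f = FArr G f \<cdot>\<^bsub>D\<^esub> \<eta> a)"

definition is_product ::
  "('o, 'm, 'z) cat_scheme \<Rightarrow> 'i set \<Rightarrow> ('i \<Rightarrow> 'o) \<Rightarrow> 'o \<Rightarrow> ('i \<Rightarrow> 'm) \<Rightarrow> bool"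
where
  "is_product C I a p \<pi> \<longleftrightarrow> p \<in> Obj C \<and> (\<forall>i \<in> I. \<pi> i \<in> Hom C p (a i)) \<and>
     (\<forall>c \<in> Obj C. \<forall>f. (\<forall>i \<in> I. f i \<in> Hom C c (a i)) \<longrightarrow>
        (\<exists>!h. h \<in> Hom C c p \<and> (\<forall>i \<in> I. \<pi> i \<cdot>\<^bsub>C\<^esub> h = f i)))"

definition is_limit ::
  "('o1, 'm1, 'z1) cat_scheme \<Rightarrow> ('o2, 'm2, 'z2) cat_scheme \<Rightarrow> ('o1, 'm1, 'o2, 'm2) ftor
   \<Rightarrow> 'o2 \<Rightarrow> ('o1 \<Rightarrow> 'm2) \<Rightarrow> bool"
where
  "is_limit C D F l \<pi> \<longleftrightarrow>
     (let cone = (\<lambda>d f. d \<in> Obj D \<and> (\<forall>c \<in> Obj C. f c \<in> Hom D d (FObj F c)) \<and>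
                   (\<forall>a b. \<forall>u \<in> Hom C a b. FArr F u \<cdot>\<^bsub>D\<^esub> f a = f b))
      in cone l \<pi> \<and>
         (\<forall>d f. cone d f \<longrightarrow> (\<exists>!h. h \<in> Hom D d l \<and> (\<forall>c \<in> Obj C. \<pi> c \<cdot>\<^bsub>D\<^esub> h = f c))))"


section \<open>Abelian categories\<close>

record ('o, 'm) abcat = "('o, 'm) cat" +
  ZeroArr :: "'o \<Rightarrow> 'o \<Rightarrow> 'm"
  AddArr :: "'m \<Rightarrow> 'm \<Rightarrow> 'm"

text \<open>The additive group of arrows from \<open>a\<close> to \<open>b\<close>, in the multiplicative notation of
  HOL-Algebra: \<open>\<otimes>\<close> is addition and \<open>f [^] k\<close> is the integer multiple \<open>k f\<close>.\<close>

definition hom_group :: "('o, 'm, 'z) abcat_scheme \<Rightarrow> 'o \<Rightarrow> 'o \<Rightarrow> 'm monoid" where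
  "hom_group A a b = \<lparr>carrier = Hom A a b, mult = AddArr A, one = ZeroArr A a b\<rparr>"

locale preadditive = category A for A :: "('o, 'm, 'z) abcat_scheme" (structure) +
  assumes hom_comm_group: "\<lbrakk>a \<in> Obj A; b \<in> Obj A\<rbrakk> \<Longrightarrow> comm_group (hom_group A a b)"
    and comp_add_right: "\<lbrakk>f \<in> Hom A a b; g \<in> Hom A a b; h \<in> Hom A b c\<rbrakk>
      \<Longrightarrow> h \<cdot> AddArr A f g = AddArr A (h \<cdot> f) (h \<cdot> g)"
    and comp_add_left: "\<lbrakk>h \<in> Hom A a b; f \<in> Hom A b c; g \<in> Hom A b c\<rbrakk>
      \<Longrightarrow> AddArr A f g \<cdot> h = AddArr A (f \<cdot> h) (g \<cdot> h)"

definition zero_object :: "('o, 'm, 'z) cat_scheme \<Rightarrow> 'o \<Rightarrow> bool" where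
  "zero_object C z \<longleftrightarrow> z \<in> Obj C \<and>
     (\<forall>a \<in> Obj C. (\<exists>!f. f \<in> Hom C a z) \<and> (\<exists>!f. f \<in> Hom C z a))"

definition is_kernel :: "('o, 'm, 'z) abcat_scheme \<Rightarrow> 'm \<Rightarrow> 'm \<Rightarrow> bool" where
  "is_kernel A k f \<longleftrightarrow> f \<in> Arr A \<and> k \<in> Arr A \<and> Cod A k = Dom A f \<and>
     f \<cdot>\<^bsub>A\<^esub> k = ZeroArr A (Dom A k) (Cod A f) \<and>
     (\<forall>c. \<forall>g \<in> Hom A c (Dom A f). f \<cdot>\<^bsub>A\<^esub> g = ZeroArr A c (Cod A f) \<longrightarrow>
        (\<exists>!h. h \<in> Hom A c (Dom A k) \<and> k \<cdot>\<^bsub>A\<^esub> h = g))"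

definition is_cokernel :: "('o, 'm, 'z) abcat_scheme \<Rightarrow> 'm \<Rightarrow> 'm \<Rightarrow> bool" where
  "is_cokernel A q f \<longleftrightarrow> f \<in> Arr A \<and> q \<in> Arr A \<and> Dom A q = Cod A f \<and>
     q \<cdot>\<^bsub>A\<^esub> f = ZeroArr A (Dom A f) (Cod A q) \<and>
     (\<forall>c. \<forall>g \<in> Hom A (Cod A f) c. g \<cdot>\<^bsub>A\<^esub> f = ZeroArr A (Dom A f) c \<longrightarrow>
        (\<exists>!h. h \<in> Hom A (Cod A q) c \<and> h \<cdot>\<^bsub>A\<^esub> q = g))"

locale abelian_category = preadditive A for A :: "('o, 'm, 'z) abcat_scheme" (structure) +
  assumes ex_zero_object: "\<exists>z. zero_object A z"
    and ex_binary_product: "\<lbrakk>a \<in> Obj A; b \<in> Obj A\<rbrakk>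
      \<Longrightarrow> \<exists>p \<pi>. is_product A (UNIV :: bool set) (case_bool a b) p \<pi>"
    and ex_kernel: "f \<in> Arr A \<Longrightarrow> \<exists>k. is_kernel A k f"
    and ex_cokernel: "f \<in> Arr A \<Longrightarrow> \<exists>q. is_cokernel A q f"
    and mono_is_kernel: "mono_arr A m \<Longrightarrow> \<exists>f. is_kernel A m f"
    and epi_is_cokernel: "epi_arr A e \<Longrightarrow> \<exists>f. is_cokernel A e f"

definition short_exact :: "('o, 'm, 'z) abcat_scheme \<Rightarrow> 'm \<Rightarrow> 'm \<Rightarrow> bool" where
  "short_exact A f g \<longleftrightarrow> is_kernel A f g \<and> is_cokernel A g f"

text \<open>Exactness of \<open>a \<rightarrow> b \<rightarrow> c\<close> at \<open>b\<close>: the image \<open>ker (coker f)\<close> of \<open>f\<close> is the kernel of \<open>g\<close>.\<close>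

definition exact_at :: "('o, 'm, 'z) abcat_scheme \<Rightarrow> 'm \<Rightarrow> 'm \<Rightarrow> bool" where
  "exact_at A f g \<longleftrightarrow> (\<exists>q k. is_cokernel A q f \<and> is_kernel A k q \<and> is_kernel A k g)"

text \<open>The type \<open>'u\<close> (assumed infinite where it matters) is the universe of smallness: a set is small if it is
  in bijection with a set of elements of type \<open>'u\<close>.\<close>

definition has_small_products :: "'u itself \<Rightarrow> ('o, 'm, 'z) cat_scheme \<Rightarrow> bool" where
  "has_small_products _ C \<longleftrightarrow>
     (\<forall>(I :: 'u set) a. (\<forall>i \<in> I. a i \<in> Obj C) \<longrightarrow> (\<exists>p \<pi>. is_product C I a p \<pi>))"

definition small_products_exact :: "'u itself \<Rightarrow> ('o, 'm, 'z) abcat_scheme \<Rightarrow> bool" where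
  "small_products_exact _ A \<longleftrightarrow>
     (\<forall>(I :: 'u set) f g p \<pi> q \<rho> r \<sigma> u v.
        (\<forall>i \<in> I. short_exact A (f i) (g i)) \<longrightarrow>
        is_product A I (\<lambda>i. Dom A (f i)) p \<pi> \<longrightarrow>
        is_product A I (\<lambda>i. Cod A (f i)) q \<rho> \<longrightarrow>
        is_product A I (\<lambda>i. Cod A (g i)) r \<sigma> \<longrightarrow>
        u \<in> Hom A p q \<longrightarrow> (\<forall>i \<in> I. \<rho> i \<cdot>\<^bsub>A\<^esub> u = f i \<cdot>\<^bsub>A\<^esub> \<pi> i) \<longrightarrow>
        v \<in> Hom A q r \<longrightarrow> (\<forall>i \<in> I. \<sigma> i \<cdot>\<^bsub>A\<^esub> v = g i \<cdot>\<^bsub>A\<^esub> \<rho> i) \<longrightarrow>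
        short_exact A u v)"

definition ab4star :: "'u itself \<Rightarrow> ('o, 'm, 'z) abcat_scheme \<Rightarrow> bool" where
  "ab4star U A \<longleftrightarrow> abelian_category A \<and> has_small_products U A \<and> small_products_exact U A"


section \<open>Functor categories, cohomological delta-functors and satellites of the limit\<close>

type_synonym ('o1, 'm1, 'o2, 'm2) nattrans =
  "('o1, 'm1, 'o2, 'm2) ftor \<times> ('o1 \<Rightarrow> 'm2) \<times> ('o1, 'm1, 'o2, 'm2) ftor"

definition functor_cat ::
  "('o1, 'm1, 'z1) cat_scheme \<Rightarrow> ('o2, 'm2, 'z2) abcat_scheme
   \<Rightarrow> (('o1, 'm1, 'o2, 'm2) ftor, ('o1, 'm1, 'o2, 'm2) nattrans) abcat"
where
  "functor_cat C A =
    \<lparr>Obj = {F. is_functor C A F},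
     Arr = {(F, \<eta>, G). is_nattrans C A F G \<eta>},
     Dom = (\<lambda>(F, \<eta>, G). F),
     Cod = (\<lambda>(F, \<eta>, G). G),
     Ident = (\<lambda>F. (F, \<lambda>c \<in> Obj C. Ident A (FObj F c), F)),
     Comp = (\<lambda>(G', \<theta>, H) (F, \<eta>, G). (F, \<lambda>c \<in> Obj C. \<theta> c \<cdot>\<^bsub>A\<^esub> \<eta> c, H)),
     ZeroArr = (\<lambda>F G. (F, \<lambda>c \<in> Obj C. ZeroArr A (FObj F c) (FObj G c), G)),
     AddArr = (\<lambda>(F, \<eta>, G) (F', \<theta>, G'). (F, \<lambda>c \<in> Obj C. AddArr A (\<eta> c) (\<theta> c), G))\<rparr>"

definition component :: "('o1, 'm1, 'o2, 'm2) nattrans \<Rightarrow> 'o1 \<Rightarrow> 'm2" where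
  "component t = fst (snd t)"

definition additive_functor ::
  "('o1, 'm1, 'z1) abcat_scheme \<Rightarrow> ('o2, 'm2, 'z2) abcat_scheme
   \<Rightarrow> ('o1, 'm1, 'o2, 'm2) ftor \<Rightarrow> bool"
where
  "additive_functor B A T \<longleftrightarrow> is_functor B A T \<and>
     (\<forall>a b. \<forall>f \<in> Hom B a b. \<forall>g \<in> Hom B a b.
        FArr T (AddArr B f g) = AddArr A (FArr T f) (FArr T g))"

text \<open>\<open>\<delta> n f g\<close> is the connecting morphism \<open>T\<^sup>n(c) \<rightarrow> T\<^sup>n\<^sup>+\<^sup>1(a)\<close> of the short
  exact sequence \<open>0 \<rightarrow> a \<rightarrow> b \<rightarrow> c \<rightarrow> 0\<close> formed by \<open>f\<close> and \<open>g\<close>.\<close>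

definition delta_functor ::
  "('o1, 'm1, 'z1) abcat_scheme \<Rightarrow> ('o2, 'm2, 'z2) abcat_scheme
   \<Rightarrow> (nat \<Rightarrow> ('o1, 'm1, 'o2, 'm2) ftor) \<Rightarrow> (nat \<Rightarrow> 'm1 \<Rightarrow> 'm1 \<Rightarrow> 'm2) \<Rightarrow> bool"
where
  "delta_functor B A T \<delta> \<longleftrightarrow>
     (\<forall>n. additive_functor B A (T n)) \<and>
     (\<forall>f g. short_exact B f g \<longrightarrow>
        mono_arr A (FArr (T 0) f) \<and>
        (\<forall>n. \<delta> n f g \<in> Hom A (FObj (T n) (Cod B g)) (FObj (T (Suc n)) (Dom B f)) \<and>
             exact_at A (FArr (T n) f) (FArr (T n) g) \<and>
             exact_at A (FArr (T n) g) (\<delta> n f g) \<and>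
             exact_at A (\<delta> n f g) (FArr (T (Suc n)) f))) \<and>
     (\<forall>f g f' g' a b c. short_exact B f g \<longrightarrow> short_exact B f' g' \<longrightarrow>
        a \<in> Hom B (Dom B f) (Dom B f') \<longrightarrow> b \<in> Hom B (Cod B f) (Cod B f') \<longrightarrow>
        c \<in> Hom B (Cod B g) (Cod B g') \<longrightarrow>
        b \<cdot>\<^bsub>B\<^esub> f = f' \<cdot>\<^bsub>B\<^esub> a \<longrightarrow> c \<cdot>\<^bsub>B\<^esub> g = g' \<cdot>\<^bsub>B\<^esub> b \<longrightarrow>
        (\<forall>n. FArr (T (Suc n)) a \<cdot>\<^bsub>A\<^esub> \<delta> n f g = \<delta> n f' g' \<cdot>\<^bsub>A\<^esub> FArr (T n) c))"

definition delta_morphism ::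
  "('o1, 'm1, 'z1) abcat_scheme \<Rightarrow> ('o2, 'm2, 'z2) abcat_scheme
   \<Rightarrow> (nat \<Rightarrow> ('o1, 'm1, 'o2, 'm2) ftor) \<Rightarrow> (nat \<Rightarrow> 'm1 \<Rightarrow> 'm1 \<Rightarrow> 'm2)
   \<Rightarrow> (nat \<Rightarrow> ('o1, 'm1, 'o2, 'm2) ftor) \<Rightarrow> (nat \<Rightarrow> 'm1 \<Rightarrow> 'm1 \<Rightarrow> 'm2)
   \<Rightarrow> (nat \<Rightarrow> ('o1, 'm1, 'o2, 'm2) nattrans) \<Rightarrow> bool"
where
  "delta_morphism B A T \<delta> T' \<delta>' \<phi> \<longleftrightarrow>
     (\<forall>n. \<phi> n \<in> Hom (functor_cat B A) (T n) (T' n)) \<and>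
     (\<forall>f g n. short_exact B f g \<longrightarrow>
        component (\<phi> (Suc n)) (Dom B f) \<cdot>\<^bsub>A\<^esub> \<delta> n f g =
        \<delta>' n f g \<cdot>\<^bsub>A\<^esub> component (\<phi> n) (Cod B g))"

definition universal_delta_functor ::
  "('o1, 'm1, 'z1) abcat_scheme \<Rightarrow> ('o2, 'm2, 'z2) abcat_scheme
   \<Rightarrow> (nat \<Rightarrow> ('o1, 'm1, 'o2, 'm2) ftor) \<Rightarrow> (nat \<Rightarrow> 'm1 \<Rightarrow> 'm1 \<Rightarrow> 'm2) \<Rightarrow> bool"
where
  "universal_delta_functor B A T \<delta> \<longleftrightarrow> delta_functor B A T \<delta> \<and>
     (\<forall>T' \<delta>'. delta_functor B A T' \<delta>' \<longrightarrow>
        (\<forall>\<psi> \<in> Hom (functor_cat B A) (T 0) (T' 0).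
           \<exists>!\<phi>. delta_morphism B A T \<delta> T' \<delta>' \<phi> \<and> \<phi> 0 = \<psi>))"

definition is_limit_functor ::
  "('o1, 'm1, 'z1) cat_scheme \<Rightarrow> ('o2, 'm2, 'z2) abcat_scheme
   \<Rightarrow> (('o1, 'm1, 'o2, 'm2) ftor, ('o1, 'm1, 'o2, 'm2) nattrans, 'o2, 'm2) ftor \<Rightarrow> bool"
where
  "is_limit_functor C A L \<longleftrightarrow> is_functor (functor_cat C A) A L \<and>
     (\<exists>\<pi>. (\<forall>F. is_functor C A F \<longrightarrow> is_limit C A F (FObj L F) (\<pi> F)) \<and>
          (\<forall>F G. \<forall>t \<in> Hom (functor_cat C A) F G. \<forall>c \<in> Obj C.
             \<pi> G c \<cdot>\<^bsub>A\<^esub> FArr L t = component t c \<cdot>\<^bsub>A\<^esub> \<pi> F c))"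

definition right_satellites_lim ::
  "('o1, 'm1, 'z1) cat_scheme \<Rightarrow> ('o2, 'm2, 'z2) abcat_scheme
   \<Rightarrow> (nat \<Rightarrow> (('o1, 'm1, 'o2, 'm2) ftor, ('o1, 'm1, 'o2, 'm2) nattrans, 'o2, 'm2) ftor) \<Rightarrow> bool"
where
  "right_satellites_lim C A L \<longleftrightarrow>
     is_limit_functor C A (L 0) \<and> (\<exists>\<delta>. universal_delta_functor (functor_cat C A) A L \<delta>)"


section \<open>The cube category, cubical sets and the category of elements\<close>

definition cube :: "nat \<Rightarrow> bool list set" where
  "cube n = {xs. length xs = n}"

definition face_map :: "nat \<Rightarrow> nat \<Rightarrow> bool \<Rightarrow> bool list \<Rightarrow> bool list" where
  "face_map k i \<epsilon> = (\<lambda>xs \<in> cube (k - 1). take (i - 1) xs @ [\<epsilon>] @ drop (i - 1) xs)"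

definition degeneracy_map :: "nat \<Rightarrow> nat \<Rightarrow> bool list \<Rightarrow> bool list" where
  "degeneracy_map k i = (\<lambda>xs \<in> cube k. take (i - 1) xs @ drop i xs)"

inductive box_map :: "nat \<Rightarrow> nat \<Rightarrow> (bool list \<Rightarrow> bool list) \<Rightarrow> bool" where
  ident: "box_map n n (\<lambda>xs \<in> cube n. xs)"
| face: "\<lbrakk>1 \<le> i; i \<le> k\<rbrakk> \<Longrightarrow> box_map (k - 1) k (face_map k i \<epsilon>)"
| degeneracy: "\<lbrakk>1 \<le> i; i \<le> k\<rbrakk> \<Longrightarrow> box_map k (k - 1) (degeneracy_map k i)"
| comp: "\<lbrakk>box_map l m f; box_map m n g\<rbrakk> \<Longrightarrow> box_map l n (compose (cube l) g f)"

text \<open>The object \<open>\<I>\<^sup>n\<close> is encoded by \<open>n\<close>, and arrows carry their source and target.\<close>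

type_synonym box_arr = "nat \<times> (bool list \<Rightarrow> bool list) \<times> nat"

definition box_cat :: "(nat, box_arr) cat" where
  "box_cat =
    \<lparr>Obj = UNIV,
     Arr = {(m, f, n). box_map m n f},
     Dom = (\<lambda>(m, f, n). m),
     Cod = (\<lambda>(m, f, n). n),
     Ident = (\<lambda>n. (n, \<lambda>xs \<in> cube n. xs, n)),
     Comp = (\<lambda>(m', g, n) (l, f, m). (l, compose (cube l) g f, n))\<rparr>"

definition face :: "nat \<Rightarrow> nat \<Rightarrow> bool \<Rightarrow> box_arr" where
  "face k i \<epsilon> = (k - 1, face_map k i \<epsilon>, k)"

definition degeneracy :: "nat \<Rightarrow> nat \<Rightarrow> box_arr" where
  "degeneracy k i = (k, degeneracy_map k i, k - 1)"

definition set_cat :: "('u set, 'u set \<times> ('u \<Rightarrow> 'u) \<times> 'u set) cat" where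
  "set_cat =
    \<lparr>Obj = UNIV,
     Arr = {(S, f, T). f \<in> S \<rightarrow>\<^sub>E T},
     Dom = (\<lambda>(S, f, T). S),
     Cod = (\<lambda>(S, f, T). T),
     Ident = (\<lambda>S. (S, \<lambda>x \<in> S. x, S)),
     Comp = (\<lambda>(T', g, U) (S, f, T). (S, compose S g f, U))\<rparr>"

type_synonym 'u cubical = "(nat, box_arr, 'u set, 'u set \<times> ('u \<Rightarrow> 'u) \<times> 'u set) ftor"

definition cubical_set :: "'u cubical \<Rightarrow> bool" where
  "cubical_set X \<longleftrightarrow> is_functor (op_cat box_cat) set_cat X"

definition act :: "'u cubical \<Rightarrow> box_arr \<Rightarrow> 'u \<Rightarrow> 'u" where
  "act X \<alpha> = fst (snd (FArr X \<alpha>))"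

text \<open>Objects of \<open>\<box>/X\<close> are pairs \<open>(n, x)\<close> with \<open>x \<in> X\<^sub>n\<close>; the arrow \<open>(y, \<alpha>, x)\<close>
  is \<open>\<alpha>\<close> regarded as a morphism from \<open>y = X(\<alpha>)(x)\<close> to \<open>x\<close>.\<close>

type_synonym 'u el_arr = "(nat \<times> 'u) \<times> box_arr \<times> (nat \<times> 'u)"

definition el_arrow :: "'u cubical \<Rightarrow> box_arr \<Rightarrow> 'u \<Rightarrow> 'u el_arr" where
  "el_arrow X \<alpha> x = ((Dom box_cat \<alpha>, act X \<alpha> x), \<alpha>, (Cod box_cat \<alpha>, x))"

definition el_cat :: "'u cubical \<Rightarrow> (nat \<times> 'u, 'u el_arr) cat" where
  "el_cat X =
    \<lparr>Obj = {(n, x). x \<in> FObj X n},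
     Arr = {el_arrow X \<alpha> x | \<alpha> x. \<alpha> \<in> Arr box_cat \<and> x \<in> FObj X (Cod box_cat \<alpha>)},
     Dom = (\<lambda>(y, \<alpha>, x). y),
     Cod = (\<lambda>(y, \<alpha>, x). x),
     Ident = (\<lambda>(n, x). ((n, x), Ident box_cat n, (n, x))),
     Comp = (\<lambda>(y', \<beta>, x) (z, \<alpha>, y). (z, \<beta> \<cdot>\<^bsub>box_cat\<^esub> \<alpha>, x))\<rparr>"


section \<open>Cohomology of a cochain complex\<close>

definition some_product :: "('o, 'm, 'z) cat_scheme \<Rightarrow> 'i set \<Rightarrow> ('i \<Rightarrow> 'o) \<Rightarrow> 'o \<times> ('i \<Rightarrow> 'm)" where
  "some_product C I a = (SOME (p, \<pi>). is_product C I a p \<pi>)"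

definition some_kernel :: "('o, 'm, 'z) abcat_scheme \<Rightarrow> 'm \<Rightarrow> 'm" where
  "some_kernel A f = (SOME k. is_kernel A k f)"

definition some_cokernel :: "('o, 'm, 'z) abcat_scheme \<Rightarrow> 'm \<Rightarrow> 'm" where
  "some_cokernel A f = (SOME q. is_cokernel A q f)"

definition lift_through :: "('o, 'm, 'z) cat_scheme \<Rightarrow> 'm \<Rightarrow> 'm \<Rightarrow> 'm" where
  "lift_through C k g = (THE h. h \<in> Hom C (Dom C g) (Dom C k) \<and> k \<cdot>\<^bsub>C\<^esub> h = g)"

text \<open>\<open>d n\<close> is the differential from degree \<open>n\<close> to degree \<open>n + 1\<close>, starting in degree \<open>0\<close>.
  In positive degrees cohomology is the cokernel of the map from the preceding term to the
  cocycles.\<close>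

fun cohomology :: "('o, 'm, 'z) abcat_scheme \<Rightarrow> (nat \<Rightarrow> 'm) \<Rightarrow> nat \<Rightarrow> 'o" where
  "cohomology A d 0 = Dom A (some_kernel A (d 0))"
| "cohomology A d (Suc n) =
     Cod A (some_cokernel A (lift_through A (some_kernel A (d (Suc n))) (d n)))"


section \<open>The normalized cochain complex of a cubical set\<close>

context
  fixes A :: "('o, 'm, 'z) abcat_scheme"
    and X :: "'u cubical"
    and F :: "(nat \<times> 'u, 'u el_arr, 'o, 'm) ftor"
begin

definition cochain_obj :: "nat \<Rightarrow> 'o" where
  "cochain_obj n = fst (some_product A (FObj X n) (\<lambda>x. FObj F (n, x)))"

definition cochain_pr :: "nat \<Rightarrow> 'u \<Rightarrow> 'm" where
  "cochain_pr n = snd (some_product A (FObj X n) (\<lambda>x. FObj F (n, x)))"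

definition coface :: "nat \<Rightarrow> nat \<Rightarrow> bool \<Rightarrow> 'm" where
  "coface n i \<epsilon> = (THE h. h \<in> Hom A (cochain_obj (n - 1)) (cochain_obj n) \<and>
     (\<forall>x \<in> FObj X n. cochain_pr n x \<cdot>\<^bsub>A\<^esub> h =
        FArr F (el_arrow X (face n i \<epsilon>) x) \<cdot>\<^bsub>A\<^esub> cochain_pr (n - 1) (act X (face n i \<epsilon>) x)))"

definition codegeneracy :: "nat \<Rightarrow> nat \<Rightarrow> 'm" where
  "codegeneracy n i = (THE h. h \<in> Hom A (cochain_obj n) (cochain_obj (n - 1)) \<and>
     (\<forall>x \<in> FObj X (n - 1). cochain_pr (n - 1) x \<cdot>\<^bsub>A\<^esub> h =
        FArr F (el_arrow X (degeneracy n i) x) \<cdot>\<^bsub>A\<^esub> cochain_pr n (act X (degeneracy n i) x)))"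

text \<open>For \<open>n = 0\<close> the target is an empty product, that is, a zero object.\<close>

definition codegeneracies :: "nat \<Rightarrow> 'm" where
  "codegeneracies n =
     (let (p, \<pi>) = some_product A {1..n} (\<lambda>_. cochain_obj (n - 1))
      in THE h. h \<in> Hom A (cochain_obj n) p \<and> (\<forall>i \<in> {1..n}. \<pi> i \<cdot>\<^bsub>A\<^esub> h = codegeneracy n i))"

definition normalized_incl :: "nat \<Rightarrow> 'm" where
  "normalized_incl n = some_kernel A (codegeneracies n)"

text \<open>\<open>cochain_diff n\<close> is \<open>\<Sum>\<^sub>i (-1)\<^sup>i (d\<^sup>i\<^sub>n\<^sub>,\<^sub>0 - d\<^sup>i\<^sub>n\<^sub>,\<^sub>1)\<close>, with target in degree \<open>n\<close>.\<close>

definition cochain_diff :: "nat \<Rightarrow> 'm" where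
  "cochain_diff n =
     (let G = hom_group A (cochain_obj (n - 1)) (cochain_obj n)
      in finprod G
           (\<lambda>i. (coface n i False \<otimes>\<^bsub>G\<^esub> inv\<^bsub>G\<^esub> (coface n i True)) [^]\<^bsub>G\<^esub> ((- 1) ^ i :: int))
           {1..n})"

definition normalized_diff :: "nat \<Rightarrow> 'm" where
  "normalized_diff n =
     lift_through A (normalized_incl (Suc n)) (cochain_diff (Suc n) \<cdot>\<^bsub>A\<^esub> normalized_incl n)"

end

end

theory Submission
  imports Defs "HOL-Library.Countable_Set"
begin

text \<open>
  Normalization is exact: composing the idempotents \<open>1 - \<delta>\<^sub>i\<sigma>\<^sub>i\<close> projects the cochains naturally onto
  the normalized ones, and products are exact. So \<open>F \<mapsto> H\<^sup>n(C\<^sub>N(X, F))\<close> is a cohomological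
  \<open>\<delta>\<close>-functor. In degree \<open>0\<close> it is the limit: a compatible family is determined by its values at the
  vertices, and a \<open>0\<close>-cocycle takes the same value at all vertices of a cube. Every \<open>F\<close> embeds in
  the cofree system \<open>x \<mapsto> \<Prod>\<^bsub>x \<rightarrow> y\<^esub> F(y)\<close>. Its normalized cochains are
  products over \<open>y\<close> of the cellular cochains of a standard cube, because a map of cubes is uniquely a composite of
  degeneracies followed by a face; hence it has no cohomology in positive degrees. By effaceability the
  \<open>\<delta>\<close>-functor is universal, and universal \<open>\<delta>\<close>-functors that agree in degree \<open>0\<close> are isomorphic.
\<close>

section \<open>Arrows, sums of arrows and generalized elements\<close>

text \<open>\<open>A\<close> is not assumed to have enough injectives, so the satellites are not
  accessible through injective resolutions. Being defined by universality, they only ask for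
  effaceability, and the cofree systems, whose units split at each object, take the place of
  injectives. Normalization is essential: for a one-point cubical set and a constant system the two
  faces in each direction agree, all unnormalized differentials vanish, and cohomology appears in
  every degree. An abstract abelian category has no elements, so a cochain is an arrow from a test
  object \<open>P\<close>, and \<open>P\<close> is replaced by a cover whenever an epimorphism has
  to be lifted through. Infinitely many components would each ask for a cover of their own;
  exactness of products supplies a common one. The functor category is not shown to be abelian: what
  is needed of it is reduced to kernels and cokernels computed pointwise. The products that form a
  cofree system are indexed by arrows of \<open>el_cat X\<close> rather than by elements of
  \<open>'u\<close>; this is where the size of the universe is felt most.\<close>

lemma Hom_iff: "f \<in> Hom C a b \<longleftrightarrow> f \<in> Arr C \<and> Dom C f = a \<and> Cod C f = b"
  by (auto simp: Hom_def)

section \<open>Composition, monomorphisms and epimorphisms\<close>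

context category
begin

declare dom_obj [simp] cod_obj [simp]

lemma comp_arr [simp]:
  assumes "f \<in> Arr C" "g \<in> Arr C" "Dom C g = Cod C f"
  shows "g \<cdot> f \<in> Arr C" "Dom C (g \<cdot> f) = Dom C f" "Cod C (g \<cdot> f) = Cod C g"
  using comp_hom[of f "Dom C f" "Cod C f" g "Cod C g"] assms by (auto simp: Hom_iff)

lemma assoc [simp]:
  "\<lbrakk>f \<in> Arr C; g \<in> Arr C; h \<in> Arr C; Dom C g = Cod C f; Dom C h = Cod C g\<rbrakk>
    \<Longrightarrow> (h \<cdot> g) \<cdot> f = h \<cdot> (g \<cdot> f)"
  using comp_assoc[of f "Dom C f" "Cod C f" g "Cod C g" h "Cod C h"] by (auto simp: Hom_iff)

lemma ident_arr [simp]: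
  assumes "a \<in> Obj C"
  shows "Ident C a \<in> Arr C" "Dom C (Ident C a) = a" "Cod C (Ident C a) = a"
  using ident_hom[OF assms] by (auto simp: Hom_iff)

lemma ident_comp [simp]:
  "\<lbrakk>f \<in> Arr C; Cod C f = b\<rbrakk> \<Longrightarrow> Ident C b \<cdot> f = f"
  "\<lbrakk>f \<in> Arr C; Dom C f = a\<rbrakk> \<Longrightarrow> f \<cdot> Ident C a = f"
  using ident_left[of f "Dom C f" "Cod C f"] ident_right[of f "Dom C f" "Cod C f"]
  by (auto simp: Hom_iff)

text \<open>The simplifier nests composites to the right, so an equation for
  \<open>g \<cdot> f\<close> cannot be applied inside \<open>g \<cdot> (f \<cdot> x)\<close>. This
  is its form with a trailing factor, on which most chases below rely.\<close>

lemma pre_comp: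
  "\<lbrakk>g \<cdot> f = k; f \<in> Arr C; g \<in> Arr C; Dom C g = Cod C f; x \<in> Arr C; Cod C x = Dom C f\<rbrakk>
    \<Longrightarrow> g \<cdot> (f \<cdot> x) = k \<cdot> x"
  using assoc[of x f g] by auto

lemma mono_arrD:
  "\<lbrakk>mono_arr C m; m \<cdot> f = m \<cdot> g; f \<in> Arr C; g \<in> Arr C; Dom C f = Dom C g;
    Cod C f = Dom C m; Cod C g = Dom C m\<rbrakk> \<Longrightarrow> f = g"
  unfolding mono_arr_def by (auto simp: Hom_iff)

lemma epi_arrD:
  "\<lbrakk>epi_arr C e; f \<cdot> e = g \<cdot> e; f \<in> Arr C; g \<in> Arr C; Cod C f = Cod C g;
    Dom C f = Cod C e; Dom C g = Cod C e\<rbrakk> \<Longrightarrow> f = g"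
  unfolding epi_arr_def by (auto simp: Hom_iff)

lemma mono_arr_Arr: "mono_arr C m \<Longrightarrow> m \<in> Arr C"
  and epi_arr_Arr: "epi_arr C m \<Longrightarrow> m \<in> Arr C"
  by (auto simp: mono_arr_def epi_arr_def)

lemma epi_comp:
  assumes "epi_arr C e" "epi_arr C e'" "Dom C e = Cod C e'"
  shows "epi_arr C (e \<cdot> e')"
  unfolding epi_arr_def
proof (intro conjI allI ballI impI)
  show "e \<cdot> e' \<in> Arr C" using assms by (simp add: epi_arr_Arr)
next
  fix a f g
  assume fg: "f \<in> Hom C (Cod C (e \<cdot> e')) a" "g \<in> Hom C (Cod C (e \<cdot> e')) a"
    and eq: "f \<cdot> (e \<cdot> e') = g \<cdot> (e \<cdot> e')"
  note [simp] = epi_arr_Arr[OF assms(1)] epi_arr_Arr[OF assms(2)] assms(3)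
  have [simp]: "f \<in> Arr C" "g \<in> Arr C" "Dom C f = Cod C e" "Dom C g = Cod C e" "Cod C f = a"
    "Cod C g = a" using fg by (auto simp: Hom_iff)
  have "(f \<cdot> e) \<cdot> e' = (g \<cdot> e) \<cdot> e'" using eq by simp
  then have "f \<cdot> e = g \<cdot> e" by - (rule epi_arrD[OF assms(2)], simp_all)
  then show "f = g" by - (rule epi_arrD[OF assms(1)], simp_all)
qed

lemma mono_comp:
  assumes "mono_arr C m" "mono_arr C m'" "Dom C m = Cod C m'"
  shows "mono_arr C (m \<cdot> m')"
  unfolding mono_arr_def
proof (intro conjI allI ballI impI)
  show "m \<cdot> m' \<in> Arr C" using assms by (simp add: mono_arr_Arr)
next
  fix a f g
  note [simp] = mono_arr_Arr[OF assms(1)] mono_arr_Arr[OF assms(2)] assms(3)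
  assume fg: "f \<in> Hom C a (Dom C (m \<cdot> m'))" "g \<in> Hom C a (Dom C (m \<cdot> m'))"
    and eq: "m \<cdot> m' \<cdot> f = m \<cdot> m' \<cdot> g"
  have [simp]: "f \<in> Arr C" "g \<in> Arr C" "Cod C f = Dom C m'" "Cod C g = Dom C m'" "Dom C f = a"
    "Dom C g = a" using fg by (auto simp: Hom_iff)
  have "m' \<cdot> f = m' \<cdot> g" using eq mono_arrD[OF assms(1), of "m' \<cdot> f" "m' \<cdot> g"] by simp
  then show "f = g" by - (rule mono_arrD[OF assms(2)], simp_all)
qed

lemma epi_ident: "a \<in> Obj C \<Longrightarrow> epi_arr C (Ident C a)"
  by (auto simp: epi_arr_def Hom_iff)

lemma mono_cancel:
  assumes "mono_arr C (g \<cdot> f)" "f \<in> Arr C" "g \<in> Arr C" "Dom C g = Cod C f"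
  shows "mono_arr C f"
  unfolding mono_arr_def
proof (intro conjI allI ballI impI)
  fix a u v assume "u \<in> Hom C a (Dom C f)" "v \<in> Hom C a (Dom C f)" "f \<cdot> u = f \<cdot> v"
  then show "u = v"
    using mono_arrD[OF assms(1), of u v] assms(2-4) by (simp add: Hom_iff)
qed (use assms in auto)

lemma epi_cancel:
  assumes "epi_arr C (g \<cdot> f)" "f \<in> Arr C" "g \<in> Arr C" "Dom C g = Cod C f"
  shows "epi_arr C g"
  unfolding epi_arr_def
proof (intro conjI allI ballI impI)
  fix a u v assume uv: "u \<in> Hom C (Cod C g) a" "v \<in> Hom C (Cod C g) a" "u \<cdot> g = v \<cdot> g"
  have "u \<cdot> (g \<cdot> f) = v \<cdot> (g \<cdot> f)"
    using uv assms(2-4) by (simp add: Hom_iff flip: assoc)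
  then show "u = v"
    using epi_arrD[OF assms(1), of u v] assms(2-4) uv by (simp add: Hom_iff)
qed (use assms in auto)

end

section \<open>Sums of arrows, kernels and cokernels\<close>

context preadditive
begin

abbreviation add_arr_syn (infixl "\<boxplus>" 65) where "f \<boxplus> g \<equiv> AddArr A f g"

text \<open>The group is recovered from the domain and codomain of \<open>f\<close>, so that
  negation needs no further argument.\<close>

definition neg :: "'m \<Rightarrow> 'm" where
  "neg f = inv\<^bsub>hom_group A (Dom A f) (Cod A f)\<^esub> f"

abbreviation sub_arr (infixl "\<boxminus>" 65) where "f \<boxminus> g \<equiv> f \<boxplus> neg g"

lemma hom_group_sel [simp]:
  "carrier (hom_group A a b) = Hom A a b" "f \<otimes>\<^bsub>hom_group A a b\<^esub> g = f \<boxplus> g"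
  "\<one>\<^bsub>hom_group A a b\<^esub> = ZeroArr A a b"
  by (auto simp: hom_group_def)

lemma zero_arr [simp]:
  assumes "a \<in> Obj A" "b \<in> Obj A"
  shows "ZeroArr A a b \<in> Arr A" "Dom A (ZeroArr A a b) = a" "Cod A (ZeroArr A a b) = b"
proof -
  interpret comm_group "hom_group A a b" by (rule hom_comm_group[OF assms])
  show "ZeroArr A a b \<in> Arr A" "Dom A (ZeroArr A a b) = a" "Cod A (ZeroArr A a b) = b"
    using one_closed by (auto simp: Hom_iff)
qed

lemma add_arr [simp]:
  assumes "f \<in> Arr A" "g \<in> Arr A" "Dom A f = Dom A g" "Cod A f = Cod A g"
  shows "f \<boxplus> g \<in> Arr A" "Dom A (f \<boxplus> g) = Dom A g" "Cod A (f \<boxplus> g) = Cod A g"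
proof -
  interpret comm_group "hom_group A (Dom A g) (Cod A g)" by (rule hom_comm_group) (use assms in auto)
  show "f \<boxplus> g \<in> Arr A" "Dom A (f \<boxplus> g) = Dom A g" "Cod A (f \<boxplus> g) = Cod A g"
    using m_closed[of f g] assms by (auto simp: Hom_iff)
qed

lemma neg_arr [simp]:
  assumes "f \<in> Arr A"
  shows "neg f \<in> Arr A" "Dom A (neg f) = Dom A f" "Cod A (neg f) = Cod A f"
proof -
  interpret comm_group "hom_group A (Dom A f) (Cod A f)" by (rule hom_comm_group) (use assms in auto)
  show "neg f \<in> Arr A" "Dom A (neg f) = Dom A f" "Cod A (neg f) = Cod A f"
    using inv_closed[of f] assms by (auto simp: Hom_iff neg_def)
qed

lemma add_zero [simp]:
  assumes "f \<in> Arr A"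
  shows "Dom A f = a \<Longrightarrow> Cod A f = b \<Longrightarrow> f \<boxplus> ZeroArr A a b = f"
    "Dom A f = a \<Longrightarrow> Cod A f = b \<Longrightarrow> ZeroArr A a b \<boxplus> f = f"
    "Dom A f = a \<Longrightarrow> Cod A f = b \<Longrightarrow> f \<boxminus> f = ZeroArr A a b"
    "Dom A f = a \<Longrightarrow> Cod A f = b \<Longrightarrow> neg f \<boxplus> f = ZeroArr A a b"
    "neg (neg f) = f"
proof -
  interpret comm_group "hom_group A (Dom A f) (Cod A f)" by (rule hom_comm_group) (use assms in auto)
  show "Dom A f = a \<Longrightarrow> Cod A f = b \<Longrightarrow> f \<boxplus> ZeroArr A a b = f"
    "Dom A f = a \<Longrightarrow> Cod A f = b \<Longrightarrow> ZeroArr A a b \<boxplus> f = f"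
    "Dom A f = a \<Longrightarrow> Cod A f = b \<Longrightarrow> f \<boxminus> f = ZeroArr A a b"
    "Dom A f = a \<Longrightarrow> Cod A f = b \<Longrightarrow> neg f \<boxplus> f = ZeroArr A a b"
    using r_one[of f] l_one[of f] l_inv[of f] r_inv[of f] assms by (auto simp: Hom_iff neg_def)
  show "neg (neg f) = f" using inv_inv[of f] assms neg_arr[OF assms]
    by (auto simp: Hom_iff neg_def)
qed

lemma add_assoc:
  assumes "f \<in> Arr A" "g \<in> Arr A" "h \<in> Arr A" "Dom A f = Dom A g" "Cod A f = Cod A g"
    "Dom A g = Dom A h" "Cod A g = Cod A h"
  shows "f \<boxplus> g \<boxplus> h = f \<boxplus> (g \<boxplus> h)"
proof -
  interpret comm_group "hom_group A (Dom A g) (Cod A g)" by (rule hom_comm_group) (use assms in auto)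
  show ?thesis using m_assoc[of f g h] assms by (auto simp: Hom_iff)
qed

lemma add_comm:
  assumes "f \<in> Arr A" "g \<in> Arr A" "Dom A f = Dom A g" "Cod A f = Cod A g"
  shows "f \<boxplus> g = g \<boxplus> f"
proof -
  interpret comm_group "hom_group A (Dom A g) (Cod A g)" by (rule hom_comm_group) (use assms in auto)
  show ?thesis using m_comm[of f g] assms by (auto simp: Hom_iff)
qed

lemma add_left_comm:
  assumes "f \<in> Arr A" "g \<in> Arr A" "h \<in> Arr A" "Dom A f = Dom A g" "Cod A f = Cod A g"
    "Dom A g = Dom A h" "Cod A g = Cod A h"
  shows "f \<boxplus> (g \<boxplus> h) = g \<boxplus> (f \<boxplus> h)"
proof -
  interpret comm_group "hom_group A (Dom A g) (Cod A g)" by (rule hom_comm_group) (use assms in auto)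
  show ?thesis using m_lcomm[of f g h] assms by (auto simp: Hom_iff)
qed

lemmas add_ac = add_assoc add_comm add_left_comm

lemma add_cancel [simp]:
  assumes "f \<in> Arr A" "g \<in> Arr A" "Dom A f = Dom A g" "Cod A f = Cod A g"
  shows "f \<boxplus> (neg f \<boxplus> g) = g" "neg f \<boxplus> (f \<boxplus> g) = g"
  using assms by (simp_all flip: add_assoc)

lemma neg_add [simp]:
  assumes "f \<in> Arr A" "g \<in> Arr A" "Dom A f = Dom A g" "Cod A f = Cod A g"
  shows "neg (f \<boxplus> g) = neg f \<boxplus> neg g"
proof -
  interpret comm_group "hom_group A (Dom A g) (Cod A g)" by (rule hom_comm_group) (use assms in auto)
  show ?thesis using inv_mult[of f g] assms by (auto simp: Hom_iff neg_def)
qed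

lemma neg_zero [simp]:
  assumes "a \<in> Obj A" "b \<in> Obj A"
  shows "neg (ZeroArr A a b) = ZeroArr A a b"
proof -
  interpret comm_group "hom_group A a b" by (rule hom_comm_group) (use assms in auto)
  show ?thesis using inv_one assms by (auto simp: neg_def)
qed

lemma neg_unique:
  assumes "f \<boxplus> g = ZeroArr A (Dom A f) (Cod A f)" "f \<in> Arr A" "g \<in> Arr A" "Dom A f = Dom A g"
    "Cod A f = Cod A g"
  shows "g = neg f"
proof -
  have "g = neg f \<boxplus> (f \<boxplus> g)" using assms(2-) by simp
  also have "\<dots> = neg f" using assms by simp
  finally show ?thesis .
qed

lemma sub_eq_zero:
  assumes "f \<boxminus> g = ZeroArr A a b" "f \<in> Arr A" "g \<in> Arr A" "Dom A f = a" "Cod A f = b"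
    "Dom A g = a" "Cod A g = b"
  shows "f = g"
  using neg_unique[of f "neg g"] assms by (metis add_zero(5) neg_arr)

lemma add_eq_self:
  assumes "f \<boxplus> f = f" "f \<in> Arr A"
  shows "f = ZeroArr A (Dom A f) (Cod A f)"
  by (metis add_cancel(2) add_zero(4) assms)

lemma comp_add [simp]:
  assumes "f \<in> Arr A" "g \<in> Arr A" "Dom A f = Dom A g" "Cod A f = Cod A g" "h \<in> Arr A"
  shows "Dom A h = Cod A g \<Longrightarrow> h \<cdot> (f \<boxplus> g) = h \<cdot> f \<boxplus> h \<cdot> g"
    "Cod A h = Dom A g \<Longrightarrow> (f \<boxplus> g) \<cdot> h = f \<cdot> h \<boxplus> g \<cdot> h"
  using comp_add_right[of f "Dom A g" "Cod A g" g h] comp_add_left[of h _ "Dom A g" f "Cod A g" g]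
    assms by (auto simp: Hom_iff)

text \<open>Bilinearity is only assumed for sums. It makes the composite with a zero arrow equal to
  its own double, and in a group such an element is zero.\<close>

lemma comp_zero [simp]:
  assumes "h \<in> Arr A" "a \<in> Obj A"
  shows "Dom A h = b \<Longrightarrow> h \<cdot> ZeroArr A a b = ZeroArr A a (Cod A h)"
    "Cod A h = b \<Longrightarrow> ZeroArr A b a \<cdot> h = ZeroArr A (Dom A h) a"
proof -
  assume [simp]: "Dom A h = b"
  then have [simp]: "b \<in> Obj A" using assms(1) dom_obj by blast
  have "h \<cdot> (ZeroArr A a b \<boxplus> ZeroArr A a b) = h \<cdot> ZeroArr A a b \<boxplus> h \<cdot> ZeroArr A a b"
    using assms by (intro comp_add) auto
  then show "h \<cdot> ZeroArr A a b = ZeroArr A a (Cod A h)"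
    using add_eq_self[of "h \<cdot> ZeroArr A a b"] assms by simp
next
  assume [simp]: "Cod A h = b"
  then have [simp]: "b \<in> Obj A" using assms(1) cod_obj by blast
  have "(ZeroArr A b a \<boxplus> ZeroArr A b a) \<cdot> h = ZeroArr A b a \<cdot> h \<boxplus> ZeroArr A b a \<cdot> h"
    using assms by (intro comp_add) auto
  then show "ZeroArr A b a \<cdot> h = ZeroArr A (Dom A h) a"
    using add_eq_self[of "ZeroArr A b a \<cdot> h"] assms by simp
qed

lemma comp_neg [simp]:
  assumes "f \<in> Arr A" "h \<in> Arr A" "Dom A h = Cod A f"
  shows "h \<cdot> neg f = neg (h \<cdot> f)" "neg h \<cdot> f = neg (h \<cdot> f)"
proof -
  have "h \<cdot> (f \<boxplus> neg f) = h \<cdot> f \<boxplus> h \<cdot> neg f" "(h \<boxplus> neg h) \<cdot> f = h \<cdot> f \<boxplus> neg h \<cdot> f"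
    using assms by (intro comp_add; simp)+
  then show "h \<cdot> neg f = neg (h \<cdot> f)" "neg h \<cdot> f = neg (h \<cdot> f)"
    using assms by (auto intro!: neg_unique)
qed

lemma mono_arrI:
  assumes "m \<in> Arr A"
    and "\<And>u. \<lbrakk>u \<in> Arr A; Cod A u = Dom A m; m \<cdot> u = ZeroArr A (Dom A u) (Cod A m)\<rbrakk>
      \<Longrightarrow> u = ZeroArr A (Dom A u) (Dom A m)"
  shows "mono_arr A m"
  unfolding mono_arr_def
proof (intro conjI allI ballI impI)
  fix a f g assume fg: "f \<in> Hom A a (Dom A m)" "g \<in> Hom A a (Dom A m)" and eq: "m \<cdot> f = m \<cdot> g"
  then have [simp]: "f \<in> Arr A" "Dom A f = a" "Cod A f = Dom A m" "g \<in> Arr A" "Dom A g = a"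
    "Cod A g = Dom A m" by (auto simp: Hom_iff)
  have "f \<boxminus> g = ZeroArr A a (Dom A m)"
    using assms(2)[of "f \<boxminus> g"] eq assms(1) by simp
  then show "f = g" by (rule sub_eq_zero) simp_all
qed (fact assms(1))

lemma epi_arrI:
  assumes "e \<in> Arr A"
    and "\<And>u. \<lbrakk>u \<in> Arr A; Dom A u = Cod A e; u \<cdot> e = ZeroArr A (Dom A e) (Cod A u)\<rbrakk>
      \<Longrightarrow> u = ZeroArr A (Cod A e) (Cod A u)"
  shows "epi_arr A e"
  unfolding epi_arr_def
proof (intro conjI allI ballI impI)
  fix a f g assume fg: "f \<in> Hom A (Cod A e) a" "g \<in> Hom A (Cod A e) a" and eq: "f \<cdot> e = g \<cdot> e"
  then have [simp]: "f \<in> Arr A" "Cod A f = a" "Dom A f = Cod A e" "g \<in> Arr A" "Cod A g = a"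
    "Dom A g = Cod A e" by (auto simp: Hom_iff)
  have "f \<boxminus> g = ZeroArr A (Cod A e) a"
    using assms(2)[of "f \<boxminus> g"] eq assms(1) by simp
  then show "f = g" by (rule sub_eq_zero) simp_all
qed (fact assms(1))

lemma kernelD:
  assumes "is_kernel A k f"
  shows "k \<in> Arr A" "f \<in> Arr A" "Cod A k = Dom A f" "f \<cdot> k = ZeroArr A (Dom A k) (Cod A f)"
  using assms by (auto simp: is_kernel_def)

lemma cokernelD:
  assumes "is_cokernel A q f"
  shows "q \<in> Arr A" "f \<in> Arr A" "Dom A q = Cod A f" "q \<cdot> f = ZeroArr A (Dom A f) (Cod A q)"
  using assms by (auto simp: is_cokernel_def)

lemma kernel_mono: "is_kernel A k f \<Longrightarrow> mono_arr A k"
proof (rule mono_arrI)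
  fix u assume k: "is_kernel A k f"
    and u: "u \<in> Arr A" "Cod A u = Dom A k" "k \<cdot> u = ZeroArr A (Dom A u) (Cod A k)"
  note [simp] = u kernelD[OF k]
  have "\<exists>!h. h \<in> Hom A (Dom A u) (Dom A k) \<and> k \<cdot> h = ZeroArr A (Dom A u) (Cod A k)"
    using k[unfolded is_kernel_def] u by (auto simp: Hom_iff)
  moreover have "u \<in> Hom A (Dom A u) (Dom A k)"
    "ZeroArr A (Dom A u) (Dom A k) \<in> Hom A (Dom A u) (Dom A k)" by (auto simp: Hom_iff)
  moreover have "k \<cdot> ZeroArr A (Dom A u) (Dom A k) = ZeroArr A (Dom A u) (Cod A k)"
    by simp
  ultimately show "u = ZeroArr A (Dom A u) (Dom A k)" using u(3) by blast
qed (auto dest: kernelD)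

lemma cokernel_epi: "is_cokernel A q f \<Longrightarrow> epi_arr A q"
proof (rule epi_arrI)
  fix u assume q: "is_cokernel A q f"
    and u: "u \<in> Arr A" "Dom A u = Cod A q" "u \<cdot> q = ZeroArr A (Dom A q) (Cod A u)"
  note [simp] = u cokernelD[OF q]
  have "\<exists>!h. h \<in> Hom A (Cod A q) (Cod A u) \<and> h \<cdot> q = ZeroArr A (Dom A q) (Cod A u)"
    using q[unfolded is_cokernel_def] u by (auto simp: Hom_iff)
  moreover have "u \<in> Hom A (Cod A q) (Cod A u)"
    "ZeroArr A (Cod A q) (Cod A u) \<in> Hom A (Cod A q) (Cod A u)" by (auto simp: Hom_iff)
  moreover have "ZeroArr A (Cod A q) (Cod A u) \<cdot> q = ZeroArr A (Dom A q) (Cod A u)"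
    by simp
  ultimately show "u = ZeroArr A (Cod A q) (Cod A u)" using u(3) by blast
qed (auto dest: cokernelD)

lemma kernel_lift_ex:
  assumes "is_kernel A k f" "c \<in> Arr A" "Cod A c = Dom A f" "f \<cdot> c = ZeroArr A (Dom A c) (Cod A f)"
  shows "\<exists>v. v \<in> Arr A \<and> Dom A v = Dom A c \<and> Cod A v = Dom A k \<and> k \<cdot> v = c"
proof -
  have "c \<in> Hom A (Dom A c) (Dom A f)" using assms by (simp add: Hom_iff)
  with assms have "\<exists>!h. h \<in> Hom A (Dom A c) (Dom A k) \<and> k \<cdot> h = c"
    unfolding is_kernel_def by blast
  then show ?thesis by (auto simp: Hom_iff)
qed

lemma cokernel_desc_ex:
  assumes "is_cokernel A q f" "c \<in> Arr A" "Dom A c = Cod A f" "c \<cdot> f = ZeroArr A (Dom A f) (Cod A c)"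
  shows "\<exists>v. v \<in> Arr A \<and> Dom A v = Cod A q \<and> Cod A v = Cod A c \<and> v \<cdot> q = c"
proof -
  have "c \<in> Hom A (Cod A f) (Cod A c)" using assms by (simp add: Hom_iff)
  with assms have "\<exists>!h. h \<in> Hom A (Cod A q) (Cod A c) \<and> h \<cdot> q = c"
    unfolding is_cokernel_def by blast
  then show ?thesis by (auto simp: Hom_iff)
qed

lemma kernel_lift:
  assumes "is_kernel A k f" "c \<in> Arr A" "Cod A c = Dom A f" "f \<cdot> c = ZeroArr A (Dom A c) (Cod A f)"
  obtains v where "v \<in> Arr A" "Dom A v = Dom A c" "Cod A v = Dom A k" "k \<cdot> v = c"
  using kernel_lift_ex[OF assms] by blast

lemma cokernel_desc:
  assumes "is_cokernel A q f" "c \<in> Arr A" "Dom A c = Cod A f" "c \<cdot> f = ZeroArr A (Dom A f) (Cod A c)"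
  obtains v where "v \<in> Arr A" "Dom A v = Cod A q" "Cod A v = Cod A c" "v \<cdot> q = c"
  using cokernel_desc_ex[OF assms] by blast

text \<open>Uniqueness of the factorization is contained in \<open>mono_arr A k\<close>, which
  leaves existence as the only condition to check in applications.\<close>

lemma kernelI:
  assumes "mono_arr A k" "f \<in> Arr A" "Cod A k = Dom A f" "f \<cdot> k = ZeroArr A (Dom A k) (Cod A f)"
    and "\<And>c. \<lbrakk>c \<in> Arr A; Cod A c = Dom A f; f \<cdot> c = ZeroArr A (Dom A c) (Cod A f)\<rbrakk>
      \<Longrightarrow> \<exists>v. v \<in> Arr A \<and> Dom A v = Dom A c \<and> Cod A v = Dom A k \<and> k \<cdot> v = c"
  shows "is_kernel A k f"
  unfolding is_kernel_def
proof (intro conjI allI ballI impI)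
  fix c g assume g: "g \<in> Hom A c (Dom A f)" "f \<cdot> g = ZeroArr A c (Cod A f)"
  then obtain v where v: "v \<in> Arr A" "Dom A v = Dom A g" "Cod A v = Dom A k" "k \<cdot> v = g"
    using assms(5)[of g] by (auto simp: Hom_iff)
  show "\<exists>!h. h \<in> Hom A c (Dom A k) \<and> k \<cdot> h = g"
  proof (rule ex1I[of _ v])
    fix h assume "h \<in> Hom A c (Dom A k) \<and> k \<cdot> h = g"
    then show "h = v" using mono_arrD[OF assms(1), of h v] v g by (auto simp: Hom_iff)
  qed (use v g in \<open>auto simp: Hom_iff\<close>)
qed (use assms mono_arr_Arr in auto)

lemma cokernelI:
  assumes "epi_arr A q" "f \<in> Arr A" "Dom A q = Cod A f" "q \<cdot> f = ZeroArr A (Dom A f) (Cod A q)"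
    and "\<And>c. \<lbrakk>c \<in> Arr A; Dom A c = Cod A f; c \<cdot> f = ZeroArr A (Dom A f) (Cod A c)\<rbrakk>
      \<Longrightarrow> \<exists>v. v \<in> Arr A \<and> Dom A v = Cod A q \<and> Cod A v = Cod A c \<and> v \<cdot> q = c"
  shows "is_cokernel A q f"
  unfolding is_cokernel_def
proof (intro conjI allI ballI impI)
  fix c g assume g: "g \<in> Hom A (Cod A f) c" "g \<cdot> f = ZeroArr A (Dom A f) c"
  then obtain v where v: "v \<in> Arr A" "Dom A v = Cod A q" "Cod A v = Cod A g" "v \<cdot> q = g"
    using assms(5)[of g] by (auto simp: Hom_iff)
  show "\<exists>!h. h \<in> Hom A (Cod A q) c \<and> h \<cdot> q = g"
  proof (rule ex1I[of _ v])
    fix h assume "h \<in> Hom A (Cod A q) c \<and> h \<cdot> q = g"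
    then show "h = v" using epi_arrD[OF assms(1), of h v] v g by (auto simp: Hom_iff)
  qed (use v g in \<open>auto simp: Hom_iff\<close>)
qed (use assms epi_arr_Arr in auto)

lemma lift_through:
  assumes "is_kernel A k f" "c \<in> Arr A" "Cod A c = Dom A f" "f \<cdot> c = ZeroArr A (Dom A c) (Cod A f)"
  shows "lift_through A k c \<in> Arr A" "Dom A (lift_through A k c) = Dom A c"
    "Cod A (lift_through A k c) = Dom A k" "k \<cdot> lift_through A k c = c"
proof -
  have "\<exists>!h. h \<in> Hom A (Dom A c) (Dom A k) \<and> k \<cdot> h = c"
    using assms unfolding is_kernel_def by (auto simp: Hom_iff)
  from theI'[OF this] show "lift_through A k c \<in> Arr A" "Dom A (lift_through A k c) = Dom A c"
    "Cod A (lift_through A k c) = Dom A k" "k \<cdot> lift_through A k c = c"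
    by (auto simp: lift_through_def Hom_iff)
qed

end

section \<open>Exactness by chasing generalized elements\<close>

context abelian_category
begin

lemma some_kernel: "f \<in> Arr A \<Longrightarrow> is_kernel A (some_kernel A f) f"
  unfolding some_kernel_def by (rule someI_ex) (rule ex_kernel)

lemma some_cokernel: "f \<in> Arr A \<Longrightarrow> is_cokernel A (some_cokernel A f) f"
  unfolding some_cokernel_def by (rule someI_ex) (rule ex_cokernel)

text \<open>By the axiom \<open>m\<close> is a kernel of some \<open>f\<close>. As \<open>f\<close>
  kills \<open>m\<close>, it factors through the cokernel \<open>q\<close>; so whatever
  \<open>q\<close> kills is killed by \<open>f\<close> and factors through \<open>m\<close>.\<close>

lemma mono_kernel_of_cokernel:
  assumes m: "mono_arr A m" and q: "is_cokernel A q m"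
  shows "is_kernel A m q"
proof -
  obtain f where f: "is_kernel A m f" using mono_is_kernel[OF m] by blast
  note [simp] = kernelD[OF f] cokernelD[OF q]
  obtain r where r [simp]: "r \<in> Arr A" "Dom A r = Cod A q" "Cod A r = Cod A f" "r \<cdot> q = f"
    using cokernel_desc[OF q, of f] by auto
  show ?thesis
  proof (rule kernelI[OF m])
    fix c assume c [simp]: "c \<in> Arr A" "Cod A c = Dom A q" "q \<cdot> c = ZeroArr A (Dom A c) (Cod A q)"
    have "f \<cdot> c = r \<cdot> (q \<cdot> c)" by (subst r(4)[symmetric]) (simp del: r(4) c(3))
    also have "\<dots> = ZeroArr A (Dom A c) (Cod A f)" by simp
    finally show "\<exists>v. v \<in> Arr A \<and> Dom A v = Dom A c \<and> Cod A v = Dom A m \<and> m \<cdot> v = c"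
      by - (rule kernel_lift_ex[OF f], simp_all)
  qed auto
qed

lemma epi_cokernel_of_kernel:
  assumes e: "epi_arr A e" and k: "is_kernel A k e"
  shows "is_cokernel A e k"
proof -
  obtain f where f: "is_cokernel A e f" using epi_is_cokernel[OF e] by blast
  note [simp] = cokernelD[OF f] kernelD[OF k]
  obtain r where r [simp]: "r \<in> Arr A" "Dom A r = Dom A f" "Cod A r = Dom A k" "k \<cdot> r = f"
    using kernel_lift[OF k, of f] by auto
  show ?thesis
  proof (rule cokernelI[OF e])
    fix c assume c [simp]: "c \<in> Arr A" "Dom A c = Cod A k" "c \<cdot> k = ZeroArr A (Dom A k) (Cod A c)"
    have "c \<cdot> f = (c \<cdot> k) \<cdot> r" by (subst r(4)[symmetric]) (simp del: r(4) c(3))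
    also have "\<dots> = ZeroArr A (Dom A f) (Cod A c)" by simp
    finally show "\<exists>v. v \<in> Arr A \<and> Dom A v = Cod A e \<and> Cod A v = Cod A c \<and> v \<cdot> e = c"
      by - (rule cokernel_desc_ex[OF f], simp_all)
  qed auto
qed

lemma short_exactI: "\<lbrakk>is_kernel A f g; epi_arr A g\<rbrakk> \<Longrightarrow> short_exact A f g"
  unfolding short_exact_def using epi_cokernel_of_kernel by blast

lemma short_exactD:
  assumes "short_exact A f g"
  shows "is_kernel A f g" "epi_arr A g" "mono_arr A f"
  using assms cokernel_epi kernel_mono by (auto simp: short_exact_def)

text \<open>A chase shows only that \<open>u\<close> vanishes on some cover of its domain. That is
  enough, because the cover is an epimorphism.\<close>

lemma kernel_free_mono:
  assumes "m \<in> Arr A" and "\<And>u. \<lbrakk>u \<in> Arr A; Cod A u = Dom A m; m \<cdot> u = ZeroArr A (Dom A u) (Cod A m)\<rbrakk>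
      \<Longrightarrow> \<exists>e. epi_arr A e \<and> Cod A e = Dom A u \<and> u \<cdot> e = ZeroArr A (Dom A e) (Cod A u)"
  shows "mono_arr A m"
proof (rule mono_arrI[OF assms(1)])
  fix u assume u [simp]: "u \<in> Arr A" "Cod A u = Dom A m" "m \<cdot> u = ZeroArr A (Dom A u) (Cod A m)"
  obtain e where e: "epi_arr A e" "Cod A e = Dom A u" "u \<cdot> e = ZeroArr A (Dom A e) (Cod A u)"
    using assms(2)[OF u] by blast
  note [simp] = epi_arr_Arr[OF e(1)] assms(1) e(2)
  show "u = ZeroArr A (Dom A u) (Dom A m)"
    by (rule epi_arrD[OF e(1)]) (use e(3) in simp_all)
qed

text \<open>Pullbacks of epimorphisms are epimorphisms: this is what allows diagram chasing with generalized
  elements \<open>P \<rightarrow> a\<close>, at the price of replacing \<open>P\<close> by an object covering it.\<close>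

lemma epi_lift:
  assumes e: "epi_arr A e" and v: "v \<in> Arr A" "Cod A v = Cod A e"
  obtains e' v' where "epi_arr A e'" "v' \<in> Arr A" "Cod A e' = Dom A v" "Cod A v' = Dom A e"
    "Dom A v' = Dom A e'" "e \<cdot> v' = v \<cdot> e'"
proof -
  note [simp] = epi_arr_Arr[OF e] v
  define a where "a = Dom A e"
  define b where "b = Dom A v"
  have [simp]: "a \<in> Obj A" "b \<in> Obj A" "Dom A e = a" "Dom A v = b" by (auto simp: a_def b_def)
  obtain p \<pi> where pr: "is_product A (UNIV :: bool set) (case_bool a b) p \<pi>"
    using ex_binary_product[of a b] by auto
  have [simp]: "p \<in> Obj A" using pr by (auto simp: is_product_def)
  have "\<pi> True \<in> Hom A p (case True of True \<Rightarrow> a | False \<Rightarrow> b)"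
    "\<pi> False \<in> Hom A p (case False of True \<Rightarrow> a | False \<Rightarrow> b)"
    using pr unfolding is_product_def by blast+
  then have [simp]: "\<pi> True \<in> Arr A" "\<pi> False \<in> Arr A" "Dom A (\<pi> True) = p" "Dom A (\<pi> False) = p"
    "Cod A (\<pi> True) = a" "Cod A (\<pi> False) = b" by (auto simp: Hom_iff)
  have pair: "\<exists>h. h \<in> Arr A \<and> Dom A h = c \<and> Cod A h = p \<and> \<pi> True \<cdot> h = f \<and> \<pi> False \<cdot> h = g"
    if "f \<in> Hom A c a" "g \<in> Hom A c b" "c \<in> Obj A" for c f g
  proof -
    have "\<forall>i. case_bool f g i \<in> Hom A c (case_bool a b i)" using that by (auto split: bool.split)
    then have "\<exists>!h. h \<in> Hom A c p \<and> (\<forall>i. \<pi> i \<cdot> h = case_bool f g i)"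
      using pr that(3) unfolding is_product_def by (metis (mono_tags) UNIV_I)
    then obtain h where "h \<in> Hom A c p" "\<forall>i. \<pi> i \<cdot> h = case_bool f g i" by blast
    then show ?thesis by (intro exI[of _ h]) (auto simp: Hom_iff dest: spec[of _ True] spec[of _ False])
  qed
  \<comment> \<open>The injections of the biproduct, obtained by pairing identities with zero
    arrows.\<close>
  obtain i1 where i1 [simp]: "i1 \<in> Arr A" "Dom A i1 = a" "Cod A i1 = p" "\<pi> True \<cdot> i1 = Ident A a"
    "\<pi> False \<cdot> i1 = ZeroArr A a b"
    using pair[of "Ident A a" a "ZeroArr A a b"] by (auto simp: Hom_iff)
  obtain i2 where i2 [simp]: "i2 \<in> Arr A" "Dom A i2 = b" "Cod A i2 = p" "\<pi> True \<cdot> i2 = ZeroArr A b a"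
    "\<pi> False \<cdot> i2 = Ident A b"
    using pair[of "ZeroArr A b a" b "Ident A b"] by (auto simp: Hom_iff)
  \<comment> \<open>The pullback of \<open>e\<close> and \<open>v\<close> is the kernel
    \<open>k\<close> of this difference on the product. Since \<open>\<phi>\<close> restricts to
    \<open>e\<close> on the first factor, it is an epimorphism, hence the cokernel of
    \<open>k\<close>.\<close>
  define \<phi> where "\<phi> = e \<cdot> \<pi> True \<boxminus> v \<cdot> \<pi> False"
  have [simp]: "\<phi> \<in> Arr A" "Dom A \<phi> = p" "Cod A \<phi> = Cod A e" by (simp_all add: \<phi>_def)
  have phi_i1: "\<phi> \<cdot> i1 = e" by (simp add: \<phi>_def)
  have "epi_arr A (\<phi> \<cdot> i1)" using e phi_i1 by simp
  then have epi: "epi_arr A \<phi>" by (rule epi_cancel) simp_all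
  define k where "k = some_kernel A \<phi>"
  have k: "is_kernel A k \<phi>" unfolding k_def by (rule some_kernel) simp
  note [simp] = kernelD[OF k, simplified]
  have cok: "is_cokernel A \<phi> k" by (rule epi_cokernel_of_kernel[OF epi k])
  have epi': "epi_arr A (\<pi> False \<cdot> k)"
  proof (rule epi_arrI)
    fix u assume "u \<in> Arr A" "Dom A u = Cod A (\<pi> False \<cdot> k)"
      "u \<cdot> (\<pi> False \<cdot> k) = ZeroArr A (Dom A (\<pi> False \<cdot> k)) (Cod A u)"
    then have u [simp]: "u \<in> Arr A" "Dom A u = b" "u \<cdot> (\<pi> False \<cdot> k) = ZeroArr A (Dom A k) (Cod A u)"
      by auto
    \<comment> \<open>\<open>u \<cdot> \<pi> False\<close> kills \<open>k\<close> and so descends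
      along \<open>\<phi>\<close>. Restriction to the first factor gives
      \<open>w \<cdot> e = 0\<close>, hence \<open>w = 0\<close>; restriction to the second factor
      then gives \<open>u = 0\<close>.\<close>
    obtain w where w [simp]: "w \<in> Arr A" "Dom A w = Cod A e" "Cod A w = Cod A u" "w \<cdot> \<phi> = u \<cdot> \<pi> False"
      using cokernel_desc[OF cok, of "u \<cdot> \<pi> False"] by auto
    have "w \<cdot> e = (w \<cdot> \<phi>) \<cdot> i1" by (simp add: phi_i1 del: w(4))
    also have "\<dots> = ZeroArr A a (Cod A u)" by simp
    finally have "w = ZeroArr A (Cod A e) (Cod A u)"
      by - (rule epi_arrD[OF e], simp_all)
    then have "u \<cdot> \<pi> False = ZeroArr A p (Cod A u)" using w(4) by simp
    then have "(u \<cdot> \<pi> False) \<cdot> i2 = ZeroArr A b (Cod A u)" by simp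
    then show "u = ZeroArr A (Cod A (\<pi> False \<cdot> k)) (Cod A u)" by simp
  qed simp
  have "\<phi> \<cdot> k = ZeroArr A (Dom A k) (Cod A e)" by simp
  then have "e \<cdot> (\<pi> True \<cdot> k) = v \<cdot> (\<pi> False \<cdot> k)"
    unfolding \<phi>_def by - (rule sub_eq_zero[of _ _ "Dom A k" "Cod A e"], simp_all)
  with epi' show thesis by (intro that[of "\<pi> False \<cdot> k" "\<pi> True \<cdot> k"]) simp_all
qed

lemma image_factor:
  assumes q: "is_cokernel A q f" and k: "is_kernel A k q"
  obtains f' where "epi_arr A f'" "Dom A f' = Dom A f" "Cod A f' = Dom A k" "k \<cdot> f' = f"
proof -
  note [simp] = cokernelD[OF q] kernelD[OF k]
  obtain f' where f' [simp]: "f' \<in> Arr A" "Dom A f' = Dom A f" "Cod A f' = Dom A k" "k \<cdot> f' = f"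
    using kernel_lift[OF k, of f] by auto
  have "epi_arr A f'"
  proof (rule epi_arrI)
    fix u assume u [simp]: "u \<in> Arr A" "Dom A u = Cod A f'" "u \<cdot> f' = ZeroArr A (Dom A f') (Cod A u)"
    \<comment> \<open>Since \<open>f'\<close> lands in the kernel \<open>m\<close> of
      \<open>u\<close>, \<open>f\<close> lands in the subobject \<open>k \<cdot> m\<close>, which is
      a kernel of some \<open>r\<close>. Then \<open>r\<close> kills \<open>f\<close>, factors
      through \<open>q\<close>, and so kills \<open>k\<close>. Thus \<open>k\<close> factors through
      \<open>k \<cdot> m\<close>, which gives \<open>m\<close> a right inverse and forces
      \<open>u = 0\<close>.\<close>
    define m where "m = some_kernel A u"
    have m: "is_kernel A m u" unfolding m_def by (rule some_kernel) simp
    note [simp] = kernelD[OF m]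
    obtain f'' where f'' [simp]: "f'' \<in> Arr A" "Dom A f'' = Dom A f'" "Cod A f'' = Dom A m" "m \<cdot> f'' = f'"
      using kernel_lift[OF m, of f'] by auto
    have "mono_arr A (k \<cdot> m)" by (rule mono_comp[OF kernel_mono[OF k] kernel_mono[OF m]]) simp
    then obtain r where r: "is_kernel A (k \<cdot> m) r" using mono_is_kernel by blast
    note [simp] = kernelD(2)[OF r]
    have r0: "r \<cdot> (k \<cdot> m) = ZeroArr A (Dom A m) (Cod A r)" using kernelD(4)[OF r] by simp
    have [simp]: "Dom A r = Cod A k" using kernelD(3)[OF r] by simp
    have "r \<cdot> f = ZeroArr A (Dom A f) (Cod A r)" using pre_comp[OF r0, of f''] by simp
    then obtain r' where r' [simp]: "r' \<in> Arr A" "Dom A r' = Cod A q" "Cod A r' = Cod A r" "r' \<cdot> q = r"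
      using cokernel_desc[OF q, of r] by auto
    have "(r' \<cdot> q) \<cdot> k = r' \<cdot> (q \<cdot> k)" by (rule assoc) simp_all
    then have "r \<cdot> k = ZeroArr A (Dom A k) (Cod A r)" by simp
    then obtain s where s: "s \<in> Arr A" "Dom A s = Dom A k" "Cod A s = Dom A m" "(k \<cdot> m) \<cdot> s = k"
      using kernel_lift[OF r, of k] by auto
    note [simp] = s(1-3)
    have "m \<cdot> s = Ident A (Dom A k)"
      by (rule mono_arrD[OF kernel_mono[OF k]]) (use s(4) in simp_all)
    then show "u = ZeroArr A (Cod A f') (Cod A u)" using pre_comp[OF kernelD(4)[OF m], of s] by simp
  qed simp
  then show thesis by (rule that) simp_all
qed

text \<open>An arrow killed by the cokernel of \<open>f\<close> factors through the image, and
  \<open>f\<close> is an epimorphism onto its image; so it lifts through \<open>f\<close> after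
  passing to a cover, in general not before.\<close>

lemma cokernel_local_lift:
  assumes q: "is_cokernel A q f" and y: "y \<in> Arr A" "Cod A y = Cod A f"
    "q \<cdot> y = ZeroArr A (Dom A y) (Cod A q)"
  obtains e x where "epi_arr A e" "x \<in> Arr A" "Cod A e = Dom A y" "Dom A x = Dom A e"
    "Cod A x = Dom A f" "f \<cdot> x = y \<cdot> e"
proof -
  note [simp] = cokernelD[OF q] y
  define k where "k = some_kernel A q"
  have k: "is_kernel A k q" unfolding k_def by (rule some_kernel) simp
  note [simp] = kernelD[OF k]
  obtain f' where f': "epi_arr A f'" "Dom A f' = Dom A f" "Cod A f' = Dom A k" "k \<cdot> f' = f"
    by (rule image_factor[OF q k])
  note [simp] = epi_arr_Arr[OF f'(1)] f'(2-)
  obtain v where v [simp]: "v \<in> Arr A" "Dom A v = Dom A y" "Cod A v = Dom A k" "k \<cdot> v = y"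
    using kernel_lift[OF k, of y] by auto
  obtain e x where ex: "epi_arr A e" "x \<in> Arr A" "Cod A e = Dom A v" "Cod A x = Dom A f'"
    "Dom A x = Dom A e" "f' \<cdot> x = v \<cdot> e"
    by (rule epi_lift[OF f'(1), of v]) auto
  note [simp] = epi_arr_Arr[OF ex(1)] ex(2-5)
  have "f \<cdot> x = k \<cdot> (f' \<cdot> x)" by (simp flip: assoc)
  also have "\<dots> = y \<cdot> e" unfolding ex(6) by (simp flip: assoc)
  finally show thesis using ex by (intro that[of e x]) auto
qed

text \<open>The chase shows that the cokernel \<open>q\<close> of \<open>f\<close> kills everything
  that \<open>g\<close> kills: \<open>q \<cdot> c \<cdot> e = q \<cdot> f \<cdot> x = 0\<close> and
  \<open>e\<close> is an epimorphism. So the kernel of \<open>q\<close> serves as a kernel of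
  \<open>g\<close>.\<close>

lemma exact_atI:
  assumes fg: "f \<in> Arr A" "g \<in> Arr A" "Cod A f = Dom A g" "g \<cdot> f = ZeroArr A (Dom A f) (Cod A g)"
    and chase: "\<And>y. \<lbrakk>y \<in> Arr A; Cod A y = Dom A g; g \<cdot> y = ZeroArr A (Dom A y) (Cod A g)\<rbrakk>
      \<Longrightarrow> \<exists>e x. epi_arr A e \<and> x \<in> Arr A \<and> Cod A e = Dom A y \<and> Dom A x = Dom A e \<and>
        Cod A x = Dom A f \<and> f \<cdot> x = y \<cdot> e"
  shows "exact_at A f g"
proof -
  define q where "q = some_cokernel A f"
  define k where "k = some_kernel A q"
  have q: "is_cokernel A q f" unfolding q_def by (rule some_cokernel) (rule fg)
  note [simp] = cokernelD[OF q] fg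
  have k: "is_kernel A k q" unfolding k_def by (rule some_kernel) simp
  note [simp] = kernelD[OF k]
  obtain g' where g' [simp]: "g' \<in> Arr A" "Dom A g' = Cod A q" "Cod A g' = Cod A g" "g' \<cdot> q = g"
    using cokernel_desc[OF q, of g] by auto
  have "is_kernel A k g"
  proof (rule kernelI[OF kernel_mono[OF k]])
    have "(g' \<cdot> q) \<cdot> k = g' \<cdot> (q \<cdot> k)" by (rule assoc) simp_all
    then show "g \<cdot> k = ZeroArr A (Dom A k) (Cod A g)" by simp
  next
    fix c assume c [simp]: "c \<in> Arr A" "Cod A c = Dom A g" "g \<cdot> c = ZeroArr A (Dom A c) (Cod A g)"
    obtain e x where ex: "epi_arr A e" "x \<in> Arr A" "Cod A e = Dom A c" "Dom A x = Dom A e"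
        "Cod A x = Dom A f" "f \<cdot> x = c \<cdot> e" using chase[OF c] by blast
    note [simp] = ex(2-5) epi_arr_Arr[OF ex(1)]
    have "q \<cdot> c = ZeroArr A (Dom A c) (Cod A q)"
    proof (rule epi_arrD[OF ex(1)])
      have "(q \<cdot> c) \<cdot> e = (q \<cdot> f) \<cdot> x" using ex(6) by (simp del: cokernelD[OF q] add: cokernelD(1-3)[OF q])
      then show "(q \<cdot> c) \<cdot> e = ZeroArr A (Dom A c) (Cod A q) \<cdot> e" by simp
    qed simp_all
    then show "\<exists>v. v \<in> Arr A \<and> Dom A v = Dom A c \<and> Cod A v = Dom A k \<and> k \<cdot> v = c"
      by - (rule kernel_lift_ex[OF k], simp_all)
  qed simp_all
  then show ?thesis using q k unfolding exact_at_def by blast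
qed

lemma exact_atD:
  assumes "exact_at A f g"
  shows "f \<in> Arr A" "g \<in> Arr A" "Cod A f = Dom A g" "g \<cdot> f = ZeroArr A (Dom A f) (Cod A g)"
proof -
  obtain q k where q: "is_cokernel A q f" and k: "is_kernel A k q" and kg: "is_kernel A k g"
    using assms unfolding exact_at_def by blast
  note [simp] = cokernelD[OF q] kernelD[OF k] 
  have kg': "g \<in> Arr A" "Cod A k = Dom A g" "g \<cdot> k = ZeroArr A (Dom A k) (Cod A g)"
    using kernelD[OF kg] by auto
  show [simp]: "f \<in> Arr A" "g \<in> Arr A" "Cod A f = Dom A g" using kg' by simp_all
  obtain v where v: "v \<in> Arr A" "Dom A v = Dom A f" "Cod A v = Dom A k" "k \<cdot> v = f"
    using kernel_lift[OF k, of f] by auto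
  show "g \<cdot> f = ZeroArr A (Dom A f) (Cod A g)" using pre_comp[OF kg'(3), of v] v kg' by simp
qed

text \<open>An epimorphism is the cokernel of its kernel, and exactness makes this kernel the image
  of \<open>f\<close>; an arrow kills the image as soon as it kills \<open>f\<close>.\<close>

lemma exact_at_cokernel:
  assumes "exact_at A f g" "epi_arr A g"
  shows "is_cokernel A g f"
proof -
  note [simp] = exact_atD[OF assms(1)]
  obtain q k where q: "is_cokernel A q f" and k: "is_kernel A k q" and kg: "is_kernel A k g"
    using assms unfolding exact_at_def by blast
  have c: "is_cokernel A g k" by (rule epi_cokernel_of_kernel[OF assms(2) kg])
  note [simp] = cokernelD[OF q] kernelD[OF k]
  obtain v where v: "v \<in> Arr A" "Dom A v = Dom A f" "Cod A v = Dom A k" "k \<cdot> v = f"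
    using kernel_lift[OF k, of f] by auto
  show ?thesis
  proof (rule cokernelI[OF assms(2)])
    fix d assume d [simp]: "d \<in> Arr A" "Dom A d = Cod A f" "d \<cdot> f = ZeroArr A (Dom A f) (Cod A d)"
    obtain r where r [simp]: "r \<in> Arr A" "Dom A r = Cod A q" "Cod A r = Cod A d" "r \<cdot> q = d"
      using cokernel_desc[OF q, of d] by auto
    have "d \<cdot> k = r \<cdot> (q \<cdot> k)" by (subst r(4)[symmetric]) (simp del: r(4) kernelD[OF k] add: kernelD(1-3)[OF k])
    then have "d \<cdot> k = ZeroArr A (Dom A k) (Cod A d)" by simp
    then show "\<exists>v. v \<in> Arr A \<and> Dom A v = Cod A g \<and> Cod A v = Cod A d \<and> v \<cdot> g = d"
      by - (rule cokernel_desc_ex[OF c], simp_all)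
  qed simp_all
qed

lemma exact_at_chase:
  assumes "exact_at A f g" "y \<in> Arr A" "Cod A y = Dom A g" "g \<cdot> y = ZeroArr A (Dom A y) (Cod A g)"
  obtains e x where "epi_arr A e" "x \<in> Arr A" "Cod A e = Dom A y" "Dom A x = Dom A e"
    "Cod A x = Dom A f" "f \<cdot> x = y \<cdot> e"
proof -
  note [simp] = exact_atD[OF assms(1)] assms(2-)
  obtain q k where q: "is_cokernel A q f" and k: "is_kernel A k q" and kg: "is_kernel A k g"
    using assms unfolding exact_at_def by blast
  note [simp] = cokernelD[OF q] kernelD[OF k]
  obtain v where v: "v \<in> Arr A" "Dom A v = Dom A y" "Cod A v = Dom A k" "k \<cdot> v = y"
    using kernel_lift[OF kg, of y] by auto
  have "q \<cdot> y = (q \<cdot> k) \<cdot> v" using v by (simp del: kernelD[OF k] add: kernelD(1-3)[OF k])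
  then have "q \<cdot> y = ZeroArr A (Dom A y) (Cod A q)" using v by simp
  then show thesis by - (rule cokernel_local_lift[OF q, of y], auto intro: that)
qed

end

section \<open>Cohomology of cochain complexes\<close>

context abelian_category
begin

definition cochain_complex :: "(nat \<Rightarrow> 'm) \<Rightarrow> bool" where
  "cochain_complex d \<longleftrightarrow> (\<forall>n. d n \<in> Arr A \<and> Dom A (d (Suc n)) = Cod A (d n) \<and>
     d (Suc n) \<cdot> d n = ZeroArr A (Dom A (d n)) (Cod A (d (Suc n))))"

definition cocycle :: "(nat \<Rightarrow> 'm) \<Rightarrow> nat \<Rightarrow> 'm \<Rightarrow> bool" where
  "cocycle d n c \<longleftrightarrow> c \<in> Arr A \<and> Cod A c = Dom A (d n) \<and> d n \<cdot> c = ZeroArr A (Dom A c) (Cod A (d n))"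

text \<open>An honest factorization through the preceding differential, with no cover. A cocycle of
  vanishing class becomes such a boundary after a cover (\<open>cls_zero\<close>).\<close>

definition boundary :: "(nat \<Rightarrow> 'm) \<Rightarrow> nat \<Rightarrow> 'm \<Rightarrow> bool" where
  "boundary d n c \<longleftrightarrow> (case n of 0 \<Rightarrow> c = ZeroArr A (Dom A c) (Cod A c)
     | Suc m \<Rightarrow> \<exists>b. b \<in> Arr A \<and> Dom A b = Dom A c \<and> Cod A b = Dom A (d m) \<and> d m \<cdot> b = c)"

definition zinc :: "(nat \<Rightarrow> 'm) \<Rightarrow> nat \<Rightarrow> 'm" where
  "zinc d n = some_kernel A (d n)"

text \<open>The projection from cocycles to cohomology. In degree 0 \<open>cohomology\<close> is the
  kernel itself and not a quotient of it, hence the identity there.\<close>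

definition zcls :: "(nat \<Rightarrow> 'm) \<Rightarrow> nat \<Rightarrow> 'm" where
  "zcls d n = (case n of 0 \<Rightarrow> Ident A (Dom A (zinc d 0))
     | Suc m \<Rightarrow> some_cokernel A (lift_through A (zinc d (Suc m)) (d m)))"

definition cls :: "(nat \<Rightarrow> 'm) \<Rightarrow> nat \<Rightarrow> 'm \<Rightarrow> 'm" where
  "cls d n c = zcls d n \<cdot> lift_through A (zinc d n) c"

lemma complexD [simp]:
  assumes "cochain_complex d"
  shows "d n \<in> Arr A" "Dom A (d (Suc n)) = Cod A (d n)"
    "d (Suc n) \<cdot> d n = ZeroArr A (Dom A (d n)) (Cod A (d (Suc n)))"
  using assms by (auto simp: cochain_complex_def)

lemma zinc_kernel: "cochain_complex d \<Longrightarrow> is_kernel A (zinc d n) (d n)"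
  unfolding zinc_def by (rule some_kernel) simp

lemma zinc_arr [simp]:
  assumes "cochain_complex d"
  shows "zinc d n \<in> Arr A" "Cod A (zinc d n) = Dom A (d n)"
    "d n \<cdot> zinc d n = ZeroArr A (Dom A (zinc d n)) (Cod A (d n))"
  using kernelD[OF zinc_kernel[OF assms]] by auto

lemma cocycleD:
  assumes "cocycle d n c"
  shows "c \<in> Arr A" "Cod A c = Dom A (d n)" "d n \<cdot> c = ZeroArr A (Dom A c) (Cod A (d n))"
  using assms by (auto simp: cocycle_def)

lemma cocycle_lift:
  assumes "cochain_complex d" "cocycle d n c"
  shows "lift_through A (zinc d n) c \<in> Arr A" "Dom A (lift_through A (zinc d n) c) = Dom A c"
    "Cod A (lift_through A (zinc d n) c) = Dom A (zinc d n)" "zinc d n \<cdot> lift_through A (zinc d n) c = c"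
  using lift_through[OF zinc_kernel[OF assms(1)] cocycleD[OF assms(2)]] by auto

lemma cocycle_lift_eq:
  assumes "cochain_complex d" "v \<in> Arr A" "Cod A v = Dom A (zinc d n)"
  shows "cocycle d n (zinc d n \<cdot> v)" "lift_through A (zinc d n) (zinc d n \<cdot> v) = v"
proof -
  note [simp] = assms
  show c: "cocycle d n (zinc d n \<cdot> v)"
    using pre_comp[OF zinc_arr(3)[OF assms(1)], where x=v] by (simp add: cocycle_def)
  show "lift_through A (zinc d n) (zinc d n \<cdot> v) = v"
    by (rule mono_arrD[OF kernel_mono[OF zinc_kernel[OF assms(1), of n]]])
      (use cocycle_lift[OF assms(1) c] in simp_all)
qed

lemma zcls:
  assumes d: "cochain_complex d"
  shows "epi_arr A (zcls d n)" "Dom A (zcls d n) = Dom A (zinc d n)"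
    "Cod A (zcls d n) = cohomology A d n"
proof -
  note [simp] = d
  have "epi_arr A (zcls d n) \<and> Dom A (zcls d n) = Dom A (zinc d n) \<and> Cod A (zcls d n) = cohomology A d n"
  proof (cases n)
    case 0
    have "Dom A (zinc d 0) \<in> Obj A" by simp
    then show ?thesis using 0 by (simp add: zcls_def epi_ident zinc_def)
  next
    case (Suc m)
    have "cocycle d (Suc m) (d m)" by (simp add: cocycle_def)
    from cocycle_lift[OF d this]
    have "is_cokernel A (zcls d n) (lift_through A (zinc d (Suc m)) (d m))"
      "Cod A (lift_through A (zinc d (Suc m)) (d m)) = Dom A (zinc d n)"
      unfolding zcls_def Suc nat.case using some_cokernel by simp_all
    then show ?thesis using cokernel_epi cokernelD(3) Suc by (simp add: zcls_def zinc_def)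
  qed
  then show "epi_arr A (zcls d n)" "Dom A (zcls d n) = Dom A (zinc d n)"
    "Cod A (zcls d n) = cohomology A d n" by auto
qed

lemma zcls_arr [simp]:
  assumes "cochain_complex d"
  shows "zcls d n \<in> Arr A" "Dom A (zcls d n) = Dom A (zinc d n)" "Cod A (zcls d n) = cohomology A d n"
  using zcls[OF assms] epi_arr_Arr by auto

lemma cohomology_obj [simp]: "cochain_complex d \<Longrightarrow> cohomology A d n \<in> Obj A"
  using zcls_arr[of d n] cod_obj by metis

lemma cls_arr [simp]:
  assumes "cochain_complex d" "cocycle d n c"
  shows "cls d n c \<in> Arr A" "Dom A (cls d n c) = Dom A c" "Cod A (cls d n c) = cohomology A d n"
  using assms cocycle_lift[OF assms] by (simp_all add: cls_def)

lemma cls_zinc: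
  assumes "cochain_complex d" "v \<in> Arr A" "Cod A v = Dom A (zinc d n)"
  shows "cls d n (zinc d n \<cdot> v) = zcls d n \<cdot> v"
  using cocycle_lift_eq[OF assms] by (simp add: cls_def)

lemma cls_comp:
  assumes "cochain_complex d" "cocycle d n c" "u \<in> Arr A" "Cod A u = Dom A c"
  shows "cocycle d n (c \<cdot> u)" "cls d n (c \<cdot> u) = cls d n c \<cdot> u"
proof -
  note [simp] = assms cocycle_lift[OF assms(1,2)]
  have c: "c \<cdot> u = zinc d n \<cdot> (lift_through A (zinc d n) c \<cdot> u)" by (simp flip: assoc)
  show "cocycle d n (c \<cdot> u)" unfolding c by (rule cocycle_lift_eq) simp_all
  show "cls d n (c \<cdot> u) = cls d n c \<cdot> u" unfolding c by (subst cls_zinc) (simp_all add: cls_def)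
qed

lemma cls_add:
  assumes "cochain_complex d" "cocycle d n c" "cocycle d n c'" "Dom A c = Dom A c'"
  shows "cocycle d n (c \<boxplus> c')" "cls d n (c \<boxplus> c') = cls d n c \<boxplus> cls d n c'"
proof -
  note [simp] = assms cocycle_lift[OF assms(1,2)] cocycle_lift[OF assms(1,3)]
  have c: "c \<boxplus> c' = zinc d n \<cdot> (lift_through A (zinc d n) c \<boxplus> lift_through A (zinc d n) c')" by simp
  show "cocycle d n (c \<boxplus> c')" unfolding c by (rule cocycle_lift_eq) simp_all
  show "cls d n (c \<boxplus> c') = cls d n c \<boxplus> cls d n c'" unfolding c
    by (subst cls_zinc) (simp_all add: cls_def)
qed

lemma cls_neg:
  assumes "cochain_complex d" "cocycle d n c"
  shows "cocycle d n (neg c)" "cls d n (neg c) = neg (cls d n c)"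
proof -
  note [simp] = assms cocycle_lift[OF assms(1,2)]
  have c: "neg c = zinc d n \<cdot> neg (lift_through A (zinc d n) c)" by simp
  show "cocycle d n (neg c)" unfolding c by (rule cocycle_lift_eq) simp_all
  show "cls d n (neg c) = neg (cls d n c)" unfolding c
    by (subst cls_zinc) (simp_all add: cls_def)
qed

lemma cls_sub:
  assumes "cochain_complex d" "cocycle d n c" "cocycle d n c'" "Dom A c = Dom A c'"
  shows "cocycle d n (c \<boxminus> c')" "cls d n (c \<boxminus> c') = cls d n c \<boxminus> cls d n c'"
  using cls_add[of d n c "neg c'"] cls_neg[of d n c'] assms cocycleD by auto

lemma cls_surj:
  assumes d: "cochain_complex d" and h: "h \<in> Arr A" "Cod A h = cohomology A d n"
  obtains e c where "epi_arr A e" "Cod A e = Dom A h" "cocycle d n c" "Dom A c = Dom A e"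
    "cls d n c = h \<cdot> e"
proof -
  note [simp] = d h
  obtain e v where ev: "epi_arr A e" "v \<in> Arr A" "Cod A e = Dom A h" "Cod A v = Dom A (zcls d n)"
    "Dom A v = Dom A e" "zcls d n \<cdot> v = h \<cdot> e"
    by (rule epi_lift[OF zcls(1)[OF d, of n], of h]) simp_all
  note [simp] = ev(2-5)
  show thesis
    by (rule that[of e "zinc d n \<cdot> v"]) (use ev cocycle_lift_eq[OF d, of v] cls_zinc[OF d, of v] in simp_all)
qed

lemma boundary_cocycle:
  assumes "cochain_complex d" "boundary d n c" "c \<in> Arr A" "Cod A c = Dom A (d n)"
  shows "cocycle d n c"
proof (cases n)
  case 0
  then have c: "c = ZeroArr A (Dom A c) (Dom A (d 0))" using assms by (simp add: boundary_def)
  have "d 0 \<cdot> ZeroArr A (Dom A c) (Dom A (d 0)) = ZeroArr A (Dom A c) (Cod A (d 0))"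
    by (rule comp_zero) (use assms in simp_all)
  then show ?thesis using 0 assms c by (simp add: cocycle_def)
next
  case (Suc m)
  then obtain b where b: "b \<in> Arr A" "Dom A b = Dom A c" "Cod A b = Dom A (d m)" "d m \<cdot> b = c"
    using assms by (auto simp: boundary_def)
  show ?thesis using pre_comp[OF complexD(3)[OF assms(1), of m], of b] b assms Suc
    by (simp add: cocycle_def)
qed

lemma cls_zero:
  assumes d: "cochain_complex d" and c: "cocycle d n c" and z: "cls d n c = ZeroArr A (Dom A c) (cohomology A d n)"
  obtains e where "epi_arr A e" "Cod A e = Dom A c" "boundary d n (c \<cdot> e)"
proof (cases n)
  case 0
  note [simp] = d c
  note [simp] = cocycleD[OF c] cocycle_lift[OF d c]
  have [simp]: "Dom A (zinc d 0) \<in> Obj A" by simp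
  note [simp] = cocycle_lift[OF d c, unfolded 0]
  have "cls d n c = lift_through A (zinc d n) c" using 0 by (simp add: cls_def zcls_def)
  then have *: "lift_through A (zinc d n) c = ZeroArr A (Dom A c) (Dom A (zinc d n))"
    using z 0 by (simp add: zinc_def)
  have "zinc d n \<cdot> lift_through A (zinc d n) c = ZeroArr A (Dom A c) (Cod A c)"
    unfolding * by simp
  then have "c = ZeroArr A (Dom A c) (Cod A c)" by simp
  then have "boundary d n (c \<cdot> Ident A (Dom A c))" using 0 by (simp add: boundary_def)
  then show thesis by (intro that[of "Ident A (Dom A c)"]) (simp_all add: epi_ident)
next
  case (Suc m)
  note [simp] = d c
  note [simp] = cocycleD[OF c] cocycle_lift[OF d c] cocycle_lift[OF d c, unfolded Suc]
  have dm: "cocycle d (Suc m) (d m)" by (simp add: cocycle_def)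
  note dml [simp] = cocycle_lift[OF d dm]
  have cok: "is_cokernel A (zcls d n) (lift_through A (zinc d (Suc m)) (d m))"
    unfolding zcls_def Suc nat.case by (rule some_cokernel) simp
  obtain e x where ex: "epi_arr A e" "x \<in> Arr A" "Cod A e = Dom A c" "Dom A x = Dom A e"
    "Cod A x = Dom A (lift_through A (zinc d (Suc m)) (d m))"
    "lift_through A (zinc d (Suc m)) (d m) \<cdot> x = lift_through A (zinc d n) c \<cdot> e"
    by (rule cokernel_local_lift[OF cok, of "lift_through A (zinc d n) c"])
      (use z Suc in \<open>simp_all add: cls_def\<close>)
  note [simp] = ex(2-5) epi_arr_Arr[OF ex(1)]
  have "d m \<cdot> x = zinc d (Suc m) \<cdot> (lift_through A (zinc d (Suc m)) (d m) \<cdot> x)"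
    using pre_comp[OF dml(4), of x] by simp
  also have "\<dots> = c \<cdot> e" unfolding ex(6) using pre_comp[OF cocycle_lift(4)[OF d c], of e] Suc by simp
  finally have "boundary d n (c \<cdot> e)" using Suc by (auto simp: boundary_def intro!: exI[of _ x])
  then show thesis using ex by (intro that[of e]) simp_all
qed

lemma cls_boundary:
  assumes d: "cochain_complex d" and c: "boundary d n c" "c \<in> Arr A" "Cod A c = Dom A (d n)"
  shows "cls d n c = ZeroArr A (Dom A c) (cohomology A d n)"
proof (cases n)
  case 0
  have cube_component: "c = ZeroArr A (Dom A c) (Cod A c)" using 0 c by (simp add: boundary_def)
  note [simp] = d c
  have "c = zinc d n \<cdot> ZeroArr A (Dom A c) (Dom A (zinc d n))" using cube_component by simp
  then have "cls d n c = zcls d n \<cdot> ZeroArr A (Dom A c) (Dom A (zinc d n))"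
    using cls_zinc[of d "ZeroArr A (Dom A c) (Dom A (zinc d n))" n] by simp
  then show ?thesis by simp
next
  case (Suc m)
  note [simp] = d c
  obtain b where b: "b \<in> Arr A" "Dom A b = Dom A c" "Cod A b = Dom A (d m)" "d m \<cdot> b = c"
    using c(1) Suc by (auto simp: boundary_def)
  have dm: "cocycle d (Suc m) (d m)" by (simp add: cocycle_def)
  note dml [simp] = cocycle_lift[OF d dm]
  have cok: "is_cokernel A (zcls d n) (lift_through A (zinc d (Suc m)) (d m))"
    unfolding zcls_def Suc nat.case by (rule some_cokernel) simp
  have "cls d n (d m) = ZeroArr A (Dom A (d m)) (cohomology A d n)"
    using cokernelD(4)[OF cok] Suc by (simp add: cls_def)
  moreover have "cls d n c = cls d n (d m) \<cdot> b" using cls_comp(2)[OF d dm, of b] b Suc by simp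
  ultimately show ?thesis using b by simp
qed

text \<open>The inclusion \<open>zinc d n\<close> is the universal cocycle. Its class is the
  epimorphism \<open>zcls d n\<close>, which stays an epimorphism after composition with a cover, so
  this one class detects equality.\<close>

lemma cls_ext:
  assumes d: "cochain_complex d" and h: "h \<in> Hom A (cohomology A d n) W" "h' \<in> Hom A (cohomology A d n) W"
    and eq: "\<And>c. cocycle d n c \<Longrightarrow> \<exists>e. epi_arr A e \<and> Cod A e = Dom A c \<and> h \<cdot> (cls d n c \<cdot> e) = h' \<cdot> (cls d n c \<cdot> e)"
  shows "h = h'"
proof -
  note [simp] = d
  have [simp]: "h \<in> Arr A" "Dom A h = cohomology A d n" "Cod A h = W"
    "h' \<in> Arr A" "Dom A h' = cohomology A d n" "Cod A h' = W" using h by (auto simp: Hom_iff)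
  have [simp]: "Dom A (zinc d n) \<in> Obj A" by simp
  have z: "cocycle d n (zinc d n)" by (simp add: cocycle_def)
  have "cls d n (zinc d n) = zcls d n"
    using cls_zinc[of d "Ident A (Dom A (zinc d n))" n] by simp
  then obtain e where e: "epi_arr A e" "Cod A e = Dom A (zinc d n)" "h \<cdot> (zcls d n \<cdot> e) = h' \<cdot> (zcls d n \<cdot> e)"
    using eq[OF z] by auto
  have "epi_arr A (zcls d n \<cdot> e)" by (rule epi_comp[OF zcls(1) e(1)]) (use e in simp_all)
  then show ?thesis by (rule epi_arrD) (use e epi_arr_Arr[OF e(1)] in simp_all)
qed

text \<open>Arrows out of cohomology are defined on representing generalized cocycles; it suffices to do so
  locally, by a relation \<open>\<rho>\<close> that need not be single-valued in advance.\<close>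

lemma cls_desc:
  assumes d: "cochain_complex d" and W: "W \<in> Obj A"
    and tp: "\<And>c w. \<rho> c w \<Longrightarrow> cocycle d n c \<and> w \<in> Arr A \<and> Dom A w = Dom A c \<and> Cod A w = W"
    and loc: "\<And>c. cocycle d n c \<Longrightarrow> \<exists>e w. epi_arr A e \<and> Cod A e = Dom A c \<and> \<rho> (c \<cdot> e) w"
    and nat: "\<And>c w u. \<lbrakk>\<rho> c w; u \<in> Arr A; Cod A u = Dom A c\<rbrakk> \<Longrightarrow> \<rho> (c \<cdot> u) (w \<cdot> u)"
    and sub: "\<And>c w c' w'. \<lbrakk>\<rho> c w; \<rho> c' w'; Dom A c = Dom A c'\<rbrakk> \<Longrightarrow> \<rho> (c \<boxminus> c') (w \<boxminus> w')"
    and bd: "\<And>c w. \<lbrakk>\<rho> c w; boundary d n c\<rbrakk> \<Longrightarrow> w = ZeroArr A (Dom A c) W"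
  shows "\<exists>!h. h \<in> Hom A (cohomology A d n) W \<and> (\<forall>c w. \<rho> c w \<longrightarrow> h \<cdot> cls d n c = w)"
proof -
  note [simp] = d W
  have [simp]: "Dom A (zinc d n) \<in> Obj A" by simp
  have z: "cocycle d n (zinc d n)" by (simp add: cocycle_def)
  have clz: "cls d n (zinc d n) = zcls d n"
    using cls_zinc[of d "Ident A (Dom A (zinc d n))" n] by simp
  \<comment> \<open>A cocycle of zero class becomes a boundary on a cover, where \<open>bd\<close>
    applies. Together with \<open>sub\<close> this makes \<open>\<rho>\<close> depend on the class
    only.\<close>
  have zero: "w = ZeroArr A (Dom A c) W" if r: "\<rho> c w" and 0: "cls d n c = ZeroArr A (Dom A c) (cohomology A d n)" for c w
  proof -
    have c: "cocycle d n c" and [simp]: "w \<in> Arr A" "Dom A w = Dom A c" "Cod A w = W" using tp[OF r] by auto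
    note [simp] = cocycleD[OF c]
    obtain e where e: "epi_arr A e" "Cod A e = Dom A c" "boundary d n (c \<cdot> e)" by (rule cls_zero[OF d c 0])
    note [simp] = epi_arr_Arr[OF e(1)] e(2)
    have "w \<cdot> e = ZeroArr A (Dom A (c \<cdot> e)) W"
      by (rule bd[OF nat[OF r]]) (use e in simp_all)
    then show ?thesis by - (rule epi_arrD[OF e(1)], simp_all)
  qed
  have sub0: "w = w'" if r: "\<rho> c w" "\<rho> c' w'" "Dom A c = Dom A c'" and eq: "cls d n c = cls d n c'" for c w c' w'
  proof -
    note [simp] = tp[OF r(1), THEN conjunct1] tp[OF r(2), THEN conjunct1]
      cocycleD[OF tp[OF r(1), THEN conjunct1]] cocycleD[OF tp[OF r(2), THEN conjunct1]]
      tp[OF r(1), THEN conjunct2] tp[OF r(2), THEN conjunct2]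
    have "w \<boxminus> w' = ZeroArr A (Dom A (c \<boxminus> c')) W"
      by (rule zero[OF sub[OF r]]) (use eq r(3) cls_sub(2)[of d n c c'] in simp_all)
    then show ?thesis by - (rule sub_eq_zero, use r(3) in simp_all)
  qed
  \<comment> \<open>The relation is evaluated at the universal cocycle, restricted to a cover
    \<open>e\<close>. The value \<open>w\<close> vanishes on the kernel of the epimorphism
    \<open>zcls d n \<cdot> e\<close>, and the arrow \<open>h\<close> to which it descends is the
    desired one.\<close>
  obtain e w where e: "epi_arr A e" "Cod A e = Dom A (zinc d n)" and r: "\<rho> (zinc d n \<cdot> e) w"
    using loc[OF z] by blast
  note [simp] = epi_arr_Arr[OF e(1)] e(2)
  have [simp]: "w \<in> Arr A" "Dom A w = Dom A e" "Cod A w = W" using tp[OF r] by auto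
  have epi: "epi_arr A (zcls d n \<cdot> e)" by (rule epi_comp[OF zcls(1) e(1)]) simp_all
  define k where "k = some_kernel A (zcls d n \<cdot> e)"
  have k: "is_kernel A k (zcls d n \<cdot> e)" unfolding k_def by (rule some_kernel) simp
  have cok: "is_cokernel A (zcls d n \<cdot> e) k" by (rule epi_cokernel_of_kernel[OF epi k])
  have [simp]: "k \<in> Arr A" "Cod A k = Dom A e" "zcls d n \<cdot> (e \<cdot> k) = ZeroArr A (Dom A k) (cohomology A d n)"
    using kernelD[OF k] by simp_all
  have "w \<cdot> k = ZeroArr A (Dom A ((zinc d n \<cdot> e) \<cdot> k)) W"
    by (rule zero[OF nat[OF r]]) (use cls_comp(2)[OF d z, of "e \<cdot> k"] clz in simp_all)
  then have wk: "w \<cdot> k = ZeroArr A (Dom A k) W" by simp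
  obtain h where h: "h \<in> Arr A" "Dom A h = Cod A (zcls d n \<cdot> e)" "Cod A h = Cod A w" "h \<cdot> (zcls d n \<cdot> e) = w"
    by (rule cokernel_desc[OF cok, of w]) (use wk in simp_all)
  note [simp] = h(1-3)
  have main: "h \<cdot> cls d n c = w'" if r': "\<rho> c w'" for c w'
  proof -
    have c: "cocycle d n c" and [simp]: "w' \<in> Arr A" "Dom A w' = Dom A c" "Cod A w' = W" using tp[OF r'] by auto
    note [simp] = c cocycleD[OF c]
    define v where "v = lift_through A (zinc d n) c"
    have v: "v \<in> Arr A" "Dom A v = Dom A c" "Cod A v = Dom A (zinc d n)" "zinc d n \<cdot> v = c"
      using cocycle_lift[OF d c] by (auto simp: v_def)
    note [simp] = v(1-3)
    \<comment> \<open>Pulling \<open>v\<close> back along \<open>e\<close> turns \<open>c\<close>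
      into a restriction of the covered universal cocycle, so that \<open>sub0\<close> compares
      \<open>w'\<close> with \<open>w\<close>.\<close>
    obtain e' v' where ev: "epi_arr A e'" "v' \<in> Arr A" "Cod A e' = Dom A v" "Cod A v' = Dom A e"
       "Dom A v' = Dom A e'" "e \<cdot> v' = v \<cdot> e'" by (rule epi_lift[OF e(1), of v]) simp_all
    note [simp] = epi_arr_Arr[OF ev(1)] ev(2-5)
    have ce': "c \<cdot> e' = zinc d n \<cdot> (e \<cdot> v')" unfolding ev(6) using pre_comp[OF v(4), of e'] by simp
    have "w' \<cdot> e' = w \<cdot> v'"
      by (rule sub0[OF nat[OF r'] nat[OF r]]) (use ce' in simp_all)
    also have "\<dots> = h \<cdot> (zcls d n \<cdot> (e \<cdot> v'))" using pre_comp[OF h(4), of v'] by simp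
    also have "zcls d n \<cdot> (e \<cdot> v') = cls d n (c \<cdot> e')" unfolding ce' by (subst cls_zinc) simp_all
    also have "\<dots> = cls d n c \<cdot> e'" by (rule cls_comp) simp_all
    finally show ?thesis by - (rule epi_arrD[OF ev(1)], simp_all)
  qed
  show ?thesis
  proof (rule ex1I[of _ h])
    show "h \<in> Hom A (cohomology A d n) W \<and> (\<forall>c w. \<rho> c w \<longrightarrow> h \<cdot> cls d n c = w)"
      using main by (simp add: Hom_iff)
  next
    fix h' assume h': "h' \<in> Hom A (cohomology A d n) W \<and> (\<forall>c w. \<rho> c w \<longrightarrow> h' \<cdot> cls d n c = w)"
    show "h' = h"
    proof (rule cls_ext[OF d])
      show "h' \<in> Hom A (cohomology A d n) W" "h \<in> Hom A (cohomology A d n) W"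
        using h' by (simp_all add: Hom_iff)
      fix c assume c: "cocycle d n c"
      from loc[OF c] obtain e w where ew: "epi_arr A e" "Cod A e = Dom A c" "\<rho> (c \<cdot> e) w" by blast
      have "h' \<cdot> cls d n (c \<cdot> e) = h \<cdot> cls d n (c \<cdot> e)" using main[OF ew(3)] h' ew(3) by simp
      then show "\<exists>e. epi_arr A e \<and> Cod A e = Dom A c \<and> h' \<cdot> (cls d n c \<cdot> e) = h \<cdot> (cls d n c \<cdot> e)"
        using ew cls_comp(2)[OF d c, of e] epi_arr_Arr[OF ew(1)] by auto
    qed
  qed
qed

section \<open>Chain maps and the induced maps on cohomology\<close>

definition chain_map :: "(nat \<Rightarrow> 'm) \<Rightarrow> (nat \<Rightarrow> 'm) \<Rightarrow> (nat \<Rightarrow> 'm) \<Rightarrow> bool" where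
  "chain_map d d' \<phi> \<longleftrightarrow> cochain_complex d \<and> cochain_complex d' \<and>
     (\<forall>n. \<phi> n \<in> Arr A \<and> Dom A (\<phi> n) = Dom A (d n) \<and> Cod A (\<phi> n) = Dom A (d' n) \<and>
        \<phi> (Suc n) \<cdot> d n = d' n \<cdot> \<phi> n)"

text \<open>The value \<open>w\<close> is quantified separately to match the relation in the
  conclusion of \<open>cls_desc\<close> literally.\<close>

definition hmap :: "(nat \<Rightarrow> 'm) \<Rightarrow> (nat \<Rightarrow> 'm) \<Rightarrow> (nat \<Rightarrow> 'm) \<Rightarrow> nat \<Rightarrow> 'm" where
  "hmap d d' \<phi> n = (THE h. h \<in> Hom A (cohomology A d n) (cohomology A d' n) \<and>
     (\<forall>c w. cocycle d n c \<and> w = cls d' n (\<phi> n \<cdot> c) \<longrightarrow> h \<cdot> cls d n c = w))"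

lemma chain_mapD:
  assumes "chain_map d d' \<phi>"
  shows "\<phi> n \<in> Arr A" "Dom A (\<phi> n) = Dom A (d n)" "Cod A (\<phi> n) = Dom A (d' n)"
  using assms by (auto simp: chain_map_def)

lemma chain_map_eq: 
  assumes "chain_map d d' \<phi>"
  shows "cochain_complex d" "cochain_complex d'" "\<phi> (Suc n) \<cdot> d n = d' n \<cdot> \<phi> n"
  using assms by (auto simp: chain_map_def)

lemma chain_map_comp:
  assumes \<phi>: "chain_map d d' \<phi>" and c: "c \<in> Arr A" "Cod A c = Dom A (d n)"
  shows "\<phi> (Suc n) \<cdot> (d n \<cdot> c) = d' n \<cdot> (\<phi> n \<cdot> c)"
  using pre_comp[OF chain_map_eq(3)[OF \<phi>, of n], of c] chain_mapD[OF \<phi>] c chain_map_eq(1,2)[OF \<phi>] by simp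

lemma chain_map_cocycle:
  assumes \<phi>: "chain_map d d' \<phi>" and c: "cocycle d n c"
  shows "cocycle d' n (\<phi> n \<cdot> c)"
  using chain_map_comp[OF \<phi>, of c n] chain_mapD[OF \<phi>] cocycleD[OF c] chain_map_eq(1,2)[OF \<phi>]
  by (simp add: cocycle_def)

lemma chain_map_boundary:
  assumes \<phi>: "chain_map d d' \<phi>" and c: "boundary d n c" "c \<in> Arr A" "Cod A c = Dom A (d n)"
  shows "boundary d' n (\<phi> n \<cdot> c)"
proof -
  note [simp] = chain_mapD[OF \<phi>] chain_map_eq(1,2)[OF \<phi>]
  show ?thesis
proof (cases n)
  case 0
  then have cube_component: "c = ZeroArr A (Dom A c) (Dom A (\<phi> 0))" using c \<phi> by (simp add: boundary_def)
  have "\<phi> 0 \<cdot> c = ZeroArr A (Dom A c) (Cod A (\<phi> 0))"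
    by (subst cube_component) (rule comp_zero, use c in simp_all)
  then show ?thesis using 0 c by (simp add: boundary_def)
next
  case (Suc m)
  then obtain b where b: "b \<in> Arr A" "Dom A b = Dom A c" "Cod A b = Dom A (d m)" "d m \<cdot> b = c"
    using c by (auto simp: boundary_def)
  show ?thesis using chain_map_comp[OF \<phi>, of b m] b c Suc \<phi>
    by (auto simp: boundary_def intro!: exI[of _ "\<phi> m \<cdot> b"])
qed
qed

lemma hmap:
  assumes \<phi>: "chain_map d d' \<phi>"
  shows "hmap d d' \<phi> n \<in> Arr A" "Dom A (hmap d d' \<phi> n) = cohomology A d n"
    "Cod A (hmap d d' \<phi> n) = cohomology A d' n"
    and hmap_cls: "\<And>c. cocycle d n c \<Longrightarrow> hmap d d' \<phi> n \<cdot> cls d n c = cls d' n (\<phi> n \<cdot> c)"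
proof -
  note [simp] = chain_map_eq(1,2)[OF \<phi>] chain_mapD[OF \<phi>]
  have "\<exists>!h. h \<in> Hom A (cohomology A d n) (cohomology A d' n) \<and>
     (\<forall>c w. cocycle d n c \<and> w = cls d' n (\<phi> n \<cdot> c) \<longrightarrow> h \<cdot> cls d n c = w)"
  proof (rule cls_desc)
    fix c w assume cw: "cocycle d n c \<and> w = cls d' n (\<phi> n \<cdot> c)"
    then have c: "cocycle d n c" by simp
    note [simp] = cocycleD(1,2)[OF c]
    show "cocycle d n c \<and> w \<in> Arr A \<and> Dom A w = Dom A c \<and> Cod A w = cohomology A d' n"
      using cw chain_map_cocycle[OF \<phi> c] by auto
    show "cocycle d n (c \<cdot> u) \<and> w \<cdot> u = cls d' n (\<phi> n \<cdot> (c \<cdot> u))"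
      if "u \<in> Arr A" "Cod A u = Dom A c" for u
      using cls_comp[OF _ c that] cls_comp[OF _ chain_map_cocycle[OF \<phi> c], of u] that cw by simp
    show "w = ZeroArr A (Dom A c) (cohomology A d' n)" if "boundary d n c"
      using cls_boundary[OF _ chain_map_boundary[OF \<phi> that]] cw by simp
    show "cocycle d n (c \<boxminus> c') \<and> w \<boxminus> w' = cls d' n (\<phi> n \<cdot> (c \<boxminus> c'))"
      if c': "cocycle d n c' \<and> w' = cls d' n (\<phi> n \<cdot> c')" and "Dom A c = Dom A c'" for c' w'
      using that cw cls_sub[OF _ chain_map_cocycle[OF \<phi> c] chain_map_cocycle[OF \<phi>, of n c']]
        cls_sub[OF _ c, of c'] cocycleD(1,2)[of d n c'] by simp
  next
    fix c assume c: "cocycle d n c"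
    note [simp] = cocycleD(1,2)[OF c]
    show "\<exists>e w. epi_arr A e \<and> Cod A e = Dom A c \<and> cocycle d n (c \<cdot> e) \<and> w = cls d' n (\<phi> n \<cdot> (c \<cdot> e))"
      using c by - (rule exI[of _ "Ident A (Dom A c)"], simp add: epi_ident)
  qed simp_all
  from theI'[OF this]
  have *: "hmap d d' \<phi> n \<in> Hom A (cohomology A d n) (cohomology A d' n)"
    "\<And>c. cocycle d n c \<Longrightarrow> hmap d d' \<phi> n \<cdot> cls d n c = cls d' n (\<phi> n \<cdot> c)"
    unfolding hmap_def by auto
  then show "hmap d d' \<phi> n \<in> Arr A" "Dom A (hmap d d' \<phi> n) = cohomology A d n"
    "Cod A (hmap d d' \<phi> n) = cohomology A d' n"
    "\<And>c. cocycle d n c \<Longrightarrow> hmap d d' \<phi> n \<cdot> cls d n c = cls d' n (\<phi> n \<cdot> c)"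
    by (auto simp: Hom_iff)
qed

lemma hmap_unique:
  assumes \<phi>: "chain_map d d' \<phi>" and h: "h \<in> Arr A" "Dom A h = cohomology A d n" "Cod A h = cohomology A d' n"
    and eq: "\<And>c. cocycle d n c \<Longrightarrow> h \<cdot> cls d n c = cls d' n (\<phi> n \<cdot> c)"
  shows "hmap d d' \<phi> n = h"
proof (rule cls_ext[OF chain_map_eq(1)[OF \<phi>]])
  fix c assume c: "cocycle d n c"
  then show "\<exists>e. epi_arr A e \<and> Cod A e = Dom A c \<and> hmap d d' \<phi> n \<cdot> (cls d n c \<cdot> e) = h \<cdot> (cls d n c \<cdot> e)"
    using h hmap_cls[OF \<phi> c] eq[OF c] chain_map_eq[OF \<phi>] cocycleD[OF c]
    by (intro exI[of _ "Ident A (Dom A c)"]) (simp add: epi_ident)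
qed (use h hmap[OF \<phi>] in \<open>auto simp: Hom_iff\<close>)

lemma chain_map_ident: "cochain_complex d \<Longrightarrow> chain_map d d (\<lambda>n. Ident A (Dom A (d n)))"
  by (simp add: chain_map_def)

lemma hmap_ident: "cochain_complex d \<Longrightarrow> hmap d d (\<lambda>n. Ident A (Dom A (d n))) n = Ident A (cohomology A d n)"
  by (rule hmap_unique[OF chain_map_ident]) (simp_all add: cocycle_def)

lemma chain_map_compose:
  assumes "chain_map d d' \<phi>" "chain_map d' d'' \<psi>"
  shows "chain_map d d'' (\<lambda>n. \<psi> n \<cdot> \<phi> n)"
  unfolding chain_map_def
proof (intro conjI allI)
  note [simp] = chain_mapD[OF assms(1)] chain_mapD[OF assms(2)] chain_map_eq(1,2)[OF assms(1)]
    chain_map_eq(1,2)[OF assms(2)]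
  show "(\<psi> (Suc n) \<cdot> \<phi> (Suc n)) \<cdot> d n = d'' n \<cdot> (\<psi> n \<cdot> \<phi> n)" for n
    using chain_map_eq(3)[OF assms(1), of n] chain_map_comp[OF assms(2), of "\<phi> n" n] by simp
qed (use chain_mapD[OF assms(1)] chain_mapD[OF assms(2)] chain_map_eq(1,2)[OF assms(1)]
  chain_map_eq(1,2)[OF assms(2)] in simp_all)

lemma hmap_compose:
  assumes "chain_map d d' \<phi>" "chain_map d' d'' \<psi>"
  shows "hmap d d'' (\<lambda>n. \<psi> n \<cdot> \<phi> n) n = hmap d' d'' \<psi> n \<cdot> hmap d d' \<phi> n"
proof (rule hmap_unique[OF chain_map_compose[OF assms]])
  note [simp] = chain_mapD[OF assms(1)] chain_mapD[OF assms(2)] chain_map_eq(1,2)[OF assms(1)]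
    chain_map_eq(1,2)[OF assms(2)] hmap(1-3)[OF assms(1)] hmap(1-3)[OF assms(2)]
  fix c assume c: "cocycle d n c"
  note [simp] = c cocycleD[OF c]
  show "(hmap d' d'' \<psi> n \<cdot> hmap d d' \<phi> n) \<cdot> cls d n c = cls d'' n ((\<psi> n \<cdot> \<phi> n) \<cdot> c)"
    using hmap_cls[OF assms(1) c] hmap_cls[OF assms(2) chain_map_cocycle[OF assms(1) c]] by simp
qed (use hmap[OF assms(1)] hmap[OF assms(2)] in simp_all)

lemma hmap_add:
  assumes "chain_map d d' \<phi>" "chain_map d d' \<psi>"
  shows "hmap d d' (\<lambda>n. \<phi> n \<boxplus> \<psi> n) n = hmap d d' \<phi> n \<boxplus> hmap d d' \<psi> n"
proof (rule hmap_unique)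
  note [simp] = chain_mapD[OF assms(1)] chain_mapD[OF assms(2)] chain_map_eq(1,2)[OF assms(1)]
    hmap(1-3)[OF assms(1)] hmap(1-3)[OF assms(2)]
  show "chain_map d d' (\<lambda>n. \<phi> n \<boxplus> \<psi> n)"
    using chain_map_eq(3)[OF assms(1)] chain_map_eq(3)[OF assms(2)] by (simp add: chain_map_def)
  show "(hmap d d' \<phi> n \<boxplus> hmap d d' \<psi> n) \<cdot> cls d n c = cls d' n ((\<phi> n \<boxplus> \<psi> n) \<cdot> c)" if c: "cocycle d n c" for c
    using c hmap_cls[OF assms(1) c] hmap_cls[OF assms(2) c] cocycleD[OF c]
      cls_add(2)[OF _ chain_map_cocycle[OF assms(1) c] chain_map_cocycle[OF assms(2) c]] by simp
qed (use hmap[OF assms(1)] hmap[OF assms(2)] in simp_all)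

end

section \<open>The long exact cohomology sequence\<close>

locale short_exact_complexes = abelian_category A for A :: "('o, 'm, 'z) abcat_scheme" (structure) +
  fixes d d' d'' f g
  assumes chain_f: "chain_map d d' f" and chain_g: "chain_map d' d'' g"
    and exact: "short_exact A (f n) (g n)"
begin

lemmas [simp] = chain_mapD[OF chain_f] chain_mapD[OF chain_g] chain_map_eq(1,2)[OF chain_f]
  chain_map_eq(1,2)[OF chain_g]

lemma g_epi: "epi_arr A (g n)" and f_mono: "mono_arr A (f n)" and f_kernel: "is_kernel A (f n) (g n)"
  using short_exactD[OF exact] by auto

lemma gf_zero: "x \<in> Arr A \<Longrightarrow> Cod A x = Dom A (d n) \<Longrightarrow> g n \<cdot> (f n \<cdot> x) = ZeroArr A (Dom A x) (Dom A (d'' n))"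
  using pre_comp[OF kernelD(4)[OF f_kernel[of n]], of x] by simp

text \<open>The pairs of the snake lemma: \<open>y\<close> lifts the cocycle
  \<open>g n \<cdot> y\<close> to the middle complex, and \<open>x\<close> is its differential,
  pulled back along \<open>f\<close>.\<close>

definition connecting_rel :: "nat \<Rightarrow> 'm \<Rightarrow> 'm \<Rightarrow> bool" where
  "connecting_rel n y x \<longleftrightarrow> y \<in> Arr A \<and> Cod A y = Dom A (d' n) \<and> x \<in> Arr A \<and> Dom A x = Dom A y \<and>
     Cod A x = Dom A (d (Suc n)) \<and> f (Suc n) \<cdot> x = d' n \<cdot> y"

lemma connecting_relD:
  assumes "connecting_rel n y x"
  shows "y \<in> Arr A" "Cod A y = Dom A (d' n)" "x \<in> Arr A" "Dom A x = Dom A y"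
    "Cod A x = Dom A (d (Suc n))" "f (Suc n) \<cdot> x = d' n \<cdot> y"
  using assms by (auto simp: connecting_rel_def)

text \<open>The differential of \<open>x\<close> vanishes because the monomorphism \<open>f\<close>
  carries it to \<open>d' \<cdot> d' \<cdot> y = 0\<close>, and that of \<open>g n \<cdot> y\<close>
  because \<open>g\<close> kills \<open>f \<cdot> x\<close>.\<close>

lemma connecting_rel_cocycle:
  assumes r: "connecting_rel n y x"
  shows "cocycle d (Suc n) x" "cocycle d'' n (g n \<cdot> y)"
proof -
  note [simp] = connecting_relD(1-5)[OF r]
  have "f (Suc (Suc n)) \<cdot> (d (Suc n) \<cdot> x) = d' (Suc n) \<cdot> (f (Suc n) \<cdot> x)"
    by (rule chain_map_comp[OF chain_f]) simp_all
  also have "\<dots> = ZeroArr A (Dom A y) (Cod A (d' (Suc n)))"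
    using connecting_relD(6)[OF r] pre_comp[OF complexD(3)[OF chain_map_eq(2)[OF chain_f], of n], of y] by simp
  also have "\<dots> = f (Suc (Suc n)) \<cdot> ZeroArr A (Dom A y) (Cod A (d (Suc n)))"
    by (subst comp_zero) simp_all
  finally have "d (Suc n) \<cdot> x = ZeroArr A (Dom A y) (Cod A (d (Suc n)))"
    by - (rule mono_arrD[OF f_mono[of "Suc (Suc n)"]], simp_all)
  then show "cocycle d (Suc n) x" by (simp add: cocycle_def)
  have "d'' n \<cdot> (g n \<cdot> y) = g (Suc n) \<cdot> (d' n \<cdot> y)" by (rule chain_map_comp[OF chain_g, symmetric]) simp_all
  also have "\<dots> = ZeroArr A (Dom A y) (Cod A (d'' n))"
    using gf_zero[of x "Suc n"] connecting_relD(6)[OF r] by simp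
  finally show "cocycle d'' n (g n \<cdot> y)" by (simp add: cocycle_def)
qed

lemma connecting_rel_ex:
  assumes y: "y \<in> Arr A" "Cod A y = Dom A (d' n)" and c: "cocycle d'' n (g n \<cdot> y)"
  obtains x where "connecting_rel n y x"
proof -
  note [simp] = y
  have "g (Suc n) \<cdot> (d' n \<cdot> y) = d'' n \<cdot> (g n \<cdot> y)" by (rule chain_map_comp[OF chain_g]) simp_all
  also have "\<dots> = ZeroArr A (Dom A y) (Cod A (g (Suc n)))" using cocycleD(3)[OF c] by simp
  finally obtain x where "x \<in> Arr A" "Dom A x = Dom A (d' n \<cdot> y)" "Cod A x = Dom A (f (Suc n))"
    "f (Suc n) \<cdot> x = d' n \<cdot> y"
    by - (rule kernel_lift[OF f_kernel[of "Suc n"], of "d' n \<cdot> y"], simp_all)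
  then show thesis by (intro that[of x]) (simp add: connecting_rel_def)
qed

lemma connecting_rel_local:
  assumes z: "cocycle d'' n z"
  obtains e y x where "epi_arr A e" "Cod A e = Dom A z" "Dom A y = Dom A e" "connecting_rel n y x"
    "g n \<cdot> y = z \<cdot> e"
proof -
  note [simp] = cocycleD[OF z]
  obtain e y where ey: "epi_arr A e" "y \<in> Arr A" "Cod A e = Dom A z" "Cod A y = Dom A (g n)"
    "Dom A y = Dom A e" "g n \<cdot> y = z \<cdot> e" by (rule epi_lift[OF g_epi[of n], of z]) simp_all
  have "cocycle d'' n (g n \<cdot> y)" using cls_comp(1)[OF _ z, of e] ey epi_arr_Arr[OF ey(1)] by simp
  then obtain x where "connecting_rel n y x" using ey by - (rule connecting_rel_ex[of y n], simp_all)
  then show thesis using that ey by blast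
qed

lemma connecting_rel_comp: 
  assumes r: "connecting_rel n y x" and u: "u \<in> Arr A" "Cod A u = Dom A y"
  shows "connecting_rel n (y \<cdot> u) (x \<cdot> u)"
  using connecting_relD[OF r] u pre_comp[OF connecting_relD(6)[OF r], of u] by (simp add: connecting_rel_def)

lemma connecting_rel_sub:
  assumes r: "connecting_rel n y x" and r': "connecting_rel n y' x'" and D: "Dom A y = Dom A y'"
  shows "connecting_rel n (y \<boxminus> y') (x \<boxminus> x')"
  using connecting_relD[OF r] connecting_relD[OF r'] D by (simp add: connecting_rel_def)

text \<open>What is lifted in positive degrees is a primitive of \<open>z\<close>, not
  \<open>z\<close> itself, so the lift of \<open>z\<close> is again a boundary. In degree 0 a
  boundary is zero and the zero arrow lifts it.\<close>

lemma boundary_lift: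
  assumes z: "boundary d'' n z" "z \<in> Arr A" "Cod A z = Dom A (d'' n)"
  obtains e b where "epi_arr A e" "Cod A e = Dom A z" "b \<in> Arr A" "Dom A b = Dom A e"
    "Cod A b = Dom A (d' n)" "boundary d' n b" "g n \<cdot> b = z \<cdot> e"
proof (cases n)
  case 0
  have 1: "epi_arr A (Ident A (Dom A z))" using z by (simp add: epi_ident)
  have zz: "z = ZeroArr A (Dom A z) (Dom A (d'' n))" using 0 z by (simp add: boundary_def)
  show thesis
    by (rule that[OF 1, of "ZeroArr A (Dom A z) (Dom A (d' n))"])
      (use 0 z zz in \<open>simp_all add: boundary_def\<close>)
next
  case (Suc m)
  obtain b where b: "b \<in> Arr A" "Dom A b = Dom A z" "Cod A b = Dom A (d'' m)" "d'' m \<cdot> b = z"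
    using z Suc by (auto simp: boundary_def)
  obtain e y where ey: "epi_arr A e" "y \<in> Arr A" "Cod A e = Dom A b" "Cod A y = Dom A (g m)"
    "Dom A y = Dom A e" "g m \<cdot> y = b \<cdot> e" by (rule epi_lift[OF g_epi[of m], of b]) (use b in simp_all)
  note [simp] = b(1-3) ey(2-5) epi_arr_Arr[OF ey(1)]
  have "g n \<cdot> (d' m \<cdot> y) = d'' m \<cdot> (g m \<cdot> y)"
    unfolding Suc by (rule chain_map_comp[OF chain_g]) simp_all
  also have "\<dots> = z \<cdot> e" unfolding ey(6) using pre_comp[OF b(4), of e] by simp
  finally show thesis
    by - (rule that[OF ey(1), of "d' m \<cdot> y"], use Suc in \<open>auto simp: boundary_def intro!: exI[of _ y]\<close>)
qed

text \<open>Independence of choices in the snake lemma. Subtracting from \<open>y\<close> a boundary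
  with the same image under \<open>g\<close> leaves, on a cover, an arrow of the form
  \<open>f n \<cdot> a\<close>. Boundaries have zero differential, so \<open>a\<close> is a
  primitive of \<open>x\<close> there.\<close>

lemma connecting_rel_boundary:
  assumes r: "connecting_rel n y x" and b: "boundary d'' n (g n \<cdot> y)"
  shows "cls d (Suc n) x = ZeroArr A (Dom A y) (cohomology A d (Suc n))"
proof -
  note rD [simp] = connecting_relD(1-5)[OF r]
  note [simp] = connecting_rel_cocycle(1)[OF r]
  obtain e b where eb: "epi_arr A e" "Cod A e = Dom A (g n \<cdot> y)" "b \<in> Arr A" "Dom A b = Dom A e"
    "Cod A b = Dom A (d' n)" "boundary d' n b" "g n \<cdot> b = (g n \<cdot> y) \<cdot> e"
    by (rule boundary_lift[OF b]) simp_all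
  note [simp] = eb(2-5)[simplified] epi_arr_Arr[OF eb(1)]
  have "g n \<cdot> (y \<cdot> e \<boxminus> b) = ZeroArr A (Dom A e) (Dom A (d'' n))" using eb(7) by simp
  then obtain a where a: "a \<in> Arr A" "Dom A a = Dom A e" "Cod A a = Dom A (d n)" "f n \<cdot> a = y \<cdot> e \<boxminus> b"
    by - (rule kernel_lift[OF f_kernel[of n], of "y \<cdot> e \<boxminus> b"], simp_all)
  note [simp] = a(1-3)
  have db: "d' n \<cdot> b = ZeroArr A (Dom A e) (Cod A (d' n))"
    using cocycleD(3)[OF boundary_cocycle[OF _ eb(6)]] by simp
  have "f (Suc n) \<cdot> (d n \<cdot> a) = d' n \<cdot> (f n \<cdot> a)" by (rule chain_map_comp[OF chain_f]) simp_all
  also have "\<dots> = f (Suc n) \<cdot> (x \<cdot> e)" unfolding a(4) using db pre_comp[OF connecting_relD(6)[OF r], of e] by simp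
  finally have "d n \<cdot> a = x \<cdot> e" by - (rule mono_arrD[OF f_mono[of "Suc n"]], simp_all)
  then have "boundary d (Suc n) (x \<cdot> e)" by (auto simp: boundary_def intro!: exI[of _ a])
  then have "cls d (Suc n) x \<cdot> e = ZeroArr A (Dom A e) (cohomology A d (Suc n))"
    using cls_boundary[of d "Suc n" "x \<cdot> e"] cls_comp(2)[OF _ connecting_rel_cocycle(1)[OF r], of e] by simp
  then show ?thesis by - (rule epi_arrD[OF eb(1)], simp_all del: cohomology.simps)
qed

definition connecting :: "nat \<Rightarrow> 'm" where
  "connecting n = (THE h. h \<in> Hom A (cohomology A d'' n) (cohomology A d (Suc n)) \<and>
     (\<forall>z w. (\<exists>y x. connecting_rel n y x \<and> z = g n \<cdot> y \<and> w = cls d (Suc n) x) \<longrightarrow> h \<cdot> cls d'' n z = w))"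

lemma connecting:
  shows "connecting n \<in> Arr A" "Dom A (connecting n) = cohomology A d'' n" "Cod A (connecting n) = cohomology A d (Suc n)"
    and connecting_cls: "\<And>y x. connecting_rel n y x \<Longrightarrow> connecting n \<cdot> cls d'' n (g n \<cdot> y) = cls d (Suc n) x"
proof -
  have "\<exists>!h. h \<in> Hom A (cohomology A d'' n) (cohomology A d (Suc n)) \<and>
     (\<forall>z w. (\<exists>y x. connecting_rel n y x \<and> z = g n \<cdot> y \<and> w = cls d (Suc n) x) \<longrightarrow> h \<cdot> cls d'' n z = w)"
  proof (rule cls_desc)
    fix z w assume "\<exists>y x. connecting_rel n y x \<and> z = g n \<cdot> y \<and> w = cls d (Suc n) x"
    then obtain y x where r: "connecting_rel n y x" and zw: "z = g n \<cdot> y" "w = cls d (Suc n) x" by blast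
    note [simp] = connecting_relD(1-5)[OF r] connecting_rel_cocycle[OF r]
    show "cocycle d'' n z \<and> w \<in> Arr A \<and> Dom A w = Dom A z \<and> Cod A w = cohomology A d (Suc n)"
      using zw by (simp del: cohomology.simps)
    show "\<exists>y x. connecting_rel n y x \<and> z \<cdot> u = g n \<cdot> y \<and> w \<cdot> u = cls d (Suc n) x"
      if u: "u \<in> Arr A" "Cod A u = Dom A z" for u
    proof (intro exI conjI)
      show "connecting_rel n (y \<cdot> u) (x \<cdot> u)" by (rule connecting_rel_comp[OF r]) (use zw u in simp_all)
    qed (use zw u cls_comp(2)[OF _ connecting_rel_cocycle(1)[OF r], of u] in simp_all)
    show "w = ZeroArr A (Dom A z) (cohomology A d (Suc n))" if "boundary d'' n z"
      using connecting_rel_boundary[OF r] that zw by simp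
    fix z' w' assume "\<exists>y x. connecting_rel n y x \<and> z' = g n \<cdot> y \<and> w' = cls d (Suc n) x" and D: "Dom A z = Dom A z'"
    then obtain y' x' where r': "connecting_rel n y' x'" and zw': "z' = g n \<cdot> y'" "w' = cls d (Suc n) x'" by blast
    note [simp] = connecting_relD(1-5)[OF r'] connecting_rel_cocycle[OF r']
    have [simp]: "Dom A y = Dom A y'" using D zw zw' by simp
    show "\<exists>y x. connecting_rel n y x \<and> z \<boxminus> z' = g n \<cdot> y \<and> w \<boxminus> w' = cls d (Suc n) x"
    proof (intro exI conjI)
      show "connecting_rel n (y \<boxminus> y') (x \<boxminus> x')" by (rule connecting_rel_sub[OF r r']) simp
    qed (use zw zw' cls_sub(2)[OF _ connecting_rel_cocycle(1)[OF r] connecting_rel_cocycle(1)[OF r']] in simp_all)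
  next
    fix z assume z: "cocycle d'' n z"
    show "\<exists>e w. epi_arr A e \<and> Cod A e = Dom A z \<and> (\<exists>y x. connecting_rel n y x \<and> z \<cdot> e = g n \<cdot> y \<and> w = cls d (Suc n) x)"
      by (rule connecting_rel_local[OF z]) metis
  qed (simp_all del: cohomology.simps)
  from theI'[OF this]
  have *: "connecting n \<in> Hom A (cohomology A d'' n) (cohomology A d (Suc n))"
    "\<And>y x. connecting_rel n y x \<Longrightarrow> connecting n \<cdot> cls d'' n (g n \<cdot> y) = cls d (Suc n) x"
    unfolding connecting_def by blast+
  then show "connecting n \<in> Arr A" "Dom A (connecting n) = cohomology A d'' n" "Cod A (connecting n) = cohomology A d (Suc n)"
    "\<And>y x. connecting_rel n y x \<Longrightarrow> connecting n \<cdot> cls d'' n (g n \<cdot> y) = cls d (Suc n) x"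
    by (auto simp: Hom_iff)
qed

text \<open>Every cocycle of the right-hand complex has a lift \<open>y\<close> on a cover, and
  \<open>cls_ext\<close> may be applied on covers.\<close>

lemma connecting_ext:
  assumes h: "h \<in> Hom A (cohomology A d'' n) W" "h' \<in> Hom A (cohomology A d'' n) W"
    and eq: "\<And>y x. connecting_rel n y x \<Longrightarrow> h \<cdot> cls d'' n (g n \<cdot> y) = h' \<cdot> cls d'' n (g n \<cdot> y)"
  shows "h = h'"
proof (rule cls_ext[OF _ h])
  fix z assume z: "cocycle d'' n z"
  obtain e y x where ey: "epi_arr A e" "Cod A e = Dom A z" "Dom A y = Dom A e" "connecting_rel n y x"
    "g n \<cdot> y = z \<cdot> e" by (rule connecting_rel_local[OF z])
  have "cls d'' n (g n \<cdot> y) = cls d'' n z \<cdot> e" 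
    unfolding ey(5) by (rule cls_comp) (use z ey epi_arr_Arr[OF ey(1)] in simp_all)
  then show "\<exists>e. epi_arr A e \<and> Cod A e = Dom A z \<and> h \<cdot> (cls d'' n z \<cdot> e) = h' \<cdot> (cls d'' n z \<cdot> e)"
    using ey eq[OF ey(4)] by auto
qed simp

section \<open>Exactness of the long cohomology sequence\<close>

lemmas hmapF [simp] = hmap(1-3)[OF chain_f]
lemmas hmapG [simp] = hmap(1-3)[OF chain_g]
declare connecting(1-3) [simp] cohomology.simps [simp del]

text \<open>Degree 0 has no boundaries except zero: if the class of \<open>f 0 \<cdot> c\<close>
  vanishes, \<open>f 0 \<cdot> c\<close> itself vanishes on a cover, and therefore so does
  \<open>c\<close>.\<close>

lemma hmap_mono: "mono_arr A (hmap d d' f 0)"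
proof (rule kernel_free_mono)
  fix h assume h [simp]: "h \<in> Arr A" "Cod A h = Dom A (hmap d d' f 0)" 
    and 0: "hmap d d' f 0 \<cdot> h = ZeroArr A (Dom A h) (Cod A (hmap d d' f 0))"
  obtain e c where ec: "epi_arr A e" "Cod A e = Dom A h" "cocycle d 0 c" "Dom A c = Dom A e"
    "cls d 0 c = h \<cdot> e" by (rule cls_surj[of d h 0]) simp_all
  note [simp] = epi_arr_Arr[OF ec(1)] ec(2,4) cocycleD[OF ec(3)]
  note fc [simp] = chain_map_cocycle[OF chain_f ec(3)]
  have "cls d' 0 (f 0 \<cdot> c) = ZeroArr A (Dom A (f 0 \<cdot> c)) (cohomology A d' 0)"
    using hmap_cls[OF chain_f ec(3)] pre_comp[OF 0, of e] ec(5) by simp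
  then obtain e' where e': "epi_arr A e'" "Cod A e' = Dom A (f 0 \<cdot> c)" "boundary d' 0 ((f 0 \<cdot> c) \<cdot> e')"
    by (rule cls_zero[OF _ fc, rotated]) simp_all
  note [simp] = epi_arr_Arr[OF e'(1)] e'(2)
  have "f 0 \<cdot> (c \<cdot> e') = f 0 \<cdot> ZeroArr A (Dom A e') (Dom A (d 0))" using e'(3) by (simp add: boundary_def)
  then have 1: "c \<cdot> e' = ZeroArr A (Dom A e') (Dom A (d 0))" by - (rule mono_arrD[OF f_mono[of 0]], simp_all)
  have "h \<cdot> (e \<cdot> e') = cls d 0 c \<cdot> e'" using ec(5) by simp
  also have "\<dots> = cls d 0 (c \<cdot> e')" by (rule cls_comp(2)[symmetric]) (use ec in simp_all)
  also have "\<dots> = ZeroArr A (Dom A e') (cohomology A d 0)"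
    unfolding 1 by (subst cls_boundary) (simp_all add: boundary_def)
  finally show "\<exists>e. epi_arr A e \<and> Cod A e = Dom A h \<and> h \<cdot> e = ZeroArr A (Dom A e) (Cod A h)"
    using epi_comp[OF ec(1) e'(1)] by (intro exI[of _ "e \<cdot> e'"]) simp
qed simp

lemma exact1: "exact_at A (hmap d d' f n) (hmap d' d'' g n)"
proof (rule exact_atI)
  show "hmap d' d'' g n \<cdot> hmap d d' f n = ZeroArr A (Dom A (hmap d d' f n)) (Cod A (hmap d' d'' g n))"
  proof (rule cls_ext[of d])
    fix c assume c: "cocycle d n c"
    note [simp] = cocycleD(1,2)[OF c] c chain_map_cocycle[OF chain_f c]
    have "boundary d'' n (ZeroArr A (Dom A c) (Dom A (d'' n)))"
      by (cases n) (auto simp: boundary_def intro!: exI[of _ "ZeroArr A (Dom A c) (Dom A (d'' _))"])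
    then have "(hmap d' d'' g n \<cdot> hmap d d' f n) \<cdot> cls d n c = ZeroArr A (Dom A c) (cohomology A d'' n)"
      using hmap_cls[OF chain_f c] hmap_cls[OF chain_g chain_map_cocycle[OF chain_f c]] gf_zero[of c n]
        cls_boundary[of d'' n "ZeroArr A (Dom A c) (Dom A (d'' n))"] by simp
    then show "\<exists>e. epi_arr A e \<and> Cod A e = Dom A c \<and> (hmap d' d'' g n \<cdot> hmap d d' f n) \<cdot> (cls d n c \<cdot> e) =
      ZeroArr A (Dom A (hmap d d' f n)) (Cod A (hmap d' d'' g n)) \<cdot> (cls d n c \<cdot> e)"
      by (intro exI[of _ "Ident A (Dom A c)"]) (simp add: epi_ident)
  qed (simp_all add: Hom_iff)
next
  fix h assume h [simp]: "h \<in> Arr A" "Cod A h = Dom A (hmap d' d'' g n)"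
    and 0: "hmap d' d'' g n \<cdot> h = ZeroArr A (Dom A h) (Cod A (hmap d' d'' g n))"
  obtain e c where ec: "epi_arr A e" "Cod A e = Dom A h" "cocycle d' n c" "Dom A c = Dom A e"
    "cls d' n c = h \<cdot> e" by (rule cls_surj[of d' h n]) simp_all
  note [simp] = epi_arr_Arr[OF ec(1)] ec(2,4) cocycleD[OF ec(3)] ec(3)
  note gc [simp] = chain_map_cocycle[OF chain_g ec(3)]
  have "cls d'' n (g n \<cdot> c) = ZeroArr A (Dom A (g n \<cdot> c)) (cohomology A d'' n)"
    using hmap_cls[OF chain_g ec(3)] pre_comp[OF 0, of e] ec(5) by simp
  then obtain e' where e': "epi_arr A e'" "Cod A e' = Dom A (g n \<cdot> c)" "boundary d'' n ((g n \<cdot> c) \<cdot> e')"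
    by (rule cls_zero[OF _ gc, rotated]) simp_all
  note [simp] = epi_arr_Arr[OF e'(1)] e'(2)
  obtain e2 b where eb: "epi_arr A e2" "Cod A e2 = Dom A ((g n \<cdot> c) \<cdot> e')" "b \<in> Arr A" "Dom A b = Dom A e2"
    "Cod A b = Dom A (d' n)" "boundary d' n b" "g n \<cdot> b = ((g n \<cdot> c) \<cdot> e') \<cdot> e2"
    by (rule boundary_lift[OF e'(3)]) simp_all
  note [simp] = epi_arr_Arr[OF eb(1)] eb(2)[simplified] eb(3-5)
  define E where "E = e' \<cdot> e2"
  have E [simp]: "E \<in> Arr A" "Dom A E = Dom A e2" "Cod A E = Dom A e" "epi_arr A E"
    using epi_comp[OF e'(1) eb(1)] by (simp_all add: E_def)
  \<comment> \<open>On a cover the image of \<open>c\<close> is a boundary. Subtracting the boundary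
    \<open>b\<close> that lifts it changes no class and leaves an arrow in the kernel of
    \<open>g n\<close>, hence one coming from the left complex through some \<open>a\<close>;
    \<open>a\<close> is a cocycle because \<open>f\<close> is a monomorphism.\<close>
  have "g n \<cdot> (c \<cdot> E \<boxminus> b) = ZeroArr A (Dom A e2) (Dom A (d'' n))" using eb(7) by (simp add: E_def)
  then obtain a where a: "a \<in> Arr A" "Dom A a = Dom A e2" "Cod A a = Dom A (d n)" "f n \<cdot> a = c \<cdot> E \<boxminus> b"
    by - (rule kernel_lift[OF f_kernel[of n], of "c \<cdot> E \<boxminus> b"], simp_all)
  note [simp] = a(1-3)
  have cE: "cocycle d' n (c \<cdot> E)" "cls d' n (c \<cdot> E) = cls d' n c \<cdot> E"
    by (rule cls_comp; simp)+
  have bc: "cocycle d' n b" by (rule boundary_cocycle) (use eb in simp_all)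
  have fa: "cocycle d' n (f n \<cdot> a)" unfolding a(4) by (rule cls_sub) (use cE bc in simp_all)
  have "f (Suc n) \<cdot> (d n \<cdot> a) = f (Suc n) \<cdot> ZeroArr A (Dom A a) (Cod A (d n))"
    using chain_map_comp[OF chain_f, of a n] cocycleD(3)[OF fa] by simp
  then have "d n \<cdot> a = ZeroArr A (Dom A a) (Cod A (d n))"
    by - (rule mono_arrD[OF f_mono[of "Suc n"]], simp_all)
  then have ca: "cocycle d n a" by (simp add: cocycle_def)
  have "hmap d d' f n \<cdot> cls d n a = cls d' n (c \<cdot> E \<boxminus> b)" using hmap_cls[OF chain_f ca] a(4) by simp
  also have "\<dots> = cls d' n (c \<cdot> E)" 
    using cls_sub(2)[OF _ cE(1) bc] cls_boundary[of d' n b] eb(6) cE by simp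
  also have "\<dots> = h \<cdot> (e \<cdot> E)" using cE(2) ec(5) by simp
  finally show "\<exists>e x. epi_arr A e \<and> x \<in> Arr A \<and> Cod A e = Dom A h \<and> Dom A x = Dom A e \<and>
      Cod A x = Dom A (hmap d d' f n) \<and> hmap d d' f n \<cdot> x = h \<cdot> e"
    using epi_comp[OF ec(1) E(4)] ca by (intro exI[of _ "e \<cdot> E"] exI[of _ "cls d n a"]) simp
qed simp_all

lemma exact2: "exact_at A (hmap d' d'' g n) (connecting n)"
proof (rule exact_atI)
  show "connecting n \<cdot> hmap d' d'' g n = ZeroArr A (Dom A (hmap d' d'' g n)) (Cod A (connecting n))"
  proof (rule cls_ext[of d'])
    fix c assume c: "cocycle d' n c"
    note [simp] = cocycleD[OF c] c chain_map_cocycle[OF chain_g c]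
    have r: "connecting_rel n c (ZeroArr A (Dom A c) (Dom A (d (Suc n))))"
      by (simp add: connecting_rel_def)
    have "boundary d (Suc n) (ZeroArr A (Dom A c) (Dom A (d (Suc n))))"
      by (auto simp: boundary_def intro!: exI[of _ "ZeroArr A (Dom A c) (Dom A (d n))"])
    then have "(connecting n \<cdot> hmap d' d'' g n) \<cdot> cls d' n c = ZeroArr A (Dom A c) (cohomology A d (Suc n))"
      using hmap_cls[OF chain_g c] connecting_cls[OF r] 
        cls_boundary[of d "Suc n" "ZeroArr A (Dom A c) (Dom A (d (Suc n)))"] by simp
    then show "\<exists>e. epi_arr A e \<and> Cod A e = Dom A c \<and> (connecting n \<cdot> hmap d' d'' g n) \<cdot> (cls d' n c \<cdot> e) =
      ZeroArr A (Dom A (hmap d' d'' g n)) (Cod A (connecting n)) \<cdot> (cls d' n c \<cdot> e)"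
      by (intro exI[of _ "Ident A (Dom A c)"]) (simp add: epi_ident)
  qed (simp_all add: Hom_iff)
next
  fix h assume h [simp]: "h \<in> Arr A" "Cod A h = Dom A (connecting n)"
    and 0: "connecting n \<cdot> h = ZeroArr A (Dom A h) (Cod A (connecting n))"
  obtain e c where ec: "epi_arr A e" "Cod A e = Dom A h" "cocycle d'' n c" "Dom A c = Dom A e"
    "cls d'' n c = h \<cdot> e" by (rule cls_surj[of d'' h n]) simp_all
  note [simp] = epi_arr_Arr[OF ec(1)] ec(2,4) cocycleD[OF ec(3)] ec(3)
  obtain e1 y x where r1: "epi_arr A e1" "Cod A e1 = Dom A c" "Dom A y = Dom A e1" "connecting_rel n y x"
    "g n \<cdot> y = c \<cdot> e1" by (rule connecting_rel_local[OF ec(3)])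
  note [simp] = epi_arr_Arr[OF r1(1)] r1(2,3) connecting_relD(1-5)[OF r1(4)] connecting_rel_cocycle[OF r1(4)]
  have gy: "cls d'' n (g n \<cdot> y) = h \<cdot> (e \<cdot> e1)"
    unfolding r1(5) using cls_comp(2)[of d'' n c e1] ec(5) by simp
  have "cls d (Suc n) x = ZeroArr A (Dom A x) (cohomology A d (Suc n))"
    using connecting_cls[OF r1(4)] gy pre_comp[OF 0, of "e \<cdot> e1"] by simp
  then obtain e2 where e2: "epi_arr A e2" "Cod A e2 = Dom A x" "boundary d (Suc n) (x \<cdot> e2)"
    by (rule cls_zero[of d, rotated 2]) simp_all
  note [simp] = epi_arr_Arr[OF e2(1)] e2(2)
  \<comment> \<open>On a cover \<open>x\<close> is the differential of some \<open>a\<close>.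
    Correcting the lift \<open>y\<close> by \<open>f n \<cdot> a\<close> makes it a cocycle and does
    not change its image under \<open>g n\<close>.\<close>
  obtain a where a: "a \<in> Arr A" "Dom A a = Dom A e2" "Cod A a = Dom A (d n)" "d n \<cdot> a = x \<cdot> e2"
    using e2(3) by (auto simp: boundary_def)
  note [simp] = a(1-3)
  have "d' n \<cdot> (f n \<cdot> a) = f (Suc n) \<cdot> (x \<cdot> e2)"
    using chain_map_comp[OF chain_f, of a n] a(4) by simp
  also have "\<dots> = d' n \<cdot> (y \<cdot> e2)" using pre_comp[OF connecting_relD(6)[OF r1(4)], of e2] by simp
  finally have "cocycle d' n (y \<cdot> e2 \<boxminus> f n \<cdot> a)" by (simp add: cocycle_def)
  note ca = this
  have "hmap d' d'' g n \<cdot> cls d' n (y \<cdot> e2 \<boxminus> f n \<cdot> a) = cls d'' n (g n \<cdot> (y \<cdot> e2 \<boxminus> f n \<cdot> a))"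
    using hmap_cls[OF chain_g ca] by simp
  also have "g n \<cdot> (y \<cdot> e2 \<boxminus> f n \<cdot> a) = (g n \<cdot> y) \<cdot> e2" using gf_zero[of a n] by simp
  also have "cls d'' n \<dots> = h \<cdot> ((e \<cdot> e1) \<cdot> e2)" using cls_comp(2)[of d'' n "g n \<cdot> y" e2] gy by simp
  finally show "\<exists>e x. epi_arr A e \<and> x \<in> Arr A \<and> Cod A e = Dom A h \<and> Dom A x = Dom A e \<and>
      Cod A x = Dom A (hmap d' d'' g n) \<and> hmap d' d'' g n \<cdot> x = h \<cdot> e"
    using epi_comp[OF epi_comp[OF ec(1) r1(1)] e2(1)] ca
    by (intro exI[of _ "(e \<cdot> e1) \<cdot> e2"] exI[of _ "cls d' n (y \<cdot> e2 \<boxminus> f n \<cdot> a)"]) simp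
qed simp_all

lemma exact3: "exact_at A (connecting n) (hmap d d' f (Suc n))"
proof (rule exact_atI)
  show "hmap d d' f (Suc n) \<cdot> connecting n = ZeroArr A (Dom A (connecting n)) (Cod A (hmap d d' f (Suc n)))"
  proof (rule connecting_ext)
    fix y x assume r: "connecting_rel n y x"
    note [simp] = connecting_relD(1-5)[OF r] connecting_rel_cocycle[OF r]
    have "boundary d' (Suc n) (f (Suc n) \<cdot> x)"
      unfolding connecting_relD(6)[OF r] by (auto simp: boundary_def intro!: exI[of _ y])
    then show "(hmap d d' f (Suc n) \<cdot> connecting n) \<cdot> cls d'' n (g n \<cdot> y) =
       ZeroArr A (Dom A (connecting n)) (Cod A (hmap d d' f (Suc n))) \<cdot> cls d'' n (g n \<cdot> y)"
      using connecting_cls[OF r] hmap_cls[OF chain_f connecting_rel_cocycle(1)[OF r]]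
        cls_boundary[of d' "Suc n" "f (Suc n) \<cdot> x"] by simp
  qed (simp_all add: Hom_iff)
next
  fix h assume h [simp]: "h \<in> Arr A" "Cod A h = Dom A (hmap d d' f (Suc n))"
    and 0: "hmap d d' f (Suc n) \<cdot> h = ZeroArr A (Dom A h) (Cod A (hmap d d' f (Suc n)))"
  obtain e x where ec: "epi_arr A e" "Cod A e = Dom A h" "cocycle d (Suc n) x" "Dom A x = Dom A e"
    "cls d (Suc n) x = h \<cdot> e" by (rule cls_surj[of d h "Suc n"]) simp_all
  note [simp] = epi_arr_Arr[OF ec(1)] ec(2,4) cocycleD[OF ec(3)] ec(3)
  note fx [simp] = chain_map_cocycle[OF chain_f ec(3)]
  have "cls d' (Suc n) (f (Suc n) \<cdot> x) = ZeroArr A (Dom A (f (Suc n) \<cdot> x)) (cohomology A d' (Suc n))"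
    using hmap_cls[OF chain_f ec(3)] pre_comp[OF 0, of e] ec(5) by simp
  then obtain e1 where e1: "epi_arr A e1" "Cod A e1 = Dom A (f (Suc n) \<cdot> x)" "boundary d' (Suc n) ((f (Suc n) \<cdot> x) \<cdot> e1)"
    by (rule cls_zero[OF _ fx, rotated]) simp_all
  note [simp] = epi_arr_Arr[OF e1(1)] e1(2)
  \<comment> \<open>A primitive of \<open>f \<cdot> x\<close> in the middle complex is by definition
    a snake partner of \<open>x\<close>, so the class of its image under \<open>g\<close> is the
    preimage sought.\<close>
  obtain y where y: "y \<in> Arr A" "Dom A y = Dom A e1" "Cod A y = Dom A (d' n)" "d' n \<cdot> y = (f (Suc n) \<cdot> x) \<cdot> e1"
    using e1(3) by (auto simp: boundary_def)
  note [simp] = y(1-3)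
  have r: "connecting_rel n y (x \<cdot> e1)" using y(4) by (simp add: connecting_rel_def)
  have "connecting n \<cdot> cls d'' n (g n \<cdot> y) = cls d (Suc n) x \<cdot> e1"
    using connecting_cls[OF r] cls_comp(2)[of d "Suc n" x e1] by simp
  also have "\<dots> = h \<cdot> (e \<cdot> e1)" using ec(5) by simp
  finally show "\<exists>e x. epi_arr A e \<and> x \<in> Arr A \<and> Cod A e = Dom A h \<and> Dom A x = Dom A e \<and>
      Cod A x = Dom A (connecting n) \<and> connecting n \<cdot> x = h \<cdot> e"
    using epi_comp[OF ec(1) e1(1)] connecting_rel_cocycle[OF r]
    by (intro exI[of _ "e \<cdot> e1"] exI[of _ "cls d'' n (g n \<cdot> y)"]) simp
qed simp_all

end

context abelian_category
begin

text \<open>The vertical chain maps carry snake pairs to snake pairs, and a connecting morphism is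
  determined by its snake pairs.\<close>

lemma connecting_natural:
  assumes "short_exact_complexes A d d' d'' f g" "short_exact_complexes A D D' D'' F G"
    and a: "chain_map d D a" and b: "chain_map d' D' b" and c: "chain_map d'' D'' c"
    and fa: "\<And>n. b n \<cdot> f n = F n \<cdot> a n" and gb: "\<And>n. c n \<cdot> g n = G n \<cdot> b n"
  shows "hmap d D a (Suc n) \<cdot> short_exact_complexes.connecting A d d' d'' f g n =
    short_exact_complexes.connecting A D D' D'' F G n \<cdot> hmap d'' D'' c n"
proof -
  interpret S: short_exact_complexes A d d' d'' f g by fact
  interpret T: short_exact_complexes A D D' D'' F G by fact
  note [simp] = hmap(1-3)[OF a] hmap(1-3)[OF b] hmap(1-3)[OF c] chain_mapD[OF a] chain_mapD[OF b] chain_mapD[OF c]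
  show ?thesis
  proof (rule S.connecting_ext)
    fix y x assume r: "S.connecting_rel n y x"
    note [simp] = S.connecting_relD(1-5)[OF r] S.connecting_rel_cocycle[OF r]
    have cg: "c n \<cdot> (g n \<cdot> y) = G n \<cdot> (b n \<cdot> y)" using pre_comp[OF gb[of n], of y] by simp
    have "F (Suc n) \<cdot> (a (Suc n) \<cdot> x) = b (Suc n) \<cdot> (f (Suc n) \<cdot> x)" using pre_comp[OF fa[of "Suc n"], of x] by simp
    also have "\<dots> = D' n \<cdot> (b n \<cdot> y)" unfolding S.connecting_relD(6)[OF r] by (rule chain_map_comp[OF b]) simp_all
    finally have r': "T.connecting_rel n (b n \<cdot> y) (a (Suc n) \<cdot> x)" by (simp add: T.connecting_rel_def)
    show "(hmap d D a (Suc n) \<cdot> S.connecting n) \<cdot> cls d'' n (g n \<cdot> y) = (T.connecting n \<cdot> hmap d'' D'' c n) \<cdot> cls d'' n (g n \<cdot> y)"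
      using S.connecting_cls[OF r] T.connecting_cls[OF r'] hmap_cls[OF a S.connecting_rel_cocycle(1)[OF r]]
        hmap_cls[OF c S.connecting_rel_cocycle(2)[OF r]] cg by simp
  qed (simp_all add: Hom_iff)
qed

end

section \<open>Functors, natural transformations and universal delta functors\<close>

lemma functorD:
  assumes "is_functor C D F"
  shows "a \<in> Obj C \<Longrightarrow> FObj F a \<in> Obj D"
    and "f \<in> Arr C \<Longrightarrow> FArr F f \<in> Arr D"
    and "f \<in> Arr C \<Longrightarrow> Dom D (FArr F f) = FObj F (Dom C f)"
    and "f \<in> Arr C \<Longrightarrow> Cod D (FArr F f) = FObj F (Cod C f)"
    and "a \<in> Obj C \<Longrightarrow> FArr F (Ident C a) = Ident D (FObj F a)"
    and "\<lbrakk>f \<in> Arr C; g \<in> Arr C; Dom C g = Cod C f\<rbrakk>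
      \<Longrightarrow> FArr F (g \<cdot>\<^bsub>C\<^esub> f) = FArr F g \<cdot>\<^bsub>D\<^esub> FArr F f"
  using assms unfolding is_functor_def by (auto simp: Hom_iff)

lemma nattransD:
  assumes "is_nattrans C D F G \<eta>"
  shows "is_functor C D F" "is_functor C D G" "\<eta> \<in> extensional (Obj C)"
    and "a \<in> Obj C \<Longrightarrow> \<eta> a \<in> Arr D"
    and "a \<in> Obj C \<Longrightarrow> Dom D (\<eta> a) = FObj F a"
    and "a \<in> Obj C \<Longrightarrow> Cod D (\<eta> a) = FObj G a"
    and "f \<in> Arr C \<Longrightarrow> \<eta> (Cod C f) \<cdot>\<^bsub>D\<^esub> FArr F f = FArr G f \<cdot>\<^bsub>D\<^esub> \<eta> (Dom C f)"
  using assms unfolding is_nattrans_def by (auto simp: Hom_iff)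

lemma nattransI:
  assumes "is_functor C D F" "is_functor C D G" "\<eta> \<in> extensional (Obj C)"
    and "\<And>a. a \<in> Obj C \<Longrightarrow> \<eta> a \<in> Arr D \<and> Dom D (\<eta> a) = FObj F a \<and> Cod D (\<eta> a) = FObj G a"
    and "\<And>f. f \<in> Arr C \<Longrightarrow> \<eta> (Cod C f) \<cdot>\<^bsub>D\<^esub> FArr F f = FArr G f \<cdot>\<^bsub>D\<^esub> \<eta> (Dom C f)"
  shows "is_nattrans C D F G \<eta>"
  using assms unfolding is_nattrans_def by (auto simp: Hom_iff)

lemma functor_cat_sel [simp]:
  "Obj (functor_cat C A) = {F. is_functor C A F}"
  "(F, \<eta>, G) \<in> Arr (functor_cat C A) \<longleftrightarrow> is_nattrans C A F G \<eta>"
  "Dom (functor_cat C A) t = fst t"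
  "Cod (functor_cat C A) t = snd (snd t)"
  "Ident (functor_cat C A) F = (F, \<lambda>c \<in> Obj C. Ident A (FObj F c), F)"
  "s \<cdot>\<^bsub>functor_cat C A\<^esub> t = (fst t, \<lambda>c \<in> Obj C. component s c \<cdot>\<^bsub>A\<^esub> component t c, snd (snd s))"
  "ZeroArr (functor_cat C A) F G = (F, \<lambda>c \<in> Obj C. ZeroArr A (FObj F c) (FObj G c), G)"
  "AddArr (functor_cat C A) s t =
    (fst s, \<lambda>c \<in> Obj C. AddArr A (component s c) (component t c), snd (snd s))"
  by (auto simp: functor_cat_def component_def split: prod.splits)

lemma component_simp [simp]: "component (F, \<eta>, G) = \<eta>"
  by (simp add: component_def)

lemma functor_cat_Arr: "t \<in> Arr (functor_cat C A) \<longleftrightarrow> is_nattrans C A (fst t) (snd (snd t)) (component t)"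
  by (cases t) simp

lemma functor_cat_Hom:
  "t \<in> Hom (functor_cat C A) F G \<longleftrightarrow>
    is_nattrans C A F G (component t) \<and> fst t = F \<and> snd (snd t) = G"
  by (auto simp: Hom_iff functor_cat_Arr)

lemma functor_cat_arr_eqI:
  assumes "s \<in> Arr (functor_cat C A)" "t \<in> Arr (functor_cat C A)" "fst s = fst t" "snd (snd s) = snd (snd t)"
    and "\<And>c. c \<in> Obj C \<Longrightarrow> component s c = component t c"
  shows "s = t"
proof -
  have "component s = component t"
    using assms by (auto simp: functor_cat_Arr intro!: extensionalityI[of _ "Obj C"] dest: nattransD(3))
  then show ?thesis using assms by (simp add: component_def prod_eq_iff)
qed

lemma category_functor_cat:
  assumes "category C" "category D"
  shows "category (functor_cat C D)"
proof -
  interpret C: category C by fact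
  interpret D: category D by fact
  let ?F = "functor_cat C D"
  have id: "is_nattrans C D F F (\<lambda>c \<in> Obj C. Ident D (FObj F c))" if "is_functor C D F" for F
    by (rule nattransI) (use that functorD[OF that] in simp_all)
  have comp: "is_nattrans C D F H (\<lambda>c \<in> Obj C. \<theta> c \<cdot>\<^bsub>D\<^esub> \<eta> c)"
    if e: "is_nattrans C D F G \<eta>" "is_nattrans C D G H \<theta>" for F G H \<eta> \<theta>
  proof (rule nattransI)
    note [simp] = nattransD[OF e(1)] nattransD[OF e(2)] functorD[OF nattransD(1)[OF e(1)]]
      functorD[OF nattransD(1)[OF e(2)]] functorD[OF nattransD(2)[OF e(2)]]
    fix f assume f: "f \<in> Arr C"
    note [simp] = f
    show "(\<lambda>c \<in> Obj C. \<theta> c \<cdot>\<^bsub>D\<^esub> \<eta> c) (Cod C f) \<cdot>\<^bsub>D\<^esub> FArr F f =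
      FArr H f \<cdot>\<^bsub>D\<^esub> (\<lambda>c \<in> Obj C. \<theta> c \<cdot>\<^bsub>D\<^esub> \<eta> c) (Dom C f)"
      using D.pre_comp[OF nattransD(7)[OF e(2) f], of "\<eta> (Dom C f)"] by simp
  qed (use nattransD[OF e(1)] nattransD[OF e(2)] in simp_all)
  show ?thesis
  proof
    fix f assume "f \<in> Arr ?F"
    then show "Dom ?F f \<in> Obj ?F" "Cod ?F f \<in> Obj ?F" using nattransD by (auto simp: functor_cat_Arr)
  next
    fix a assume "a \<in> Obj ?F"
    then show "Ident ?F a \<in> Hom ?F a a" using id by (auto simp: Hom_iff)
  next
    fix f a b g c assume "f \<in> Hom ?F a b" "g \<in> Hom ?F b c"
    then show "g \<cdot>\<^bsub>?F\<^esub> f \<in> Hom ?F a c"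
      using comp by (auto simp: Hom_iff functor_cat_Arr)
  next
    fix f a b assume f: "f \<in> Hom ?F a b"
    then have n: "is_nattrans C D a b (component f)" and [simp]: "fst f = a" "snd (snd f) = b"
      by (auto simp: Hom_iff functor_cat_Arr)
    show "Ident ?F b \<cdot>\<^bsub>?F\<^esub> f = f" "f \<cdot>\<^bsub>?F\<^esub> Ident ?F a = f"
      by (rule functor_cat_arr_eqI[of _ C D];
        use f comp[OF n id] comp[OF id n] n nattransD[OF n] in \<open>simp add: Hom_iff\<close>)+
  next
    fix f a b g c h d assume *: "f \<in> Hom ?F a b" "g \<in> Hom ?F b c" "h \<in> Hom ?F c d"
    then have n: "is_nattrans C D a b (component f)" "is_nattrans C D b c (component g)"
      "is_nattrans C D c d (component h)" and
      [simp]: "fst f = a" "snd (snd f) = b" "fst g = b" "snd (snd g) = c" "fst h = c" "snd (snd h) = d"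
      by (auto simp: Hom_iff functor_cat_Arr)
    show "(h \<cdot>\<^bsub>?F\<^esub> g) \<cdot>\<^bsub>?F\<^esub> f = h \<cdot>\<^bsub>?F\<^esub> (g \<cdot>\<^bsub>?F\<^esub> f)"
      by (rule functor_cat_arr_eqI[of _ C D])
        (use comp[OF n(1) comp[OF n(2,3)]] comp[OF comp[OF n(1,2)] n(3)]
          nattransD[OF n(1)] nattransD[OF n(2)] nattransD[OF n(3)] in simp_all)
  qed
qed

lemma functorI:
  assumes "category C"
    and "\<And>a. a \<in> Obj C \<Longrightarrow> Fo a \<in> Obj D"
    and "\<And>f. f \<in> Arr C \<Longrightarrow> Fa f \<in> Arr D \<and> Dom D (Fa f) = Fo (Dom C f) \<and> Cod D (Fa f) = Fo (Cod C f)"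
    and "\<And>a. a \<in> Obj C \<Longrightarrow> Fa (Ident C a) = Ident D (Fo a)"
    and "\<And>f g. \<lbrakk>f \<in> Arr C; g \<in> Arr C; Dom C g = Cod C f\<rbrakk> \<Longrightarrow> Fa (g \<cdot>\<^bsub>C\<^esub> f) = Fa g \<cdot>\<^bsub>D\<^esub> Fa f"
  shows "is_functor C D \<lparr>FObj = restrict Fo (Obj C), FArr = restrict Fa (Arr C)\<rparr>"
proof -
  interpret category C by fact
  show ?thesis unfolding is_functor_def using assms(2-) by (auto simp: Hom_iff)
qed

text \<open>\<open>\<iota> a\<close> is an effacing monomorphism with cokernel \<open>\<pi> a\<close>. The condition \<open>extend\<close> yields naturality of the
  inductively constructed morphisms; \<open>embed\<close> yields their compatibility with the connecting morphisms, by
  comparing \<open>f\<close> and \<open>\<iota> a\<close> with \<open>\<iota> b \<circ> f\<close> rather than with a pushout.\<close>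

locale effaceable_delta_functor = B: category B + A: abelian_category A
  for B :: "('o1, 'm1, 'z1) abcat_scheme" and A :: "('o2, 'm2, 'z2) abcat_scheme" +
  fixes T \<delta> \<iota> \<pi>
  assumes delta: "delta_functor B A T \<delta>"
    and effacing: "a \<in> Obj B \<Longrightarrow> short_exact B (\<iota> a) (\<pi> a)"
    and dom_iota: "a \<in> Obj B \<Longrightarrow> Dom B (\<iota> a) = a"
    and efface: "a \<in> Obj B \<Longrightarrow> FArr (T (Suc n)) (\<iota> a) =
      ZeroArr A (FObj (T (Suc n)) a) (FObj (T (Suc n)) (Cod B (\<iota> a)))"
    and extend: "f \<in> Arr B \<Longrightarrow> \<exists>r s. r \<in> Hom B (Cod B (\<iota> (Dom B f))) (Cod B (\<iota> (Cod B f))) \<and>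
      s \<in> Hom B (Cod B (\<pi> (Dom B f))) (Cod B (\<pi> (Cod B f))) \<and>
      r \<cdot>\<^bsub>B\<^esub> \<iota> (Dom B f) = \<iota> (Cod B f) \<cdot>\<^bsub>B\<^esub> f \<and> s \<cdot>\<^bsub>B\<^esub> \<pi> (Dom B f) = \<pi> (Cod B f) \<cdot>\<^bsub>B\<^esub> r"
    and embed: "short_exact B f g \<Longrightarrow> \<exists>g' c r q. short_exact B (\<iota> (Cod B f) \<cdot>\<^bsub>B\<^esub> f) g' \<and>
      c \<in> Hom B (Cod B g) (Cod B g') \<and> c \<cdot>\<^bsub>B\<^esub> g = g' \<cdot>\<^bsub>B\<^esub> \<iota> (Cod B f) \<and>
      r \<in> Hom B (Cod B (\<iota> (Dom B f))) (Cod B (\<iota> (Cod B f))) \<and>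
      r \<cdot>\<^bsub>B\<^esub> \<iota> (Dom B f) = \<iota> (Cod B f) \<cdot>\<^bsub>B\<^esub> f \<and>
      q \<in> Hom B (Cod B (\<pi> (Dom B f))) (Cod B g') \<and> q \<cdot>\<^bsub>B\<^esub> \<pi> (Dom B f) = g' \<cdot>\<^bsub>B\<^esub> r"

lemma delta_functorD:
  assumes "delta_functor B A T \<delta>"
  shows "is_functor B A (T n)"
    and "short_exact B f g \<Longrightarrow> \<delta> n f g \<in> Hom A (FObj (T n) (Cod B g)) (FObj (T (Suc n)) (Dom B f))"
    and "short_exact B f g \<Longrightarrow> exact_at A (FArr (T n) f) (FArr (T n) g)"
    and "short_exact B f g \<Longrightarrow> exact_at A (FArr (T n) g) (\<delta> n f g)"
    and "short_exact B f g \<Longrightarrow> exact_at A (\<delta> n f g) (FArr (T (Suc n)) f)"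
    and "\<lbrakk>short_exact B f g; short_exact B f' g'; a \<in> Hom B (Dom B f) (Dom B f');
      b \<in> Hom B (Cod B f) (Cod B f'); c \<in> Hom B (Cod B g) (Cod B g');
      b \<cdot>\<^bsub>B\<^esub> f = f' \<cdot>\<^bsub>B\<^esub> a; c \<cdot>\<^bsub>B\<^esub> g = g' \<cdot>\<^bsub>B\<^esub> b\<rbrakk>
      \<Longrightarrow> FArr (T (Suc n)) a \<cdot>\<^bsub>A\<^esub> \<delta> n f g = \<delta> n f' g' \<cdot>\<^bsub>A\<^esub> FArr (T n) c"
  using assms unfolding delta_functor_def additive_functor_def by blast+

lemma short_exact_arr:
  assumes "short_exact B f g"
  shows "f \<in> Arr B" "g \<in> Arr B" "Cod B f = Dom B g"
  using assms by (auto simp: short_exact_def is_kernel_def)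

context effaceable_delta_functor
begin

abbreviation Q where "Q a \<equiv> Cod B (\<pi> a)"

lemmas T_functor = delta_functorD(1)[OF delta]
lemmas [simp] = functorD[OF T_functor]

lemma iota_arr [simp]:
  assumes "a \<in> Obj B"
  shows "\<iota> a \<in> Arr B" "\<pi> a \<in> Arr B" "Dom B (\<iota> a) = a" "Dom B (\<pi> a) = Cod B (\<iota> a)"
  using short_exact_arr[OF effacing[OF assms]] dom_iota[OF assms] by auto

lemma delta_arr:
  assumes "short_exact B f g"
  shows "\<delta> n f g \<in> Arr A" "Dom A (\<delta> n f g) = FObj (T n) (Cod B g)"
    "Cod A (\<delta> n f g) = FObj (T (Suc n)) (Dom B f)"
  using delta_functorD(2)[OF delta assms] by (auto simp: Hom_iff)

text \<open>If \<open>T (Suc n)\<close> kills \<open>f\<close>, exactness after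
  \<open>\<delta> n f g\<close> makes it an epimorphism, and exactness before it makes it a cokernel
  of \<open>T n g\<close>. In this way degree \<open>Suc n\<close> is read off from degree
  \<open>n\<close>.\<close>

lemma delta_epi:
  assumes se: "short_exact B f g"
    and z: "FArr (T (Suc n)) f = ZeroArr A (FObj (T (Suc n)) (Dom B f)) (FObj (T (Suc n)) (Cod B f))"
  shows "epi_arr A (\<delta> n f g)" "is_cokernel A (\<delta> n f g) (FArr (T n) g)"
proof -
  note [simp] = short_exact_arr[OF se] delta_arr[OF se]
  have obj [simp]: "FObj (T (Suc n)) (Dom B f) \<in> Obj A" "FObj (T (Suc n)) (Dom B g) \<in> Obj A" by simp_all
  obtain e x where ex: "epi_arr A e" "x \<in> Arr A" "Cod A e = FObj (T (Suc n)) (Dom B f)" "Dom A x = Dom A e"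
    "Cod A x = Dom A (\<delta> n f g)" "\<delta> n f g \<cdot>\<^bsub>A\<^esub> x = Ident A (FObj (T (Suc n)) (Dom B f)) \<cdot>\<^bsub>A\<^esub> e"
    by (rule A.exact_at_chase[OF delta_functorD(5)[OF delta se, of n], of "Ident A (FObj (T (Suc n)) (Dom B f))"])
      (use z in simp_all)
  then have "epi_arr A (\<delta> n f g \<cdot>\<^bsub>A\<^esub> x)" using A.epi_arr_Arr[OF ex(1)] by simp
  then show "epi_arr A (\<delta> n f g)" by (rule A.epi_cancel) (use ex in simp_all)
  then show "is_cokernel A (\<delta> n f g) (FArr (T n) g)"
    by (rule A.exact_at_cokernel[OF delta_functorD(4)[OF delta se]])
qed

lemmas eff_arr [simp] = delta_arr[OF effacing]

lemma eff_epi: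
  assumes "a \<in> Obj B"
  shows "epi_arr A (\<delta> n (\<iota> a) (\<pi> a))" "is_cokernel A (\<delta> n (\<iota> a) (\<pi> a)) (FArr (T n) (\<pi> a))"
  using delta_epi[OF effacing[OF assms]] efface[OF assms] assms by simp_all

end

section \<open>Extending a transformation from degree 0 by dimension shifting\<close>

locale delta_extension = effaceable_delta_functor B A T \<delta> \<iota> \<pi>
  for B :: "('o1, 'm1, 'z1) abcat_scheme" and A :: "('o2, 'm2, 'z2) abcat_scheme" and T \<delta> \<iota> \<pi> +
  fixes T' \<delta>'
  assumes delta': "delta_functor B A T' \<delta>'"
begin

lemmas T'_functor = delta_functorD(1)[OF delta']
lemmas [simp] = functorD[OF T'_functor]

lemma delta'_arr:
  assumes "short_exact B f g"
  shows "\<delta>' n f g \<in> Arr A" "Dom A (\<delta>' n f g) = FObj (T' n) (Cod B g)"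
    "Cod A (\<delta>' n f g) = FObj (T' (Suc n)) (Dom B f)"
  using delta_functorD(2)[OF delta' assms] by (auto simp: Hom_iff)

lemmas eff'_arr [simp] = delta'_arr[OF effacing]

lemma delta_zero:
  assumes "short_exact B f g"
  shows "\<delta> n f g \<cdot>\<^bsub>A\<^esub> FArr (T n) g = ZeroArr A (FObj (T n) (Dom B g)) (FObj (T (Suc n)) (Dom B f))"
    "\<delta>' n f g \<cdot>\<^bsub>A\<^esub> FArr (T' n) g = ZeroArr A (FObj (T' n) (Dom B g)) (FObj (T' (Suc n)) (Dom B f))"
  using A.exact_atD(4)[OF delta_functorD(4)[OF delta assms, of n]] delta_arr[OF assms, of n] short_exact_arr[OF assms]
   A.exact_atD(4)[OF delta_functorD(4)[OF delta' assms, of n]] delta'_arr[OF assms, of n] by simp_all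

text \<open>Unlike an arrow of the functor category, \<open>\<psi>\<close> need not be extensional
  outside \<open>Obj B\<close>; \<open>natural_nattrans\<close> passes to the restriction.\<close>

definition natural :: "nat \<Rightarrow> ('o1 \<Rightarrow> 'm2) \<Rightarrow> bool" where
  "natural n \<psi> \<longleftrightarrow> (\<forall>a \<in> Obj B. \<psi> a \<in> Hom A (FObj (T n) a) (FObj (T' n) a)) \<and>
     (\<forall>f \<in> Arr B. \<psi> (Cod B f) \<cdot>\<^bsub>A\<^esub> FArr (T n) f = FArr (T' n) f \<cdot>\<^bsub>A\<^esub> \<psi> (Dom B f))"

lemma naturalD:
  assumes "natural n \<psi>"
  shows "a \<in> Obj B \<Longrightarrow> \<psi> a \<in> Arr A" "a \<in> Obj B \<Longrightarrow> Dom A (\<psi> a) = FObj (T n) a"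
    "a \<in> Obj B \<Longrightarrow> Cod A (\<psi> a) = FObj (T' n) a"
    "f \<in> Arr B \<Longrightarrow> \<psi> (Cod B f) \<cdot>\<^bsub>A\<^esub> FArr (T n) f = FArr (T' n) f \<cdot>\<^bsub>A\<^esub> \<psi> (Dom B f)"
  using assms by (auto simp: natural_def Hom_iff)

text \<open>Dimension shifting: the connecting morphism of the effacing sequence of \<open>a\<close>
  is a cokernel, so the component in degree \<open>Suc n\<close> at \<open>a\<close> is forced by
  the component in degree \<open>n\<close> at the quotient \<open>Q a\<close>.\<close>

definition step :: "nat \<Rightarrow> ('o1 \<Rightarrow> 'm2) \<Rightarrow> 'o1 \<Rightarrow> 'm2" where
  "step n \<psi> a = (THE h. h \<in> Hom A (FObj (T (Suc n)) a) (FObj (T' (Suc n)) a) \<and>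
     h \<cdot>\<^bsub>A\<^esub> \<delta> n (\<iota> a) (\<pi> a) = \<delta>' n (\<iota> a) (\<pi> a) \<cdot>\<^bsub>A\<^esub> \<psi> (Q a))"

lemma step:
  assumes \<psi>: "natural n \<psi>" and a: "a \<in> Obj B"
  shows "step n \<psi> a \<in> Arr A" "Dom A (step n \<psi> a) = FObj (T (Suc n)) a"
    "Cod A (step n \<psi> a) = FObj (T' (Suc n)) a"
    "step n \<psi> a \<cdot>\<^bsub>A\<^esub> \<delta> n (\<iota> a) (\<pi> a) = \<delta>' n (\<iota> a) (\<pi> a) \<cdot>\<^bsub>A\<^esub> \<psi> (Q a)"
proof -
  note [simp] = a naturalD(1-3)[OF \<psi>]
  have "\<psi> (Q a) \<cdot>\<^bsub>A\<^esub> FArr (T n) (\<pi> a) = FArr (T' n) (\<pi> a) \<cdot>\<^bsub>A\<^esub> \<psi> (Cod B (\<iota> a))"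
    using naturalD(4)[OF \<psi>, of "\<pi> a"] by simp
  then have z: "(\<delta>' n (\<iota> a) (\<pi> a) \<cdot>\<^bsub>A\<^esub> \<psi> (Q a)) \<cdot>\<^bsub>A\<^esub> FArr (T n) (\<pi> a) =
    ZeroArr A (FObj (T n) (Cod B (\<iota> a))) (FObj (T' (Suc n)) a)"
    using A.pre_comp[OF delta_zero(2)[OF effacing[OF a]], where x = "\<psi> (Cod B (\<iota> a))"] by simp
  obtain h where h: "h \<in> Arr A" "Dom A h = FObj (T (Suc n)) a" "Cod A h = FObj (T' (Suc n)) a"
    "h \<cdot>\<^bsub>A\<^esub> \<delta> n (\<iota> a) (\<pi> a) = \<delta>' n (\<iota> a) (\<pi> a) \<cdot>\<^bsub>A\<^esub> \<psi> (Q a)"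
    by (rule A.cokernel_desc[OF eff_epi(2)[OF a, of n], of "\<delta>' n (\<iota> a) (\<pi> a) \<cdot>\<^bsub>A\<^esub> \<psi> (Q a)"])
      (use z in simp_all)
  have "\<exists>!h. h \<in> Hom A (FObj (T (Suc n)) a) (FObj (T' (Suc n)) a) \<and>
     h \<cdot>\<^bsub>A\<^esub> \<delta> n (\<iota> a) (\<pi> a) = \<delta>' n (\<iota> a) (\<pi> a) \<cdot>\<^bsub>A\<^esub> \<psi> (Q a)"
  proof (rule ex1I[of _ h])
    fix h' assume "h' \<in> Hom A (FObj (T (Suc n)) a) (FObj (T' (Suc n)) a) \<and>
     h' \<cdot>\<^bsub>A\<^esub> \<delta> n (\<iota> a) (\<pi> a) = \<delta>' n (\<iota> a) (\<pi> a) \<cdot>\<^bsub>A\<^esub> \<psi> (Q a)"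
    then show "h' = h"
      using A.epi_arrD[OF eff_epi(1)[OF a, of n], of h' h] h by (simp add: Hom_iff)
  qed (use h in \<open>simp add: Hom_iff\<close>)
  from theI'[OF this, folded step_def]
  show "step n \<psi> a \<in> Arr A" "Dom A (step n \<psi> a) = FObj (T (Suc n)) a"
    "Cod A (step n \<psi> a) = FObj (T' (Suc n)) a"
    "step n \<psi> a \<cdot>\<^bsub>A\<^esub> \<delta> n (\<iota> a) (\<pi> a) = \<delta>' n (\<iota> a) (\<pi> a) \<cdot>\<^bsub>A\<^esub> \<psi> (Q a)"
    by (auto simp: Hom_iff)
qed

text \<open>The two sides need only be compared after the epimorphism
  \<open>\<delta> n (\<iota> a) (\<pi> a)\<close>. An extension of \<open>f\<close> to the effacing
  sequences, with induced map \<open>s\<close> of quotients, makes both connecting morphisms natural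
  and reduces the claim to naturality of \<open>\<psi>\<close> at \<open>s\<close>.\<close>

lemma step_natural:
  assumes \<psi>: "natural n \<psi>"
  shows "natural (Suc n) (step n \<psi>)"
  unfolding natural_def
proof (intro conjI ballI)
  fix a assume "a \<in> Obj B" then show "step n \<psi> a \<in> Hom A (FObj (T (Suc n)) a) (FObj (T' (Suc n)) a)"
    using step[OF \<psi>] by (simp add: Hom_iff)
next
  fix f assume f [simp]: "f \<in> Arr B"
  define a b where "a = Dom B f" and "b = Cod B f"
  have a [simp]: "a \<in> Obj B" "b \<in> Obj B" "Dom B f = a" "Cod B f = b" by (auto simp: a_def b_def)
  note [simp] = naturalD(1-3)[OF \<psi>] step(1-3)[OF \<psi>]
  obtain r s where rs: "r \<in> Hom B (Cod B (\<iota> a)) (Cod B (\<iota> b))" "s \<in> Hom B (Q a) (Q b)"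
    "r \<cdot>\<^bsub>B\<^esub> \<iota> a = \<iota> b \<cdot>\<^bsub>B\<^esub> f" "s \<cdot>\<^bsub>B\<^esub> \<pi> a = \<pi> b \<cdot>\<^bsub>B\<^esub> r"
    using extend[OF f] by auto
  have [simp]: "s \<in> Arr B" "Dom B s = Q a" "Cod B s = Q b" using rs by (auto simp: Hom_iff)
  have d: "FArr (T (Suc n)) f \<cdot>\<^bsub>A\<^esub> \<delta> n (\<iota> a) (\<pi> a) = \<delta> n (\<iota> b) (\<pi> b) \<cdot>\<^bsub>A\<^esub> FArr (T n) s"
    by (rule delta_functorD(6)[OF delta, where b = r]) (use rs effacing in \<open>simp_all add: Hom_iff\<close>)
  have d': "FArr (T' (Suc n)) f \<cdot>\<^bsub>A\<^esub> \<delta>' n (\<iota> a) (\<pi> a) = \<delta>' n (\<iota> b) (\<pi> b) \<cdot>\<^bsub>A\<^esub> FArr (T' n) s"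
    by (rule delta_functorD(6)[OF delta', where b = r]) (use rs effacing in \<open>simp_all add: Hom_iff\<close>)
  have "(step n \<psi> b \<cdot>\<^bsub>A\<^esub> FArr (T (Suc n)) f) \<cdot>\<^bsub>A\<^esub> \<delta> n (\<iota> a) (\<pi> a) =
    step n \<psi> b \<cdot>\<^bsub>A\<^esub> (\<delta> n (\<iota> b) (\<pi> b) \<cdot>\<^bsub>A\<^esub> FArr (T n) s)" using d by simp
  also have "\<dots> = \<delta>' n (\<iota> b) (\<pi> b) \<cdot>\<^bsub>A\<^esub> (\<psi> (Q b) \<cdot>\<^bsub>A\<^esub> FArr (T n) s)"
    using A.pre_comp[OF step(4)[OF \<psi> a(2)], of "FArr (T n) s"] by simp
  also have "\<psi> (Q b) \<cdot>\<^bsub>A\<^esub> FArr (T n) s = FArr (T' n) s \<cdot>\<^bsub>A\<^esub> \<psi> (Q a)" using naturalD(4)[OF \<psi>, of s] by simp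
  also have "\<delta>' n (\<iota> b) (\<pi> b) \<cdot>\<^bsub>A\<^esub> (FArr (T' n) s \<cdot>\<^bsub>A\<^esub> \<psi> (Q a)) =
    FArr (T' (Suc n)) f \<cdot>\<^bsub>A\<^esub> (\<delta>' n (\<iota> a) (\<pi> a) \<cdot>\<^bsub>A\<^esub> \<psi> (Q a))"
    using A.pre_comp[OF d', of "\<psi> (Q a)"] by simp
  also have "\<dots> = (FArr (T' (Suc n)) f \<cdot>\<^bsub>A\<^esub> step n \<psi> a) \<cdot>\<^bsub>A\<^esub> \<delta> n (\<iota> a) (\<pi> a)"
    using step(4)[OF \<psi> a(1)] by simp
  finally have "step n \<psi> b \<cdot>\<^bsub>A\<^esub> FArr (T (Suc n)) f = FArr (T' (Suc n)) f \<cdot>\<^bsub>A\<^esub> step n \<psi> a"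
    by - (rule A.epi_arrD[OF eff_epi(1)[OF a(1), of n]], simp_all)
  then show "step n \<psi> (Cod B f) \<cdot>\<^bsub>A\<^esub> FArr (T (Suc n)) f = FArr (T' (Suc n)) f \<cdot>\<^bsub>A\<^esub> step n \<psi> (Dom B f)"
    by simp
qed

lemma step_delta:
  assumes \<psi>: "natural n \<psi>" and se: "short_exact B f g"
  shows "step n \<psi> (Dom B f) \<cdot>\<^bsub>A\<^esub> \<delta> n f g = \<delta>' n f g \<cdot>\<^bsub>A\<^esub> \<psi> (Cod B g)"
proof -
  define a b where "a = Dom B f" and "b = Cod B f"
  note [simp] = naturalD(1-3)[OF \<psi>] step(1-3)[OF \<psi>] delta_arr[OF se] delta'_arr[OF se]
  have a [simp]: "a \<in> Obj B" "b \<in> Obj B" using short_exact_arr[OF se] by (simp_all add: a_def b_def)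
  have [simp]: "f \<in> Arr B" "g \<in> Arr B" "Dom B f = a" "Cod B f = b" "Dom B g = b"
    using short_exact_arr[OF se] by (auto simp: a_def b_def)
  obtain g' c r q where se2: "short_exact B (\<iota> b \<cdot>\<^bsub>B\<^esub> f) g'" and 
     c: "c \<in> Hom B (Cod B g) (Cod B g')" "c \<cdot>\<^bsub>B\<^esub> g = g' \<cdot>\<^bsub>B\<^esub> \<iota> b" and
     r: "r \<in> Hom B (Cod B (\<iota> a)) (Cod B (\<iota> b))" "r \<cdot>\<^bsub>B\<^esub> \<iota> a = \<iota> b \<cdot>\<^bsub>B\<^esub> f" and
     q: "q \<in> Hom B (Q a) (Cod B g')" "q \<cdot>\<^bsub>B\<^esub> \<pi> a = g' \<cdot>\<^bsub>B\<^esub> r"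
    using embed[OF se] by auto
  define f' where "f' = \<iota> b \<cdot>\<^bsub>B\<^esub> f"
  have f' [simp]: "f' \<in> Arr B" "Dom B f' = a" "Cod B f' = Cod B (\<iota> b)" by (simp_all add: f'_def)
  note se2 = se2[folded f'_def] and r = r[folded f'_def]
  have [simp]: "c \<in> Arr B" "Dom B c = Cod B g" "Cod B c = Cod B g'" "q \<in> Arr B" "Dom B q = Q a" "Cod B q = Cod B g'"
    using c q by (auto simp: Hom_iff)
  note [simp] = delta_arr[OF se2] delta'_arr[OF se2]
  have [simp]: "g' \<in> Arr B" "Dom B g' = Cod B (\<iota> b)" using short_exact_arr[OF se2] by auto
  \<comment> \<open>The effacing sequence of \<open>a\<close> and the given sequence both map to the
    sequence of \<open>f'\<close> and \<open>g'\<close> by the identity on \<open>a\<close>.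
    Therefore the connecting morphisms of both factor through that of \<open>f'\<close> and
    \<open>g'\<close>, along \<open>q\<close> and \<open>c\<close> respectively.\<close>
  have ia: "Ident B a \<in> Hom B a a" by (simp add: Hom_iff)
  have "FArr (T (Suc n)) (Ident B a) \<cdot>\<^bsub>A\<^esub> \<delta> n (\<iota> a) (\<pi> a) = \<delta> n f' g' \<cdot>\<^bsub>A\<^esub> FArr (T n) q"
    by (rule delta_functorD(6)[OF delta effacing[OF a(1)] se2, where b = r]) (use r q ia in simp_all)
  then have d1: "\<delta> n (\<iota> a) (\<pi> a) = \<delta> n f' g' \<cdot>\<^bsub>A\<^esub> FArr (T n) q" by simp
  have "FArr (T' (Suc n)) (Ident B a) \<cdot>\<^bsub>A\<^esub> \<delta>' n (\<iota> a) (\<pi> a) = \<delta>' n f' g' \<cdot>\<^bsub>A\<^esub> FArr (T' n) q"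
    by (rule delta_functorD(6)[OF delta' effacing[OF a(1)] se2, where b = r]) (use r q ia in simp_all)
  then have d1': "\<delta>' n (\<iota> a) (\<pi> a) = \<delta>' n f' g' \<cdot>\<^bsub>A\<^esub> FArr (T' n) q" by simp
  have "FArr (T (Suc n)) (Ident B a) \<cdot>\<^bsub>A\<^esub> \<delta> n f g = \<delta> n f' g' \<cdot>\<^bsub>A\<^esub> FArr (T n) c"
    by (rule delta_functorD(6)[OF delta se se2, where b = "\<iota> b"]) (use c ia in \<open>simp_all add: Hom_iff f'_def\<close>)
  then have d2: "\<delta> n f g = \<delta> n f' g' \<cdot>\<^bsub>A\<^esub> FArr (T n) c" by simp
  have "FArr (T' (Suc n)) (Ident B a) \<cdot>\<^bsub>A\<^esub> \<delta>' n f g = \<delta>' n f' g' \<cdot>\<^bsub>A\<^esub> FArr (T' n) c"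
    by (rule delta_functorD(6)[OF delta' se se2, where b = "\<iota> b"]) (use c ia in \<open>simp_all add: Hom_iff f'_def\<close>)
  then have d2': "\<delta>' n f g = \<delta>' n f' g' \<cdot>\<^bsub>A\<^esub> FArr (T' n) c" by simp
  \<comment> \<open>\<open>f'\<close> is killed because it factors through the effacing arrow
    \<open>\<iota> b\<close>.\<close>
  have "FArr (T (Suc n)) f' = ZeroArr A (FObj (T (Suc n)) a) (FObj (T (Suc n)) (Cod B f'))"
    unfolding f'_def by (simp add: efface)
  then have cok: "is_cokernel A (\<delta> n f' g') (FArr (T n) g')"
    by - (rule delta_epi(2)[OF se2], simp)
  \<comment> \<open>The failure of compatibility for \<open>f'\<close> and \<open>g'\<close>. It
    kills \<open>T n g'\<close> and so descends to some \<open>\<epsilon>\<close> along the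
    connecting morphism. Along \<open>q\<close> compatibility is the definition of
    \<open>step\<close>, so \<open>\<epsilon>\<close> vanishes after the epimorphism
    \<open>\<delta> n (\<iota> a) (\<pi> a)\<close> and is zero.\<close>
  define \<theta> where "\<theta> = AddArr A (step n \<psi> a \<cdot>\<^bsub>A\<^esub> \<delta> n f' g') (A.neg (\<delta>' n f' g' \<cdot>\<^bsub>A\<^esub> \<psi> (Cod B g')))"
  have th [simp]: "\<theta> \<in> Arr A" "Dom A \<theta> = FObj (T n) (Cod B g')" "Cod A \<theta> = FObj (T' (Suc n)) a"
    by (simp_all add: \<theta>_def)
  have "(\<delta>' n f' g' \<cdot>\<^bsub>A\<^esub> \<psi> (Cod B g')) \<cdot>\<^bsub>A\<^esub> FArr (T n) g' =
     ZeroArr A (FObj (T n) (Cod B (\<iota> b))) (FObj (T' (Suc n)) a)"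
    using A.pre_comp[OF delta_zero(2)[OF se2], where x = "\<psi> (Cod B (\<iota> b))"] naturalD(4)[OF \<psi>, of g'] by simp
  moreover have "(step n \<psi> a \<cdot>\<^bsub>A\<^esub> \<delta> n f' g') \<cdot>\<^bsub>A\<^esub> FArr (T n) g' =
     ZeroArr A (FObj (T n) (Cod B (\<iota> b))) (FObj (T' (Suc n)) a)"
    using delta_zero(1)[OF se2, of n] by simp
  ultimately have "\<theta> \<cdot>\<^bsub>A\<^esub> FArr (T n) g' = ZeroArr A (FObj (T n) (Cod B (\<iota> b))) (FObj (T' (Suc n)) a)"
    by (simp add: \<theta>_def)
  then obtain \<epsilon> where eps: "\<epsilon> \<in> Arr A" "Dom A \<epsilon> = FObj (T (Suc n)) a" "Cod A \<epsilon> = FObj (T' (Suc n)) a"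
    "\<epsilon> \<cdot>\<^bsub>A\<^esub> \<delta> n f' g' = \<theta>"
    by - (rule A.cokernel_desc[OF cok, of \<theta>], simp_all)
  note [simp] = eps(1-3)
  have "\<psi> (Cod B g') \<cdot>\<^bsub>A\<^esub> FArr (T n) q = FArr (T' n) q \<cdot>\<^bsub>A\<^esub> \<psi> (Q a)" using naturalD(4)[OF \<psi>, of q] by simp
  moreover have "step n \<psi> a \<cdot>\<^bsub>A\<^esub> (\<delta> n f' g' \<cdot>\<^bsub>A\<^esub> FArr (T n) q) = \<delta>' n f' g' \<cdot>\<^bsub>A\<^esub> (FArr (T' n) q \<cdot>\<^bsub>A\<^esub> \<psi> (Q a))"
    using step(4)[OF \<psi> a(1)] unfolding d1 d1' by simp
  ultimately have "\<theta> \<cdot>\<^bsub>A\<^esub> FArr (T n) q = ZeroArr A (FObj (T n) (Q a)) (FObj (T' (Suc n)) a)"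
    by (simp add: \<theta>_def)
  then have "\<epsilon> \<cdot>\<^bsub>A\<^esub> \<delta> n (\<iota> a) (\<pi> a) = ZeroArr A (FObj (T n) (Q a)) (FObj (T' (Suc n)) a)"
    unfolding d1 using A.pre_comp[OF eps(4), of "FArr (T n) q"] by simp
  then have "\<epsilon> = ZeroArr A (FObj (T (Suc n)) a) (FObj (T' (Suc n)) a)"
    by - (rule A.epi_arrD[OF eff_epi(1)[OF a(1), of n]], simp_all)
  then have "\<theta> = ZeroArr A (FObj (T n) (Cod B g')) (FObj (T' (Suc n)) a)" using eps(4) by simp
  then have eq: "step n \<psi> a \<cdot>\<^bsub>A\<^esub> \<delta> n f' g' = \<delta>' n f' g' \<cdot>\<^bsub>A\<^esub> \<psi> (Cod B g')"
    unfolding \<theta>_def by - (rule A.sub_eq_zero, simp_all)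
  have "step n \<psi> a \<cdot>\<^bsub>A\<^esub> \<delta> n f g = \<delta>' n f' g' \<cdot>\<^bsub>A\<^esub> (\<psi> (Cod B g') \<cdot>\<^bsub>A\<^esub> FArr (T n) c)"
    unfolding d2 using A.pre_comp[OF eq, of "FArr (T n) c"] by simp
  also have "\<psi> (Cod B g') \<cdot>\<^bsub>A\<^esub> FArr (T n) c = FArr (T' n) c \<cdot>\<^bsub>A\<^esub> \<psi> (Cod B g)" using naturalD(4)[OF \<psi>, of c] by simp
  also have "\<delta>' n f' g' \<cdot>\<^bsub>A\<^esub> (FArr (T' n) c \<cdot>\<^bsub>A\<^esub> \<psi> (Cod B g)) = \<delta>' n f g \<cdot>\<^bsub>A\<^esub> \<psi> (Cod B g)"
    unfolding d2' by simp
  finally show ?thesis by simp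
qed

lemma natural_nattrans:
  "natural n \<psi> \<longleftrightarrow> (T n, restrict \<psi> (Obj B), T' n) \<in> Hom (functor_cat B A) (T n) (T' n)"
  unfolding natural_def by (auto simp: Hom_iff is_nattrans_def T_functor T'_functor)

lemma unique_extension:
  assumes \<psi>: "\<psi> \<in> Hom (functor_cat B A) (T 0) (T' 0)"
  shows "\<exists>!\<phi>. delta_morphism B A T \<delta> T' \<delta>' \<phi> \<and> \<phi> 0 = \<psi>"
proof -
  define c where "c = rec_nat (component \<psi>) step"
  have c0: "c 0 = component \<psi>" and cS: "c (Suc n) = step n (c n)" for n by (auto simp: c_def)
  have psi: "(T 0, component \<psi>, T' 0) = \<psi>" "restrict (component \<psi>) (Obj B) = component \<psi>"
    using \<psi> nattransD(3)[of B A "T 0" "T' 0" "component \<psi>"]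
    by (auto simp: functor_cat_Hom component_def extensional_restrict prod_eq_iff)
  have nat: "natural n (c n)" for n
    by (induction n) (use \<psi> psi in \<open>auto simp: c0 cS natural_nattrans[of 0] intro: step_natural\<close>)
  show ?thesis
  proof (rule ex1I[of _ "\<lambda>n. (T n, restrict (c n) (Obj B), T' n)"], intro conjI)
    show "delta_morphism B A T \<delta> T' \<delta>' (\<lambda>n. (T n, restrict (c n) (Obj B), T' n))"
      unfolding delta_morphism_def
    proof (intro conjI allI impI)
      fix n show "(T n, restrict (c n) (Obj B), T' n) \<in> Hom (functor_cat B A) (T n) (T' n)"
        using nat natural_nattrans by blast
    next
      fix f g n assume se: "short_exact B f g"
      show "component (T (Suc n), restrict (c (Suc n)) (Obj B), T' (Suc n)) (Dom B f) \<cdot>\<^bsub>A\<^esub> \<delta> n f g =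
        \<delta>' n f g \<cdot>\<^bsub>A\<^esub> component (T n, restrict (c n) (Obj B), T' n) (Cod B g)"
        using step_delta[OF nat se] short_exact_arr[OF se] by (simp add: cS)
    qed
    show "(T 0, restrict (c 0) (Obj B), T' 0) = \<psi>" using psi by (simp add: c0)
  next
    fix \<phi> assume "delta_morphism B A T \<delta> T' \<delta>' \<phi> \<and> \<phi> 0 = \<psi>"
    then have \<phi>: "\<And>n. \<phi> n \<in> Hom (functor_cat B A) (T n) (T' n)" "\<phi> 0 = \<psi>"
      "\<And>f g n. short_exact B f g \<Longrightarrow> component (\<phi> (Suc n)) (Dom B f) \<cdot>\<^bsub>A\<^esub> \<delta> n f g =
        \<delta>' n f g \<cdot>\<^bsub>A\<^esub> component (\<phi> n) (Cod B g)"
      by (auto simp: delta_morphism_def)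
    have n: "is_nattrans B A (T n) (T' n) (component (\<phi> n))" for n
      using \<phi>(1)[of n] by (auto simp: Hom_iff functor_cat_Arr)
    \<comment> \<open>Uniqueness: agreement at \<open>Q a\<close> in degree \<open>n\<close> forces
      agreement at \<open>a\<close> in degree \<open>Suc n\<close>, since the connecting morphism of
      the effacing sequence is an epimorphism.\<close>
    have eq: "\<forall>a \<in> Obj B. component (\<phi> n) a = c n a" for n
    proof (induction n)
      case (Suc n)
      show ?case
      proof
        fix a assume a [simp]: "a \<in> Obj B"
        have "component (\<phi> (Suc n)) a \<cdot>\<^bsub>A\<^esub> \<delta> n (\<iota> a) (\<pi> a) = \<delta>' n (\<iota> a) (\<pi> a) \<cdot>\<^bsub>A\<^esub> c n (Q a)"
          using \<phi>(3)[OF effacing[OF a], of n] Suc by simp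
        also have "\<dots> = c (Suc n) a \<cdot>\<^bsub>A\<^esub> \<delta> n (\<iota> a) (\<pi> a)" using step(4)[OF nat[of n] a] by (simp add: cS)
        finally show "component (\<phi> (Suc n)) a = c (Suc n) a"
          by - (rule A.epi_arrD[OF eff_epi(1)[OF a, of n]], use nattransD[OF n[of "Suc n"]] naturalD[OF nat[of "Suc n"]] in simp_all)
      qed
    qed (use \<phi>(2) c0 in simp)
    show "\<phi> = (\<lambda>n. (T n, restrict (c n) (Obj B), T' n))"
    proof
      fix k
      show "\<phi> k = (T k, restrict (c k) (Obj B), T' k)"
      proof (rule functor_cat_arr_eqI)
        show "\<phi> k \<in> Arr (functor_cat B A)" using \<phi>(1) by (simp add: Hom_iff)
        show "(T k, restrict (c k) (Obj B), T' k) \<in> Arr (functor_cat B A)"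
          using nat natural_nattrans by (metis Hom_iff)
      qed (use \<phi>(1)[of k] eq in \<open>simp_all add: Hom_iff\<close>)
    qed
  qed
qed

end

lemma (in effaceable_delta_functor) universal: "universal_delta_functor B A T \<delta>"
  unfolding universal_delta_functor_def
proof (intro conjI allI impI ballI)
  fix T' \<delta>' \<psi> assume d: "delta_functor B A T' \<delta>'" and p: "\<psi> \<in> Hom (functor_cat B A) (T 0) (T' 0)"
  interpret delta_extension B A T \<delta> \<iota> \<pi> T' \<delta>' by unfold_locales (rule d)
  show "\<exists>!\<phi>. delta_morphism B A T \<delta> T' \<delta>' \<phi> \<and> \<phi> 0 = \<psi>" by (rule unique_extension[OF p])
qed (rule delta)

section \<open>Uniqueness of universal delta functors\<close>

lemma delta_morphism_comp:
  assumes B: "category B" and A: "category A"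
    and T: "delta_functor B A T \<delta>" and T': "delta_functor B A T' \<delta>'" and T'': "delta_functor B A T'' \<delta>''"
    and \<phi>: "delta_morphism B A T \<delta> T' \<delta>' \<phi>" and \<psi>: "delta_morphism B A T' \<delta>' T'' \<delta>'' \<psi>"
  shows "delta_morphism B A T \<delta> T'' \<delta>'' (\<lambda>n. \<psi> n \<cdot>\<^bsub>functor_cat B A\<^esub> \<phi> n)"
proof -
  interpret B: category B by fact
  interpret A: category A by fact
  interpret F: category "functor_cat B A" by (rule category_functor_cat[OF B A])
  have 1: "\<phi> n \<in> Hom (functor_cat B A) (T n) (T' n)" "\<psi> n \<in> Hom (functor_cat B A) (T' n) (T'' n)" for n
    using \<phi> \<psi> by (auto simp: delta_morphism_def)
  from 1 have n: "is_nattrans B A (T n) (T' n) (component (\<phi> n))" "is_nattrans B A (T' n) (T'' n) (component (\<psi> n))" for n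
    unfolding functor_cat_Hom by simp_all
  show ?thesis
    unfolding delta_morphism_def
  proof (intro conjI allI impI)
    show "\<psi> n \<cdot>\<^bsub>functor_cat B A\<^esub> \<phi> n \<in> Hom (functor_cat B A) (T n) (T'' n)" for n
      using F.comp_hom[OF 1] .
  next
    fix f g n assume se: "short_exact B f g"
    note [simp] = short_exact_arr[OF se] nattransD(4-6)[OF n(1)] nattransD(4-6)[OF n(2)]
    have [simp]: "\<delta> n f g \<in> Arr A" "Dom A (\<delta> n f g) = FObj (T n) (Cod B g)" "Cod A (\<delta> n f g) = FObj (T (Suc n)) (Dom B f)"
      "\<delta>' n f g \<in> Arr A" "Dom A (\<delta>' n f g) = FObj (T' n) (Cod B g)" "Cod A (\<delta>' n f g) = FObj (T' (Suc n)) (Dom B f)"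
      "\<delta>'' n f g \<in> Arr A" "Dom A (\<delta>'' n f g) = FObj (T'' n) (Cod B g)" "Cod A (\<delta>'' n f g) = FObj (T'' (Suc n)) (Dom B f)"
      using delta_functorD(2)[OF T se, of n] delta_functorD(2)[OF T' se, of n] delta_functorD(2)[OF T'' se, of n]
      by (auto simp: Hom_iff)
    have p: "component (\<phi> (Suc n)) (Dom B f) \<cdot>\<^bsub>A\<^esub> \<delta> n f g = \<delta>' n f g \<cdot>\<^bsub>A\<^esub> component (\<phi> n) (Cod B g)"
      "component (\<psi> (Suc n)) (Dom B f) \<cdot>\<^bsub>A\<^esub> \<delta>' n f g = \<delta>'' n f g \<cdot>\<^bsub>A\<^esub> component (\<psi> n) (Cod B g)"
      using \<phi> \<psi> se by (auto simp: delta_morphism_def)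
    show "component (\<psi> (Suc n) \<cdot>\<^bsub>functor_cat B A\<^esub> \<phi> (Suc n)) (Dom B f) \<cdot>\<^bsub>A\<^esub> \<delta> n f g =
       \<delta>'' n f g \<cdot>\<^bsub>A\<^esub> component (\<psi> n \<cdot>\<^bsub>functor_cat B A\<^esub> \<phi> n) (Cod B g)"
      using p(1) A.pre_comp[OF p(2), of "component (\<phi> n) (Cod B g)"] by simp
  qed
qed

lemma delta_morphism_ident:
  assumes B: "category B" and A: "category A" and T: "delta_functor B A T \<delta>"
  shows "delta_morphism B A T \<delta> T \<delta> (\<lambda>n. Ident (functor_cat B A) (T n))"
proof -
  interpret B: category B by fact
  interpret A: category A by fact
  interpret F: category "functor_cat B A" by (rule category_functor_cat[OF B A])
  show ?thesis unfolding delta_morphism_def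
  proof (intro conjI allI impI)
    show "Ident (functor_cat B A) (T n) \<in> Hom (functor_cat B A) (T n) (T n)" for n
      by (rule F.ident_hom) (simp add: delta_functorD[OF T])
  next
    fix f g n assume se: "short_exact B f g"
    show "component (Ident (functor_cat B A) (T (Suc n))) (Dom B f) \<cdot>\<^bsub>A\<^esub> \<delta> n f g =
       \<delta> n f g \<cdot>\<^bsub>A\<^esub> component (Ident (functor_cat B A) (T n)) (Cod B g)"
      using delta_functorD(2)[OF T se, of n] short_exact_arr[OF se] by (simp add: Hom_iff)
  qed
qed

lemma universal_iso:
  assumes B: "category B" and A: "category A"
    and T: "universal_delta_functor B A T \<delta>" and T': "universal_delta_functor B A T' \<delta>'"
    and iso: "isomorphic (functor_cat B A) (T 0) (T' 0)" and a: "a \<in> Obj B"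
  shows "isomorphic A (FObj (T n) a) (FObj (T' n) a)"
proof -
  interpret F: category "functor_cat B A" by (rule category_functor_cat[OF B A])
  let ?F = "functor_cat B A"
  have d: "delta_functor B A T \<delta>" "delta_functor B A T' \<delta>'"
    using T T' by (auto simp: universal_delta_functor_def)
  obtain f g where fg: "f \<in> Hom ?F (T 0) (T' 0)" "g \<in> Hom ?F (T' 0) (T 0)"
    "g \<cdot>\<^bsub>?F\<^esub> f = Ident ?F (T 0)" "f \<cdot>\<^bsub>?F\<^esub> g = Ident ?F (T' 0)"
    using iso unfolding isomorphic_def by blast
  obtain \<phi> where p: "delta_morphism B A T \<delta> T' \<delta>' \<phi>" "\<phi> 0 = f"
    using T d fg unfolding universal_delta_functor_def by blast
  obtain \<psi> where q: "delta_morphism B A T' \<delta>' T \<delta> \<psi>" "\<psi> 0 = g"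
    using T' d fg unfolding universal_delta_functor_def by blast
  have id: "Ident ?F (T 0) \<in> Hom ?F (T 0) (T 0)" "Ident ?F (T' 0) \<in> Hom ?F (T' 0) (T' 0)"
    by (rule F.ident_hom; simp add: delta_functorD[OF d(1)] delta_functorD[OF d(2)])+
  have "\<exists>!\<phi>. delta_morphism B A T \<delta> T \<delta> \<phi> \<and> \<phi> 0 = Ident ?F (T 0)"
    using T d id(1) unfolding universal_delta_functor_def by blast
  \<comment> \<open>Both the composite and the identity extend the identity in degree 0, and such an
    extension is unique.\<close>
  then have 1: "(\<lambda>n. \<psi> n \<cdot>\<^bsub>?F\<^esub> \<phi> n) = (\<lambda>n. Ident ?F (T n))"
    using delta_morphism_comp[OF B A d(1,2,1) p(1) q(1)] delta_morphism_ident[OF B A d(1)] fg p(2) q(2)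
    by (metis (no_types, lifting))
  have "\<exists>!\<phi>. delta_morphism B A T' \<delta>' T' \<delta>' \<phi> \<and> \<phi> 0 = Ident ?F (T' 0)"
    using T' d id(2) unfolding universal_delta_functor_def by blast
  then have 2: "(\<lambda>n. \<phi> n \<cdot>\<^bsub>?F\<^esub> \<psi> n) = (\<lambda>n. Ident ?F (T' n))"
    using delta_morphism_comp[OF B A d(2,1,2) q(1) p(1)] delta_morphism_ident[OF B A d(2)] fg p(2) q(2)
    by (metis (no_types, lifting))
  have n: "is_nattrans B A (T n) (T' n) (component (\<phi> n))" "is_nattrans B A (T' n) (T n) (component (\<psi> n))"
    using p(1) q(1) unfolding delta_morphism_def functor_cat_Hom by blast+
  have "component (\<psi> n \<cdot>\<^bsub>?F\<^esub> \<phi> n) a = component (Ident ?F (T n)) a"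
    "component (\<phi> n \<cdot>\<^bsub>?F\<^esub> \<psi> n) a = component (Ident ?F (T' n)) a"
    using fun_cong[OF 1, of n] fun_cong[OF 2, of n] by simp_all
  then have "component (\<psi> n) a \<cdot>\<^bsub>A\<^esub> component (\<phi> n) a = Ident A (FObj (T n) a)"
    "component (\<phi> n) a \<cdot>\<^bsub>A\<^esub> component (\<psi> n) a = Ident A (FObj (T' n) a)" using a by simp_all
  moreover have "FObj (T n) a \<in> Obj A" "FObj (T' n) a \<in> Obj A"
    using functorD(1)[OF nattransD(1)[OF n(1)] a] functorD(1)[OF nattransD(2)[OF n(1)] a] by auto
  moreover have "component (\<phi> n) a \<in> Hom A (FObj (T n) a) (FObj (T' n) a)"
    "component (\<psi> n) a \<in> Hom A (FObj (T' n) a) (FObj (T n) a)"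
    using nattransD(4-6)[OF n(1) a] nattransD(4-6)[OF n(2) a] by (auto simp: Hom_iff)
  ultimately show ?thesis unfolding isomorphic_def by blast
qed

section \<open>Short exact sequences of functors\<close>

locale functor_category = C: category C + abelian_category A
  for C :: "('o1, 'm1) cat" and A :: "('o, 'm, 'z) abcat_scheme" (structure)
begin

abbreviation FC where "FC \<equiv> functor_cat C A"

sublocale FC: category FC
  by (rule category_functor_cat) unfold_locales

lemma nat_add:
  assumes s: "is_nattrans C A F G \<eta>" and t: "is_nattrans C A F G \<theta>"
  shows "is_nattrans C A F G (\<lambda>c \<in> Obj C. \<eta> c \<boxplus> \<theta> c)"
proof (rule nattransI)
  note [simp] = nattransD(4-6)[OF s] nattransD(4-6)[OF t] functorD[OF nattransD(1)[OF s]]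
    functorD[OF nattransD(2)[OF s]]
  fix f assume [simp]: "f \<in> Arr C"
  show "(\<lambda>c \<in> Obj C. \<eta> c \<boxplus> \<theta> c) (Cod C f) \<cdot> FArr F f = FArr G f \<cdot> (\<lambda>c \<in> Obj C. \<eta> c \<boxplus> \<theta> c) (Dom C f)"
    using nattransD(7)[OF s, of f] nattransD(7)[OF t, of f] by simp
qed (use nattransD[OF s] nattransD[OF t] in simp_all)

text \<open>The lifts are taken separately at each object; they are natural because each
  \<open>\<eta> c\<close> is a monomorphism, so that naturality may be checked after it.\<close>

lemma pointwise_kernel:
  assumes f: "is_nattrans C A F G \<eta>" and g: "is_nattrans C A G H \<theta>"
    and k: "\<And>c. c \<in> Obj C \<Longrightarrow> is_kernel A (\<eta> c) (\<theta> c)"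
  shows "is_kernel FC (F, \<eta>, G) (G, \<theta>, H)"
  unfolding is_kernel_def
proof (intro conjI allI ballI impI)
  note fD [simp] = nattransD(4-6)[OF f] nattransD(4-6)[OF g] functorD[OF nattransD(1)[OF f]]
    functorD[OF nattransD(2)[OF f]]
  show "(G, \<theta>, H) \<cdot>\<^bsub>FC\<^esub> (F, \<eta>, G) = ZeroArr FC (Dom FC (F, \<eta>, G)) (Cod FC (G, \<theta>, H))"
    using kernelD(4)[OF k] by (auto intro!: restrict_ext)
  fix K t assume t: "t \<in> Hom FC K (Dom FC (G, \<theta>, H))" and z: "(G, \<theta>, H) \<cdot>\<^bsub>FC\<^esub> t = ZeroArr FC K (Cod FC (G, \<theta>, H))"
  define \<tau> where "\<tau> = component t"
  have t': "t = (K, \<tau>, G)" and nt: "is_nattrans C A K G \<tau>"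
    using t by (auto simp: functor_cat_Hom \<tau>_def component_def prod_eq_iff)
  note [simp] = nattransD(4-6)[OF nt] functorD[OF nattransD(1)[OF nt]]
  have "\<theta> c \<cdot> \<tau> c = ZeroArr A (FObj K c) (FObj H c)" if "c \<in> Obj C" for c
    using z that unfolding t' by (auto dest!: fun_cong[of _ _ c])
  then have L: "lift_through A (\<eta> c) (\<tau> c) \<in> Arr A" "Dom A (lift_through A (\<eta> c) (\<tau> c)) = FObj K c"
    "Cod A (lift_through A (\<eta> c) (\<tau> c)) = FObj F c" "\<eta> c \<cdot> lift_through A (\<eta> c) (\<tau> c) = \<tau> c"
    if "c \<in> Obj C" for c
    using lift_through[OF k, of c "\<tau> c"] that by simp_all
  note [simp] = L
  have ntv: "is_nattrans C A K F (\<lambda>c \<in> Obj C. lift_through A (\<eta> c) (\<tau> c))"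
  proof (rule nattransI)
    fix u assume [simp]: "u \<in> Arr C"
    have "\<eta> (Cod C u) \<cdot> (lift_through A (\<eta> (Cod C u)) (\<tau> (Cod C u)) \<cdot> FArr K u) = FArr G u \<cdot> \<tau> (Dom C u)"
      using pre_comp[OF L(4)[of "Cod C u"], of "FArr K u"] nattransD(7)[OF nt, of u] by simp
    also have "\<dots> = \<eta> (Cod C u) \<cdot> (FArr F u \<cdot> lift_through A (\<eta> (Dom C u)) (\<tau> (Dom C u)))"
      using pre_comp[OF nattransD(7)[OF f, of u], of "lift_through A (\<eta> (Dom C u)) (\<tau> (Dom C u))"] by simp
    finally show "(\<lambda>c \<in> Obj C. lift_through A (\<eta> c) (\<tau> c)) (Cod C u) \<cdot> FArr K u =
      FArr F u \<cdot> (\<lambda>c \<in> Obj C. lift_through A (\<eta> c) (\<tau> c)) (Dom C u)"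
      by simp (rule mono_arrD[OF kernel_mono[OF k[of "Cod C u"]]], simp_all)
  qed (use nattransD[OF nt] nattransD[OF f] in simp_all)
  show "\<exists>!h. h \<in> Hom FC K (Dom FC (F, \<eta>, G)) \<and> (F, \<eta>, G) \<cdot>\<^bsub>FC\<^esub> h = t"
  proof (rule ex1I[of _ "(K, \<lambda>c \<in> Obj C. lift_through A (\<eta> c) (\<tau> c), F)"])
    show "(K, \<lambda>c \<in> Obj C. lift_through A (\<eta> c) (\<tau> c), F) \<in> Hom FC K (Dom FC (F, \<eta>, G)) \<and>
      (F, \<eta>, G) \<cdot>\<^bsub>FC\<^esub> (K, \<lambda>c \<in> Obj C. lift_through A (\<eta> c) (\<tau> c), F) = t"
      using ntv nattransD(3)[OF nt] t' by (auto simp: functor_cat_Hom intro!: extensionalityI[of _ "Obj C"])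
  next
    fix h assume h: "h \<in> Hom FC K (Dom FC (F, \<eta>, G)) \<and> (F, \<eta>, G) \<cdot>\<^bsub>FC\<^esub> h = t"
    then have nh: "is_nattrans C A K F (component h)" "fst h = K" "snd (snd h) = F" by (auto simp: functor_cat_Hom)
    show "h = (K, \<lambda>c \<in> Obj C. lift_through A (\<eta> c) (\<tau> c), F)"
    proof (rule functor_cat_arr_eqI[of _ C A])
      fix c assume c: "c \<in> Obj C"
      have "component ((F, \<eta>, G) \<cdot>\<^bsub>FC\<^esub> h) c = \<tau> c" using h t' by simp
      then show "component h c = component (K, \<lambda>c \<in> Obj C. lift_through A (\<eta> c) (\<tau> c), F) c"
        using c mono_arrD[OF kernel_mono[OF k[OF c]], of "component h c" "lift_through A (\<eta> c) (\<tau> c)"]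
          nattransD(4-6)[OF nh(1) c] by simp
    qed (use h nh ntv in \<open>simp_all add: functor_cat_Arr\<close>)
  qed
qed (use f g in \<open>auto simp: functor_cat_Arr\<close>)

lemma pointwise_cokernel:
  assumes f: "is_nattrans C A F G \<eta>" and g: "is_nattrans C A G H \<theta>"
    and k: "\<And>c. c \<in> Obj C \<Longrightarrow> is_cokernel A (\<theta> c) (\<eta> c)"
  shows "is_cokernel FC (G, \<theta>, H) (F, \<eta>, G)"
  unfolding is_cokernel_def
proof (intro conjI allI ballI impI)
  note fD [simp] = nattransD(4-6)[OF f] nattransD(4-6)[OF g] functorD[OF nattransD(2)[OF f]]
    functorD[OF nattransD(2)[OF g]]
  show "(G, \<theta>, H) \<cdot>\<^bsub>FC\<^esub> (F, \<eta>, G) = ZeroArr FC (Dom FC (F, \<eta>, G)) (Cod FC (G, \<theta>, H))"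
    using cokernelD(4)[OF k] by (auto intro!: restrict_ext)
  fix K t assume t: "t \<in> Hom FC (Cod FC (F, \<eta>, G)) K" and z: "t \<cdot>\<^bsub>FC\<^esub> (F, \<eta>, G) = ZeroArr FC (Dom FC (F, \<eta>, G)) K"
  define \<tau> where "\<tau> = component t"
  have t': "t = (G, \<tau>, K)" and nt: "is_nattrans C A G K \<tau>"
    using t by (auto simp: functor_cat_Hom \<tau>_def component_def prod_eq_iff)
  note [simp] = nattransD(4-6)[OF nt] functorD[OF nattransD(2)[OF nt]]
  have "\<tau> c \<cdot> \<eta> c = ZeroArr A (FObj F c) (FObj K c)" if "c \<in> Obj C" for c
    using z that unfolding t' by (auto dest!: fun_cong[of _ _ c])
  then have "\<forall>c \<in> Obj C. \<exists>v. v \<in> Arr A \<and> Dom A v = FObj H c \<and> Cod A v = FObj K c \<and> v \<cdot> \<theta> c = \<tau> c"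
    using cokernel_desc_ex[OF k, of c "\<tau> c" for c] by (intro ballI) simp
  from bchoice[OF this] obtain v where L: "v c \<in> Arr A" "Dom A (v c) = FObj H c"
    "Cod A (v c) = FObj K c" "v c \<cdot> \<theta> c = \<tau> c" if "c \<in> Obj C" for c by blast
  note [simp] = L
  have ntv: "is_nattrans C A H K (\<lambda>c \<in> Obj C. v c)"
  proof (rule nattransI)
    fix u assume [simp]: "u \<in> Arr C"
    have "(v (Cod C u) \<cdot> FArr H u) \<cdot> \<theta> (Dom C u) = v (Cod C u) \<cdot> (\<theta> (Cod C u) \<cdot> FArr G u)"
      using nattransD(7)[OF g, of u] by simp
    also have "\<dots> = (FArr K u \<cdot> v (Dom C u)) \<cdot> \<theta> (Dom C u)"
      using pre_comp[OF L(4)[of "Cod C u"], of "FArr G u"] nattransD(7)[OF nt, of u] by simp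
    finally show "(\<lambda>c \<in> Obj C. v c) (Cod C u) \<cdot> FArr H u = FArr K u \<cdot> (\<lambda>c \<in> Obj C. v c) (Dom C u)"
      by - (simp, rule epi_arrD[OF cokernel_epi[OF k[of "Dom C u"]]], simp_all)
  qed (use nattransD[OF nt] nattransD[OF g] in simp_all)
  show "\<exists>!h. h \<in> Hom FC (Cod FC (G, \<theta>, H)) K \<and> h \<cdot>\<^bsub>FC\<^esub> (G, \<theta>, H) = t"
  proof (rule ex1I[of _ "(H, \<lambda>c \<in> Obj C. v c, K)"])
    show "(H, \<lambda>c \<in> Obj C. v c, K) \<in> Hom FC (Cod FC (G, \<theta>, H)) K \<and> (H, \<lambda>c \<in> Obj C. v c, K) \<cdot>\<^bsub>FC\<^esub> (G, \<theta>, H) = t"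
      using ntv nattransD(3)[OF nt] t' by (auto simp: functor_cat_Hom intro!: extensionalityI[of _ "Obj C"])
  next
    fix h assume h: "h \<in> Hom FC (Cod FC (G, \<theta>, H)) K \<and> h \<cdot>\<^bsub>FC\<^esub> (G, \<theta>, H) = t"
    then have nh: "is_nattrans C A H K (component h)" "fst h = H" "snd (snd h) = K" by (auto simp: functor_cat_Hom)
    show "h = (H, \<lambda>c \<in> Obj C. v c, K)"
    proof (rule functor_cat_arr_eqI[of _ C A])
      fix c assume c: "c \<in> Obj C"
      have "component (h \<cdot>\<^bsub>FC\<^esub> (G, \<theta>, H)) c = \<tau> c" using h t' by simp
      then show "component h c = component (H, \<lambda>c \<in> Obj C. v c, K) c"
        using c epi_arrD[OF cokernel_epi[OF k[OF c]], of "component h c" "v c"]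
          nattransD(4-6)[OF nh(1) c] by simp
    qed (use h nh ntv in \<open>simp_all add: functor_cat_Arr\<close>)
  qed
qed (use f g in \<open>auto simp: functor_cat_Arr\<close>)

lemma kernel_functor:
  assumes g: "is_nattrans C A G H \<theta>"
  obtains K \<kappa> where "is_nattrans C A K G \<kappa>" "\<And>c. c \<in> Obj C \<Longrightarrow> is_kernel A (\<kappa> c) (\<theta> c)"
proof -
  note [simp] = nattransD(4-6)[OF g] functorD[OF nattransD(1)[OF g]] functorD[OF nattransD(2)[OF g]]
  define k where "k c = some_kernel A (\<theta> c)" for c
  have k: "is_kernel A (k c) (\<theta> c)" if "c \<in> Obj C" for c
    unfolding k_def by (rule some_kernel) (use that in simp)
  have [simp]: "k c \<in> Arr A" "Cod A (k c) = FObj G c" "\<theta> c \<cdot> k c = ZeroArr A (Dom A (k c)) (FObj H c)" if "c \<in> Obj C" for c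
    using kernelD[OF k[OF that]] that by auto
  define l where "l u = lift_through A (k (Cod C u)) (FArr G u \<cdot> k (Dom C u))" for u
  have l: "l u \<in> Arr A" "Dom A (l u) = Dom A (k (Dom C u))" "Cod A (l u) = Dom A (k (Cod C u))"
    "k (Cod C u) \<cdot> l u = FArr G u \<cdot> k (Dom C u)" if [simp]: "u \<in> Arr C" for u
  proof -
    have "\<theta> (Cod C u) \<cdot> (FArr G u \<cdot> k (Dom C u)) = ZeroArr A (Dom A (k (Dom C u))) (FObj H (Cod C u))"
      using pre_comp[OF nattransD(7)[OF g, of u], of "k (Dom C u)"] by simp
    then show "l u \<in> Arr A" "Dom A (l u) = Dom A (k (Dom C u))" "Cod A (l u) = Dom A (k (Cod C u))"
      "k (Cod C u) \<cdot> l u = FArr G u \<cdot> k (Dom C u)"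
      unfolding l_def using lift_through[OF k[of "Cod C u"], of "FArr G u \<cdot> k (Dom C u)"] by simp_all
  qed
  note [simp] = l(1-3)
  define K where "K = \<lparr>FObj = restrict (\<lambda>c. Dom A (k c)) (Obj C), FArr = restrict l (Arr C)\<rparr>"
  have K: "is_functor C A K" unfolding K_def
  proof (rule functorI[OF C.category_axioms])
    fix a assume [simp]: "a \<in> Obj C"
    show "l (Ident C a) = Ident A (Dom A (k a))"
      by (rule mono_arrD[OF kernel_mono[OF k[of a]]]) (use l(4)[of "Ident C a"] in simp_all)
  next
    fix f g assume [simp]: "f \<in> Arr C" "g \<in> Arr C" "Dom C g = Cod C f"
    have "k (Cod C g) \<cdot> (l g \<cdot> l f) = k (Cod C g) \<cdot> l (g \<cdot>\<^bsub>C\<^esub> f)"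
      using pre_comp[OF l(4)[of g], of "l f"] l(4)[of f] l(4)[of "g \<cdot>\<^bsub>C\<^esub> f"] by simp
    then show "l (g \<cdot>\<^bsub>C\<^esub> f) = l g \<cdot> l f"
      by - (rule mono_arrD[OF kernel_mono[OF k[of "Cod C g"]]], simp_all)
  qed simp_all
  have "is_nattrans C A K G (restrict k (Obj C))"
    by (rule nattransI[OF K nattransD(1)[OF g]]) (use l(4) in \<open>simp_all add: K_def\<close>)
  then show thesis by (rule that) (use k in simp)
qed

lemma cokernel_functor:
  assumes g: "is_nattrans C A G H \<theta>"
  obtains K \<kappa> where "is_nattrans C A H K \<kappa>" "\<And>c. c \<in> Obj C \<Longrightarrow> is_cokernel A (\<kappa> c) (\<theta> c)"
proof -
  note [simp] = nattransD(4-6)[OF g] functorD[OF nattransD(1)[OF g]] functorD[OF nattransD(2)[OF g]]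
  define k where "k c = some_cokernel A (\<theta> c)" for c
  have k: "is_cokernel A (k c) (\<theta> c)" if "c \<in> Obj C" for c
    unfolding k_def by (rule some_cokernel) (use that in simp)
  have [simp]: "k c \<in> Arr A" "Dom A (k c) = FObj H c" and kz: "k c \<cdot> \<theta> c = ZeroArr A (FObj G c) (Cod A (k c))" if "c \<in> Obj C" for c
    using cokernelD[OF k[OF that]] that by auto
  have "\<forall>u \<in> Arr C. \<exists>v. v \<in> Arr A \<and> Dom A v = Cod A (k (Dom C u)) \<and> Cod A v = Cod A (k (Cod C u)) \<and>
    v \<cdot> k (Dom C u) = k (Cod C u) \<cdot> FArr H u"
  proof
    fix u assume [simp]: "u \<in> Arr C"
    have "(k (Cod C u) \<cdot> FArr H u) \<cdot> \<theta> (Dom C u) = ZeroArr A (FObj G (Dom C u)) (Cod A (k (Cod C u)))"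
      using pre_comp[OF kz[of "Cod C u"], of "FArr G u"] nattransD(7)[OF g, of u] by simp
    then show "\<exists>v. v \<in> Arr A \<and> Dom A v = Cod A (k (Dom C u)) \<and> Cod A v = Cod A (k (Cod C u)) \<and>
      v \<cdot> k (Dom C u) = k (Cod C u) \<cdot> FArr H u"
      using cokernel_desc_ex[OF k[of "Dom C u"], of "k (Cod C u) \<cdot> FArr H u"] by simp
  qed
  from bchoice[OF this] obtain l where l: "l u \<in> Arr A" "Dom A (l u) = Cod A (k (Dom C u))" "Cod A (l u) = Cod A (k (Cod C u))"
    "l u \<cdot> k (Dom C u) = k (Cod C u) \<cdot> FArr H u" if "u \<in> Arr C" for u by blast
  note [simp] = l(1-3)
  define K where "K = \<lparr>FObj = restrict (\<lambda>c. Cod A (k c)) (Obj C), FArr = restrict l (Arr C)\<rparr>"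
  have K: "is_functor C A K" unfolding K_def
  proof (rule functorI[OF C.category_axioms])
    fix a assume [simp]: "a \<in> Obj C"
    show "l (Ident C a) = Ident A (Cod A (k a))"
      by (rule epi_arrD[OF cokernel_epi[OF k[of a]]]) (use l(4)[of "Ident C a"] in simp_all)
  next
    fix f g assume [simp]: "f \<in> Arr C" "g \<in> Arr C" "Dom C g = Cod C f"
    have "(l g \<cdot> l f) \<cdot> k (Dom C f) = l (g \<cdot>\<^bsub>C\<^esub> f) \<cdot> k (Dom C f)"
      using pre_comp[OF l(4)[of g], of "FArr H f"] l(4)[of f] l(4)[of "g \<cdot>\<^bsub>C\<^esub> f"] by simp
    then show "l (g \<cdot>\<^bsub>C\<^esub> f) = l g \<cdot> l f"
      by - (rule epi_arrD[OF cokernel_epi[OF k[of "Dom C f"]]], simp_all)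
  qed simp_all
  have "is_nattrans C A H K (restrict k (Obj C))"
    by (rule nattransI[OF nattransD(2)[OF g] K]) (use l(4) in \<open>simp_all add: K_def\<close>)
  then show thesis by (rule that) (use k in simp)
qed

text \<open>The substantial direction is that a kernel in the functor category is one at each
  object. A kernel computed pointwise exists and has the same universal property, so it is compared
  with the given one and its pointwise property carried over; cokernels are treated dually.\<close>

lemma short_exact_iff:
  assumes f: "is_nattrans C A F G \<eta>" and g: "is_nattrans C A G H \<theta>"
  shows "short_exact FC (F, \<eta>, G) (G, \<theta>, H) \<longleftrightarrow> (\<forall>c \<in> Obj C. short_exact A (\<eta> c) (\<theta> c))"
proof
  assume "\<forall>c \<in> Obj C. short_exact A (\<eta> c) (\<theta> c)"
  then show "short_exact FC (F, \<eta>, G) (G, \<theta>, H)"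
    using pointwise_kernel[OF f g] pointwise_cokernel[OF f g] by (simp add: short_exact_def)
next
  assume se: "short_exact FC (F, \<eta>, G) (G, \<theta>, H)"
  then have ker: "is_kernel FC (F, \<eta>, G) (G, \<theta>, H)" and cok: "is_cokernel FC (G, \<theta>, H) (F, \<eta>, G)"
    by (auto simp: short_exact_def)
  note [simp] = nattransD(4-6)[OF f] nattransD(4-6)[OF g] functorD[OF nattransD(1)[OF f]]
    functorD[OF nattransD(2)[OF f]] functorD[OF nattransD(2)[OF g]]
  have nf: "(F, \<eta>, G) \<in> Hom FC F G" and ng: "(G, \<theta>, H) \<in> Hom FC G H" using f g by (simp_all add: functor_cat_Hom)
  have zero: "(G, \<theta>, H) \<cdot>\<^bsub>FC\<^esub> (F, \<eta>, G) = ZeroArr FC F H" using ker by (simp add: is_kernel_def)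
  have z: "\<theta> c \<cdot> \<eta> c = ZeroArr A (FObj F c) (FObj H c)" if "c \<in> Obj C" for c
    using arg_cong[OF zero, of "\<lambda>t. component t c"] that by simp
  have D: "Dom FC (G, \<theta>, H) = G" "Cod FC (G, \<theta>, H) = H" "Dom FC (F, \<eta>, G) = F" "Cod FC (F, \<eta>, G) = G"
    by simp_all
  have kerU: "\<exists>!h. h \<in> Hom FC c F \<and> (F, \<eta>, G) \<cdot>\<^bsub>FC\<^esub> h = k"
    if "k \<in> Hom FC c G" "(G, \<theta>, H) \<cdot>\<^bsub>FC\<^esub> k = ZeroArr FC c H" for c k
    using ker that unfolding is_kernel_def D by blast
  have cokU: "\<exists>!h. h \<in> Hom FC H c \<and> h \<cdot>\<^bsub>FC\<^esub> (G, \<theta>, H) = k"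
    if "k \<in> Hom FC G c" "k \<cdot>\<^bsub>FC\<^esub> (F, \<eta>, G) = ZeroArr FC F c" for c k
    using cok that unfolding is_cokernel_def D by blast
  have uniqF: "s = t" if "s \<in> Hom FC K F" "t \<in> Hom FC K F" "(F, \<eta>, G) \<cdot>\<^bsub>FC\<^esub> s = (F, \<eta>, G) \<cdot>\<^bsub>FC\<^esub> t" for s t K
  proof -
    have a: "(F, \<eta>, G) \<cdot>\<^bsub>FC\<^esub> s \<in> Hom FC K G" by (rule FC.comp_hom[OF that(1) nf])
    have "(G, \<theta>, H) \<cdot>\<^bsub>FC\<^esub> ((F, \<eta>, G) \<cdot>\<^bsub>FC\<^esub> s) = ((G, \<theta>, H) \<cdot>\<^bsub>FC\<^esub> (F, \<eta>, G)) \<cdot>\<^bsub>FC\<^esub> s"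
      by (rule FC.comp_assoc[OF that(1) nf ng, symmetric])
    also have "\<dots> = ZeroArr FC K H" unfolding zero
      using that(1) nattransD(4-6)[of C A K F "component s"] by (auto simp: functor_cat_Hom intro!: restrict_ext)
    finally have "\<exists>!h. h \<in> Hom FC K F \<and> (F, \<eta>, G) \<cdot>\<^bsub>FC\<^esub> h = (F, \<eta>, G) \<cdot>\<^bsub>FC\<^esub> s"
      by (rule kerU[OF a])
    then show ?thesis using that by metis
  qed
  have uniqH: "s = t" if "s \<in> Hom FC H K" "t \<in> Hom FC H K" "s \<cdot>\<^bsub>FC\<^esub> (G, \<theta>, H) = t \<cdot>\<^bsub>FC\<^esub> (G, \<theta>, H)" for s t K
  proof -
    have a: "s \<cdot>\<^bsub>FC\<^esub> (G, \<theta>, H) \<in> Hom FC G K" by (rule FC.comp_hom[OF ng that(1)])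
    have "(s \<cdot>\<^bsub>FC\<^esub> (G, \<theta>, H)) \<cdot>\<^bsub>FC\<^esub> (F, \<eta>, G) = s \<cdot>\<^bsub>FC\<^esub> ((G, \<theta>, H) \<cdot>\<^bsub>FC\<^esub> (F, \<eta>, G))"
      by (rule FC.comp_assoc[OF nf ng that(1)])
    also have "\<dots> = ZeroArr FC F K" unfolding zero
      using that(1) nattransD(4-6)[of C A H K "component s"] by (auto simp: functor_cat_Hom intro!: restrict_ext)
    finally have "\<exists>!h. h \<in> Hom FC H K \<and> h \<cdot>\<^bsub>FC\<^esub> (G, \<theta>, H) = s \<cdot>\<^bsub>FC\<^esub> (G, \<theta>, H)"
      by (rule cokU[OF a])
    then show ?thesis using that by metis
  qed
  obtain K \<kappa> where K: "is_nattrans C A K G \<kappa>" "\<And>c. c \<in> Obj C \<Longrightarrow> is_kernel A (\<kappa> c) (\<theta> c)"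
    by (rule kernel_functor[OF g]) blast
  obtain L \<mu> where L: "is_nattrans C A G L \<mu>" "\<And>c. c \<in> Obj C \<Longrightarrow> is_cokernel A (\<mu> c) (\<eta> c)"
    by (rule cokernel_functor[OF f]) blast
  note [simp] = nattransD(4-6)[OF K(1)] nattransD(4-6)[OF L(1)]
  have kK: "is_kernel FC (K, \<kappa>, G) (G, \<theta>, H)" by (rule pointwise_kernel[OF K(1) g K(2)])
  have cL: "is_cokernel FC (G, \<mu>, L) (F, \<eta>, G)" by (rule pointwise_cokernel[OF f L(1) L(2)])
  have DK: "Dom FC (K, \<kappa>, G) = K" "Cod FC (K, \<kappa>, G) = G" "Dom FC (G, \<mu>, L) = G" "Cod FC (G, \<mu>, L) = L"
    by simp_all
  have nK: "(K, \<kappa>, G) \<in> Hom FC K G" and nL: "(G, \<mu>, L) \<in> Hom FC G L"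
    using K L by (simp_all add: functor_cat_Hom)
  have "\<exists>!h. h \<in> Hom FC F K \<and> (K, \<kappa>, G) \<cdot>\<^bsub>FC\<^esub> h = (F, \<eta>, G)"
    using kK nf zero unfolding is_kernel_def D DK by blast
  then obtain s where s: "s \<in> Hom FC F K" "(K, \<kappa>, G) \<cdot>\<^bsub>FC\<^esub> s = (F, \<eta>, G)" by blast
  have "(G, \<theta>, H) \<cdot>\<^bsub>FC\<^esub> (K, \<kappa>, G) = ZeroArr FC K H"
    using kK unfolding is_kernel_def D DK by blast
  from kerU[OF nK this]
  obtain t where t: "t \<in> Hom FC K F" "(F, \<eta>, G) \<cdot>\<^bsub>FC\<^esub> t = (K, \<kappa>, G)" by blast
  \<comment> \<open>One composite is enough: it makes \<open>s\<close> a split monomorphism at each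
    object, hence \<open>\<eta>\<close>, which is \<open>\<kappa>\<close> after \<open>s\<close>, a
    monomorphism; and \<open>t\<close> carries lifts through \<open>\<kappa>\<close> to lifts
    through \<open>\<eta>\<close>.\<close>
  have "t \<cdot>\<^bsub>FC\<^esub> s = Ident FC F"
  proof (rule uniqF)
    show "t \<cdot>\<^bsub>FC\<^esub> s \<in> Hom FC F F" by (rule FC.comp_hom[OF s(1) t(1)])
    show "Ident FC F \<in> Hom FC F F" by (rule FC.ident_hom) (use nattransD(1)[OF f] in simp)
    show "(F, \<eta>, G) \<cdot>\<^bsub>FC\<^esub> (t \<cdot>\<^bsub>FC\<^esub> s) = (F, \<eta>, G) \<cdot>\<^bsub>FC\<^esub> Ident FC F"
      unfolding FC.comp_assoc[OF s(1) t(1) nf, symmetric] t(2) s(2) FC.ident_right[OF nf] by (rule refl)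
  qed
  then have ts: "component t c \<cdot> component s c = Ident A (FObj F c)" if "c \<in> Obj C" for c
    using arg_cong[of "t \<cdot>\<^bsub>FC\<^esub> s" "Ident FC F" "\<lambda>t. component t c"] that by (auto dest!: fun_cong[of _ _ c])
  have ks: "\<kappa> c \<cdot> component s c = \<eta> c" and ft: "\<eta> c \<cdot> component t c = \<kappa> c" if "c \<in> Obj C" for c
    using arg_cong[OF s(2), of "\<lambda>t. component t c"] arg_cong[OF t(2), of "\<lambda>t. component t c"] that by simp_all
  have sD: "is_nattrans C A F K (component s)" "is_nattrans C A K F (component t)"
    using s(1) t(1) by (auto simp: functor_cat_Hom)
  note [simp] = nattransD(4-6)[OF sD(1)] nattransD(4-6)[OF sD(2)]
  have kerc: "is_kernel A (\<eta> c) (\<theta> c)" if [simp]: "c \<in> Obj C" for c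
  proof (rule kernelI)
    have "epi_arr A (component t c \<cdot> component s c)" by (simp add: ts epi_ident)
    have "mono_arr A (component t c \<cdot> component s c)"
      by (simp add: ts) (auto simp: mono_arr_def Hom_iff)
    then have "mono_arr A (component s c)" by (rule mono_cancel) simp_all
    then have "mono_arr A (\<kappa> c \<cdot> component s c)" by (intro mono_comp kernel_mono[OF K(2)]) simp_all
    then show "mono_arr A (\<eta> c)" by (simp add: ks)
  next
    fix u assume u: "u \<in> Arr A" "Cod A u = Dom A (\<theta> c)" "\<theta> c \<cdot> u = ZeroArr A (Dom A u) (Cod A (\<theta> c))"
    obtain v where v: "v \<in> Arr A" "Dom A v = Dom A u" "Cod A v = Dom A (\<kappa> c)" "\<kappa> c \<cdot> v = u"
      by (rule kernel_lift[OF K(2)[of c], of u]) (use u in simp_all)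
    then show "\<exists>v. v \<in> Arr A \<and> Dom A v = Dom A u \<and> Cod A v = Dom A (\<eta> c) \<and> \<eta> c \<cdot> v = u"
      using pre_comp[OF ft[of c], of v] by (intro exI[of _ "component t c \<cdot> v"]) simp
  qed (simp_all add: z)
  have "\<exists>!h. h \<in> Hom FC L H \<and> h \<cdot>\<^bsub>FC\<^esub> (G, \<mu>, L) = (G, \<theta>, H)"
    using cL ng zero unfolding is_cokernel_def D DK by blast
  then obtain p where p: "p \<in> Hom FC L H" "p \<cdot>\<^bsub>FC\<^esub> (G, \<mu>, L) = (G, \<theta>, H)" by blast
  have "(G, \<mu>, L) \<cdot>\<^bsub>FC\<^esub> (F, \<eta>, G) = ZeroArr FC F L"
    using cL unfolding is_cokernel_def D DK by blast
  from cokU[OF nL this]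
  obtain q where q: "q \<in> Hom FC H L" "q \<cdot>\<^bsub>FC\<^esub> (G, \<theta>, H) = (G, \<mu>, L)" by blast
  have "p \<cdot>\<^bsub>FC\<^esub> q = Ident FC H"
  proof (rule uniqH)
    show "p \<cdot>\<^bsub>FC\<^esub> q \<in> Hom FC H H" by (rule FC.comp_hom[OF q(1) p(1)])
    show "Ident FC H \<in> Hom FC H H" by (rule FC.ident_hom) (use nattransD(2)[OF g] in simp)
    show "(p \<cdot>\<^bsub>FC\<^esub> q) \<cdot>\<^bsub>FC\<^esub> (G, \<theta>, H) = Ident FC H \<cdot>\<^bsub>FC\<^esub> (G, \<theta>, H)"
      unfolding FC.comp_assoc[OF ng q(1) p(1)] q(2) p(2) FC.ident_left[OF ng] by (rule refl)
  qed
  then have pq: "component p c \<cdot> component q c = Ident A (FObj H c)" if "c \<in> Obj C" for c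
    using arg_cong[of "p \<cdot>\<^bsub>FC\<^esub> q" "Ident FC H" "\<lambda>t. component t c"] that by (auto dest!: fun_cong[of _ _ c])
  have pm: "component p c \<cdot> \<mu> c = \<theta> c" if "c \<in> Obj C" for c
    using arg_cong[OF p(2), of "\<lambda>t. component t c"] that by simp
  have pD: "is_nattrans C A L H (component p)" "is_nattrans C A H L (component q)"
    using p(1) q(1) by (auto simp: functor_cat_Hom)
  note [simp] = nattransD(4-6)[OF pD(1)] nattransD(4-6)[OF pD(2)]
  have epic: "epi_arr A (\<theta> c)" if [simp]: "c \<in> Obj C" for c
  proof -
    have "epi_arr A (component p c \<cdot> component q c)" by (simp add: pq epi_ident)
    then have "epi_arr A (component p c)" by (rule epi_cancel) simp_all
    then have "epi_arr A (component p c \<cdot> \<mu> c)" by (intro epi_comp cokernel_epi[OF L(2)]) simp_all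
    then show ?thesis by (simp add: pm)
  qed
  show "\<forall>c \<in> Obj C. short_exact A (\<eta> c) (\<theta> c)" using short_exactI kerc epic by blast
qed

lemma short_exactD_pointwise:
  assumes "short_exact FC f g" "c \<in> Obj C"
  shows "short_exact A (component f c) (component g c)"
proof -
  obtain F \<eta> G G' \<theta> H where fg: "f = (F, \<eta>, G)" "g = (G', \<theta>, H)" by (cases f, cases g)
  have "G' = G" "is_nattrans C A F G \<eta>" "is_nattrans C A G' H \<theta>"
    using short_exact_arr[OF assms(1)] fg by auto
  then show ?thesis using short_exact_iff[of F G \<eta> H \<theta>] assms fg by simp
qed

lemma mono_short_exact:
  assumes f: "is_nattrans C A F G \<eta>" and m: "\<And>c. c \<in> Obj C \<Longrightarrow> mono_arr A (\<eta> c)"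
  obtains H \<theta> where "is_nattrans C A G H \<theta>" "short_exact FC (F, \<eta>, G) (G, \<theta>, H)"
proof -
  obtain H \<theta> where H: "is_nattrans C A G H \<theta>" "\<And>c. c \<in> Obj C \<Longrightarrow> is_cokernel A (\<theta> c) (\<eta> c)"
    by (rule cokernel_functor[OF f]) blast
  have "short_exact A (\<eta> c) (\<theta> c)" if "c \<in> Obj C" for c
    using mono_kernel_of_cokernel[OF m H(2)] H(2) that by (simp add: short_exact_def)
  then show thesis using that H(1) short_exact_iff[OF f H(1)] by blast
qed

end

section \<open>The cube category\<close>

lemma box_map_funcset: "box_map m n f \<Longrightarrow> f \<in> cube m \<rightarrow>\<^sub>E cube n"
proof (induction rule: box_map.induct)
  case (comp l m f n g)
  then show ?case by (auto simp: compose_def extensional_def PiE_iff)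
qed (auto simp: cube_def face_map_def degeneracy_map_def PiE_iff extensional_def split: if_splits)

lemma box_cat_sel [simp]:
  "Obj box_cat = UNIV" "(m, f, n) \<in> Arr box_cat \<longleftrightarrow> box_map m n f"
  "Dom box_cat \<alpha> = fst \<alpha>" "Cod box_cat \<alpha> = snd (snd \<alpha>)"
  "Ident box_cat n = (n, \<lambda>xs \<in> cube n. xs, n)"
  "\<beta> \<cdot>\<^bsub>box_cat\<^esub> \<alpha> = (fst \<alpha>, compose (cube (fst \<alpha>)) (fst (snd \<beta>)) (fst (snd \<alpha>)), snd (snd \<beta>))"
  by (auto simp: box_cat_def split: prod.splits)

lemma box_Arr: "\<alpha> \<in> Arr box_cat \<longleftrightarrow> box_map (fst \<alpha>) (snd (snd \<alpha>)) (fst (snd \<alpha>))"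
  by (cases \<alpha>) simp

lemma category_box_cat: "category box_cat"
proof
  fix f a b g c h d
  show "f \<in> Hom box_cat a b \<Longrightarrow> Ident box_cat b \<cdot>\<^bsub>box_cat\<^esub> f = f"
    by (cases f) (auto simp: Hom_iff intro!: extensionalityI[of _ "cube a"] dest: box_map_funcset simp: compose_def PiE_iff)
  show "f \<in> Hom box_cat a b \<Longrightarrow> f \<cdot>\<^bsub>box_cat\<^esub> Ident box_cat a = f"
    by (cases f) (auto simp: Hom_iff intro!: extensionalityI[of _ "cube a"] dest: box_map_funcset simp: compose_def PiE_iff)
  show "\<lbrakk>f \<in> Hom box_cat a b; g \<in> Hom box_cat b c; h \<in> Hom box_cat c d\<rbrakk>
    \<Longrightarrow> (h \<cdot>\<^bsub>box_cat\<^esub> g) \<cdot>\<^bsub>box_cat\<^esub> f = h \<cdot>\<^bsub>box_cat\<^esub> (g \<cdot>\<^bsub>box_cat\<^esub> f)"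
    by (cases f) (auto simp: Hom_iff compose_def PiE_iff dest!: box_map_funcset intro!: restrict_ext)
qed (use box_map.ident box_map.comp in \<open>auto simp: Hom_iff box_Arr\<close>)

section \<open>Faces, degeneracies and the cubical identities\<close>

lemma face_arr:
  assumes "1 \<le> i" "i \<le> k"
  shows "face k i e \<in> Arr box_cat" "fst (face k i e) = k - 1" "snd (snd (face k i e)) = k"
  using assms box_map.face[of i k e] by (auto simp: face_def)

lemma degeneracy_arr:
  assumes "1 \<le> i" "i \<le> k"
  shows "degeneracy k i \<in> Arr box_cat" "fst (degeneracy k i) = k" "snd (snd (degeneracy k i)) = k - 1"
  using assms box_map.degeneracy[of i k] by (auto simp: degeneracy_def)

text \<open>The cubical identities are verified on lists cut at the two positions involved, where
  \<open>take\<close> and \<open>drop\<close> can be computed.\<close>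

lemma list_split3:
  assumes "p + q \<le> length xs"
  obtains a b c where "xs = a @ b @ c" "length a = p" "length b = q"
proof
  show "xs = take p xs @ take q (drop p xs) @ drop (p + q) xs"
    by (metis add.commute append_take_drop_id drop_drop)
qed (use assms in auto)

lemma face_face:
  assumes "1 \<le> i" "i < j" "j \<le> Suc k"
  shows "face (Suc k) j e \<cdot>\<^bsub>box_cat\<^esub> face k i e' = face (Suc k) i e' \<cdot>\<^bsub>box_cat\<^esub> face k (j - 1) e"
proof -
  have "take (j - 1) (take (i - 1) xs @ e' # drop (i - 1) xs) @ e # drop (j - 1) (take (i - 1) xs @ e' # drop (i - 1) xs) =
    take (i - 1) (take (j - 1 - 1) xs @ e # drop (j - 1 - 1) xs) @ e' # drop (i - 1) (take (j - 1 - 1) xs @ e # drop (j - 1 - 1) xs)"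
    if xs: "length xs = k - 1" for xs
  proof -
    have "(i - 1) + (j - 1 - i) \<le> length xs" using assms xs by simp
    then obtain a b c where *: "xs = a @ b @ c" "length a = i - 1" "length b = j - 1 - i" by (rule list_split3)
    have ij: "i = Suc (length a)" "j = Suc (Suc (length a + length b))" using * assms by auto
    show ?thesis unfolding *(1) ij by simp
  qed
  then show ?thesis using assms
    by (auto simp: face_def face_map_def compose_def cube_def intro!: restrict_ext)
qed

lemma degeneracy_face_eq:
  assumes "1 \<le> i" "i \<le> k"
  shows "degeneracy k i \<cdot>\<^bsub>box_cat\<^esub> face k i e = Ident box_cat (k - 1)"
  using assms
  by (auto simp: face_def degeneracy_def face_map_def degeneracy_map_def compose_def cube_def intro!: restrict_ext)

lemma degeneracy_face_less:
  assumes "1 \<le> i" "i < j" "j \<le> k"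
  shows "degeneracy k j \<cdot>\<^bsub>box_cat\<^esub> face k i e = face (k - 1) i e \<cdot>\<^bsub>box_cat\<^esub> degeneracy (k - 1) (j - 1)"
proof -
  have "take (j - 1) (take (i - 1) xs @ e # drop (i - 1) xs) @ drop j (take (i - 1) xs @ e # drop (i - 1) xs) =
    take (i - 1) (take (j - 1 - 1) xs @ drop (j - 1) xs) @ e # drop (i - 1) (take (j - 1 - 1) xs @ drop (j - 1) xs)"
    if xs: "length xs = k - 1" for xs
  proof -
    have "(i - 1) + (j - 1 - i) \<le> length xs" using assms xs by simp
    then obtain a b c where *: "xs = a @ b @ c" "length a = i - 1" "length b = j - 1 - i" by (rule list_split3)
    have ij: "i = Suc (length a)" "j = Suc (Suc (length a + length b))" using * assms by auto
    show ?thesis unfolding *(1) ij by simp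
  qed
  then show ?thesis using assms
    by (auto simp: face_def degeneracy_def face_map_def degeneracy_map_def compose_def cube_def intro!: restrict_ext)
qed

lemma degeneracy_face_greater:
  assumes "1 \<le> j" "j < i" "i \<le> k"
  shows "degeneracy k j \<cdot>\<^bsub>box_cat\<^esub> face k i e = face (k - 1) (i - 1) e \<cdot>\<^bsub>box_cat\<^esub> degeneracy (k - 1) j"
proof -
  have "take (j - 1) (take (i - 1) xs @ e # drop (i - 1) xs) @ drop j (take (i - 1) xs @ e # drop (i - 1) xs) =
    take (i - 1 - 1) (take (j - 1) xs @ drop j xs) @ e # drop (i - 1 - 1) (take (j - 1) xs @ drop j xs)"
    if xs: "length xs = k - 1" for xs
  proof -
    have "(j - 1) + (i - j) \<le> length xs" using assms xs by simp
    then obtain a b' c where *: "xs = a @ b' @ c" "length a = j - 1" "length b' = i - j" by (rule list_split3)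
    then obtain y b where b': "b' = y # b" using assms by (cases b') auto
    have ij: "j = Suc (length a)" "i = Suc (Suc (length a + length b))" using * b' assms by auto
    show ?thesis unfolding *(1) ij b' by simp
  qed
  then show ?thesis using assms
    by (auto simp: face_def degeneracy_def face_map_def degeneracy_map_def compose_def cube_def intro!: restrict_ext)
qed

lemma degeneracy_degeneracy:
  assumes "1 \<le> i" "i < j" "j \<le> k"
  shows "degeneracy (k - 1) i \<cdot>\<^bsub>box_cat\<^esub> degeneracy k j = degeneracy (k - 1) (j - 1) \<cdot>\<^bsub>box_cat\<^esub> degeneracy k i"
proof -
  have "take (i - 1) (take (j - 1) xs @ drop j xs) @ drop i (take (j - 1) xs @ drop j xs) =
    take (j - 1 - 1) (take (i - 1) xs @ drop i xs) @ drop (j - 1) (take (i - 1) xs @ drop i xs)"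
    if xs: "length xs = k" for xs :: "bool list"
  proof -
    have "(i - 1) + (j - i) \<le> length xs" using assms xs by simp
    then obtain a b' c' where *: "xs = a @ b' @ c'" "length a = i - 1" "length b' = j - i" by (rule list_split3)
    then obtain x b where b': "b' = x # b" using assms by (cases b') auto
    obtain y c where c': "c' = y # c" using * assms xs by (cases c') auto
    have ij: "i = Suc (length a)" "j = Suc (Suc (length a + length b))" using * b' assms by auto
    show ?thesis unfolding *(1) ij b' c' by simp
  qed
  then show ?thesis using assms
    by (auto simp: degeneracy_def degeneracy_map_def compose_def cube_def intro!: restrict_ext)
qed

text \<open>A word over \<open>{0, 1, *}\<close>, with \<open>None\<close> for \<open>*\<close>, encodes a face of a standard cube; \<open>fill w\<close> is the
  corresponding injective map, which substitutes its arguments for the stars.\<close>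

fun fill :: "bool option list \<Rightarrow> bool list \<Rightarrow> bool list" where
  "fill [] xs = []"
| "fill (Some b # w) xs = b # fill w xs"
| "fill (None # w) xs = hd xs # fill w (tl xs)"

abbreviation stars :: "bool option list \<Rightarrow> nat" where
  "stars w \<equiv> count_list w None"

definition fill_map :: "bool option list \<Rightarrow> bool list \<Rightarrow> bool list" where
  "fill_map w = (\<lambda>xs \<in> cube (stars w). fill w xs)"

definition word_arr :: "bool option list \<Rightarrow> box_arr" where
  "word_arr w = (stars w, fill_map w, length w)"

lemma length_fill [simp]: "length (fill w xs) = length w"
  by (induction w xs rule: fill.induct) auto

text \<open>Adding a first coordinate is an endofunctor of the cube category that shifts the indices
  of faces and degeneracies by 1. It accounts for a leading star of a word.\<close>

lemma box_map_lift:
  "box_map m n f \<Longrightarrow> box_map (Suc m) (Suc n) (\<lambda>xs \<in> cube (Suc m). hd xs # f (tl xs))"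
proof (induction rule: box_map.induct)
  case (ident n)
  have "(\<lambda>xs \<in> cube (Suc n). hd xs # (\<lambda>xs \<in> cube n. xs) (tl xs)) = (\<lambda>xs \<in> cube (Suc n). xs)"
    by (auto simp: cube_def length_Suc_conv intro!: restrict_ext)
  then show ?case using box_map.ident[of "Suc n"] by (simp only:)
next
  case (face i k e)
  then obtain i' k' where ik: "i = Suc i'" "k = Suc k'" by (cases i; cases k) auto
  have "(\<lambda>xs \<in> cube k. hd xs # face_map k i e (tl xs)) = face_map (Suc k) (Suc i) e"
    unfolding ik by (auto simp: cube_def face_map_def length_Suc_conv intro!: restrict_ext)
  then show ?case using box_map.face[of "Suc i" "Suc k" e] face ik by simp
next
  case (degeneracy i k)
  then obtain i' k' where ik: "i = Suc i'" "k = Suc k'" by (cases i; cases k) auto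
  have "(\<lambda>xs \<in> cube (Suc k). hd xs # degeneracy_map k i (tl xs)) = degeneracy_map (Suc k) (Suc i)"
    unfolding ik by (auto simp: cube_def degeneracy_map_def length_Suc_conv intro!: restrict_ext)
  then show ?case using box_map.degeneracy[of "Suc i" "Suc k"] degeneracy ik by simp
next
  case (comp l m f n g)
  have "compose (cube (Suc l)) (\<lambda>xs \<in> cube (Suc m). hd xs # g (tl xs)) (\<lambda>xs \<in> cube (Suc l). hd xs # f (tl xs)) =
    (\<lambda>xs \<in> cube (Suc l). hd xs # compose (cube l) g f (tl xs))"
    using PiE_mem[OF box_map_funcset[OF comp(1)]] by (auto simp: compose_def cube_def intro!: restrict_ext)
  then show ?case using box_map.comp[OF comp(3,4)] by (simp only:)
qed

lemma word_arr_Arr: "word_arr w \<in> Arr box_cat"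
proof -
  have "box_map (stars w) (length w) (fill_map w)"
  proof (induction w)
    case Nil
    have "fill_map [] = (\<lambda>xs \<in> cube 0. xs)" by (auto simp: fill_map_def cube_def intro!: restrict_ext)
    then show ?case using box_map.ident[of 0] by (simp only: count_list.simps list.size)
  next
    case (Cons a w)
    show ?case
    proof (cases a)
      case None
      have "fill_map (None # w) = (\<lambda>xs \<in> cube (Suc (stars w)). hd xs # fill_map w (tl xs))"
        by (auto simp: fill_map_def cube_def intro!: restrict_ext)
      then have "box_map (Suc (stars w)) (Suc (length w)) (fill_map (None # w))"
        using box_map_lift[OF Cons] by (simp only:)
      then show ?thesis using None by simp
    next
      case (Some b)
      have "fill_map (Some b # w) = compose (cube (stars w)) (face_map (Suc (length w)) 1 b) (fill_map w)"
        by (auto simp: fill_map_def cube_def compose_def face_map_def intro!: restrict_ext)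
      then show ?thesis using box_map.comp[OF Cons box_map.face[of 1 "Suc (length w)" b, simplified]] Some by simp
    qed
  qed
  then show ?thesis by (simp add: word_arr_def)
qed

lemma word_arr_sel [simp]: "fst (word_arr w) = stars w" "snd (snd (word_arr w)) = length w"
  by (auto simp: word_arr_def)

lemma fill_inj:
  assumes "fill w xs = fill w ys" "length xs = stars w" "length ys = stars w"
  shows "xs = ys"
  using assms
proof (induction w xs arbitrary: ys rule: fill.induct)
  case (3 w xs)
  then show ?case by (auto simp: length_Suc_conv)
qed auto

lemma fill_word_inj:
  assumes "\<And>xs. length xs = stars w \<Longrightarrow> fill w xs = fill w' xs" "stars w = stars w'" "length w = length w'"
  shows "w = w'"
  using assms(3,1,2)
proof (induction w w' rule: list_induct2)
  case (Cons a w b w')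
  obtain xs :: "bool list" where xs: "length xs = stars (a # w)" by (metis length_replicate)
  show ?case
  proof (cases a)
    case [simp]: None
    have b: "b = None"
    proof (cases b)
      case (Some c)
      \<comment> \<open>An argument that starts with the negation of \<open>c\<close> tells a
        leading star from the constant \<open>c\<close>.\<close>
      have "fill (None # w) ((\<not> c) # replicate (stars w) True) = fill (Some c # w') ((\<not> c) # replicate (stars w) True)"
        using Cons(3)[of "(\<not> c) # replicate (stars w) True"] Some by simp
      then show ?thesis by simp
    qed simp
    have "fill w ys = fill w' ys" if "length ys = stars w" for ys
      using Cons(3)[of "True # ys"] that b by simp
    then show ?thesis using Cons b by simp
  next
    case [simp]: (Some c)
    have b: "b = Some c"
    proof (cases b)
      case None
      then have "stars w = Suc (stars w')" using Cons by simp
      then show ?thesis using Cons(3)[of "(\<not> c) # replicate (stars w') True"] None by simp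
    next
      case (Some d)
      then show ?thesis using Cons(3)[of xs] xs by simp
    qed
    have "fill w ys = fill w' ys" if "length ys = stars w" for ys
      using Cons(3)[of ys] that b by simp
    then show ?thesis using Cons b by simp
  qed
qed simp

lemma word_arr_inj: "word_arr w = word_arr w' \<Longrightarrow> w = w'"
proof (rule fill_word_inj)
  assume eq: "word_arr w = word_arr w'"
  fix xs :: "bool list" assume "length xs = stars w"
  moreover have "fill_map w xs = fill_map w' xs" "stars w = stars w'" using eq by (simp_all add: word_arr_def)
  ultimately show "fill w xs = fill w' xs" by (simp add: fill_map_def cube_def)
qed (auto simp: word_arr_def)

text \<open>The \<open>i\<close>-th star is replaced by a constant. Stars are counted from 1, like
  the directions of faces; the value at \<open>i = 0\<close> is irrelevant.\<close>

fun star_subst :: "nat \<Rightarrow> bool \<Rightarrow> bool option list \<Rightarrow> bool option list" where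
  "star_subst i b [] = []"
| "star_subst i b (Some c # w) = Some c # star_subst i b w"
| "star_subst i b (None # w) = (if i = 1 then Some b # w else None # star_subst (i - 1) b w)"

lemma length_star_subst [simp]: "length (star_subst i b w) = length w"
  by (induction i b w rule: star_subst.induct) auto

lemma stars_star_subst: "\<lbrakk>1 \<le> i; i \<le> stars w\<rbrakk> \<Longrightarrow> stars (star_subst i b w) = stars w - 1"
proof (induction i b w rule: star_subst.induct)
  case (3 i b w)
  then show ?case by (cases "i = 1") auto
qed auto

lemma fill_star_subst:
  "\<lbrakk>1 \<le> i; i \<le> stars w; length xs = stars w - 1\<rbrakk>
    \<Longrightarrow> fill (star_subst i b w) xs = fill w (take (i - 1) xs @ b # drop (i - 1) xs)"
proof (induction i b w arbitrary: xs rule: star_subst.induct)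
  case (3 i b w)
  show ?case
  proof (cases "i = 1")
    case False
    then obtain j where j: "i = Suc (Suc j)" using 3(2) by (metis One_nat_def not0_implies_Suc not_one_le_zero)
    then obtain y ys where [simp]: "xs = y # ys" using 3 by (cases xs) auto
    show ?thesis using 3(1)[of ys] 3(3,4) j by simp
  qed simp
qed auto

text \<open>The faces of a face of a standard cube are again given by words. This is what turns the
  cubical coboundary into an operation on words.\<close>

lemma word_arr_face:
  assumes "1 \<le> i" "i \<le> stars w"
  shows "word_arr w \<cdot>\<^bsub>box_cat\<^esub> face (stars w) i b = word_arr (star_subst i b w)"
proof -
  have "take (i - 1) xs @ b # drop (i - 1) xs \<in> cube (stars w)" if "xs \<in> cube (stars w - 1)" for xs
    using that assms by (auto simp: cube_def)
  then show ?thesis using assms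
    by (auto simp: word_arr_def face_def face_map_def compose_def fill_map_def stars_star_subst
        fill_star_subst cube_def intro!: restrict_ext)
qed

text \<open>Every coordinate of a cube map is a constant or an input coordinate, and the input coordinates
  occur in increasing order.\<close>

definition ev :: "bool list \<Rightarrow> bool + nat \<Rightarrow> bool" where
  "ev xs e = (case e of Inl b \<Rightarrow> b | Inr i \<Rightarrow> xs ! i)"

definition increasing :: "nat \<Rightarrow> (bool + nat) list \<Rightarrow> bool" where
  "increasing m r \<longleftrightarrow> (\<forall>i. Inr i \<in> set r \<longrightarrow> i < m) \<and>
     sorted_wrt (\<lambda>a b. \<forall>i j. a = Inr i \<longrightarrow> b = Inr j \<longrightarrow> i < j) r"

lemma map_ev_upt: "q \<le> length xs \<Longrightarrow> map (ev xs) (map Inr [p..<q]) = take (q - p) (drop p xs)"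
  by (rule nth_equalityI) (auto simp: ev_def)

lemma box_map_coordinates:
  "box_map m n f \<Longrightarrow> \<exists>r. length r = n \<and> increasing m r \<and> f = (\<lambda>xs \<in> cube m. map (ev xs) r)"
proof (induction rule: box_map.induct)
  case (ident n)
  have "(\<lambda>xs \<in> cube n. xs) = (\<lambda>xs \<in> cube n. map (ev xs) (map Inr [0..<n]))"
    by (rule restrict_ext) (subst map_ev_upt, auto simp: cube_def)
  then show ?case
    by (intro exI[of _ "map Inr [0..<n]"] conjI) (auto simp: increasing_def sorted_wrt_map)
next
  case (face i k e)
  have "face_map k i e = (\<lambda>xs \<in> cube (k - 1). map (ev xs) (map Inr [0..<i - 1] @ Inl e # map Inr [i - 1..<k - 1]))"
    unfolding face_map_def
  proof (rule restrict_ext)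
    fix xs :: "bool list" assume "xs \<in> cube (k - 1)"
    then have "map (ev xs) (map Inr [0..<i - 1]) = take (i - 1) xs"
      "map (ev xs) (map Inr [i - 1..<k - 1]) = drop (i - 1) xs"
      using face map_ev_upt[of "i - 1" xs 0] map_ev_upt[of "k - 1" xs "i - 1"] by (auto simp: cube_def)
    then show "take (i - 1) xs @ [e] @ drop (i - 1) xs =
      map (ev xs) (map Inr [0..<i - 1] @ Inl e # map Inr [i - 1..<k - 1])"
      unfolding map_append list.map by (simp add: ev_def)
  qed
  moreover have "increasing (k - 1) (map Inr [0..<i - 1] @ Inl e # map Inr [i - 1..<k - 1])"
    using face by (auto simp: increasing_def sorted_wrt_append sorted_wrt_map)
  moreover have "length (map Inr [0..<i - 1] @ Inl e # map Inr [i - 1..<k - 1]) = k" using face by simp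
  ultimately show ?case by blast
next
  case (degeneracy i k)
  have "degeneracy_map k i = (\<lambda>xs \<in> cube k. map (ev xs) (map Inr [0..<i - 1] @ map Inr [i..<k]))"
    unfolding degeneracy_map_def
  proof (rule restrict_ext)
    fix xs :: "bool list" assume "xs \<in> cube k"
    then have "map (ev xs) (map Inr [0..<i - 1]) = take (i - 1) xs"
      "map (ev xs) (map Inr [i..<k]) = drop i xs"
      using degeneracy map_ev_upt[of "i - 1" xs 0] map_ev_upt[of k xs i] by (auto simp: cube_def)
    then show "take (i - 1) xs @ drop i xs = map (ev xs) (map Inr [0..<i - 1] @ map Inr [i..<k])"
      unfolding map_append by simp
  qed
  moreover have "increasing k (map Inr [0..<i - 1] @ map Inr [i..<k])"
    using degeneracy by (auto simp: increasing_def sorted_wrt_append sorted_wrt_map)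
  moreover have "length (map Inr [0..<i - 1] @ map Inr [i..<k]) = k - 1" using degeneracy by simp
  ultimately show ?case by blast
next
  case (comp l m f n g)
  then obtain r s where r: "length r = m" "increasing l r" "f = (\<lambda>xs \<in> cube l. map (ev xs) r)"
    and s: "length s = n" "increasing m s" "g = (\<lambda>xs \<in> cube m. map (ev xs) s)" by blast
  have sm: "i < m" if "Inr i \<in> set s" for i using s(2) that by (simp add: increasing_def)
  have rl: "i < l" if "Inr i \<in> set r" for i using r(2) that by (simp add: increasing_def)
  have sinc: "i < j" if "p < q" "q < length s" "s ! p = Inr i" "s ! q = Inr j" for i j p q
    using s(2) that unfolding increasing_def sorted_wrt_iff_nth_less by blast
  have rinc: "i < j" if "p < q" "q < length r" "r ! p = Inr i" "r ! q = Inr j" for i j p q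
    using r(2) that unfolding increasing_def sorted_wrt_iff_nth_less by blast
  \<comment> \<open>The coordinates of the composite are those of \<open>s\<close>, with each input
    coordinate replaced by the corresponding entry of \<open>r\<close>. Strictly increasing
    selections compose to such a selection.\<close>
  define t where "t = map (\<lambda>e. case e of Inl b \<Rightarrow> Inl b | Inr i \<Rightarrow> r ! i) s"
  have "map (ev (map (ev xs) r)) s = map (ev xs) t" for xs
    unfolding t_def map_map
  proof (rule map_cong)
    fix e assume e: "e \<in> set s"
    show "ev (map (ev xs) r) e = (ev xs \<circ> (\<lambda>e. case e of Inl b \<Rightarrow> Inl b | Inr i \<Rightarrow> r ! i)) e"
    proof (cases e)
      case (Inr i)
      then have "i < length r" using sm[of i] e r(1) by simp
      then show ?thesis using Inr by (simp add: ev_def)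
    qed (simp add: ev_def)
  qed simp
  then have "compose (cube l) g f = (\<lambda>xs \<in> cube l. map (ev xs) t)"
    using r(1) unfolding s(3) r(3) compose_def by (auto simp: cube_def fun_eq_iff)
  moreover have "increasing l t"
    unfolding increasing_def sorted_wrt_iff_nth_less
  proof (intro conjI allI impI)
    fix i assume "Inr i \<in> set t"
    then obtain e where e: "e \<in> set s" "(case e of Inl b \<Rightarrow> Inl b | Inr i \<Rightarrow> r ! i) = Inr i"
      by (auto simp: t_def)
    from e(2) obtain i' where i': "e = Inr i'" "r ! i' = Inr i" by (auto split: sum.splits)
    then have "i' < length r" using sm[of i'] e(1) r(1) by simp
    then have "r ! i' \<in> set r" by (rule nth_mem)
    then show "i < l" using rl[of i] i'(2) by simp
  next
    fix p q i j assume pq: "p < q" "q < length t" "t ! p = Inr i" "t ! q = Inr j"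
    then obtain i' j' where ij: "s ! p = Inr i'" "r ! i' = Inr i" "s ! q = Inr j'" "r ! j' = Inr j"
      by (auto simp: t_def split: sum.splits)
    have q: "q < length s" using pq(2) by (simp add: t_def)
    have "i' < j'" by (rule sinc[OF pq(1) q ij(1,3)])
    moreover have "j' < m" using sm[of j'] nth_mem[OF q] ij(3) by simp
    ultimately show "i < j" using rinc[of i' j'] ij r(1) by simp
  qed
  ultimately show ?case using s(1) by (intro exI[of _ t]) (simp add: t_def)
qed

section \<open>Every cube map is a face or factors through a degeneracy\<close>

fun idx :: "(bool + nat) list \<Rightarrow> nat list" where
  "idx [] = []"
| "idx (Inl b # r) = idx r"
| "idx (Inr i # r) = i # idx r"

text \<open>\<open>idx r\<close> lists the input coordinates that are read, and
  \<open>word_of r\<close> keeps only the places where they appear: the map is the projection to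
  \<open>idx r\<close> followed by the face \<open>word_of r\<close>
  (\<open>map_ev_fill\<close>).\<close>

definition word_of :: "(bool + nat) list \<Rightarrow> bool option list" where
  "word_of r = map (\<lambda>e. case e of Inl b \<Rightarrow> Some b | Inr i \<Rightarrow> None) r"

lemma set_idx: "i \<in> set (idx r) \<longleftrightarrow> Inr i \<in> set r"
  by (induction r rule: idx.induct) auto

lemma stars_word_of: "stars (word_of r) = length (idx r)"
  by (induction r rule: idx.induct) (auto simp: word_of_def)

lemma map_ev_fill: "map (ev xs) r = fill (word_of r) (map ((!) xs) (idx r))"
  by (induction r rule: idx.induct) (auto simp: word_of_def ev_def)

lemma increasing_sorted: "increasing m r \<Longrightarrow> sorted_wrt (<) (idx r)"
  by (induction r rule: idx.induct) (auto simp: increasing_def set_idx)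

text \<open>If every input coordinate is read, the strictly increasing list of those read is
  \<open>[0..<m]\<close> and the map is a face. Otherwise some coordinate is ignored, and deleting
  it and inserting a constant in its place does not change the value, which exhibits the
  factorization through a degeneracy.\<close>

lemma box_map_cases:
  assumes f: "box_map m n f"
  obtains (word) w where "(m, f, n) = word_arr w"
  | (degenerate) i where "1 \<le> i" "i \<le> m"
      "(m, f, n) = ((m, f, n) \<cdot>\<^bsub>box_cat\<^esub> face m i False) \<cdot>\<^bsub>box_cat\<^esub> degeneracy m i"
proof -
  obtain r where r: "length r = n" "increasing m r" "f = (\<lambda>xs \<in> cube m. map (ev xs) r)"
    using box_map_coordinates[OF f] by blast
  show thesis
  proof (cases "\<forall>i < m. Inr i \<in> set r")
    case True
    have "set (idx r) = {..<m}" using True r(2) by (auto simp: set_idx increasing_def)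
    then have "idx r = [0..<m]"
      using increasing_sorted[OF r(2)] by (intro sorted_distinct_set_unique) (auto simp: strict_sorted_iff lessThan_atLeast0)
    then have m: "stars (word_of r) = m" by (simp add: stars_word_of)
    have "f = fill_map (word_of r)"
      unfolding r(3) fill_map_def m
    proof (rule restrict_ext)
      fix xs :: "bool list" assume "xs \<in> cube m"
      then show "map (ev xs) r = fill (word_of r) xs"
        unfolding map_ev_fill \<open>idx r = [0..<m]\<close> using map_nth[of xs] by (simp add: cube_def)
    qed
    then have "(m, f, n) = word_arr (word_of r)" using m r(1) by (simp add: word_arr_def word_of_def)
    then show thesis by (rule word)
  next
    case False
    then obtain i where i: "i < m" "Inr i \<notin> set r" by blast
    have "map (ev xs) r = map (ev (take i (take i xs @ drop (Suc i) xs) @ False # drop i (take i xs @ drop (Suc i) xs))) r"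
      if xs: "length xs = m" for xs
    proof (rule map_cong)
      fix e assume e: "e \<in> set r"
      show "ev xs e = ev (take i (take i xs @ drop (Suc i) xs) @ False # drop i (take i xs @ drop (Suc i) xs)) e"
      proof (cases e)
        case (Inr j)
        then have "j \<noteq> i" "j < m" using e i r(2) by (auto simp: increasing_def)
        then show ?thesis using Inr xs i by (auto simp: ev_def nth_append nth_Cons' min_def)
      qed (simp add: ev_def)
    qed simp
    note eq = this
    \<comment> \<open>List positions start from 0, the directions of faces and degeneracies from 1;
      hence \<open>Suc i\<close>. Any constant could be inserted.\<close>
    have "f = compose (cube m) (compose (cube (m - 1)) f (face_map m (Suc i) False)) (degeneracy_map m (Suc i))"
    proof (rule extensionalityI)
      show "f \<in> extensional (cube m)" unfolding r(3) by simp
      fix xs :: "bool list" assume xs: "xs \<in> cube m"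
      define y where "y = take i xs @ drop (Suc i) xs"
      have y: "y \<in> cube (m - 1)" "take i y @ False # drop i y \<in> cube m"
        using xs i(1) by (auto simp: y_def cube_def)
      have "compose (cube m) (compose (cube (m - 1)) f (face_map m (Suc i) False)) (degeneracy_map m (Suc i)) xs =
        f (take i y @ False # drop i y)"
        using xs y(1) by (simp add: compose_def degeneracy_map_def face_map_def flip: y_def)
      also have "\<dots> = map (ev (take i y @ False # drop i y)) r" using y(2) unfolding r(3) by simp
      also have "\<dots> = f xs" using eq[of xs] xs unfolding r(3) y_def by (simp add: cube_def)
      finally show "f xs = compose (cube m) (compose (cube (m - 1)) f (face_map m (Suc i) False)) (degeneracy_map m (Suc i)) xs" ..
    qed (simp add: compose_def)
    then have "(m, f, n) = ((m, f, n) \<cdot>\<^bsub>box_cat\<^esub> face m (Suc i) False) \<cdot>\<^bsub>box_cat\<^esub> degeneracy m (Suc i)"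
      by (simp add: face_def degeneracy_def)
    then show thesis by (rule degenerate[rotated 2]) (use i(1) in simp_all)
  qed
qed

text \<open>Faces are injective, whereas a map that factors through a degeneracy identifies two
  points that differ only in the deleted coordinate. So the two cases of
  \<open>box_map_cases\<close> exclude each other.\<close>

lemma word_arr_not_degenerate:
  assumes "1 \<le> i" "i \<le> fst (word_arr w)"
  shows "word_arr w \<noteq> \<beta> \<cdot>\<^bsub>box_cat\<^esub> degeneracy (fst (word_arr w)) i"
proof
  assume eq: "word_arr w = \<beta> \<cdot>\<^bsub>box_cat\<^esub> degeneracy (fst (word_arr w)) i"
  define m where "m = stars w"
  define xs ys where "xs = replicate m True" and "ys = (replicate m True)[i - 1 := False]"
  have i: "1 \<le> i" "i \<le> m" using assms by (auto simp: m_def)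
  have "degeneracy_map m i xs = degeneracy_map m i ys"
    using i by (auto simp: xs_def ys_def degeneracy_map_def cube_def)
  moreover have "fill_map w zs = fst (snd \<beta>) (degeneracy_map m i zs)" if "length zs = m" for zs
    using fun_cong[OF arg_cong[OF eq, of "\<lambda>\<alpha>. fst (snd \<alpha>)"], of zs] that
    by (simp add: word_arr_def degeneracy_def compose_def m_def cube_def)
  ultimately have "fill w xs = fill w ys" by (simp add: xs_def ys_def fill_map_def cube_def m_def)
  then have "xs = ys" by (rule fill_inj) (simp_all add: xs_def ys_def m_def)
  then have "xs ! (i - 1) = ys ! (i - 1)" by simp
  then show False using i by (simp add: xs_def ys_def)
qed

section \<open>Cochains on a cubical set\<close>

lemma set_cat_sel [simp]:
  "Arr set_cat = {(S, f, T). f \<in> S \<rightarrow>\<^sub>E T}" "Dom set_cat t = fst t" "Cod set_cat t = snd (snd t)"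
  "Ident set_cat S = (S, \<lambda>x \<in> S. x, S)"
  "s \<cdot>\<^bsub>set_cat\<^esub> t = (fst t, compose (fst t) (fst (snd s)) (fst (snd t)), snd (snd s))"
  by (auto simp: set_cat_def split: prod.splits)

lemma op_cat_sel [simp]:
  "Obj (op_cat C) = Obj C" "Arr (op_cat C) = Arr C" "Dom (op_cat C) = Cod C" "Cod (op_cat C) = Dom C"
  "Ident (op_cat C) = Ident C" "g \<cdot>\<^bsub>op_cat C\<^esub> f = f \<cdot>\<^bsub>C\<^esub> g"
  by (auto simp: op_cat_def)

section \<open>The action on a cubical set and the category of elements\<close>

locale cubical =
  fixes X :: "'u cubical"
  assumes cubical: "cubical_set X"
begin

lemmas XD = functorD[OF cubical[unfolded cubical_set_def]]

lemma act_obj: "\<lbrakk>\<alpha> \<in> Arr box_cat; x \<in> FObj X (snd (snd \<alpha>))\<rbrakk> \<Longrightarrow> act X \<alpha> x \<in> FObj X (fst \<alpha>)"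
  using XD(2,3,4)[of \<alpha>] by (cases "FArr X \<alpha>") (auto simp: act_def)

lemma act_comp:
  assumes "\<alpha> \<in> Arr box_cat" "\<beta> \<in> Arr box_cat" "fst \<beta> = snd (snd \<alpha>)" "x \<in> FObj X (snd (snd \<beta>))"
  shows "act X (\<beta> \<cdot>\<^bsub>box_cat\<^esub> \<alpha>) x = act X \<alpha> (act X \<beta> x)"
proof -
  have "FArr X (\<beta> \<cdot>\<^bsub>box_cat\<^esub> \<alpha>) = FArr X \<alpha> \<cdot>\<^bsub>set_cat\<^esub> FArr X \<beta>"
    using XD(6)[of \<beta> \<alpha>] assms by (simp del: box_cat_sel(6))
  moreover have "fst (FArr X \<beta>) = FObj X (snd (snd \<beta>))" using XD(3)[of \<beta>] assms by simp
  ultimately show ?thesis using assms by (simp add: act_def compose_def)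
qed

lemma act_ident: "x \<in> FObj X n \<Longrightarrow> act X (Ident box_cat n) x = x"
  using XD(5)[of n] by (simp add: act_def)

abbreviation E where "E \<equiv> el_cat X"

lemma el_sel [simp]:
  "(n, x) \<in> Obj E \<longleftrightarrow> x \<in> FObj X n" "Dom E u = fst u" "Cod E u = snd (snd u)"
  "Ident E (n, x) = ((n, x), Ident box_cat n, (n, x))"
  "u \<cdot>\<^bsub>E\<^esub> v = (fst v, fst (snd u) \<cdot>\<^bsub>box_cat\<^esub> fst (snd v), snd (snd u))"
  by (auto simp: el_cat_def split: prod.splits)

lemma el_Arr: "u \<in> Arr E \<longleftrightarrow> (\<exists>\<alpha> x. u = el_arrow X \<alpha> x \<and> \<alpha> \<in> Arr box_cat \<and> x \<in> FObj X (snd (snd \<alpha>)))"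
  by (auto simp: el_cat_def)

lemma el_arrow_sel [simp]:
  "fst (el_arrow X \<alpha> x) = (fst \<alpha>, act X \<alpha> x)" "fst (snd (el_arrow X \<alpha> x)) = \<alpha>"
  "snd (snd (el_arrow X \<alpha> x)) = (snd (snd \<alpha>), x)"
  by (auto simp: el_arrow_def)

lemma el_arrow_Arr: "\<lbrakk>\<alpha> \<in> Arr box_cat; x \<in> FObj X (snd (snd \<alpha>))\<rbrakk> \<Longrightarrow> el_arrow X \<alpha> x \<in> Arr E"
  using el_Arr by blast

lemma el_arrow_ident: "x \<in> FObj X n \<Longrightarrow> el_arrow X (Ident box_cat n) x = Ident E (n, x)"
  using act_ident[of x n] by (simp add: el_arrow_def)

lemma el_arrow_comp:
  assumes "\<alpha> \<in> Arr box_cat" "\<beta> \<in> Arr box_cat" "fst \<beta> = snd (snd \<alpha>)" "x \<in> FObj X (snd (snd \<beta>))"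
  shows "el_arrow X (\<beta> \<cdot>\<^bsub>box_cat\<^esub> \<alpha>) x = el_arrow X \<beta> x \<cdot>\<^bsub>E\<^esub> el_arrow X \<alpha> (act X \<beta> x)"
  using act_comp[OF assms] by (simp add: el_arrow_def)

lemma box_comp_Arr:
  assumes "\<alpha> \<in> Arr box_cat" "\<beta> \<in> Arr box_cat" "fst \<beta> = snd (snd \<alpha>)"
  shows "\<beta> \<cdot>\<^bsub>box_cat\<^esub> \<alpha> \<in> Arr box_cat" "fst (\<beta> \<cdot>\<^bsub>box_cat\<^esub> \<alpha>) = fst \<alpha>" "snd (snd (\<beta> \<cdot>\<^bsub>box_cat\<^esub> \<alpha>)) = snd (snd \<beta>)"
  using category.comp_arr(1)[OF category_box_cat assms(1,2)] assms(3) by simp_all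

lemma box_ident_Arr: "Ident box_cat n \<in> Arr box_cat"
  using box_map.ident by simp

lemma category_el: "category E"
proof -
  interpret box: category box_cat by (rule category_box_cat)
  show ?thesis
  proof
    fix f a b g c h d
    show "f \<in> Arr E \<Longrightarrow> Dom E f \<in> Obj E" "f \<in> Arr E \<Longrightarrow> Cod E f \<in> Obj E"
      using act_obj by (auto simp: el_Arr)
    show "a \<in> Obj E \<Longrightarrow> Ident E a \<in> Hom E a a"
    proof -
      assume a: "a \<in> Obj E"
      obtain n x where [simp]: "a = (n, x)" by (cases a)
      have x: "x \<in> FObj X n" using a by simp
      show ?thesis using el_arrow_Arr[OF box_ident_Arr, of x n] x
        by (simp add: el_arrow_ident Hom_iff del: el_sel(4) box_cat_sel(5)) simp
    qed
    show "f \<in> Hom E a b \<Longrightarrow> Ident E b \<cdot>\<^bsub>E\<^esub> f = f"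
      by (auto simp: Hom_iff el_Arr el_arrow_def simp del: box_cat_sel)
    show "f \<in> Hom E a b \<Longrightarrow> f \<cdot>\<^bsub>E\<^esub> Ident E a = f"
      by (auto simp: Hom_iff el_Arr el_arrow_def simp del: box_cat_sel)
    show "f \<in> Hom E a b \<Longrightarrow> g \<in> Hom E b c \<Longrightarrow> g \<cdot>\<^bsub>E\<^esub> f \<in> Hom E a c"
    proof -
      assume fg: "f \<in> Hom E a b" "g \<in> Hom E b c"
      obtain \<alpha> y where f: "f = el_arrow X \<alpha> y" "\<alpha> \<in> Arr box_cat" "y \<in> FObj X (snd (snd \<alpha>))"
        using fg by (auto simp: Hom_iff el_Arr)
      obtain \<beta> x where g: "g = el_arrow X \<beta> x" "\<beta> \<in> Arr box_cat" "x \<in> FObj X (snd (snd \<beta>))"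
        using fg by (auto simp: Hom_iff el_Arr)
      have m: "fst \<beta> = snd (snd \<alpha>)" "act X \<beta> x = y" using fg f g by (auto simp: Hom_iff)
      have "g \<cdot>\<^bsub>E\<^esub> f = el_arrow X (\<beta> \<cdot>\<^bsub>box_cat\<^esub> \<alpha>) x" using el_arrow_comp[OF f(2) g(2) m(1) g(3)] f g m by simp
      moreover have "\<dots> \<in> Arr E" by (rule el_arrow_Arr) (use box_comp_Arr[OF f(2) g(2) m(1)] g(3) in \<open>simp_all del: box_cat_sel\<close>)
      ultimately have "g \<cdot>\<^bsub>E\<^esub> f \<in> Arr E" by (simp only:)
      moreover have "Dom E (g \<cdot>\<^bsub>E\<^esub> f) = a" "Cod E (g \<cdot>\<^bsub>E\<^esub> f) = c" using fg by (simp_all add: Hom_iff)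
      ultimately show ?thesis unfolding Hom_iff by blast
    qed
    show "\<lbrakk>f \<in> Hom E a b; g \<in> Hom E b c; h \<in> Hom E c d\<rbrakk> \<Longrightarrow> (h \<cdot>\<^bsub>E\<^esub> g) \<cdot>\<^bsub>E\<^esub> f = h \<cdot>\<^bsub>E\<^esub> (g \<cdot>\<^bsub>E\<^esub> f)"
      by (auto simp: Hom_iff el_Arr el_arrow_def box.assoc simp del: box_cat_sel(6))
  qed
qed

end

section \<open>Alternating sums of arrows\<close>

context preadditive
begin

text \<open>Meaningful only if \<open>f 1, \<dots>, f n\<close> are arrows from \<open>a\<close> to \<open>b\<close>.\<close>

fun asum :: "'o \<Rightarrow> 'o \<Rightarrow> (nat \<Rightarrow> 'm) \<Rightarrow> nat \<Rightarrow> 'm" where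
  "asum a b f 0 = ZeroArr A a b"
| "asum a b f (Suc n) = asum a b f n \<boxplus> (if even n then neg (f (Suc n)) else f (Suc n))"

definition arrs :: "'o \<Rightarrow> 'o \<Rightarrow> (nat \<Rightarrow> 'm) \<Rightarrow> nat \<Rightarrow> bool" where
  "arrs a b f n \<longleftrightarrow> a \<in> Obj A \<and> b \<in> Obj A \<and> (\<forall>i. 1 \<le> i \<longrightarrow> i \<le> n \<longrightarrow> f i \<in> Hom A a b)"

lemma arrsI: "\<lbrakk>a \<in> Obj A; b \<in> Obj A; \<And>i. \<lbrakk>1 \<le> i; i \<le> n\<rbrakk> \<Longrightarrow> f i \<in> Hom A a b\<rbrakk> \<Longrightarrow> arrs a b f n"
  by (auto simp: arrs_def)

lemma arrs_Suc:
  assumes "arrs a b f (Suc n)"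
  shows "arrs a b f n" "f (Suc n) \<in> Arr A" "Dom A (f (Suc n)) = a" "Cod A (f (Suc n)) = b"
    "a \<in> Obj A" "b \<in> Obj A"
  using assms by (auto simp: arrs_def Hom_iff)

lemma asum_arr:
  "arrs a b f n \<Longrightarrow> asum a b f n \<in> Arr A \<and> Dom A (asum a b f n) = a \<and> Cod A (asum a b f n) = b"
proof (induction n)
  case (Suc n)
  then show ?case using arrs_Suc[OF Suc(2)] by simp
qed (simp add: arrs_def)

lemma asum_comp_left:
  "\<lbrakk>arrs a b f n; h \<in> Arr A; Dom A h = b\<rbrakk> \<Longrightarrow> h \<cdot> asum a b f n = asum a (Cod A h) (\<lambda>i. h \<cdot> f i) n"
proof (induction n)
  case (Suc n)
  then show ?case using arrs_Suc[OF Suc(2)] asum_arr[OF arrs_Suc(1)[OF Suc(2)]] by simp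
qed (simp add: arrs_def)

lemma asum_comp_right:
  "\<lbrakk>arrs a b f n; h \<in> Arr A; Cod A h = a\<rbrakk> \<Longrightarrow> asum a b f n \<cdot> h = asum (Dom A h) b (\<lambda>i. f i \<cdot> h) n"
proof (induction n)
  case (Suc n)
  then show ?case using arrs_Suc[OF Suc(2)] asum_arr[OF arrs_Suc(1)[OF Suc(2)]] by simp
qed (simp add: arrs_def)

lemma asum_cong: "(\<And>i. \<lbrakk>1 \<le> i; i \<le> n\<rbrakk> \<Longrightarrow> f i = g i) \<Longrightarrow> asum a b f n = asum a b g n"
  by (induction n) auto

lemma asum_zero:
  assumes "a \<in> Obj A" "b \<in> Obj A" "\<And>i. \<lbrakk>1 \<le> i; i \<le> n\<rbrakk> \<Longrightarrow> f i = ZeroArr A a b"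
  shows "asum a b f n = ZeroArr A a b"
  using assms(3) by (induction n) (use assms(1,2) in auto)

lemma asum_neg: "arrs a b f n \<Longrightarrow> asum a b (\<lambda>i. neg (f i)) n = neg (asum a b f n)"
proof (induction n)
  case (Suc n)
  then show ?case using arrs_Suc[OF Suc(2)] asum_arr[OF arrs_Suc(1)[OF Suc(2)]] by simp
qed (simp add: arrs_def)

lemma add_swap:
  assumes "f \<in> Arr A" "g \<in> Arr A" "h \<in> Arr A" "k \<in> Arr A" "Dom A f = a" "Dom A g = a" "Dom A h = a" "Dom A k = a"
    "Cod A f = b" "Cod A g = b" "Cod A h = b" "Cod A k = b"
  shows "(f \<boxplus> g) \<boxplus> (h \<boxplus> k) = (f \<boxplus> h) \<boxplus> (g \<boxplus> k)"
  using assms by (simp add: add_ac)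

lemma asum_add: "\<lbrakk>arrs a b f n; arrs a b g n\<rbrakk> \<Longrightarrow> asum a b (\<lambda>i. f i \<boxplus> g i) n = asum a b f n \<boxplus> asum a b g n"
proof (induction n)
  case (Suc n)
  note [simp] = arrs_Suc[OF Suc(2)] arrs_Suc[OF Suc(3)] asum_arr[OF arrs_Suc(1)[OF Suc(2)]] asum_arr[OF arrs_Suc(1)[OF Suc(3)]]
  show ?case using Suc(1) by (simp add: add_swap)
qed (simp add: arrs_def)

text \<open>Recursion over words starts at their first letter, so the first summand has to be split
  off instead of the last. Renumbering the others reverses their signs.\<close>

lemma asum_shift:
  "arrs a b f (Suc n) \<Longrightarrow> asum a b f (Suc n) = neg (f 1 \<boxplus> asum a b (\<lambda>i. f (Suc i)) n)"
proof (induction n)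
  case 0
  then show ?case using arrs_Suc[OF 0] by simp
next
  case (Suc n)
  note [simp] = arrs_Suc[OF Suc(2)] arrs_Suc[OF arrs_Suc(1)[OF Suc(2)]]
  have f1: "f (Suc 0) \<in> Arr A" "Dom A (f (Suc 0)) = a" "Cod A (f (Suc 0)) = b"
    using Suc(2) by (auto simp: arrs_def Hom_iff)
  have s: "arrs a b (\<lambda>i. f (Suc i)) n" using Suc(2) by (auto simp: arrs_def)
  note [simp] = f1 asum_arr[OF s]
  show ?case unfolding asum.simps(2)[of a b f "Suc n"] Suc(1)[OF arrs_Suc(1)[OF Suc(2)]]
    by (simp add: add_assoc)
qed

text \<open>The combinatorial reason for \<open>d d = 0\<close>.\<close>

lemma asum_asum_zero:
  assumes "\<And>j. arrs a b (\<lambda>i. f j i) N" and "\<And>i j. \<lbrakk>1 \<le> i; i < j; j \<le> Suc N\<rbrakk> \<Longrightarrow> f j i = f i (j - 1)"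
  shows "asum a b (\<lambda>j. asum a b (\<lambda>i. f j i) N) (Suc N) = ZeroArr A a b"
  using assms
proof (induction N)
  case 0
  then show ?case by (simp add: arrs_def)
next
  case (Suc N)
  note ar = arrs_Suc[OF Suc(2)]
  note [simp] = ar(2-6) asum_arr[OF ar(1)]
  have IH: "asum a b (\<lambda>j. asum a b (\<lambda>i. f j i) N) (Suc N) = ZeroArr A a b"
    by (rule Suc(1)[OF ar(1)]) (use Suc(3) in simp)
  have arc: "arrs a b (\<lambda>j. f j (Suc N)) n" for n by (rule arrsI) (simp_all add: Hom_iff)
  have arr2: "arrs a b (\<lambda>j. asum a b (f j) N) n" for n by (rule arrsI) (simp_all add: Hom_iff)
  \<comment> \<open>By induction everything cancels except the last column \<open>g\<close> and the
    last row. The symmetry of \<open>f\<close> says that both consist of the entries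
    \<open>f j (Suc N)\<close>, and they enter with opposite signs.\<close>
  define g where "g j = (if even N then neg (f j (Suc N)) else f j (Suc N))" for j
  have g [simp]: "g j \<in> Arr A" "Dom A (g j) = a" "Cod A (g j) = b" for j by (simp_all add: g_def)
  have gar: "arrs a b g n" for n by (rule arrsI) (simp_all add: Hom_iff)
  have "asum a b (\<lambda>j. asum a b (f j) (Suc N)) (Suc N) = asum a b (\<lambda>j. asum a b (f j) N \<boxplus> g j) (Suc N)"
    by (simp add: g_def cong: if_cong)
  also have "\<dots> = asum a b g (Suc N)"
    using asum_add[OF arr2 gar, of "Suc N"] IH asum_arr[OF gar[of "Suc N"]] by simp
  finally have 1: "asum a b (\<lambda>j. asum a b (f j) (Suc N)) (Suc N) = asum a b g (Suc N)" .
  have 2: "asum a b (f (Suc (Suc N))) (Suc N) = asum a b (\<lambda>i. f i (Suc N)) (Suc N)"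
    by (rule asum_cong) (use Suc(3)[of _ "Suc (Suc N)"] in simp)
  have 3: "asum a b g (Suc N) = (if even N then neg (asum a b (\<lambda>i. f i (Suc N)) (Suc N)) else asum a b (\<lambda>i. f i (Suc N)) (Suc N))"
    unfolding g_def using asum_neg[OF arc, of "Suc N"] by (cases "even N") (simp_all del: asum.simps)
  show ?case
    unfolding asum.simps(2)[of a b _ "Suc N"] 1 2 3 using asum_arr[OF arc[of "Suc N"]]
    by (simp del: asum.simps)
qed

text \<open>Reads the sum in \<open>cochain_diff\<close>, written multiplicatively with exponents
  \<open>(- 1) ^ i\<close>, as a recursive alternating sum.\<close>

lemma finprod_asum:
  assumes "arrs a b f n"
  shows "finprod (hom_group A a b) (\<lambda>i. f i [^]\<^bsub>hom_group A a b\<^esub> ((- 1) ^ i :: int)) {1..n} = asum a b f n"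
  using assms
proof (induction n)
  case 0
  then interpret G: comm_group "hom_group A a b" by (intro hom_comm_group) (auto simp: arrs_def)
  show ?case using 0 by simp
next
  case (Suc n)
  note ar = arrs_Suc[OF Suc(2)]
  interpret G: comm_group "hom_group A a b" by (intro hom_comm_group) (use ar in auto)
  have f: "f i \<in> carrier (hom_group A a b)" if "i \<in> {1..Suc n}" for i
    using Suc(2) that by (auto simp: arrs_def)
  have ins: "{1..Suc n} = insert (Suc n) {1..n}" by auto
  have "finprod (hom_group A a b) (\<lambda>i. f i [^]\<^bsub>hom_group A a b\<^esub> ((- 1) ^ i :: int)) {1..Suc n} =
    f (Suc n) [^]\<^bsub>hom_group A a b\<^esub> ((- 1) ^ Suc n :: int) \<otimes>\<^bsub>hom_group A a b\<^esub>
    finprod (hom_group A a b) (\<lambda>i. f i [^]\<^bsub>hom_group A a b\<^esub> ((- 1) ^ i :: int)) {1..n}"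
    unfolding ins using f by (subst G.finprod_insert) (auto simp del: hom_group_sel intro!: G.int_pow_closed)
  also have "f (Suc n) [^]\<^bsub>hom_group A a b\<^esub> ((- 1) ^ Suc n :: int) = (if even n then neg (f (Suc n)) else f (Suc n))"
    using f[of "Suc n"] ar G.int_pow_neg[of "f (Suc n)" 1] by (auto simp: neg_def simp del: hom_group_sel)
  finally show ?case using Suc(1)[OF ar(1)] asum_arr[OF ar(1)] ar by (simp add: add_comm)
qed

end

section \<open>Families of generalized elements\<close>

type_synonym ('u, 'o, 'm) coefficient_system = "(nat \<times> 'u, 'u el_arr, 'o, 'm) ftor"

locale cubical_coefficients = cubical X + abelian_category A
  for X :: "'u cubical" and A :: "('o, 'm, 'z) abcat_scheme" (structure) +
  assumes infinite_universe: "infinite (UNIV :: 'u set)"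
    and small_products: "has_small_products TYPE('u) A"
    and products_exact: "small_products_exact TYPE('u) A"
begin

declare box_cat_sel(5,6) [simp del] el_sel(4,5) [simp del]

text \<open>A generalized element of the cochain product, given by its components, so that
  computations avoid the product object. Nothing is said about \<open>c x\<close> for
  \<open>x\<close> outside \<open>FObj X n\<close>; equality of families is therefore always stated
  pointwise.\<close>

definition family :: "('u, 'o, 'm) coefficient_system \<Rightarrow> 'o \<Rightarrow> nat \<Rightarrow> ('u \<Rightarrow> 'm) \<Rightarrow> bool" where
  "family F P n c \<longleftrightarrow> P \<in> Obj A \<and> (\<forall>x \<in> FObj X n. c x \<in> Hom A P (FObj F (n, x)))"

text \<open>One operator for all structure maps: faces give the cofaces and degeneracies the
  codegeneracies. It is covariant in \<open>\<beta>\<close>, as \<open>X\<close> is contravariant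
  and \<open>F\<close> covariant, so every cubical identity becomes an identity of operators in the
  same order.\<close>

definition transport :: "('u, 'o, 'm) coefficient_system \<Rightarrow> box_arr \<Rightarrow> ('u \<Rightarrow> 'm) \<Rightarrow> 'u \<Rightarrow> 'm" where
  "transport F \<beta> c x = FArr F (el_arrow X \<beta> x) \<cdot> c (act X \<beta> x)"

definition face_diff :: "('u, 'o, 'm) coefficient_system \<Rightarrow> nat \<Rightarrow> nat \<Rightarrow> ('u \<Rightarrow> 'm) \<Rightarrow> 'u \<Rightarrow> 'm" where
  "face_diff F n i c x = transport F (face n i False) c x \<boxminus> transport F (face n i True) c x"

definition coboundary :: "('u, 'o, 'm) coefficient_system \<Rightarrow> 'o \<Rightarrow> nat \<Rightarrow> ('u \<Rightarrow> 'm) \<Rightarrow> 'u \<Rightarrow> 'm" where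
  "coboundary F P n c x = asum P (FObj F (Suc n, x)) (\<lambda>i. face_diff F (Suc n) i c x) (Suc n)"

definition normalized :: "('u, 'o, 'm) coefficient_system \<Rightarrow> 'o \<Rightarrow> nat \<Rightarrow> ('u \<Rightarrow> 'm) \<Rightarrow> bool" where
  "normalized F P n c \<longleftrightarrow> (\<forall>i x. 1 \<le> i \<longrightarrow> i \<le> n \<longrightarrow> x \<in> FObj X (n - 1) \<longrightarrow>
     transport F (degeneracy n i) c x = ZeroArr A P (FObj F (n - 1, x)))"

lemma familyD:
  assumes "family F P n c"
  shows "P \<in> Obj A" "x \<in> FObj X n \<Longrightarrow> c x \<in> Arr A" "x \<in> FObj X n \<Longrightarrow> Dom A (c x) = P"
    "x \<in> FObj X n \<Longrightarrow> Cod A (c x) = FObj F (n, x)"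
  using assms by (auto simp: family_def Hom_iff)

lemma familyI:
  assumes "P \<in> Obj A" "\<And>x. x \<in> FObj X n \<Longrightarrow> c x \<in> Arr A \<and> Dom A (c x) = P \<and> Cod A (c x) = FObj F (n, x)"
  shows "family F P n c"
  using assms by (auto simp: family_def Hom_iff)

lemma el_functor:
  assumes F: "is_functor E A F" and b: "\<beta> \<in> Arr box_cat" "x \<in> FObj X (snd (snd \<beta>))"
  shows "FArr F (el_arrow X \<beta> x) \<in> Arr A" "Dom A (FArr F (el_arrow X \<beta> x)) = FObj F (fst \<beta>, act X \<beta> x)"
    "Cod A (FArr F (el_arrow X \<beta> x)) = FObj F (snd (snd \<beta>), x)"
  using functorD(2-4)[OF F el_arrow_Arr[OF b]] by simp_all

lemma el_functor_obj: "\<lbrakk>is_functor E A F; x \<in> FObj X n\<rbrakk> \<Longrightarrow> FObj F (n, x) \<in> Obj A"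
  using functorD(1)[of E A F "(n, x)"] by simp

lemma transport_arr:
  assumes F: "is_functor E A F" and b: "\<beta> \<in> Arr box_cat" and c: "family F P (fst \<beta>) c" and x: "x \<in> FObj X (snd (snd \<beta>))"
  shows "transport F \<beta> c x \<in> Arr A" "Dom A (transport F \<beta> c x) = P" "Cod A (transport F \<beta> c x) = FObj F (snd (snd \<beta>), x)"
  using el_functor[OF F b x] familyD(2-4)[OF c act_obj[OF b x]] by (simp_all add: transport_def)

lemma transport_family:
  assumes "is_functor E A F" "\<beta> \<in> Arr box_cat" "family F P (fst \<beta>) c"
  shows "family F P (snd (snd \<beta>)) (transport F \<beta> c)"
  by (rule familyI) (use assms transport_arr[OF assms] familyD in auto)

lemma transport_cong:
  assumes "\<beta> \<in> Arr box_cat" "x \<in> FObj X (snd (snd \<beta>))" "\<And>x. x \<in> FObj X (fst \<beta>) \<Longrightarrow> c x = c' x"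
  shows "transport F \<beta> c x = transport F \<beta> c' x"
  using assms(3)[OF act_obj[OF assms(1,2)]] by (simp add: transport_def)

lemma transport_comp:
  assumes F: "is_functor E A F" and a: "\<alpha> \<in> Arr box_cat" and b: "\<beta> \<in> Arr box_cat" and m: "fst \<beta> = snd (snd \<alpha>)"
    and c: "family F P (fst \<alpha>) c" and x: "x \<in> FObj X (snd (snd \<beta>))"
  shows "transport F (\<beta> \<cdot>\<^bsub>box_cat\<^esub> \<alpha>) c x = transport F \<beta> (transport F \<alpha> c) x"
proof -
  have y: "act X \<beta> x \<in> FObj X (snd (snd \<alpha>))" using act_obj[OF b x] m by simp
  have "FArr F (el_arrow X (\<beta> \<cdot>\<^bsub>box_cat\<^esub> \<alpha>) x) = FArr F (el_arrow X \<beta> x) \<cdot> FArr F (el_arrow X \<alpha> (act X \<beta> x))"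
    unfolding el_arrow_comp[OF a b m x]
    by (rule functorD(6)[OF F el_arrow_Arr[OF a y] el_arrow_Arr[OF b x]]) (simp add: m)
  then show ?thesis
    using el_functor[OF F b x] el_functor[OF F a y] familyD(2-4)[OF c act_obj[OF a y]] m
    by (simp add: transport_def act_comp[OF a b m x])
qed

lemma transport_ident:
  assumes F: "is_functor E A F" and c: "family F P n c" and x: "x \<in> FObj X n"
  shows "transport F (Ident box_cat n) c x = c x"
  using functorD(5)[OF F, of "(n, x)"] familyD[OF c] x by (simp add: transport_def el_arrow_ident act_ident)

lemma transport_zero:
  assumes F: "is_functor E A F" and b: "\<beta> \<in> Arr box_cat" and P: "P \<in> Obj A"
    and c: "\<And>x. x \<in> FObj X (fst \<beta>) \<Longrightarrow> c x = ZeroArr A P (FObj F (fst \<beta>, x))" and x: "x \<in> FObj X (snd (snd \<beta>))"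
  shows "transport F \<beta> c x = ZeroArr A P (FObj F (snd (snd \<beta>), x))"
  using el_functor[OF F b x] c[OF act_obj[OF b x]] P by (simp add: transport_def)

lemma transport_sub:
  assumes F: "is_functor E A F" and b: "\<beta> \<in> Arr box_cat" and c: "family F P (fst \<beta>) c" "family F P (fst \<beta>) c'"
    and x: "x \<in> FObj X (snd (snd \<beta>))"
  shows "transport F \<beta> (\<lambda>x. c x \<boxminus> c' x) x = transport F \<beta> c x \<boxminus> transport F \<beta> c' x"
  using el_functor[OF F b x] familyD(2-4)[OF c(1) act_obj[OF b x]] familyD(2-4)[OF c(2) act_obj[OF b x]]
  by (simp add: transport_def)

lemma transport_comp_right:
  assumes F: "is_functor E A F" and b: "\<beta> \<in> Arr box_cat" and c: "family F P (fst \<beta>) c"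
    and x: "x \<in> FObj X (snd (snd \<beta>))" and u: "u \<in> Arr A" "Cod A u = P"
  shows "transport F \<beta> (\<lambda>x. c x \<cdot> u) x = transport F \<beta> c x \<cdot> u"
  using el_functor[OF F b x] familyD(2-4)[OF c act_obj[OF b x]] u by (simp add: transport_def)

lemma transport_nat:
  assumes n: "is_nattrans E A F G \<eta>" and b: "\<beta> \<in> Arr box_cat" and c: "family F P (fst \<beta>) c"
    and x: "x \<in> FObj X (snd (snd \<beta>))"
  shows "transport G \<beta> (\<lambda>x. \<eta> (fst \<beta>, x) \<cdot> c x) x = \<eta> (snd (snd \<beta>), x) \<cdot> transport F \<beta> c x"
proof -
  have o: "(fst \<beta>, act X \<beta> x) \<in> Obj E" "(snd (snd \<beta>), x) \<in> Obj E" using act_obj[OF b x] x by simp_all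
  show ?thesis
    using el_functor[OF nattransD(1)[OF n] b x] el_functor[OF nattransD(2)[OF n] b x]
      familyD(2-4)[OF c act_obj[OF b x]] nattransD(4-6)[OF n o(1)] nattransD(4-6)[OF n o(2)]
      pre_comp[OF nattransD(7)[OF n el_arrow_Arr[OF b x]], of "c (act X \<beta> x)"]
    by (simp add: transport_def)
qed

lemma family_comp: "\<lbrakk>family F P n c; u \<in> Arr A; Cod A u = P\<rbrakk> \<Longrightarrow> family F (Dom A u) n (\<lambda>x. c x \<cdot> u)"
  by (auto simp: family_def Hom_iff)

lemma family_nat:
  assumes "is_nattrans E A F G \<eta>" "family F P n c"
  shows "family G P n (\<lambda>x. \<eta> (n, x) \<cdot> c x)"
  by (rule familyI) (use assms familyD[OF assms(2)] nattransD(4-6)[OF assms(1)] in auto)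

lemma face_diff_arr:
  assumes F: "is_functor E A F" and c: "family F P (n - 1) c" and i: "1 \<le> i" "i \<le> n" and x: "x \<in> FObj X n"
  shows "face_diff F n i c x \<in> Arr A" "Dom A (face_diff F n i c x) = P" "Cod A (face_diff F n i c x) = FObj F (n, x)"
  using transport_arr[OF F face_arr(1)[OF i], of P _ c x] c x face_arr(2,3)[OF i] by (simp_all add: face_diff_def)

lemma face_diff_arrs:
  assumes F: "is_functor E A F" and c: "family F P n c" and x: "x \<in> FObj X (Suc n)"
  shows "arrs P (FObj F (Suc n, x)) (\<lambda>i. face_diff F (Suc n) i c x) (Suc n)"
  by (rule arrsI) (use face_diff_arr[OF F, of P "Suc n" c] c x familyD(1)[OF c] el_functor_obj[OF F x] in \<open>auto simp: Hom_iff\<close>)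

lemma coboundary_arr:
  assumes F: "is_functor E A F" and c: "family F P n c" and x: "x \<in> FObj X (Suc n)"
  shows "coboundary F P n c x \<in> Arr A" "Dom A (coboundary F P n c x) = P" "Cod A (coboundary F P n c x) = FObj F (Suc n, x)"
  using asum_arr[OF face_diff_arrs[OF assms]] by (simp_all add: coboundary_def)

lemma coboundary_family: "\<lbrakk>is_functor E A F; family F P n c\<rbrakk> \<Longrightarrow> family F P (Suc n) (coboundary F P n c)"
  using coboundary_arr familyD(1) by (intro familyI) blast+

lemma face_diff_cong:
  assumes "1 \<le> i" "i \<le> n" "x \<in> FObj X n" "\<And>x. x \<in> FObj X (n - 1) \<Longrightarrow> c x = c' x"
  shows "face_diff F n i c x = face_diff F n i c' x"
  unfolding face_diff_def using transport_cong[of "face n i _" x c c' F] face_arr[OF assms(1,2)] assms by simp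

lemma coboundary_cong:
  assumes "x \<in> FObj X (Suc n)" "\<And>x. x \<in> FObj X n \<Longrightarrow> c x = c' x"
  shows "coboundary F P n c x = coboundary F P n c' x"
  unfolding coboundary_def by (rule asum_cong) (rule face_diff_cong, use assms in simp_all)

lemma normalized_cong:
  assumes "\<And>x. x \<in> FObj X n \<Longrightarrow> c x = c' x" "normalized F P n c"
  shows "normalized F P n c'"
  unfolding normalized_def
proof (intro allI impI)
  fix i x assume i: "1 \<le> i" "i \<le> n" and x: "x \<in> FObj X (n - 1)"
  have "transport F (degeneracy n i) c' x = transport F (degeneracy n i) c x"
    by (rule transport_cong) (use degeneracy_arr[OF i] x assms(1) in simp_all)
  then show "transport F (degeneracy n i) c' x = ZeroArr A P (FObj F (n - 1, x))"
    using assms(2) i x by (simp add: normalized_def)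
qed

lemma coboundary_comp_right:
  assumes F: "is_functor E A F" and c: "family F P n c" and x: "x \<in> FObj X (Suc n)" and u: "u \<in> Arr A" "Cod A u = P"
  shows "coboundary F (Dom A u) n (\<lambda>x. c x \<cdot> u) x = coboundary F P n c x \<cdot> u"
proof -
  have "coboundary F P n c x \<cdot> u = asum (Dom A u) (FObj F (Suc n, x)) (\<lambda>i. face_diff F (Suc n) i c x \<cdot> u) (Suc n)"
    unfolding coboundary_def by (rule asum_comp_right[OF face_diff_arrs[OF F c x] u])
  also have "\<dots> = coboundary F (Dom A u) n (\<lambda>x. c x \<cdot> u) x"
    unfolding coboundary_def
  proof (rule asum_cong)
    fix i assume i: "1 \<le> i" "i \<le> Suc n"
    show "face_diff F (Suc n) i c x \<cdot> u = face_diff F (Suc n) i (\<lambda>x. c x \<cdot> u) x"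
      using transport_arr[OF F face_arr(1)[OF i], of P _ c x] transport_comp_right[OF F face_arr(1)[OF i], of P _ c x u]
        face_arr(2,3)[OF i] c x u by (simp add: face_diff_def)
  qed
  finally show ?thesis ..
qed

lemma coboundary_nat:
  assumes n: "is_nattrans E A F G \<eta>" and c: "family F P n c" and x: "x \<in> FObj X (Suc n)"
  shows "coboundary G P n (\<lambda>x. \<eta> (n, x) \<cdot> c x) x = \<eta> (Suc n, x) \<cdot> coboundary F P n c x"
proof -
  note F = nattransD(1)[OF n]
  have o: "(Suc n, x) \<in> Obj E" using x by simp
  note h = nattransD(4-6)[OF n o]
  have "\<eta> (Suc n, x) \<cdot> coboundary F P n c x = asum P (Cod A (\<eta> (Suc n, x))) (\<lambda>i. \<eta> (Suc n, x) \<cdot> face_diff F (Suc n) i c x) (Suc n)"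
    unfolding coboundary_def by (rule asum_comp_left[OF face_diff_arrs[OF F c x]]) (use h in simp_all)
  also have "\<dots> = coboundary G P n (\<lambda>x. \<eta> (n, x) \<cdot> c x) x"
    unfolding coboundary_def h(3)
  proof (rule asum_cong)
    fix i assume i: "1 \<le> i" "i \<le> Suc n"
    show "\<eta> (Suc n, x) \<cdot> face_diff F (Suc n) i c x = face_diff G (Suc n) i (\<lambda>x. \<eta> (n, x) \<cdot> c x) x"
      using transport_arr[OF F face_arr(1)[OF i], of P _ c x] transport_nat[OF n face_arr(1)[OF i], of P _ c x]
        face_arr(2,3)[OF i] c x h by (simp add: face_diff_def)
  qed
  finally show ?thesis ..
qed

lemma normalized_nat:
  assumes n: "is_nattrans E A F G \<eta>" and c: "family F P k c" and nr: "normalized F P k c"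
  shows "normalized G P k (\<lambda>x. \<eta> (k, x) \<cdot> c x)"
  unfolding normalized_def
proof (intro allI impI)
  fix i x assume i: "1 \<le> i" "i \<le> k" and x: "x \<in> FObj X (k - 1)"
  have o: "(k - 1, x) \<in> Obj E" using x by simp
  show "transport G (degeneracy k i) (\<lambda>x. \<eta> (k, x) \<cdot> c x) x = ZeroArr A P (FObj G (k - 1, x))"
    using transport_nat[OF n degeneracy_arr(1)[OF i], of P c x] degeneracy_arr(2,3)[OF i] c x
      nr[unfolded normalized_def] i nattransD(4-6)[OF n o] familyD(1)[OF c] by simp
qed

lemma normalized_comp_right:
  assumes F: "is_functor E A F" and c: "family F P n c" and nr: "normalized F P n c" and u: "u \<in> Arr A" "Cod A u = P"
  shows "normalized F (Dom A u) n (\<lambda>x. c x \<cdot> u)"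
  unfolding normalized_def
proof (intro allI impI)
  fix i x assume i: "1 \<le> i" "i \<le> n" and x: "x \<in> FObj X (n - 1)"
  show "transport F (degeneracy n i) (\<lambda>x. c x \<cdot> u) x = ZeroArr A (Dom A u) (FObj F (n - 1, x))"
    using transport_comp_right[OF F degeneracy_arr(1)[OF i], of P c x u] degeneracy_arr(2,3)[OF i] c x
      nr[unfolded normalized_def] i u el_functor_obj[OF F x] by simp
qed

text \<open>By \<open>face_face\<close> two cofaces can be interchanged with a shift of index,
  separately for each choice of ends. The differences \<open>face_diff\<close> inherit this, which
  is the symmetry that \<open>asum_asum_zero\<close> asks for.\<close>

lemma coboundary_coboundary:
  assumes F: "is_functor E A F" and c: "family F P n c" and x: "x \<in> FObj X (Suc (Suc n))"
  shows "coboundary F P (Suc n) (coboundary F P n c) x = ZeroArr A P (FObj F (Suc (Suc n), x))"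
proof -
  let ?b = "FObj F (Suc (Suc n), x)"
  define D where "D j i = face_diff F (Suc (Suc n)) j (face_diff F (Suc n) i c) x" for j i
  have P: "P \<in> Obj A" and b: "?b \<in> Obj A" using familyD(1)[OF c] el_functor_obj[OF F x] by auto
  have fd: "family F P (Suc n) (face_diff F (Suc n) i c)" if "1 \<le> i" "i \<le> Suc n" for i
    by (rule familyI[OF P]) (use face_diff_arr[OF F, of P "Suc n" c] c that in simp)
  have D: "D j i \<in> Hom A P ?b" if "1 \<le> i" "i \<le> Suc n" "1 \<le> j" "j \<le> Suc (Suc n)" for i j
    using face_diff_arr[OF F, of P "Suc (Suc n)" "face_diff F (Suc n) i c" j x] fd that x by (simp add: D_def Hom_iff)
  \<comment> \<open>Extended by zero, because \<open>asum_asum_zero\<close> wants arrows from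
    \<open>P\<close> for every row index, including those outside the sum.\<close>
  define D' where "D' j i = (if 1 \<le> j \<and> j \<le> Suc (Suc n) then D j i else ZeroArr A P ?b)" for j i
  have sq: "transport F (face (Suc (Suc n)) j e) (transport F (face (Suc n) i e') c) x =
      transport F (face (Suc (Suc n)) i e') (transport F (face (Suc n) (j - 1) e) c) x"
    if "1 \<le> i" "i < j" "j \<le> Suc (Suc n)" for i j e e'
  proof -
    have 1: "1 \<le> i" "i \<le> Suc n" "1 \<le> j" "j \<le> Suc (Suc n)" "i \<le> Suc (Suc n)" "1 \<le> j - 1" "j - 1 \<le> Suc n"
      using that by auto
    have "transport F (face (Suc (Suc n)) j e \<cdot>\<^bsub>box_cat\<^esub> face (Suc n) i e') c x =
      transport F (face (Suc (Suc n)) j e) (transport F (face (Suc n) i e') c) x"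
      by (rule transport_comp[OF F face_arr(1)[OF 1(1,2)] face_arr(1)[OF 1(3,4)]])
        (use face_arr(2,3)[OF 1(1,2)] face_arr(2,3)[OF 1(3,4)] c x in simp_all)
    moreover have "transport F (face (Suc (Suc n)) i e' \<cdot>\<^bsub>box_cat\<^esub> face (Suc n) (j - 1) e) c x =
      transport F (face (Suc (Suc n)) i e') (transport F (face (Suc n) (j - 1) e) c) x"
      by (rule transport_comp[OF F face_arr(1)[OF 1(6,7)] face_arr(1)[OF 1(1,5)]])
        (use face_arr(2,3)[OF 1(6,7)] face_arr(2,3)[OF 1(1,5)] c x in simp_all)
    ultimately show ?thesis using face_face[of i j "Suc n" e e'] that by simp
  qed
  have fa: "transport F (face (Suc (Suc n)) j e) (transport F (face (Suc n) i e') c) x \<in> Hom A P ?b"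
    if "1 \<le> i" "i \<le> Suc n" "1 \<le> j" "j \<le> Suc (Suc n)" for i j e e'
  proof -
    have "family F P (snd (snd (face (Suc n) i e'))) (transport F (face (Suc n) i e') c)"
      by (rule transport_family[OF F face_arr(1)[OF that(1,2)]]) (use c face_arr(2)[OF that(1,2)] in simp)
    then show ?thesis
      using transport_arr[OF F face_arr(1)[OF that(3,4)], of P _ "transport F (face (Suc n) i e') c" x]
       face_arr(2,3)[OF that(3,4)] face_arr(2,3)[OF that(1,2)] x by (simp add: Hom_iff)
  qed
  have Dexp: "D j i = (transport F (face (Suc (Suc n)) j False) (transport F (face (Suc n) i False) c) x \<boxminus>
       transport F (face (Suc (Suc n)) j False) (transport F (face (Suc n) i True) c) x) \<boxminus>
       (transport F (face (Suc (Suc n)) j True) (transport F (face (Suc n) i False) c) x \<boxminus>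
       transport F (face (Suc (Suc n)) j True) (transport F (face (Suc n) i True) c) x)"
    if ij: "1 \<le> i" "i \<le> Suc n" "1 \<le> j" "j \<le> Suc (Suc n)" for i j
  proof -
    have f1: "family F P (Suc n) (transport F (face (Suc n) i e) c)" for e
      using transport_family[OF F face_arr(1)[OF ij(1,2)], of P e c] face_arr(2,3)[OF ij(1,2)] c by simp
    have "transport F (face (Suc (Suc n)) j e) (face_diff F (Suc n) i c) x = transport F (face (Suc (Suc n)) j e) (transport F (face (Suc n) i False) c) x \<boxminus>
       transport F (face (Suc (Suc n)) j e) (transport F (face (Suc n) i True) c) x" for e
      unfolding face_diff_def by (rule transport_sub[OF F face_arr(1)[OF ij(3,4)], of P]) (use f1 face_arr(2,3)[OF ij(3,4)] x in simp_all)
    then show ?thesis unfolding D_def face_diff_def[of F "Suc (Suc n)"] by simp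
  qed
  have Dsym: "D' j i = D' i (j - 1)" if ij: "1 \<le> i" "i < j" "j \<le> Suc (Suc n)" for i j
  proof -
    have 1: "1 \<le> i" "i \<le> Suc n" "1 \<le> j" "j \<le> Suc (Suc n)" "i \<le> Suc (Suc n)" "1 \<le> j - 1" "j - 1 \<le> Suc n"
      using that by auto
    note h = fa[OF 1(6,7,1,5), unfolded Hom_iff]
    have "D j i = D i (j - 1)"
      unfolding Dexp[OF 1(1,2,3,4)] Dexp[OF 1(6,7,1,5)] sq[OF ij] using h by (simp add: add_ac)
    then show ?thesis using 1 by (simp add: D'_def)
  qed
  have D'ar: "arrs P ?b (D' j) (Suc n)" for j
    by (rule arrsI[OF P b]) (use D P b in \<open>auto simp: D'_def Hom_iff\<close>)
  have "asum P ?b (\<lambda>j. asum P ?b (\<lambda>i. D' j i) (Suc n)) (Suc (Suc n)) = ZeroArr A P ?b"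
    by (rule asum_asum_zero[OF D'ar Dsym])
  moreover have "coboundary F P (Suc n) (coboundary F P n c) x = asum P ?b (\<lambda>j. asum P ?b (\<lambda>i. D' j i) (Suc n)) (Suc (Suc n))"
    unfolding coboundary_def[of F P "Suc n"]
  proof (rule asum_cong)
    fix j assume j: "1 \<le> j" "j \<le> Suc (Suc n)"
    have y: "act X (face (Suc (Suc n)) j e) x \<in> FObj X (Suc n)" for e
      using act_obj[OF face_arr(1)[OF j], of x] face_arr(2,3)[OF j] x by simp
    note fe = el_functor[OF F face_arr(1)[OF j], of x, unfolded face_arr(2,3)[OF j], OF x, simplified]
    have e: "transport F (face (Suc (Suc n)) j e) (coboundary F P n c) x =
      asum P ?b (\<lambda>i. transport F (face (Suc (Suc n)) j e) (face_diff F (Suc n) i c) x) (Suc n)" for e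
      unfolding transport_def[of F "face (Suc (Suc n)) j e"] coboundary_def
      by (subst asum_comp_left[OF face_diff_arrs[OF F c y]]) (use fe in simp_all)
    have ar: "arrs P ?b (\<lambda>i. transport F (face (Suc (Suc n)) j e) (face_diff F (Suc n) i c) x) (Suc n)" for e
      by (rule arrsI[OF P b]) (use transport_arr[OF F face_arr(1)[OF j], of P _ _ x] fd face_arr(2,3)[OF j] x in \<open>auto simp: Hom_iff\<close>)
    have ar': "arrs P ?b (\<lambda>i. neg (transport F (face (Suc (Suc n)) j e) (face_diff F (Suc n) i c) x)) (Suc n)" for e
      using ar[of e] by (auto simp: arrs_def Hom_iff)
    have "face_diff F (Suc (Suc n)) j (coboundary F P n c) x = asum P ?b (\<lambda>i. transport F (face (Suc (Suc n)) j False) (face_diff F (Suc n) i c) x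
        \<boxminus> transport F (face (Suc (Suc n)) j True) (face_diff F (Suc n) i c) x) (Suc n)"
      unfolding face_diff_def[of F "Suc (Suc n)"] e asum_neg[OF ar, symmetric] by (rule asum_add[OF ar ar', symmetric])
    also have "\<dots> = asum P ?b (D' j) (Suc n)"
      by (rule asum_cong) (use j in \<open>simp add: D'_def D_def face_diff_def[of F "Suc (Suc n)"]\<close>)
    finally show "face_diff F (Suc (Suc n)) j (coboundary F P n c) x = asum P ?b (\<lambda>i. D' j i) (Suc n)" .
  qed
  ultimately show ?thesis by simp
qed

text \<open>Apply the \<open>j\<close>-th codegeneracy to the \<open>i\<close>-th face difference.
  For \<open>i = j\<close> both ends give back \<open>c\<close> and cancel; this is why the
  differential uses differences of opposite faces. For \<open>i \<noteq> j\<close> the face moves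
  past the degeneracy, which then meets the normalized family \<open>c\<close>.\<close>

lemma coboundary_normalized:
  assumes F: "is_functor E A F" and c: "family F P n c" and nr: "normalized F P n c"
  shows "normalized F P (Suc n) (coboundary F P n c)"
  unfolding normalized_def
proof (intro allI impI)
  fix j x assume j: "1 \<le> j" "j \<le> Suc n" and x': "x \<in> FObj X (Suc n - 1)"
  then have x: "x \<in> FObj X n" by simp
  let ?b = "FObj F (n, x)"
  have P: "P \<in> Obj A" and b: "?b \<in> Obj A" using familyD(1)[OF c] el_functor_obj[OF F x] by auto
  note sj = degeneracy_arr[OF j]
  have y: "act X (degeneracy (Suc n) j) x \<in> FObj X (Suc n)" using act_obj[OF sj(1), of x] sj x by simp
  note fe = el_functor[OF F sj(1), of x, unfolded sj(2,3), OF x', simplified]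
  have "transport F (degeneracy (Suc n) j) (coboundary F P n c) x =
    asum P ?b (\<lambda>i. transport F (degeneracy (Suc n) j) (face_diff F (Suc n) i c) x) (Suc n)"
    unfolding transport_def[of F "degeneracy (Suc n) j"] coboundary_def
    by (subst asum_comp_left[OF face_diff_arrs[OF F c y]]) (use fe in simp_all)
  also have "\<dots> = ZeroArr A P ?b"
  proof (rule asum_zero[OF P b])
    fix i assume i: "1 \<le> i" "i \<le> Suc n"
    note di = face_arr[OF i]
    have f1: "family F P (Suc n) (transport F (face (Suc n) i e) c)" for e
      using transport_family[OF F di(1), of P e c] di(2,3) c by simp
    have comp: "transport F (degeneracy (Suc n) j) (transport F (face (Suc n) i e) c) x =
      transport F (degeneracy (Suc n) j \<cdot>\<^bsub>box_cat\<^esub> face (Suc n) i e) c x" for e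
      by (rule transport_comp[OF F di(1) sj(1), symmetric]) (use di sj c x in simp_all)
    have sub: "transport F (degeneracy (Suc n) j) (face_diff F (Suc n) i c) x =
      transport F (degeneracy (Suc n) j) (transport F (face (Suc n) i False) c) x \<boxminus> transport F (degeneracy (Suc n) j) (transport F (face (Suc n) i True) c) x"
      unfolding face_diff_def by (rule transport_sub[OF F sj(1), of P]) (use f1 sj x in simp_all)
    consider "i = j" | "i < j" | "j < i" by linarith
    then show "transport F (degeneracy (Suc n) j) (face_diff F (Suc n) i c) x = ZeroArr A P ?b"
    proof cases
      case 1
      show ?thesis unfolding sub comp using degeneracy_face_eq[OF j] 1 transport_ident[OF F c x] familyD[OF c] x by simp
    next
      case 2
      have k: "1 \<le> i" "i \<le> n" "1 \<le> j - 1" "j - 1 \<le> n" using 2 i j by auto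
      have z: "transport F (degeneracy (Suc n) j) (transport F (face (Suc n) i e) c) x = ZeroArr A P ?b" for e
      proof -
        have "transport F (face n i e \<cdot>\<^bsub>box_cat\<^esub> degeneracy n (j - 1)) c x = transport F (face n i e) (transport F (degeneracy n (j - 1)) c) x"
          by (rule transport_comp[OF F degeneracy_arr(1)[OF k(3,4)] face_arr(1)[OF k(1,2)]])
            (use degeneracy_arr(2,3)[OF k(3,4)] face_arr(2,3)[OF k(1,2)] c x in simp_all)
        also have "\<dots> = ZeroArr A P (FObj F (snd (snd (face n i e)), x))"
          by (rule transport_zero[OF F face_arr(1)[OF k(1,2)] P]) (use face_arr(2,3)[OF k(1,2)] x nr k in \<open>simp_all add: normalized_def\<close>)
        finally show ?thesis unfolding comp using degeneracy_face_less[OF i(1) 2 j(2)] face_arr(3)[OF k(1,2)] by simp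
      qed
      show ?thesis unfolding sub z using P b by simp
    next
      case 3
      have k: "1 \<le> i - 1" "i - 1 \<le> n" "1 \<le> j" "j \<le> n" using 3 i j by auto
      have z: "transport F (degeneracy (Suc n) j) (transport F (face (Suc n) i e) c) x = ZeroArr A P ?b" for e
      proof -
        have "transport F (face n (i - 1) e \<cdot>\<^bsub>box_cat\<^esub> degeneracy n j) c x = transport F (face n (i - 1) e) (transport F (degeneracy n j) c) x"
          by (rule transport_comp[OF F degeneracy_arr(1)[OF k(3,4)] face_arr(1)[OF k(1,2)]])
            (use degeneracy_arr(2,3)[OF k(3,4)] face_arr(2,3)[OF k(1,2)] c x in simp_all)
        also have "\<dots> = ZeroArr A P (FObj F (snd (snd (face n (i - 1) e)), x))"
          by (rule transport_zero[OF F face_arr(1)[OF k(1,2)] P]) (use face_arr(2,3)[OF k(1,2)] x nr k in \<open>simp_all add: normalized_def\<close>)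
        finally show ?thesis unfolding comp using degeneracy_face_greater[OF j(1) 3 i(2)] face_arr(3)[OF k(1,2)] by simp
      qed
      show ?thesis unfolding sub z using P b by simp
    qed
  qed
  finally show "transport F (degeneracy (Suc n) j) (coboundary F P n c) x = ZeroArr A P (FObj F (Suc n - 1, x))" by simp
qed

text \<open>The product of the idempotents \<open>1 - \<delta>\<^sub>i\<sigma>\<^sub>i\<close> projects naturally onto the normalized families, which makes
  normalization an exact functor.\<close>

fun normalization :: "('u, 'o, 'm) coefficient_system \<Rightarrow> nat \<Rightarrow> nat \<Rightarrow> ('u \<Rightarrow> 'm) \<Rightarrow> 'u \<Rightarrow> 'm" where
  "normalization F n 0 c x = c x"
| "normalization F n (Suc k) c x = normalization F n k c x \<boxminus>
     transport F (face n (Suc k) False) (transport F (degeneracy n (Suc k)) (normalization F n k c)) x"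

lemma transport_ds_family:
  assumes F: "is_functor E A F" and c: "family F P n c" and k: "1 \<le> k" "k \<le> n"
  shows "family F P (n - 1) (transport F (degeneracy n k) c)" "family F P n (transport F (face n k e) (transport F (degeneracy n k) c))"
proof -
  show 1: "family F P (n - 1) (transport F (degeneracy n k) c)"
    using transport_family[OF F degeneracy_arr(1)[OF k], of P c] c degeneracy_arr(2,3)[OF k] by simp
  show "family F P n (transport F (face n k e) (transport F (degeneracy n k) c))"
    using transport_family[OF F face_arr(1)[OF k], of P _ "transport F (degeneracy n k) c"] 1 face_arr(2,3)[OF k] by simp
qed

lemma normalization_family:
  assumes F: "is_functor E A F" and c: "family F P n c"
  shows "k \<le> n \<Longrightarrow> family F P n (normalization F n k c)"
proof (induction k)
  case (Suc k)
  have IH: "family F P n (normalization F n k c)" using Suc by simp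
  note fD = familyD(2-4)[OF transport_ds_family(2)[OF F IH, of "Suc k"]]
  show ?case using familyD[OF IH] fD Suc(2) by (intro familyI) simp_all
qed (use c in \<open>simp add: family_def\<close>)

text \<open>The new factor kills the codegeneracy \<open>Suc k\<close> because the degeneracy is a
  left inverse of the face. It does not disturb a codegeneracy \<open>j < Suc k\<close>: moved past
  the face and the other degeneracy, \<open>j\<close> acts directly on the earlier stage, which it
  kills by induction.\<close>

lemma normalization_normal:
  assumes F: "is_functor E A F" and c: "family F P n c"
  shows "\<lbrakk>k \<le> n; 1 \<le> j; j \<le> k; x \<in> FObj X (n - 1)\<rbrakk>
    \<Longrightarrow> transport F (degeneracy n j) (normalization F n k c) x = ZeroArr A P (FObj F (n - 1, x))"
proof (induction k arbitrary: j x)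
  case (Suc k)
  define b where "b = normalization F n k c"
  have b: "family F P n b" unfolding b_def by (rule normalization_family[OF F c]) (use Suc in simp)
  have P: "P \<in> Obj A" by (rule familyD(1)[OF c])
  have jn: "1 \<le> j" "j \<le> n" and kn: "1 \<le> Suc k" "Suc k \<le> n" using Suc by auto
  note sj = degeneracy_arr[OF jn] and sk = degeneracy_arr[OF kn] and dk = face_arr[OF kn]
  note x = Suc(5)
  note fs = transport_ds_family[OF F b kn]
  have "transport F (degeneracy n j) (\<lambda>x. b x \<boxminus> transport F (face n (Suc k) False) (transport F (degeneracy n (Suc k)) b) x) x =
    transport F (degeneracy n j) b x \<boxminus> transport F (degeneracy n j) (transport F (face n (Suc k) False) (transport F (degeneracy n (Suc k)) b)) x"
    by (rule transport_sub[OF F sj(1), of P]) (use b fs sj x in simp_all)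
  also have "transport F (degeneracy n j) (transport F (face n (Suc k) False) (transport F (degeneracy n (Suc k)) b)) x =
    transport F (degeneracy n j) b x"
  proof -
    have "transport F (degeneracy n j \<cdot>\<^bsub>box_cat\<^esub> face n (Suc k) False) (transport F (degeneracy n (Suc k)) b) x =
      transport F (degeneracy n j) (transport F (face n (Suc k) False) (transport F (degeneracy n (Suc k)) b)) x"
      by (rule transport_comp[OF F dk(1) sj(1)]) (use dk sj fs x in simp_all)
    moreover have "transport F (degeneracy n j \<cdot>\<^bsub>box_cat\<^esub> face n (Suc k) False) (transport F (degeneracy n (Suc k)) b) x =
      transport F (degeneracy n j) b x"
    proof (cases "j = Suc k")
      case True
      then show ?thesis using degeneracy_face_eq[OF kn] transport_ident[OF F fs(1) x] by simp
    next
      case False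
      then have jk: "j < Suc k" using Suc by simp
      then have m: "1 \<le> Suc k - 1" "Suc k - 1 \<le> n - 1" "1 \<le> j" "j \<le> n - 1" "1 \<le> k" "k \<le> n - 1" using Suc by auto
      note sj' = degeneracy_arr[OF m(3,4)] and dk' = face_arr[OF m(5,6)] and sk' = degeneracy_arr[OF m(5,6)]
      have z: "transport F (degeneracy n j) b y = ZeroArr A P (FObj F (n - 1, y))" if "y \<in> FObj X (n - 1)" for y
        unfolding b_def by (rule Suc(1)) (use Suc jk that in simp_all)
      have "transport F (face (n - 1) k False \<cdot>\<^bsub>box_cat\<^esub> degeneracy (n - 1) j) (transport F (degeneracy n (Suc k)) b) x =
        transport F (face (n - 1) k False) (transport F (degeneracy (n - 1) j) (transport F (degeneracy n (Suc k)) b)) x"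
        by (rule transport_comp[OF F sj'(1) dk'(1)]) (use sj' dk' fs x in simp_all)
      also have "\<dots> = ZeroArr A P (FObj F (snd (snd (face (n - 1) k False)), x))"
      proof (rule transport_zero[OF F dk'(1) P])
        fix y assume y: "y \<in> FObj X (fst (face (n - 1) k False))"
        have "transport F (degeneracy (n - 1) j) (transport F (degeneracy n (Suc k)) b) y =
          transport F (degeneracy (n - 1) j \<cdot>\<^bsub>box_cat\<^esub> degeneracy n (Suc k)) b y"
          by (rule transport_comp[OF F sk(1) sj'(1), symmetric]) (use sk sj' dk' b y in simp_all)
        also have "\<dots> = transport F (degeneracy (n - 1) k \<cdot>\<^bsub>box_cat\<^esub> degeneracy n j) b y"
          using degeneracy_degeneracy[OF jn(1) jk kn(2)] by simp
        also have "\<dots> = transport F (degeneracy (n - 1) k) (transport F (degeneracy n j) b) y"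
          by (rule transport_comp[OF F sj(1) sk'(1)]) (use sj sk' dk' b y in simp_all)
        also have "\<dots> = ZeroArr A P (FObj F (snd (snd (degeneracy (n - 1) k)), y))"
          by (rule transport_zero[OF F sk'(1) P]) (use sk' dk' y z in simp_all)
        finally show "transport F (degeneracy (n - 1) j) (transport F (degeneracy n (Suc k)) b) y =
          ZeroArr A P (FObj F (fst (face (n - 1) k False), y))" using sk' dk' by simp
      qed (use dk' x in simp)
      finally show ?thesis using degeneracy_face_greater[OF jn(1) jk kn(2)] z[OF x] dk' by simp
    qed
    ultimately show ?thesis by simp
  qed
  finally have eq: "transport F (degeneracy n j) (\<lambda>x. b x \<boxminus> transport F (face n (Suc k) False) (transport F (degeneracy n (Suc k)) b) x) x =
    transport F (degeneracy n j) b x \<boxminus> transport F (degeneracy n j) b x" .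
  have pS: "normalization F n (Suc k) c = (\<lambda>x. b x \<boxminus> transport F (face n (Suc k) False) (transport F (degeneracy n (Suc k)) b) x)"
    by (rule ext) (simp add: b_def)
  show ?case unfolding pS eq using transport_arr[OF F sj(1), of P b x] sj b x by simp
qed simp

lemma normalization_nat:
  assumes n: "is_nattrans E A F G \<eta>" and c: "family F P n c"
  shows "\<lbrakk>k \<le> n; x \<in> FObj X n\<rbrakk> \<Longrightarrow> normalization G n k (\<lambda>x. \<eta> (n, x) \<cdot> c x) x = \<eta> (n, x) \<cdot> normalization F n k c x"
proof (induction k arbitrary: x)
  case (Suc k)
  note F = nattransD(1)[OF n]
  define b where "b = normalization F n k c"
  have b: "family F P n b" unfolding b_def by (rule normalization_family[OF F c]) (use Suc in simp)
  have kn: "1 \<le> Suc k" "Suc k \<le> n" using Suc by auto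
  note sk = degeneracy_arr[OF kn] and dk = face_arr[OF kn]
  note fs = transport_ds_family[OF F b kn]
  note x = Suc(3)
  have IH: "normalization G n k (\<lambda>x. \<eta> (n, x) \<cdot> c x) y = \<eta> (n, y) \<cdot> b y" if "y \<in> FObj X n" for y
    using Suc that by (simp add: b_def)
  have "transport G (face n (Suc k) False) (transport G (degeneracy n (Suc k)) (normalization G n k (\<lambda>x. \<eta> (n, x) \<cdot> c x))) x =
    transport G (face n (Suc k) False) (\<lambda>y. \<eta> (n - 1, y) \<cdot> transport F (degeneracy n (Suc k)) b y) x"
  proof (rule transport_cong[OF dk(1)])
    fix y assume y: "y \<in> FObj X (fst (face n (Suc k) False))"
    have "transport G (degeneracy n (Suc k)) (normalization G n k (\<lambda>x. \<eta> (n, x) \<cdot> c x)) y = transport G (degeneracy n (Suc k)) (\<lambda>x. \<eta> (n, x) \<cdot> b x) y"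
      by (rule transport_cong[OF sk(1)]) (use sk dk y IH in simp_all)
    also have "\<dots> = \<eta> (n - 1, y) \<cdot> transport F (degeneracy n (Suc k)) b y"
      using transport_nat[OF n sk(1), of P b y] sk dk b y by simp
    finally show "transport G (degeneracy n (Suc k)) (normalization G n k (\<lambda>x. \<eta> (n, x) \<cdot> c x)) y = \<eta> (n - 1, y) \<cdot> transport F (degeneracy n (Suc k)) b y" .
  qed (use dk x in simp)
  also have "\<dots> = \<eta> (n, x) \<cdot> transport F (face n (Suc k) False) (transport F (degeneracy n (Suc k)) b) x"
    using transport_nat[OF n dk(1), of P _ "transport F (degeneracy n (Suc k)) b" x] dk fs x by simp
  finally show ?case
    using IH[OF x] familyD[OF b] familyD[OF fs(2)] nattransD(4-6)[OF n, of "(n, x)"] x by (simp flip: b_def)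
qed simp

lemma normalization_id:
  assumes F: "is_functor E A F" and c: "family F P n c" and nr: "normalized F P n c"
  shows "\<lbrakk>k \<le> n; x \<in> FObj X n\<rbrakk> \<Longrightarrow> normalization F n k c x = c x"
proof (induction k arbitrary: x)
  case (Suc k)
  have kn: "1 \<le> Suc k" "Suc k \<le> n" using Suc by auto
  note sk = degeneracy_arr[OF kn] and dk = face_arr[OF kn]
  have "transport F (face n (Suc k) False) (transport F (degeneracy n (Suc k)) (normalization F n k c)) x = ZeroArr A P (FObj F (snd (snd (face n (Suc k) False)), x))"
  proof (rule transport_zero[OF F dk(1) familyD(1)[OF c]])
    fix y assume y: "y \<in> FObj X (fst (face n (Suc k) False))"
    have "transport F (degeneracy n (Suc k)) (normalization F n k c) y = transport F (degeneracy n (Suc k)) c y"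
      by (rule transport_cong[OF sk(1)]) (use sk dk y Suc in simp_all)
    then show "transport F (degeneracy n (Suc k)) (normalization F n k c) y = ZeroArr A P (FObj F (fst (face n (Suc k) False), y))"
      using nr kn y dk by (simp add: normalized_def)
  qed (use dk Suc in simp)
  then show ?case using Suc dk familyD[OF c] el_functor_obj[OF F Suc(3)] by simp
qed simp

end

section \<open>The normalized cochain complex\<close>

context category
begin

lemma product_obj: "is_product C I a p \<pi> \<Longrightarrow> p \<in> Obj C"
  by (simp add: is_product_def)

lemma product_arr:
  assumes "is_product C I a p \<pi>" "i \<in> I"
  shows "\<pi> i \<in> Arr C" "Dom C (\<pi> i) = p" "Cod C (\<pi> i) = a i"
  using assms by (auto simp: is_product_def Hom_iff)

lemma product_ex1:
  assumes "is_product C I a p \<pi>" "c \<in> Obj C" "\<And>i. i \<in> I \<Longrightarrow> f i \<in> Hom C c (a i)"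
  shows "\<exists>!h. h \<in> Hom C c p \<and> (\<forall>i \<in> I. \<pi> i \<cdot> h = f i)"
  using assms unfolding is_product_def by blast

lemma product_ext:
  assumes p: "is_product C I a p \<pi>" and h: "h \<in> Hom C c p" "h' \<in> Hom C c p"
    and eq: "\<And>i. i \<in> I \<Longrightarrow> \<pi> i \<cdot> h = \<pi> i \<cdot> h'"
  shows "h = h'"
proof -
  have "\<pi> i \<cdot> h \<in> Hom C c (a i)" if "i \<in> I" for i
    using product_arr[OF p that] h by (simp add: Hom_iff)
  moreover have "c \<in> Obj C" using h by (auto simp: Hom_iff)
  ultimately have "\<exists>!k. k \<in> Hom C c p \<and> (\<forall>i \<in> I. \<pi> i \<cdot> k = \<pi> i \<cdot> h)"
    using product_ex1[OF p, of c "\<lambda>i. \<pi> i \<cdot> h"] by blast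
  then show ?thesis using h eq by metis
qed

text \<open>\<open>has_small_products\<close> speaks only of index sets in \<open>'u\<close>; other
  index sets, such as sets of numbers or of arrows, are brought there by an injection.\<close>

lemma product_reindex:
  assumes \<iota>: "inj_on \<iota> I" and p: "is_product C (\<iota> ` I) (\<lambda>j. a (inv_into I \<iota> j)) p \<pi>"
  shows "is_product C I a p (\<lambda>i. \<pi> (\<iota> i))"
  unfolding is_product_def
proof (intro conjI ballI allI impI)
  show "p \<in> Obj C" by (rule product_obj[OF p])
  show "\<pi> (\<iota> i) \<in> Hom C p (a i)" if "i \<in> I" for i
    using product_arr[OF p, of "\<iota> i"] that \<iota> by (simp add: Hom_iff)
  fix c f assume c: "c \<in> Obj C" and f: "\<forall>i \<in> I. f i \<in> Hom C c (a i)"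
  have "\<exists>!h. h \<in> Hom C c p \<and> (\<forall>j \<in> \<iota> ` I. \<pi> j \<cdot> h = f (inv_into I \<iota> j))"
    by (rule product_ex1[OF p c]) (use f \<iota> in auto)
  then show "\<exists>!h. h \<in> Hom C c p \<and> (\<forall>i \<in> I. \<pi> (\<iota> i) \<cdot> h = f i)" using \<iota> by (simp add: image_iff)
qed

end

context cubical_coefficients
begin

lemma some_product_small:
  fixes I :: "'i set" and \<iota> :: "'i \<Rightarrow> 'u"
  assumes \<iota>: "inj_on \<iota> I" and a: "\<And>i. i \<in> I \<Longrightarrow> a i \<in> Obj A"
  shows "is_product A I a (fst (some_product A I a)) (snd (some_product A I a))"
proof -
  have "\<exists>p \<pi>. is_product A (\<iota> ` I) (\<lambda>j. a (inv_into I \<iota> j)) p \<pi>"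
    by (rule small_products[unfolded has_small_products_def, rule_format]) (use \<iota> a in auto)
  then obtain p \<pi> where "is_product A (\<iota> ` I) (\<lambda>j. a (inv_into I \<iota> j)) p \<pi>" by blast
  then have "is_product A I a p (\<lambda>i. \<pi> (\<iota> i))" by (rule product_reindex[OF \<iota>])
  then have "\<exists>q. case q of (p, \<pi>) \<Rightarrow> is_product A I a p \<pi>" by auto
  from someI_ex[OF this] show ?thesis unfolding some_product_def by (simp add: case_prod_unfold)
qed

text \<open>This is where exactness of products enters: it supplies, for infinitely many
  epimorphisms at once, a single cover on which all components can be lifted.\<close>

lemma product_epi:
  fixes I :: "'u set"
  assumes g: "\<And>i. i \<in> I \<Longrightarrow> epi_arr A (g i)"
    and q: "is_product A I (\<lambda>i. Dom A (g i)) q \<rho>" and r: "is_product A I (\<lambda>i. Cod A (g i)) r \<sigma>"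
    and v: "v \<in> Hom A q r" "\<And>i. i \<in> I \<Longrightarrow> \<sigma> i \<cdot> v = g i \<cdot> \<rho> i"
  shows "epi_arr A v"
proof -
  define f where "f i = some_kernel A (g i)" for i
  have f: "is_kernel A (f i) (g i)" if "i \<in> I" for i
    unfolding f_def by (rule some_kernel) (use g[OF that] epi_arr_Arr in auto)
  note fD = kernelD[OF f]
  have se: "short_exact A (f i) (g i)" if "i \<in> I" for i by (rule short_exactI[OF f[OF that] g[OF that]])
  have "is_product A I (\<lambda>i. Dom A (f i)) (fst (some_product A I (\<lambda>i. Dom A (f i)))) (snd (some_product A I (\<lambda>i. Dom A (f i))))"
    by (rule some_product_small[of id]) (use fD(1) in auto)
  then obtain p \<pi> where p: "is_product A I (\<lambda>i. Dom A (f i)) p \<pi>" by blast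
  have q': "is_product A I (\<lambda>i. Cod A (f i)) q \<rho>"
    using q fD(3) by (auto simp: is_product_def)
  have "\<exists>!u. u \<in> Hom A p q \<and> (\<forall>i \<in> I. \<rho> i \<cdot> u = f i \<cdot> \<pi> i)"
    by (rule product_ex1[OF q' product_obj[OF p]]) (use product_arr[OF p] fD(1) in \<open>simp add: Hom_iff\<close>)
  then obtain u where "u \<in> Hom A p q" "\<forall>i \<in> I. \<rho> i \<cdot> u = f i \<cdot> \<pi> i" by blast
  then have "short_exact A u v"
    by - (rule products_exact[unfolded small_products_exact_def, rule_format, OF se p q' r], use v in auto)
  then show ?thesis by (rule short_exactD)
qed

section \<open>The normalized complex and its universal family\<close>

abbreviation "CO \<equiv> cochain_obj A X"
abbreviation "pr \<equiv> cochain_pr A X"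

lemma cochain_product:
  assumes F: "is_functor E A F"
  shows "is_product A (FObj X n) (\<lambda>x. FObj F (n, x)) (CO F n) (pr F n)"
  unfolding cochain_obj_def cochain_pr_def
  by (rule some_product_small[of id]) (use el_functor_obj[OF F] in auto)

lemma CO_obj: "is_functor E A F \<Longrightarrow> CO F n \<in> Obj A"
  by (rule product_obj[OF cochain_product])

lemma pr_family: "is_functor E A F \<Longrightarrow> family F (CO F n) n (pr F n)"
  using CO_obj product_arr[OF cochain_product] by (intro familyI) blast+

lemma coface:
  assumes F: "is_functor E A F" and i: "1 \<le> i" "i \<le> n"
  shows "coface A X F n i e \<in> Hom A (CO F (n - 1)) (CO F n)"
    "x \<in> FObj X n \<Longrightarrow> pr F n x \<cdot> coface A X F n i e = transport F (face n i e) (pr F (n - 1)) x"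
proof -
  note f = face_arr[OF i]
  have "\<exists>!h. h \<in> Hom A (CO F (n - 1)) (CO F n) \<and> (\<forall>x \<in> FObj X n. pr F n x \<cdot> h = transport F (face n i e) (pr F (n - 1)) x)"
  proof (rule product_ex1[OF cochain_product[OF F] CO_obj[OF F]])
    fix x assume "x \<in> FObj X n"
    then show "transport F (face n i e) (pr F (n - 1)) x \<in> Hom A (CO F (n - 1)) (FObj F (n, x))"
      using transport_arr[OF F f(1)[of e], of "CO F (n - 1)" "pr F (n - 1)" x] f(2,3) pr_family[OF F, of "n - 1"] by (simp add: Hom_iff)
  qed
  from theI'[OF this] show "coface A X F n i e \<in> Hom A (CO F (n - 1)) (CO F n)"
    "x \<in> FObj X n \<Longrightarrow> pr F n x \<cdot> coface A X F n i e = transport F (face n i e) (pr F (n - 1)) x"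
    unfolding coface_def transport_def by blast+
qed

lemma codegeneracy:
  assumes F: "is_functor E A F" and i: "1 \<le> i" "i \<le> n"
  shows "codegeneracy A X F n i \<in> Hom A (CO F n) (CO F (n - 1))"
    "x \<in> FObj X (n - 1) \<Longrightarrow> pr F (n - 1) x \<cdot> codegeneracy A X F n i = transport F (degeneracy n i) (pr F n) x"
proof -
  note f = degeneracy_arr[OF i]
  have "\<exists>!h. h \<in> Hom A (CO F n) (CO F (n - 1)) \<and> (\<forall>x \<in> FObj X (n - 1). pr F (n - 1) x \<cdot> h = transport F (degeneracy n i) (pr F n) x)"
  proof (rule product_ex1[OF cochain_product[OF F] CO_obj[OF F]])
    fix x assume "x \<in> FObj X (n - 1)"
    then show "transport F (degeneracy n i) (pr F n) x \<in> Hom A (CO F n) (FObj F (n - 1, x))"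
      using transport_arr[OF F f(1), of "CO F n" "pr F n" x] f(2,3) pr_family[OF F, of n] by (simp add: Hom_iff)
  qed
  from theI'[OF this] show "codegeneracy A X F n i \<in> Hom A (CO F n) (CO F (n - 1))"
    "x \<in> FObj X (n - 1) \<Longrightarrow> pr F (n - 1) x \<cdot> codegeneracy A X F n i = transport F (degeneracy n i) (pr F n) x"
    unfolding codegeneracy_def transport_def by blast+
qed

text \<open>Translates the kernel condition in the definition of the normalized cochains into the
  componentwise predicate \<open>normalized\<close>; the auxiliary product of codegeneracies is not
  mentioned afterwards.\<close>

lemma codegeneracies:
  assumes F: "is_functor E A F"
  shows "codegeneracies A X F n \<in> Arr A" "Dom A (codegeneracies A X F n) = CO F n"
    and codegeneracies_zero: "\<And>h. \<lbrakk>h \<in> Arr A; Cod A h = CO F n\<rbrakk> \<Longrightarrow>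
      codegeneracies A X F n \<cdot> h = ZeroArr A (Dom A h) (Cod A (codegeneracies A X F n)) \<longleftrightarrow>
      normalized F (Dom A h) n (\<lambda>x. pr F n x \<cdot> h)"
proof -
  define p \<pi> where "p = fst (some_product A {1..n} (\<lambda>_. CO F (n - 1)))" and "\<pi> = snd (some_product A {1..n} (\<lambda>_. CO F (n - 1)))"
  \<comment> \<open>The product over \<open>{1..n}\<close> is indexed by numbers; these inject into
    \<open>'u\<close> because the universe is infinite.\<close>
  obtain \<iota> :: "nat \<Rightarrow> 'u" where \<iota>: "inj \<iota>" using infinite_countable_subset[OF infinite_universe] by blast
  have p: "is_product A {1..n} (\<lambda>_. CO F (n - 1)) p \<pi>"
    unfolding p_def \<pi>_def by (rule some_product_small[of \<iota>]) (use CO_obj[OF F] \<iota> in \<open>auto intro: inj_on_subset\<close>)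
  have "\<exists>!h. h \<in> Hom A (CO F n) p \<and> (\<forall>i \<in> {1..n}. \<pi> i \<cdot> h = codegeneracy A X F n i)"
    by (rule product_ex1[OF p CO_obj[OF F]]) (use codegeneracy(1)[OF F] in simp)
  moreover have "codegeneracies A X F n = (THE h. h \<in> Hom A (CO F n) p \<and> (\<forall>i \<in> {1..n}. \<pi> i \<cdot> h = codegeneracy A X F n i))"
    unfolding codegeneracies_def p_def \<pi>_def Let_def case_prod_unfold by (rule refl)
  ultimately have c: "codegeneracies A X F n \<in> Hom A (CO F n) p"
    "\<And>i. i \<in> {1..n} \<Longrightarrow> \<pi> i \<cdot> codegeneracies A X F n = codegeneracy A X F n i"
    using theI'[of "\<lambda>h. h \<in> Hom A (CO F n) p \<and> (\<forall>i \<in> {1..n}. \<pi> i \<cdot> h = codegeneracy A X F n i)"] by simp_all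
  then have [simp]: "codegeneracies A X F n \<in> Arr A" "Dom A (codegeneracies A X F n) = CO F n" "Cod A (codegeneracies A X F n) = p"
    by (auto simp: Hom_iff)
  show "codegeneracies A X F n \<in> Arr A" "Dom A (codegeneracies A X F n) = CO F n" by simp_all
  fix h assume h [simp]: "h \<in> Arr A" "Cod A h = CO F n"
  have [simp]: "p \<in> Obj A" by (rule product_obj[OF p])
  note pD = product_arr[OF p]
  have 1: "pr F (n - 1) x \<cdot> (\<pi> i \<cdot> (codegeneracies A X F n \<cdot> h)) = transport F (degeneracy n i) (\<lambda>x. pr F n x \<cdot> h) x"
    if i: "1 \<le> i" "i \<le> n" and x: "x \<in> FObj X (n - 1)" for i x
  proof -
    note [simp] = codegeneracy(1)[OF F i, unfolded Hom_iff] familyD[OF pr_family[OF F, of "n - 1"]]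
    have "\<pi> i \<cdot> (codegeneracies A X F n \<cdot> h) = codegeneracy A X F n i \<cdot> h"
      using pre_comp[OF c(2)[of i], of h] pD[of i] i by simp
    moreover have "pr F (n - 1) x \<cdot> (codegeneracy A X F n i \<cdot> h) = transport F (degeneracy n i) (pr F n) x \<cdot> h"
      using pre_comp[OF codegeneracy(2)[OF F i x], of h] product_arr[OF cochain_product[OF F] x] by simp
    moreover have "\<dots> = transport F (degeneracy n i) (\<lambda>x. pr F n x \<cdot> h) x"
      using transport_comp_right[OF F degeneracy_arr(1)[OF i], of "CO F n" "pr F n" x h] degeneracy_arr(2,3)[OF i] pr_family[OF F, of n] x by simp
    ultimately show ?thesis by simp
  qed
  show "codegeneracies A X F n \<cdot> h = ZeroArr A (Dom A h) (Cod A (codegeneracies A X F n)) \<longleftrightarrow>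
      normalized F (Dom A h) n (\<lambda>x. pr F n x \<cdot> h)"
  proof
    assume z: "codegeneracies A X F n \<cdot> h = ZeroArr A (Dom A h) (Cod A (codegeneracies A X F n))"
    show "normalized F (Dom A h) n (\<lambda>x. pr F n x \<cdot> h)"
      unfolding normalized_def
    proof (intro allI impI)
      fix i x assume i: "1 \<le> i" "i \<le> n" and x: "x \<in> FObj X (n - 1)"
      show "transport F (degeneracy n i) (\<lambda>x. pr F n x \<cdot> h) x = ZeroArr A (Dom A h) (FObj F (n - 1, x))"
        using 1[OF i x] z pD[of i] i familyD[OF pr_family[OF F, of "n - 1"]] x by simp
    qed
  next
    assume nr: "normalized F (Dom A h) n (\<lambda>x. pr F n x \<cdot> h)"
    show "codegeneracies A X F n \<cdot> h = ZeroArr A (Dom A h) (Cod A (codegeneracies A X F n))"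
    proof (rule product_ext[OF p, of _ "Dom A h"])
      fix i assume "i \<in> {1..n}"
      then have i: "1 \<le> i" "i \<le> n" by auto
      show "\<pi> i \<cdot> (codegeneracies A X F n \<cdot> h) = \<pi> i \<cdot> ZeroArr A (Dom A h) (Cod A (codegeneracies A X F n))"
      proof (rule product_ext[OF cochain_product[OF F], of _ "Dom A h" "n - 1"])
        fix x assume x: "x \<in> FObj X (n - 1)"
        show "pr F (n - 1) x \<cdot> (\<pi> i \<cdot> (codegeneracies A X F n \<cdot> h)) = pr F (n - 1) x \<cdot> (\<pi> i \<cdot> ZeroArr A (Dom A h) (Cod A (codegeneracies A X F n)))"
          unfolding 1[OF i x] using nr[unfolded normalized_def] i x pD[of i] familyD[OF pr_family[OF F, of "n - 1"]] by simp
      qed (use pD[of i] i CO_obj[OF F] in \<open>simp_all add: Hom_iff\<close>)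
    qed (simp_all add: Hom_iff)
  qed
qed

abbreviation "nincl \<equiv> normalized_incl A X"

definition nobj :: "('u, 'o, 'm) coefficient_system \<Rightarrow> nat \<Rightarrow> 'o" where
  "nobj F n = Dom A (nincl F n)"

text \<open>The universal normalized family: by \<open>nu_ext\<close> and \<open>nu_lift\<close>,
  composition with it identifies arrows into \<open>nobj F n\<close> with normalized families in
  degree \<open>n\<close>.\<close>

definition nu :: "('u, 'o, 'm) coefficient_system \<Rightarrow> nat \<Rightarrow> 'u \<Rightarrow> 'm" where
  "nu F n x = pr F n x \<cdot> nincl F n"

lemma nincl_kernel: "is_functor E A F \<Longrightarrow> is_kernel A (nincl F n) (codegeneracies A X F n)"
  unfolding normalized_incl_def by (rule some_kernel) (rule codegeneracies(1))

lemma nincl: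
  assumes F: "is_functor E A F"
  shows "nincl F n \<in> Arr A" "Dom A (nincl F n) = nobj F n" "Cod A (nincl F n) = CO F n"
    "mono_arr A (nincl F n)" "nobj F n \<in> Obj A"
  using kernelD[OF nincl_kernel[OF F, of n]] kernel_mono[OF nincl_kernel[OF F, of n]] codegeneracies(1,2)[OF F, of n]
  by (simp_all add: nobj_def)

lemma nu_family: "is_functor E A F \<Longrightarrow> family F (nobj F n) n (nu F n)"
  using family_comp[OF pr_family, where u = "nincl F n"] nincl[of F n] by (simp add: nu_def[abs_def])

lemma nu_normalized: "is_functor E A F \<Longrightarrow> normalized F (nobj F n) n (nu F n)"
  using codegeneracies_zero[where h = "nincl F n" and n = n and F = F] kernelD(4)[OF nincl_kernel[of F n]] nincl[of F n]
  by (simp add: nu_def[abs_def])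

lemma nu_ext:
  assumes F: "is_functor E A F" and h: "h \<in> Hom A P (nobj F n)" "h' \<in> Hom A P (nobj F n)"
    and eq: "\<And>x. x \<in> FObj X n \<Longrightarrow> nu F n x \<cdot> h = nu F n x \<cdot> h'"
  shows "h = h'"
proof -
  note [simp] = nincl[OF F, of n] h[unfolded Hom_iff] product_arr[OF cochain_product[OF F]]
  have "nincl F n \<cdot> h = nincl F n \<cdot> h'"
    by (rule product_ext[OF cochain_product[OF F], of _ P n]) (use eq in \<open>simp_all add: nu_def Hom_iff\<close>)
  then show ?thesis by - (rule mono_arrD[OF nincl(4)[OF F, where n = n]], simp_all)
qed

lemma nu_lift:
  assumes F: "is_functor E A F" and c: "family F P n c" and nr: "normalized F P n c"
  obtains h where "h \<in> Hom A P (nobj F n)" "\<And>x. x \<in> FObj X n \<Longrightarrow> nu F n x \<cdot> h = c x"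
proof -
  have "\<exists>!h. h \<in> Hom A P (CO F n) \<and> (\<forall>x \<in> FObj X n. pr F n x \<cdot> h = c x)"
    by (rule product_ex1[OF cochain_product[OF F]]) (use c in \<open>auto simp: family_def\<close>)
  then obtain k where k: "k \<in> Hom A P (CO F n)" "\<And>x. x \<in> FObj X n \<Longrightarrow> pr F n x \<cdot> k = c x" by blast
  have "normalized F P n (\<lambda>x. pr F n x \<cdot> k)" by (rule normalized_cong[OF _ nr]) (use k in simp)
  then have "codegeneracies A X F n \<cdot> k = ZeroArr A P (Cod A (codegeneracies A X F n))"
    using codegeneracies_zero[OF F, where h = k and n = n] k by (simp add: Hom_iff)
  then obtain h where h: "h \<in> Arr A" "Dom A h = Dom A k" "Cod A h = Dom A (nincl F n)" "nincl F n \<cdot> h = k"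
    by - (rule kernel_lift[OF nincl_kernel[OF F, of n], of k], use k codegeneracies(1,2)[OF F] in \<open>simp_all add: Hom_iff\<close>)
  show thesis
    by (rule that[of h]) (use h k nincl[OF F, of n] product_arr[OF cochain_product[OF F]] in \<open>simp_all add: nu_def Hom_iff\<close>)
qed

lemma cochain_diff:
  assumes F: "is_functor E A F"
  shows "cochain_diff A X F (Suc n) \<in> Hom A (CO F n) (CO F (Suc n))"
    "x \<in> FObj X (Suc n) \<Longrightarrow> pr F (Suc n) x \<cdot> cochain_diff A X F (Suc n) = coboundary F (CO F n) n (pr F n) x"
proof -
  let ?G = "hom_group A (CO F n) (CO F (Suc n))"
  let ?f = "\<lambda>i. coface A X F (Suc n) i False \<otimes>\<^bsub>?G\<^esub> inv\<^bsub>?G\<^esub> (coface A X F (Suc n) i True)"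
  let ?g = "\<lambda>i. coface A X F (Suc n) i False \<boxminus> coface A X F (Suc n) i True"
  note cf = coface[OF F, of _ "Suc n", simplified]
  have fg: "?f i = ?g i" if "1 \<le> i" "i \<le> Suc n" for i
    using cf(1)[of i] that by (simp add: Hom_iff neg_def)
  have g: "arrs (CO F n) (CO F (Suc n)) ?g (Suc n)"
    by (rule arrsI[OF CO_obj[OF F] CO_obj[OF F]]) (use cf(1) in \<open>auto simp: Hom_iff\<close>)
  then have f: "arrs (CO F n) (CO F (Suc n)) ?f (Suc n)" using fg by (simp add: arrs_def)
  have eq: "cochain_diff A X F (Suc n) = asum (CO F n) (CO F (Suc n)) ?g (Suc n)"
    unfolding cochain_diff_def Let_def diff_Suc_1 finprod_asum[OF f] by (rule asum_cong[OF fg])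
  show "cochain_diff A X F (Suc n) \<in> Hom A (CO F n) (CO F (Suc n))"
    using asum_arr[OF g] by (simp add: eq Hom_iff)
  assume x: "x \<in> FObj X (Suc n)"
  note px = product_arr[OF cochain_product[OF F] x]
  have "pr F (Suc n) x \<cdot> asum (CO F n) (CO F (Suc n)) ?g (Suc n) =
    asum (CO F n) (Cod A (pr F (Suc n) x)) (\<lambda>i. pr F (Suc n) x \<cdot> ?g i) (Suc n)"
    by (rule asum_comp_left[OF g]) (use px in simp_all)
  also have "\<dots> = coboundary F (CO F n) n (pr F n) x"
    unfolding coboundary_def px(3)
  proof (rule asum_cong)
    fix i assume "1 \<le> i" "i \<le> Suc n"
    then show "pr F (Suc n) x \<cdot> ?g i = face_diff F (Suc n) i (pr F n) x"
      using cf[of i] px x by (simp add: face_diff_def Hom_iff)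
  qed
  finally show "pr F (Suc n) x \<cdot> cochain_diff A X F (Suc n) = coboundary F (CO F n) n (pr F n) x" unfolding eq .
qed

abbreviation "ndiff \<equiv> normalized_diff A X"

lemma ndiff:
  assumes F: "is_functor E A F"
  shows "ndiff F n \<in> Arr A" "Dom A (ndiff F n) = nobj F n" "Cod A (ndiff F n) = nobj F (Suc n)"
    and nu_ndiff: "\<And>x. x \<in> FObj X (Suc n) \<Longrightarrow> nu F (Suc n) x \<cdot> ndiff F n = coboundary F (nobj F n) n (nu F n) x"
proof -
  let ?c = "cochain_diff A X F (Suc n) \<cdot> nincl F n"
  note [simp] = cochain_diff(1)[OF F, of n, unfolded Hom_iff] nincl[OF F] product_arr[OF cochain_product[OF F]]
  have 1: "pr F (Suc n) x \<cdot> ?c = coboundary F (nobj F n) n (nu F n) x" if x: "x \<in> FObj X (Suc n)" for x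
    using pre_comp[OF cochain_diff(2)[OF F x], of "nincl F n"] coboundary_comp_right[OF F pr_family[OF F] x, of "nincl F n"] x
    by (simp add: nu_def[abs_def])
  have "normalized F (nobj F n) (Suc n) (\<lambda>x. pr F (Suc n) x \<cdot> ?c)"
    by (rule normalized_cong[OF _ coboundary_normalized[OF F nu_family[OF F] nu_normalized[OF F]]]) (use 1 in simp)
  then have z: "codegeneracies A X F (Suc n) \<cdot> ?c = ZeroArr A (Dom A ?c) (Cod A (codegeneracies A X F (Suc n)))"
    using codegeneracies_zero[OF F, where h = ?c and n = "Suc n"] by simp
  have L: "ndiff F n \<in> Arr A" "Dom A (ndiff F n) = Dom A ?c" "Cod A (ndiff F n) = Dom A (nincl F (Suc n))"
    "nincl F (Suc n) \<cdot> ndiff F n = ?c"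
    unfolding normalized_diff_def
    using lift_through[OF nincl_kernel[OF F, of "Suc n"], of ?c] z codegeneracies(1,2)[OF F, of "Suc n"] by simp_all
  show "ndiff F n \<in> Arr A" "Dom A (ndiff F n) = nobj F n" "Cod A (ndiff F n) = nobj F (Suc n)" using L by simp_all
  show "nu F (Suc n) x \<cdot> ndiff F n = coboundary F (nobj F n) n (nu F n) x" if x: "x \<in> FObj X (Suc n)" for x
    using L x 1[OF x] by (simp add: nu_def)
qed

lemma nu_ndiff_comp:
  assumes F: "is_functor E A F" and h: "h \<in> Arr A" "Cod A h = nobj F n" and x: "x \<in> FObj X (Suc n)"
  shows "nu F (Suc n) x \<cdot> (ndiff F n \<cdot> h) = coboundary F (Dom A h) n (\<lambda>x. nu F n x \<cdot> h) x"
  using pre_comp[OF nu_ndiff[OF F x], of h] coboundary_comp_right[OF F nu_family[OF F] x h] ndiff(1-3)[OF F, of n]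
    familyD[OF nu_family[OF F]] h x by simp

lemma normalized_complex:
  assumes F: "is_functor E A F"
  shows "cochain_complex (ndiff F)"
  unfolding cochain_complex_def
proof (intro allI conjI)
  fix n
  note [simp] = ndiff(1-3)[OF F] nincl(5)[OF F]
  show "ndiff F n \<in> Arr A" "Dom A (ndiff F (Suc n)) = Cod A (ndiff F n)" by simp_all
  show "ndiff F (Suc n) \<cdot> ndiff F n = ZeroArr A (Dom A (ndiff F n)) (Cod A (ndiff F (Suc n)))"
  proof (rule nu_ext[OF F, of _ "nobj F n" "Suc (Suc n)"])
    fix x assume x: "x \<in> FObj X (Suc (Suc n))"
    have "nu F (Suc (Suc n)) x \<cdot> (ndiff F (Suc n) \<cdot> ndiff F n) = coboundary F (nobj F n) (Suc n) (\<lambda>x. nu F (Suc n) x \<cdot> ndiff F n) x"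
      using nu_ndiff_comp[OF F _ _ x, of "ndiff F n"] by simp
    also have "\<dots> = coboundary F (nobj F n) (Suc n) (coboundary F (nobj F n) n (nu F n)) x"
      by (rule coboundary_cong[OF x]) (rule nu_ndiff[OF F])
    also have "\<dots> = ZeroArr A (nobj F n) (FObj F (Suc (Suc n), x))"
      by (rule coboundary_coboundary[OF F nu_family[OF F] x])
    also have "\<dots> = nu F (Suc (Suc n)) x \<cdot> ZeroArr A (Dom A (ndiff F n)) (Cod A (ndiff F (Suc n)))"
      using familyD[OF nu_family[OF F]] x by simp
    finally show "nu F (Suc (Suc n)) x \<cdot> (ndiff F (Suc n) \<cdot> ndiff F n) =
      nu F (Suc (Suc n)) x \<cdot> ZeroArr A (Dom A (ndiff F n)) (Cod A (ndiff F (Suc n)))" .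
  qed (simp_all add: Hom_iff)
qed

section \<open>Functoriality and exactness of normalized cochains\<close>

definition nmap :: "('u, 'o, 'm) coefficient_system \<Rightarrow> ('u, 'o, 'm) coefficient_system \<Rightarrow>
    (nat \<times> 'u \<Rightarrow> 'm) \<Rightarrow> nat \<Rightarrow> 'm" where
  "nmap F G \<eta> n = (SOME h. h \<in> Hom A (nobj F n) (nobj G n) \<and>
     (\<forall>x \<in> FObj X n. nu G n x \<cdot> h = \<eta> (n, x) \<cdot> nu F n x))"

lemma nmap:
  assumes t: "is_nattrans E A F G \<eta>"
  shows "nmap F G \<eta> n \<in> Arr A" "Dom A (nmap F G \<eta> n) = nobj F n" "Cod A (nmap F G \<eta> n) = nobj G n"
    and nu_nmap: "\<And>x. x \<in> FObj X n \<Longrightarrow> nu G n x \<cdot> nmap F G \<eta> n = \<eta> (n, x) \<cdot> nu F n x"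
proof -
  note F = nattransD(1)[OF t] and G = nattransD(2)[OF t]
  obtain h where "h \<in> Hom A (nobj F n) (nobj G n)" "\<And>x. x \<in> FObj X n \<Longrightarrow> nu G n x \<cdot> h = \<eta> (n, x) \<cdot> nu F n x"
    using nu_lift[OF G family_nat[OF t nu_family[OF F]] normalized_nat[OF t nu_family[OF F] nu_normalized[OF F]], of n] by blast
  then have "\<exists>h. h \<in> Hom A (nobj F n) (nobj G n) \<and> (\<forall>x \<in> FObj X n. nu G n x \<cdot> h = \<eta> (n, x) \<cdot> nu F n x)" by blast
  from someI_ex[OF this, folded nmap_def]
  show "nmap F G \<eta> n \<in> Arr A" "Dom A (nmap F G \<eta> n) = nobj F n" "Cod A (nmap F G \<eta> n) = nobj G n"
    "\<And>x. x \<in> FObj X n \<Longrightarrow> nu G n x \<cdot> nmap F G \<eta> n = \<eta> (n, x) \<cdot> nu F n x"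
    by (auto simp: Hom_iff)
qed

lemma nmap_unique:
  assumes t: "is_nattrans E A F G \<eta>" and h: "h \<in> Arr A" "Dom A h = nobj F n" "Cod A h = nobj G n"
    and eq: "\<And>x. x \<in> FObj X n \<Longrightarrow> nu G n x \<cdot> h = \<eta> (n, x) \<cdot> nu F n x"
  shows "nmap F G \<eta> n = h"
  by (rule nu_ext[OF nattransD(2)[OF t], of _ "nobj F n" n]) (use h eq nmap[OF t] in \<open>simp_all add: Hom_iff\<close>)

lemma nmap_chain_map:
  assumes t: "is_nattrans E A F G \<eta>"
  shows "chain_map (ndiff F) (ndiff G) (nmap F G \<eta>)"
  unfolding chain_map_def
proof (intro conjI allI)
  note F = nattransD(1)[OF t] and G = nattransD(2)[OF t]
  show "cochain_complex (ndiff F)" "cochain_complex (ndiff G)" using normalized_complex F G by blast+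
  fix n
  note [simp] = ndiff(1-3)[OF F] ndiff(1-3)[OF G] nmap(1-3)[OF t] familyD[OF nu_family[OF F]] familyD[OF nu_family[OF G]]
  show "nmap F G \<eta> n \<in> Arr A" "Dom A (nmap F G \<eta> n) = Dom A (ndiff F n)" "Cod A (nmap F G \<eta> n) = Dom A (ndiff G n)"
    by simp_all
  show "nmap F G \<eta> (Suc n) \<cdot> ndiff F n = ndiff G n \<cdot> nmap F G \<eta> n"
  proof (rule nu_ext[OF G, of _ "nobj F n" "Suc n"])
    fix x assume x [simp]: "x \<in> FObj X (Suc n)"
    note [simp] = nattransD(4-6)[OF t, of "(Suc n, x)"]
    have "nu G (Suc n) x \<cdot> (nmap F G \<eta> (Suc n) \<cdot> ndiff F n) = \<eta> (Suc n, x) \<cdot> coboundary F (nobj F n) n (nu F n) x"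
      using pre_comp[OF nu_nmap[OF t x], of "ndiff F n"] nu_ndiff[OF F x] by simp
    also have "\<dots> = coboundary G (nobj F n) n (\<lambda>x. \<eta> (n, x) \<cdot> nu F n x) x"
      by (rule coboundary_nat[OF t nu_family[OF F] x, symmetric])
    also have "\<dots> = coboundary G (nobj F n) n (\<lambda>x. nu G n x \<cdot> nmap F G \<eta> n) x"
      by (rule coboundary_cong[OF x]) (use nu_nmap[OF t] in simp)
    also have "\<dots> = nu G (Suc n) x \<cdot> (ndiff G n \<cdot> nmap F G \<eta> n)"
      using nu_ndiff_comp[OF G _ _ x, of "nmap F G \<eta> n"] by simp
    finally show "nu G (Suc n) x \<cdot> (nmap F G \<eta> (Suc n) \<cdot> ndiff F n) = nu G (Suc n) x \<cdot> (ndiff G n \<cdot> nmap F G \<eta> n)" .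
  qed (simp_all add: Hom_iff)
qed

lemma nmap_ident:
  assumes F: "is_functor E A F" and t: "is_nattrans E A F F (\<lambda>c \<in> Obj E. Ident A (FObj F c))"
  shows "nmap F F (\<lambda>c \<in> Obj E. Ident A (FObj F c)) n = Ident A (nobj F n)"
  by (rule nmap_unique[OF t]) (use nincl[OF F] familyD[OF nu_family[OF F]] in simp_all)

lemma nmap_compose:
  assumes s: "is_nattrans E A F G \<eta>" and t: "is_nattrans E A G H \<theta>"
    and st: "is_nattrans E A F H (\<lambda>c \<in> Obj E. \<theta> c \<cdot> \<eta> c)"
  shows "nmap F H (\<lambda>c \<in> Obj E. \<theta> c \<cdot> \<eta> c) n = nmap G H \<theta> n \<cdot> nmap F G \<eta> n"
proof (rule nmap_unique[OF st])
  note F = nattransD(1)[OF s] and G = nattransD(2)[OF s] and H = nattransD(2)[OF t]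
  note [simp] = nmap(1-3)[OF s] nmap(1-3)[OF t] familyD[OF nu_family[OF F]] familyD[OF nu_family[OF G]] familyD[OF nu_family[OF H]]
  fix x assume x [simp]: "x \<in> FObj X n"
  note [simp] = nattransD(4-6)[OF s, of "(n, x)"] nattransD(4-6)[OF t, of "(n, x)"]
  show "nu H n x \<cdot> (nmap G H \<theta> n \<cdot> nmap F G \<eta> n) = (\<lambda>c \<in> Obj E. \<theta> c \<cdot> \<eta> c) (n, x) \<cdot> nu F n x"
    using pre_comp[OF nu_nmap[OF t x], of "nmap F G \<eta> n"] nu_nmap[OF s x] by simp
qed (use nmap[OF s] nmap[OF t] in simp_all)

lemma nmap_add:
  assumes s: "is_nattrans E A F G \<eta>" and t: "is_nattrans E A F G \<theta>"
    and st: "is_nattrans E A F G (\<lambda>c \<in> Obj E. \<eta> c \<boxplus> \<theta> c)"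
  shows "nmap F G (\<lambda>c \<in> Obj E. \<eta> c \<boxplus> \<theta> c) n = nmap F G \<eta> n \<boxplus> nmap F G \<theta> n"
proof (rule nmap_unique[OF st])
  note F = nattransD(1)[OF s] and G = nattransD(2)[OF s]
  note [simp] = nmap(1-3)[OF s] nmap(1-3)[OF t] familyD[OF nu_family[OF F]] familyD[OF nu_family[OF G]]
  fix x assume x [simp]: "x \<in> FObj X n"
  note [simp] = nattransD(4-6)[OF s, of "(n, x)"] nattransD(4-6)[OF t, of "(n, x)"]
  show "nu G n x \<cdot> (nmap F G \<eta> n \<boxplus> nmap F G \<theta> n) = (\<lambda>c \<in> Obj E. \<eta> c \<boxplus> \<theta> c) (n, x) \<cdot> nu F n x"
    using nu_nmap[OF s x] nu_nmap[OF t x] by simp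
qed (use nmap[OF s] nmap[OF t] in simp_all)

lemma nmap_exact:
  assumes s: "is_nattrans E A F G \<eta>" and t: "is_nattrans E A G H \<theta>"
    and se: "\<And>c. c \<in> Obj E \<Longrightarrow> short_exact A (\<eta> c) (\<theta> c)"
  shows "short_exact A (nmap F G \<eta> n) (nmap G H \<theta> n)"
proof (rule short_exactI)
  note F = nattransD(1)[OF s] and G = nattransD(2)[OF s] and H = nattransD(2)[OF t]
  note [simp] = nmap(1-3)[OF s] nmap(1-3)[OF t] familyD[OF nu_family[OF F]] familyD[OF nu_family[OF G]] familyD[OF nu_family[OF H]]
    nincl(5)[OF F] nincl(5)[OF G] nincl(5)[OF H]
  have o: "(n, x) \<in> Obj E" if "x \<in> FObj X n" for x using that by simp
  note sD = nattransD(4-6)[OF s o] and tD = nattransD(4-6)[OF t o]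
  note ker = short_exactD(1)[OF se[OF o]] and epi = short_exactD(2)[OF se[OF o]] and mono = short_exactD(3)[OF se[OF o]]
  show "is_kernel A (nmap F G \<eta> n) (nmap G H \<theta> n)"
  proof (rule kernelI)
    show "mono_arr A (nmap F G \<eta> n)"
    proof (rule mono_arrI)
      fix u assume u [simp]: "u \<in> Arr A" "Cod A u = Dom A (nmap F G \<eta> n)"
        and z: "nmap F G \<eta> n \<cdot> u = ZeroArr A (Dom A u) (Cod A (nmap F G \<eta> n))"
      show "u = ZeroArr A (Dom A u) (Dom A (nmap F G \<eta> n))"
      proof (rule nu_ext[OF F, of _ "Dom A u" n])
        fix x assume x [simp]: "x \<in> FObj X n"
        note [simp] = sD[OF x]
        have "\<eta> (n, x) \<cdot> (nu F n x \<cdot> u) = nu G n x \<cdot> (nmap F G \<eta> n \<cdot> u)"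
          using pre_comp[OF nu_nmap[OF s x], of u] by simp
        also have "\<dots> = \<eta> (n, x) \<cdot> ZeroArr A (Dom A u) (FObj F (n, x))" using z by simp
        finally have "nu F n x \<cdot> u = ZeroArr A (Dom A u) (FObj F (n, x))"
          by - (rule mono_arrD[OF mono[OF x]], simp_all add: el_functor_obj[OF F])
        then show "nu F n x \<cdot> u = nu F n x \<cdot> ZeroArr A (Dom A u) (Dom A (nmap F G \<eta> n))" by simp
      qed (simp_all add: Hom_iff)
    qed simp
    show "nmap G H \<theta> n \<cdot> nmap F G \<eta> n = ZeroArr A (Dom A (nmap F G \<eta> n)) (Cod A (nmap G H \<theta> n))"
    proof (rule nu_ext[OF H, of _ "nobj F n" n])
      fix x assume x [simp]: "x \<in> FObj X n"
      note [simp] = sD[OF x] tD[OF x]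
      have "nu H n x \<cdot> (nmap G H \<theta> n \<cdot> nmap F G \<eta> n) = \<theta> (n, x) \<cdot> (\<eta> (n, x) \<cdot> nu F n x)"
        using pre_comp[OF nu_nmap[OF t x], of "nmap F G \<eta> n"] nu_nmap[OF s x] by simp
      also have "\<dots> = ZeroArr A (nobj F n) (FObj H (n, x))"
        using pre_comp[OF kernelD(4)[OF ker[OF x]], of "nu F n x"] by (simp add: el_functor_obj[OF H])
      finally show "nu H n x \<cdot> (nmap G H \<theta> n \<cdot> nmap F G \<eta> n) = nu H n x \<cdot> ZeroArr A (Dom A (nmap F G \<eta> n)) (Cod A (nmap G H \<theta> n))"
        by simp
    qed (simp_all add: Hom_iff)
  next
    fix c assume c [simp]: "c \<in> Arr A" "Cod A c = Dom A (nmap G H \<theta> n)"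
      and z: "nmap G H \<theta> n \<cdot> c = ZeroArr A (Dom A c) (Cod A (nmap G H \<theta> n))"
    have "\<forall>x \<in> FObj X n. \<exists>v. v \<in> Arr A \<and> Dom A v = Dom A c \<and> Cod A v = FObj F (n, x) \<and> \<eta> (n, x) \<cdot> v = nu G n x \<cdot> c"
    proof
      fix x assume x [simp]: "x \<in> FObj X n"
      note [simp] = sD[OF x] tD[OF x]
      have "\<theta> (n, x) \<cdot> (nu G n x \<cdot> c) = ZeroArr A (Dom A c) (FObj H (n, x))"
        using pre_comp[OF nu_nmap[OF t x], of c] z by simp
      then show "\<exists>v. v \<in> Arr A \<and> Dom A v = Dom A c \<and> Cod A v = FObj F (n, x) \<and> \<eta> (n, x) \<cdot> v = nu G n x \<cdot> c"
        using kernel_lift_ex[OF ker[OF x], of "nu G n x \<cdot> c"] by simp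
    qed
    from bchoice[OF this] obtain v where v: "\<And>x. x \<in> FObj X n \<Longrightarrow> v x \<in> Arr A \<and> Dom A (v x) = Dom A c \<and> Cod A (v x) = FObj F (n, x)"
      "\<And>x. x \<in> FObj X n \<Longrightarrow> \<eta> (n, x) \<cdot> v x = nu G n x \<cdot> c" by blast
    have vf: "family F (Dom A c) n v" by (rule familyI) (use v(1) in simp_all)
    \<comment> \<open>The lifts were chosen separately for each \<open>x\<close>, yet they form a
      normalized family: \<open>\<eta>\<close> carries their codegeneracies to those of a normalized
      family, which vanish, and \<open>\<eta>\<close> is a monomorphism.\<close>
    have "normalized F (Dom A c) n v"
      unfolding normalized_def
    proof (intro allI impI)
      fix i x assume i: "1 \<le> i" "i \<le> n" and x: "x \<in> FObj X (n - 1)"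
      have o': "(n - 1, x) \<in> Obj E" using x by simp
      note si = degeneracy_arr[OF i]
      have "\<eta> (n - 1, x) \<cdot> transport F (degeneracy n i) v x = transport G (degeneracy n i) (\<lambda>x. \<eta> (n, x) \<cdot> v x) x"
        using transport_nat[OF s si(1), of "Dom A c" v x] si vf x by simp
      also have "\<dots> = transport G (degeneracy n i) (\<lambda>x. nu G n x \<cdot> c) x"
        by (rule transport_cong[OF si(1)]) (use si x v(2) in simp_all)
      also have "\<dots> = ZeroArr A (Dom A c) (FObj G (n - 1, x))"
        using normalized_comp_right[OF G nu_family[OF G] nu_normalized[OF G], of c n] i x by (simp add: normalized_def)
      also have "\<dots> = \<eta> (n - 1, x) \<cdot> ZeroArr A (Dom A c) (FObj F (n - 1, x))"
        using nattransD(4-6)[OF s o'] by simp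
      finally show "transport F (degeneracy n i) v x = ZeroArr A (Dom A c) (FObj F (n - 1, x))"
        by - (rule mono_arrD[OF short_exactD(3)[OF se[OF o']]],
          use transport_arr[OF F si(1), of "Dom A c" v x] si vf x nattransD(4-6)[OF s o'] el_functor_obj[OF F x] in simp_all)
    qed
    from nu_lift[OF F vf this] obtain h where h: "h \<in> Hom A (Dom A c) (nobj F n)" "\<And>x. x \<in> FObj X n \<Longrightarrow> nu F n x \<cdot> h = v x" by blast
    note [simp] = h(1)[unfolded Hom_iff]
    have "nmap F G \<eta> n \<cdot> h = c"
    proof (rule nu_ext[OF G, of _ "Dom A c" n])
      fix x assume x [simp]: "x \<in> FObj X n"
      show "nu G n x \<cdot> (nmap F G \<eta> n \<cdot> h) = nu G n x \<cdot> c"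
        using pre_comp[OF nu_nmap[OF s x], of h] v(2)[OF x] h(2)[OF x] sD[OF x] by simp
    qed (simp_all add: Hom_iff)
    then show "\<exists>v. v \<in> Arr A \<and> Dom A v = Dom A c \<and> Cod A v = Dom A (nmap F G \<eta> n) \<and> nmap F G \<eta> n \<cdot> v = c"
      by (intro exI[of _ h]) simp
  qed simp_all
  note [simp] = product_arr[OF cochain_product[OF G]] product_arr[OF cochain_product[OF H]] nincl[OF G] nincl[OF H]
  have "\<exists>!h. h \<in> Hom A (CO G n) (CO H n) \<and> (\<forall>x \<in> FObj X n. pr H n x \<cdot> h = \<theta> (n, x) \<cdot> pr G n x)"
    by (rule product_ex1[OF cochain_product[OF H] CO_obj[OF G]]) (use tD in \<open>simp add: Hom_iff\<close>)
  then obtain p where p: "p \<in> Hom A (CO G n) (CO H n)" "\<And>x. x \<in> FObj X n \<Longrightarrow> pr H n x \<cdot> p = \<theta> (n, x) \<cdot> pr G n x" by blast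
  note [simp] = p(1)[unfolded Hom_iff]
  have pG: "is_product A (FObj X n) (\<lambda>x. Dom A (\<theta> (n, x))) (CO G n) (pr G n)"
    and pH: "is_product A (FObj X n) (\<lambda>x. Cod A (\<theta> (n, x))) (CO H n) (pr H n)"
    using cochain_product[OF G, of n] cochain_product[OF H, of n] tD by (auto simp: is_product_def)
  \<comment> \<open>On unnormalized cochains surjectivity is exactness of products. It gives a lift
    \<open>c\<close> of the universal normalized family of \<open>H\<close>, restricted to a cover,
    but this lift need not be normalized.\<close>
  have pe: "epi_arr A p" by (rule product_epi[OF epi pG pH p])
  obtain e v where ev: "epi_arr A e" "v \<in> Arr A" "Cod A e = Dom A (nincl H n)" "Cod A v = Dom A p"
    "Dom A v = Dom A e" "p \<cdot> v = nincl H n \<cdot> e" by (rule epi_lift[OF pe, of "nincl H n"]) simp_all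
  note [simp] = epi_arr_Arr[OF ev(1)] ev(2-5)
  define c where "c x = pr G n x \<cdot> v" for x
  have c: "family G (Dom A e) n c" unfolding c_def using family_comp[OF pr_family[OF G], of v n] by simp
  have tc: "\<theta> (n, x) \<cdot> c x = nu H n x \<cdot> e" if x [simp]: "x \<in> FObj X n" for x
    using pre_comp[OF p(2)[OF x], of v] tD[OF x] by (simp add: c_def nu_def ev(6))
  \<comment> \<open>The natural projection makes the lift normalized and does not change its image
    under \<open>\<theta>\<close>, which was normalized already and hence is fixed by the
    projection.\<close>
  define b where "b = normalization G n n c"
  have b: "family G (Dom A e) n b" unfolding b_def by (rule normalization_family[OF G c]) simp
  have "normalized G (Dom A e) n b" unfolding b_def normalized_def using normalization_normal[OF G c, of n] by simp
  from nu_lift[OF G b this] obtain h where h: "h \<in> Hom A (Dom A e) (nobj G n)" "\<And>x. x \<in> FObj X n \<Longrightarrow> nu G n x \<cdot> h = b x" by blast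
  note [simp] = h(1)[unfolded Hom_iff]
  have fe: "family H (Dom A e) n (\<lambda>x. nu H n x \<cdot> e)" "normalized H (Dom A e) n (\<lambda>x. nu H n x \<cdot> e)"
    using family_comp[OF nu_family[OF H], of e n] normalized_comp_right[OF H nu_family[OF H] nu_normalized[OF H], of e n] by simp_all
  have tcf: "family H (Dom A e) n (\<lambda>x. \<theta> (n, x) \<cdot> c x)" "normalized H (Dom A e) n (\<lambda>x. \<theta> (n, x) \<cdot> c x)"
    using family_nat[OF t c] normalized_cong[OF _ fe(2), of "\<lambda>x. \<theta> (n, x) \<cdot> c x"] tc by simp_all
  have "nmap G H \<theta> n \<cdot> h = e"
  proof (rule nu_ext[OF H, of _ "Dom A e" n])
    fix x assume x [simp]: "x \<in> FObj X n"
    have "nu H n x \<cdot> (nmap G H \<theta> n \<cdot> h) = \<theta> (n, x) \<cdot> b x"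
      using pre_comp[OF nu_nmap[OF t x], of h] h(2)[OF x] tD[OF x] by simp
    also have "\<dots> = normalization H n n (\<lambda>x. \<theta> (n, x) \<cdot> c x) x" unfolding b_def by (rule normalization_nat[OF t c, symmetric]) simp_all
    also have "\<dots> = nu H n x \<cdot> e" using normalization_id[OF H tcf, of n x] tc[OF x] by simp
    finally show "nu H n x \<cdot> (nmap G H \<theta> n \<cdot> h) = nu H n x \<cdot> e" .
  qed (simp_all add: Hom_iff)
  then have "epi_arr A (nmap G H \<theta> n \<cdot> h)" using ev(1) by simp
  then show "epi_arr A (nmap G H \<theta> n)" by (rule epi_cancel) simp_all
qed

end

section \<open>Cofree systems are acyclic\<close>

lemma countable_box: "countable (Arr box_cat)"
proof -
  have "Arr box_cat \<subseteq> (\<Union>m n. {m} \<times> (cube m \<rightarrow>\<^sub>E cube n) \<times> {n})"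
    using box_map_funcset by (auto simp: box_Arr)
  moreover have "finite (cube n)" for n
    unfolding cube_def using finite_lists_length_eq[of "UNIV :: bool set" n] by simp
  then have "countable (\<Union>m n. {m} \<times> (cube m \<rightarrow>\<^sub>E cube n) \<times> {n})"
    by (intro countable_UN) (auto intro!: countable_finite finite_cartesian_product finite_PiE)
  ultimately show ?thesis by (rule countable_subset)
qed

context cubical_coefficients
begin

declare el_sel(2,3) [simp del]

sublocale fc: functor_category E A
  by (intro functor_category.intro category_el) unfold_locales

lemma el_arrow_E [simp]:
  "Dom E (el_arrow X \<alpha> x) = (fst \<alpha>, act X \<alpha> x)" "Cod E (el_arrow X \<alpha> x) = (snd (snd \<alpha>), x)"
  by (simp_all add: el_sel(2,3))

lemma el_ArrE:
  assumes "u \<in> Arr E"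
  obtains \<alpha> y where "u = el_arrow X \<alpha> y" "\<alpha> \<in> Arr box_cat" "y \<in> FObj X (snd (snd \<alpha>))"
  using assms unfolding el_Arr by blast

text \<open>Products indexed by sets of arrows of \<open>\<box>/X\<close> exist because \<open>\<box>\<close> is countable and \<open>'u\<close> is infinite.\<close>

lemma el_arrows_small: obtains \<iota> :: "'u el_arr \<Rightarrow> 'u" where "inj_on \<iota> (Arr E)"
proof -
  obtain j :: "nat \<Rightarrow> 'u" where j: "inj j" using infinite_countable_subset[OF infinite_universe] by blast
  have "(card_of (UNIV :: nat set), card_of (UNIV :: 'u set)) \<in> ordLeq"
    using j unfolding card_of_ordLeq[symmetric] by blast
  then have "(card_of ((UNIV :: 'u set) \<times> (UNIV :: nat set)), card_of (UNIV :: 'u set)) \<in> ordIso"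
    by (intro card_of_Times_infinite[THEN conjunct1]) (use infinite_universe in auto)
  then have "(card_of ((UNIV :: 'u set) \<times> (UNIV :: nat set)), card_of (UNIV :: 'u set)) \<in> ordLeq"
    by (rule ordIso_imp_ordLeq)
  then obtain k :: "'u \<times> nat \<Rightarrow> 'u" where k: "inj k" unfolding card_of_ordLeq[symmetric] by auto
  \<comment> \<open>An arrow of \<open>E\<close> is determined by its cube map and its target
    element, since the source is computed from them.\<close>
  have "inj_on (\<lambda>u. k (snd (snd (snd u)), to_nat_on (Arr box_cat) (fst (snd u)))) (Arr E)"
  proof (rule inj_onI)
    fix u v assume u: "u \<in> Arr E" "v \<in> Arr E"
      and eq: "k (snd (snd (snd u)), to_nat_on (Arr box_cat) (fst (snd u))) = k (snd (snd (snd v)), to_nat_on (Arr box_cat) (fst (snd v)))"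
    obtain \<alpha> x where ux: "u = el_arrow X \<alpha> x" "\<alpha> \<in> Arr box_cat" using el_ArrE[OF u(1)] by blast
    obtain \<beta> y where vy: "v = el_arrow X \<beta> y" "\<beta> \<in> Arr box_cat" using el_ArrE[OF u(2)] by blast
    have "x = y" "to_nat_on (Arr box_cat) \<alpha> = to_nat_on (Arr box_cat) \<beta>"
      using injD[OF k eq] ux vy by simp_all
    then show "u = v" using inj_on_to_nat_on[OF countable_box] ux vy by (auto dest: inj_onD)
  qed
  then show thesis by (rule that)
qed

section \<open>Cofree systems\<close>

definition out :: "nat \<times> 'u \<Rightarrow> 'u el_arr set" where
  "out c = {u \<in> Arr E. Dom E u = c}"

definition cofree_obj :: "('u, 'o, 'm) coefficient_system \<Rightarrow> nat \<times> 'u \<Rightarrow> 'o" where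
  "cofree_obj G c = fst (some_product A (out c) (\<lambda>u. FObj G (Cod E u)))"

definition cofree_pr :: "('u, 'o, 'm) coefficient_system \<Rightarrow> nat \<times> 'u \<Rightarrow> 'u el_arr \<Rightarrow> 'm" where
  "cofree_pr G c = snd (some_product A (out c) (\<lambda>u. FObj G (Cod E u)))"

text \<open>Precomposition with \<open>v\<close> turns arrows out of its target into arrows out of
  its source; this is the induced change of index between the products.\<close>

definition cofree_arr :: "('u, 'o, 'm) coefficient_system \<Rightarrow> 'u el_arr \<Rightarrow> 'm" where
  "cofree_arr G v = (THE h. h \<in> Hom A (cofree_obj G (Dom E v)) (cofree_obj G (Cod E v)) \<and>
     (\<forall>u \<in> out (Cod E v). cofree_pr G (Cod E v) u \<cdot> h = cofree_pr G (Dom E v) (u \<cdot>\<^bsub>E\<^esub> v)))"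

text \<open>The right Kan extension of the object function of \<open>G\<close>: morphisms into it are families of arrows.\<close>

definition cofree :: "('u, 'o, 'm) coefficient_system \<Rightarrow> ('u, 'o, 'm) coefficient_system" where
  "cofree G = \<lparr>FObj = restrict (cofree_obj G) (Obj E), FArr = restrict (cofree_arr G) (Arr E)\<rparr>"

lemma cf_product:
  assumes G: "is_functor E A G"
  shows "is_product A (out c) (\<lambda>u. FObj G (Cod E u)) (cofree_obj G c) (cofree_pr G c)"
proof -
  obtain \<iota> :: "'u el_arr \<Rightarrow> 'u" where \<iota>: "inj_on \<iota> (Arr E)" by (rule el_arrows_small)
  show ?thesis unfolding cofree_obj_def cofree_pr_def
    by (rule some_product_small[of \<iota>]) (use \<iota> functorD(1)[OF G] in \<open>auto simp: out_def intro: inj_on_subset\<close>)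
qed

lemmas cf_obj [simp] = product_obj[OF cf_product]

lemma cofree_pr [simp]:
  assumes "is_functor E A G" "u \<in> Arr E" "Dom E u = c"
  shows "cofree_pr G c u \<in> Arr A" "Dom A (cofree_pr G c u) = cofree_obj G c" "Cod A (cofree_pr G c u) = FObj G (Cod E u)"
  using product_arr[OF cf_product[OF assms(1)], of u c] assms by (simp_all add: out_def)

lemma cofree_arr:
  assumes G [simp]: "is_functor E A G" and v [simp]: "v \<in> Arr E"
  shows "cofree_arr G v \<in> Arr A" "Dom A (cofree_arr G v) = cofree_obj G (Dom E v)" "Cod A (cofree_arr G v) = cofree_obj G (Cod E v)"
    and cofree_pr_cofree_arr: "\<And>u. \<lbrakk>u \<in> Arr E; Dom E u = Cod E v\<rbrakk> \<Longrightarrow> cofree_pr G (Cod E v) u \<cdot> cofree_arr G v = cofree_pr G (Dom E v) (u \<cdot>\<^bsub>E\<^esub> v)"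
proof -
  have "\<exists>!h. h \<in> Hom A (cofree_obj G (Dom E v)) (cofree_obj G (Cod E v)) \<and>
     (\<forall>u \<in> out (Cod E v). cofree_pr G (Cod E v) u \<cdot> h = cofree_pr G (Dom E v) (u \<cdot>\<^bsub>E\<^esub> v))"
    by (rule product_ex1[OF cf_product[OF G]]) (simp_all add: out_def Hom_iff)
  from theI'[OF this, folded cofree_arr_def]
  show "cofree_arr G v \<in> Arr A" "Dom A (cofree_arr G v) = cofree_obj G (Dom E v)" "Cod A (cofree_arr G v) = cofree_obj G (Cod E v)"
    "\<And>u. \<lbrakk>u \<in> Arr E; Dom E u = Cod E v\<rbrakk> \<Longrightarrow> cofree_pr G (Cod E v) u \<cdot> cofree_arr G v = cofree_pr G (Dom E v) (u \<cdot>\<^bsub>E\<^esub> v)"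
    by (auto simp: Hom_iff out_def)
qed

lemma cf_ext:
  assumes G: "is_functor E A G" and h: "h \<in> Arr A" "h' \<in> Arr A" "Dom A h = Dom A h'" "Cod A h = cofree_obj G c" "Cod A h' = cofree_obj G c"
    and eq: "\<And>u. \<lbrakk>u \<in> Arr E; Dom E u = c\<rbrakk> \<Longrightarrow> cofree_pr G c u \<cdot> h = cofree_pr G c u \<cdot> h'"
  shows "h = h'"
  by (rule product_ext[OF cf_product[OF G], of _ "Dom A h" c]) (use h eq in \<open>simp_all add: Hom_iff out_def\<close>)

lemma cofree_functor:
  assumes G [simp]: "is_functor E A G"
  shows "is_functor E A (cofree G)"
  unfolding cofree_def
proof (rule functorI[OF category_el])
  note [simp] = cofree_arr[OF G]
  show "cofree_arr G (Ident E a) = Ident A (cofree_obj G a)" if [simp]: "a \<in> Obj E" for a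
    by (rule cf_ext[OF G, of _ _ a]) (use cofree_pr_cofree_arr[OF G, of "Ident E a"] in simp_all)
  show "cofree_arr G (g \<cdot>\<^bsub>E\<^esub> f) = cofree_arr G g \<cdot> cofree_arr G f"
    if [simp]: "f \<in> Arr E" "g \<in> Arr E" "Dom E g = Cod E f" for f g
  proof (rule cf_ext[OF G, of _ _ "Cod E g"])
    fix u assume [simp]: "u \<in> Arr E" "Dom E u = Cod E g"
    show "cofree_pr G (Cod E g) u \<cdot> cofree_arr G (g \<cdot>\<^bsub>E\<^esub> f) = cofree_pr G (Cod E g) u \<cdot> (cofree_arr G g \<cdot> cofree_arr G f)"
      using cofree_pr_cofree_arr[OF G, of "g \<cdot>\<^bsub>E\<^esub> f" u] pre_comp[OF cofree_pr_cofree_arr[OF G, of g u], of "cofree_arr G f"]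
        cofree_pr_cofree_arr[OF G, of f "u \<cdot>\<^bsub>E\<^esub> g"] by simp
  qed simp_all
qed (use cofree_arr[OF G] in simp_all)

lemma cofree_sel:
  "c \<in> Obj E \<Longrightarrow> FObj (cofree G) c = cofree_obj G c" "v \<in> Arr E \<Longrightarrow> FArr (cofree G) v = cofree_arr G v"
  by (simp_all add: cofree_def)

text \<open>The universal property of the right Kan extension: the component at \<open>u\<close>
  must be \<open>\<theta> (Cod E u) \<cdot> FArr H u\<close>, and this choice is natural for an
  arbitrary family \<open>\<theta>\<close>, natural or not.\<close>

lemma cofree_lift:
  assumes H: "is_functor E A H" and G [simp]: "is_functor E A G"
    and \<theta>: "\<And>c. c \<in> Obj E \<Longrightarrow> \<theta> c \<in> Hom A (FObj H c) (FObj G c)"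
  obtains \<eta> where "is_nattrans E A H (cofree G) \<eta>" "\<And>c. c \<in> Obj E \<Longrightarrow> cofree_pr G c (Ident E c) \<cdot> \<eta> c = \<theta> c"
proof -
  note [simp] = functorD[OF H] \<theta>[unfolded Hom_iff] cofree_arr[OF G]
  have "\<forall>c \<in> Obj E. \<exists>h. h \<in> Hom A (FObj H c) (cofree_obj G c) \<and> (\<forall>u \<in> out c. cofree_pr G c u \<cdot> h = \<theta> (Cod E u) \<cdot> FArr H u)"
  proof
    fix c assume c: "c \<in> Obj E"
    have "\<exists>!h. h \<in> Hom A (FObj H c) (cofree_obj G c) \<and> (\<forall>u \<in> out c. cofree_pr G c u \<cdot> h = \<theta> (Cod E u) \<cdot> FArr H u)"
      by (rule product_ex1[OF cf_product[OF G]]) (use c in \<open>auto simp: out_def Hom_iff\<close>)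
    then show "\<exists>h. h \<in> Hom A (FObj H c) (cofree_obj G c) \<and> (\<forall>u \<in> out c. cofree_pr G c u \<cdot> h = \<theta> (Cod E u) \<cdot> FArr H u)" by blast
  qed
  from bchoice[OF this] obtain \<eta> where \<eta>: "\<forall>c \<in> Obj E. \<eta> c \<in> Hom A (FObj H c) (cofree_obj G c) \<and>
    (\<forall>u \<in> out c. cofree_pr G c u \<cdot> \<eta> c = \<theta> (Cod E u) \<cdot> FArr H u)" by blast
  have e: "\<eta> c \<in> Hom A (FObj H c) (cofree_obj G c)" if "c \<in> Obj E" for c using \<eta> that by blast
  have ep: "cofree_pr G c u \<cdot> \<eta> c = \<theta> (Cod E u) \<cdot> FArr H u" if "c \<in> Obj E" "u \<in> Arr E" "Dom E u = c" for c u
    using \<eta> that unfolding out_def by blast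
  note [simp] = e[unfolded Hom_iff]
  have "is_nattrans E A H (cofree G) (restrict \<eta> (Obj E))"
  proof (rule nattransI[OF H cofree_functor[OF G]])
    fix v assume v [simp]: "v \<in> Arr E"
    have "\<eta> (Cod E v) \<cdot> FArr H v = cofree_arr G v \<cdot> \<eta> (Dom E v)"
    proof (rule cf_ext[OF G, of _ _ "Cod E v"])
      fix u assume u [simp]: "u \<in> Arr E" "Dom E u = Cod E v"
      have o: "Cod E v \<in> Obj E" "Dom E v \<in> Obj E" by simp_all
      show "cofree_pr G (Cod E v) u \<cdot> (\<eta> (Cod E v) \<cdot> FArr H v) = cofree_pr G (Cod E v) u \<cdot> (cofree_arr G v \<cdot> \<eta> (Dom E v))"
        using pre_comp[OF ep[OF o(1) u], of "FArr H v"] pre_comp[OF cofree_pr_cofree_arr[OF G v u], of "\<eta> (Dom E v)"]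
          ep[OF o(2), of "u \<cdot>\<^bsub>E\<^esub> v"] by simp
    qed simp_all
    then show "restrict \<eta> (Obj E) (Cod E v) \<cdot> FArr H v = FArr (cofree G) v \<cdot> restrict \<eta> (Obj E) (Dom E v)"
      by (simp add: cofree_sel)
  qed (simp_all add: cofree_sel)
  moreover have "cofree_pr G c (Ident E c) \<cdot> restrict \<eta> (Obj E) c = \<theta> c" if "c \<in> Obj E" for c
    using ep[of c "Ident E c"] that by simp
  ultimately show thesis by (rule that)
qed

text \<open>By naturality the component at an arrow \<open>u\<close> is the identity component at
  the target of \<open>u\<close>, composed with \<open>FArr H u\<close>.\<close>

lemma cofree_ext:
  assumes s: "is_nattrans E A H (cofree G) \<eta>" and t: "is_nattrans E A H (cofree G) \<theta>" and G [simp]: "is_functor E A G"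
    and eq: "\<And>c. c \<in> Obj E \<Longrightarrow> cofree_pr G c (Ident E c) \<cdot> \<eta> c = cofree_pr G c (Ident E c) \<cdot> \<theta> c" and c [simp]: "c \<in> Obj E"
  shows "\<eta> c = \<theta> c"
proof (rule cf_ext[OF G, of _ _ c])
  note [simp] = nattransD(4-6)[OF s] nattransD(4-6)[OF t] cofree_sel functorD[OF nattransD(1)[OF s]] cofree_arr[OF G]
  fix u assume u [simp]: "u \<in> Arr E" "Dom E u = c"
  have 1: "cofree_pr G c u \<cdot> \<kappa> c = (cofree_pr G (Cod E u) (Ident E (Cod E u)) \<cdot> \<kappa> (Cod E u)) \<cdot> FArr H u"
    if k: "is_nattrans E A H (cofree G) \<kappa>" for \<kappa>
    using nattransD(7)[OF k u(1)] nattransD(4-6)[OF k] pre_comp[OF cofree_pr_cofree_arr[OF G u(1), of "Ident E (Cod E u)"], of "\<kappa> c"]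
    by simp
  show "cofree_pr G c u \<cdot> \<eta> c = cofree_pr G c u \<cdot> \<theta> c" unfolding 1[OF s] 1[OF t] by (simp only: eq fc.C.cod_obj[OF u(1)])
qed (use nattransD(4-6)[OF s c] nattransD(4-6)[OF t c] cofree_sel in simp_all)

definition cofree_unit :: "('u, 'o, 'm) coefficient_system \<Rightarrow> nat \<times> 'u \<Rightarrow> 'm" where
  "cofree_unit G = (SOME \<eta>. is_nattrans E A G (cofree G) \<eta> \<and> (\<forall>c \<in> Obj E. cofree_pr G c (Ident E c) \<cdot> \<eta> c = Ident A (FObj G c)))"

lemma cofree_unit:
  assumes G: "is_functor E A G"
  shows "is_nattrans E A G (cofree G) (cofree_unit G)" "c \<in> Obj E \<Longrightarrow> cofree_pr G c (Ident E c) \<cdot> cofree_unit G c = Ident A (FObj G c)"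
proof -
  have "\<exists>\<eta>. is_nattrans E A G (cofree G) \<eta> \<and> (\<forall>c \<in> Obj E. cofree_pr G c (Ident E c) \<cdot> \<eta> c = Ident A (FObj G c))"
    by (rule cofree_lift[OF G G, of "\<lambda>c. Ident A (FObj G c)"]) (use functorD(1)[OF G] in \<open>auto simp: Hom_iff\<close>)
  from someI_ex[OF this, folded cofree_unit_def]
  show "is_nattrans E A G (cofree G) (cofree_unit G)" "c \<in> Obj E \<Longrightarrow> cofree_pr G c (Ident E c) \<cdot> cofree_unit G c = Ident A (FObj G c)"
    by auto
qed

text \<open>The projection to the identity component is a left inverse at each object. These left
  inverses need not be natural, so \<open>G\<close> is in general no direct summand of
  \<open>cofree G\<close>.\<close>

lemma cofree_unit_mono:
  assumes G: "is_functor E A G" and c: "c \<in> Obj E"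
  shows "mono_arr A (cofree_unit G c)"
proof (rule mono_cancel)
  show "mono_arr A (cofree_pr G c (Ident E c) \<cdot> cofree_unit G c)"
    using cofree_unit(2)[OF G c] functorD(1)[OF G c] by (auto simp: mono_arr_def Hom_iff)
qed (use nattransD(4-6)[OF cofree_unit(1)[OF G] c] G c cofree_sel in simp_all)

lemma cofree_extend:
  assumes t: "is_nattrans E A F G \<eta>"
  obtains \<rho> where "is_nattrans E A (cofree F) (cofree G) \<rho>" "\<And>c. c \<in> Obj E \<Longrightarrow> \<rho> c \<cdot> cofree_unit F c = cofree_unit G c \<cdot> \<eta> c"
proof -
  note F [simp] = nattransD(1)[OF t] and G [simp] = nattransD(2)[OF t]
  note [simp] = cofree_sel nattransD(4-6)[OF t] nattransD(4-6)[OF cofree_unit(1)[OF F]] nattransD(4-6)[OF cofree_unit(1)[OF G]]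
  obtain \<rho> where r: "is_nattrans E A (cofree F) (cofree G) \<rho>"
    "\<And>c. c \<in> Obj E \<Longrightarrow> cofree_pr G c (Ident E c) \<cdot> \<rho> c = \<eta> c \<cdot> cofree_pr F c (Ident E c)"
    by (rule cofree_lift[OF cofree_functor[OF F] G, of "\<lambda>c. \<eta> c \<cdot> cofree_pr F c (Ident E c)"]) (simp_all add: Hom_iff)
  note [simp] = nattransD(4-6)[OF r(1)]
  have cn: "is_nattrans E A H H'' (\<lambda>c \<in> Obj E. \<theta> c \<cdot> \<zeta> c)"
    if "is_nattrans E A H H' \<zeta>" "is_nattrans E A H' H'' \<theta>" for H H' H'' \<zeta> \<theta>
    using fc.FC.comp_hom[of "(H, \<zeta>, H')" H H' "(H', \<theta>, H'')" H''] that by (simp add: functor_cat_Hom)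
  have "(\<lambda>c \<in> Obj E. \<rho> c \<cdot> cofree_unit F c) c = (\<lambda>c \<in> Obj E. cofree_unit G c \<cdot> \<eta> c) c" if c: "c \<in> Obj E" for c
  proof (rule cofree_ext[OF cn[OF cofree_unit(1)[OF F] r(1)] cn[OF t cofree_unit(1)[OF G]] G _ c])
    fix c assume c [simp]: "c \<in> Obj E"
    show "cofree_pr G c (Ident E c) \<cdot> (\<lambda>c \<in> Obj E. \<rho> c \<cdot> cofree_unit F c) c = cofree_pr G c (Ident E c) \<cdot> (\<lambda>c \<in> Obj E. cofree_unit G c \<cdot> \<eta> c) c"
      using pre_comp[OF r(2)[OF c], of "cofree_unit F c"] cofree_unit(2)[OF F c] pre_comp[OF cofree_unit(2)[OF G c], of "\<eta> c"] by simp
  qed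
  then show thesis using that[OF r(1)] by simp
qed

text \<open>A family with values in \<open>cofree G\<close> amounts to arrows indexed by the maps \<open>\<alpha>\<close> into the cubes \<open>y\<close>, on which
  the operators act by precomposition; for fixed \<open>y\<close> these are cochains of a standard cube.\<close>

definition cube_component :: "('u, 'o, 'm) coefficient_system \<Rightarrow> ('u \<Rightarrow> 'm) \<Rightarrow> box_arr \<Rightarrow> 'u \<Rightarrow> 'm" where
  "cube_component G f \<alpha> y = cofree_pr G (fst \<alpha>, act X \<alpha> y) (el_arrow X \<alpha> y) \<cdot> f (act X \<alpha> y)"

lemma cofree_familyD:
  assumes "family (cofree G) P k f" "x \<in> FObj X k"
  shows "f x \<in> Arr A" "Dom A (f x) = P" "Cod A (f x) = cofree_obj G (k, x)"
  using familyD[OF assms(1)] assms(2) by (simp_all add: cofree_sel)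

lemma cube_component_arr:
  assumes G [simp]: "is_functor E A G" and f: "family (cofree G) P (fst \<alpha>) f" and a: "\<alpha> \<in> Arr box_cat" "y \<in> FObj X (snd (snd \<alpha>))"
  shows "cube_component G f \<alpha> y \<in> Arr A" "Dom A (cube_component G f \<alpha> y) = P" "Cod A (cube_component G f \<alpha> y) = FObj G (snd (snd \<alpha>), y)"
  using cofree_familyD[OF f act_obj[OF a]] el_arrow_Arr[OF a] by (simp_all add: cube_component_def)

text \<open>The arrows of the cofree system reindex by composition, so the coefficients
  \<open>G\<close> are never applied to an arrow: only the cube maps move, and each \<open>y\<close>
  stays fixed.\<close>

lemma cube_component_transport:
  assumes G [simp]: "is_functor E A G" and f: "family (cofree G) P (fst \<beta>) f" and b: "\<beta> \<in> Arr box_cat"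
    and a: "\<alpha> \<in> Arr box_cat" "y \<in> FObj X (snd (snd \<alpha>))" and m: "fst \<alpha> = snd (snd \<beta>)"
  shows "cube_component G (transport (cofree G) \<beta> f) \<alpha> y = cube_component G f (\<alpha> \<cdot>\<^bsub>box_cat\<^esub> \<beta>) y"
proof -
  have x: "act X \<alpha> y \<in> FObj X (snd (snd \<beta>))" using act_obj[OF a] m by simp
  note v = el_arrow_Arr[OF b x] and u = el_arrow_Arr[OF a]
  note [simp] = cofree_arr[OF G v] cofree_familyD[OF f act_obj[OF b x]]
  have "cofree_pr G (Cod E (el_arrow X \<beta> (act X \<alpha> y))) (el_arrow X \<alpha> y) \<cdot> cofree_arr G (el_arrow X \<beta> (act X \<alpha> y)) =
    cofree_pr G (Dom E (el_arrow X \<beta> (act X \<alpha> y))) (el_arrow X \<alpha> y \<cdot>\<^bsub>E\<^esub> el_arrow X \<beta> (act X \<alpha> y))"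
    by (rule cofree_pr_cofree_arr[OF G v u]) (simp add: m)
  then have 1: "cofree_pr G (fst \<alpha>, act X \<alpha> y) (el_arrow X \<alpha> y) \<cdot> cofree_arr G (el_arrow X \<beta> (act X \<alpha> y)) =
    cofree_pr G (fst \<beta>, act X \<beta> (act X \<alpha> y)) (el_arrow X (\<alpha> \<cdot>\<^bsub>box_cat\<^esub> \<beta>) y)"
    using el_arrow_comp[OF b a(1) m a(2)] m by simp
  show ?thesis
    using pre_comp[OF 1, of "f (act X \<beta> (act X \<alpha> y))"] u v m
    by (simp add: cube_component_def transport_def cofree_sel act_comp[OF b a(1) m a(2)] box_comp_Arr[OF b a(1) m])
qed

lemma cube_component_ext:
  assumes G [simp]: "is_functor E A G" and f: "family (cofree G) P k f" "family (cofree G) P k f'"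
    and eq: "\<And>\<alpha> y. \<lbrakk>\<alpha> \<in> Arr box_cat; fst \<alpha> = k; y \<in> FObj X (snd (snd \<alpha>))\<rbrakk> \<Longrightarrow> cube_component G f \<alpha> y = cube_component G f' \<alpha> y"
    and x: "x \<in> FObj X k"
  shows "f x = f' x"
proof (rule cf_ext[OF G, of _ _ "(k, x)"])
  fix u assume u: "u \<in> Arr E" "Dom E u = (k, x)"
  obtain \<alpha> y where a: "u = el_arrow X \<alpha> y" "\<alpha> \<in> Arr box_cat" "y \<in> FObj X (snd (snd \<alpha>))" by (rule el_ArrE[OF u(1)])
  then show "cofree_pr G (k, x) u \<cdot> f x = cofree_pr G (k, x) u \<cdot> f' x" using eq[OF a(2) _ a(3)] u(2) by (simp add: cube_component_def)
qed (use cofree_familyD[OF f(1) x] cofree_familyD[OF f(2) x] in simp_all)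

text \<open>The values at different pairs of \<open>\<alpha>\<close> and \<open>y\<close> may be
  prescribed independently, because these pairs index the factors of the products without
  repetition.\<close>

lemma cube_component_realize:
  assumes G [simp]: "is_functor E A G" and P: "P \<in> Obj A"
    and B: "\<And>\<alpha> y. \<lbrakk>\<alpha> \<in> Arr box_cat; fst \<alpha> = k; y \<in> FObj X (snd (snd \<alpha>))\<rbrakk> \<Longrightarrow> B \<alpha> y \<in> Hom A P (FObj G (snd (snd \<alpha>), y))"
  obtains f where "family (cofree G) P k f"
    "\<And>\<alpha> y. \<lbrakk>\<alpha> \<in> Arr box_cat; fst \<alpha> = k; y \<in> FObj X (snd (snd \<alpha>))\<rbrakk> \<Longrightarrow> cube_component G f \<alpha> y = B \<alpha> y"
proof -
  have "\<forall>x \<in> FObj X k. \<exists>h. h \<in> Hom A P (cofree_obj G (k, x)) \<and> (\<forall>u \<in> out (k, x). cofree_pr G (k, x) u \<cdot> h = B (fst (snd u)) (snd (snd (snd u))))"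
  proof
    fix x assume x: "x \<in> FObj X k"
    have "\<exists>!h. h \<in> Hom A P (cofree_obj G (k, x)) \<and> (\<forall>u \<in> out (k, x). cofree_pr G (k, x) u \<cdot> h = B (fst (snd u)) (snd (snd (snd u))))"
    proof (rule product_ex1[OF cf_product[OF G] P])
      fix u assume "u \<in> out (k, x)"
      then have u: "u \<in> Arr E" "Dom E u = (k, x)" by (auto simp: out_def)
      obtain \<alpha> y where a: "u = el_arrow X \<alpha> y" "\<alpha> \<in> Arr box_cat" "y \<in> FObj X (snd (snd \<alpha>))" by (rule el_ArrE[OF u(1)])
      then show "B (fst (snd u)) (snd (snd (snd u))) \<in> Hom A P (FObj G (Cod E u))" using B[of \<alpha> y] u by simp
    qed
    then show "\<exists>h. h \<in> Hom A P (cofree_obj G (k, x)) \<and> (\<forall>u \<in> out (k, x). cofree_pr G (k, x) u \<cdot> h = B (fst (snd u)) (snd (snd (snd u))))" by blast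
  qed
  from bchoice[OF this] obtain f where f: "\<And>x. x \<in> FObj X k \<Longrightarrow> f x \<in> Hom A P (cofree_obj G (k, x))"
    "\<And>x u. \<lbrakk>x \<in> FObj X k; u \<in> out (k, x)\<rbrakk> \<Longrightarrow> cofree_pr G (k, x) u \<cdot> f x = B (fst (snd u)) (snd (snd (snd u)))" by blast
  show thesis
  proof (rule that)
    show "family (cofree G) P k f" by (rule familyI[OF P]) (use f(1) in \<open>simp add: cofree_sel Hom_iff\<close>)
    fix \<alpha> y assume a: "\<alpha> \<in> Arr box_cat" "fst \<alpha> = k" "y \<in> FObj X (snd (snd \<alpha>))"
    show "cube_component G f \<alpha> y = B \<alpha> y"
      using f(2)[of "act X \<alpha> y" "el_arrow X \<alpha> y"] act_obj[OF a(1,3)] a el_arrow_Arr[OF a(1,3)]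
      by (simp add: cube_component_def out_def)
  qed
qed

lemma cube_component_coboundary:
  assumes G [simp]: "is_functor E A G" and f: "family (cofree G) P k f"
    and a: "\<alpha> \<in> Arr box_cat" "y \<in> FObj X (snd (snd \<alpha>))" and m: "fst \<alpha> = Suc k"
  shows "cube_component G (coboundary (cofree G) P k f) \<alpha> y = asum P (FObj G (snd (snd \<alpha>), y))
    (\<lambda>i. cube_component G f (\<alpha> \<cdot>\<^bsub>box_cat\<^esub> face (Suc k) i False) y \<boxminus> cube_component G f (\<alpha> \<cdot>\<^bsub>box_cat\<^esub> face (Suc k) i True) y) (Suc k)"
proof -
  note R = cofree_functor[OF G]
  have x: "act X \<alpha> y \<in> FObj X (Suc k)" using act_obj[OF a] m by simp
  note u = el_arrow_Arr[OF a]
  have "cube_component G (coboundary (cofree G) P k f) \<alpha> y =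
    asum P (Cod A (cofree_pr G (fst \<alpha>, act X \<alpha> y) (el_arrow X \<alpha> y)))
     (\<lambda>i. cofree_pr G (fst \<alpha>, act X \<alpha> y) (el_arrow X \<alpha> y) \<cdot> face_diff (cofree G) (Suc k) i f (act X \<alpha> y)) (Suc k)"
    unfolding cube_component_def coboundary_def
    by (rule asum_comp_left[OF face_diff_arrs[OF R f x]]) (use u x m in \<open>simp_all add: cofree_sel\<close>)
  also have "\<dots> = asum P (FObj G (snd (snd \<alpha>), y))
    (\<lambda>i. cube_component G f (\<alpha> \<cdot>\<^bsub>box_cat\<^esub> face (Suc k) i False) y \<boxminus> cube_component G f (\<alpha> \<cdot>\<^bsub>box_cat\<^esub> face (Suc k) i True) y) (Suc k)"
  proof -
    have "Cod A (cofree_pr G (fst \<alpha>, act X \<alpha> y) (el_arrow X \<alpha> y)) = FObj G (snd (snd \<alpha>), y)" using u by simp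
    moreover have "cofree_pr G (fst \<alpha>, act X \<alpha> y) (el_arrow X \<alpha> y) \<cdot> face_diff (cofree G) (Suc k) i f (act X \<alpha> y) =
      cube_component G f (\<alpha> \<cdot>\<^bsub>box_cat\<^esub> face (Suc k) i False) y \<boxminus> cube_component G f (\<alpha> \<cdot>\<^bsub>box_cat\<^esub> face (Suc k) i True) y"
      if i: "1 \<le> i" "i \<le> Suc k" for i
    proof -
      note fi = face_arr[OF i]
      have c: "cofree_pr G (fst \<alpha>, act X \<alpha> y) (el_arrow X \<alpha> y) \<cdot> transport (cofree G) (face (Suc k) i e) f (act X \<alpha> y) = cube_component G f (\<alpha> \<cdot>\<^bsub>box_cat\<^esub> face (Suc k) i e) y" for e
        using cube_component_transport[OF G _ fi(1)[of e] a, of P f] fi(2,3) f m by (simp add: cube_component_def)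
      show ?thesis
        using transport_arr[OF R fi(1), of P _ f "act X \<alpha> y"] fi(2,3) f x u m
        by (simp add: face_diff_def cofree_sel flip: c)
    qed
    ultimately show ?thesis by (intro arg_cong2[of _ _ _ _ "\<lambda>b f. asum P b f (Suc k)"] asum_cong[THEN trans[rotated]]) (auto intro!: asum_cong)
  qed
  finally show ?thesis .
qed

end

section \<open>Cellular cochains of a standard cube\<close>

context preadditive
begin

text \<open>The cube is treated as the product of an interval and a smaller cube. A leading star
  contributes the difference of the two ends of the interval; the minus sign before the remaining
  part is the usual one of a tensor product of complexes.\<close>

fun word_diff :: "'o \<Rightarrow> 'o \<Rightarrow> (bool option list \<Rightarrow> 'm) \<Rightarrow> bool option list \<Rightarrow> 'm" where
  "word_diff a b c [] = ZeroArr A a b"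
| "word_diff a b c (Some e # w) = word_diff a b (\<lambda>v. c (Some e # v)) w"
| "word_diff a b c (None # w) = c (Some True # w) \<boxminus> c (Some False # w) \<boxminus> word_diff a b (\<lambda>v. c (None # v)) w"

definition word_arrs :: "'o \<Rightarrow> 'o \<Rightarrow> (bool option list \<Rightarrow> 'm) \<Rightarrow> bool" where
  "word_arrs a b c \<longleftrightarrow> a \<in> Obj A \<and> b \<in> Obj A \<and> (\<forall>w. c w \<in> Arr A \<and> Dom A (c w) = a \<and> Cod A (c w) = b)"

lemma word_arrsD:
  assumes "word_arrs a b c"
  shows "a \<in> Obj A" "b \<in> Obj A" "c w \<in> Arr A" "Dom A (c w) = a" "Cod A (c w) = b" "word_arrs a b (\<lambda>v. c (x # v))"
  using assms by (auto simp: word_arrs_def)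

lemma word_diff_arr: "word_arrs a b c \<Longrightarrow> word_diff a b c w \<in> Arr A \<and> Dom A (word_diff a b c w) = a \<and> Cod A (word_diff a b c w) = b"
proof (induction a b c w rule: word_diff.induct)
  case (3 a b c w)
  then show ?case using word_arrsD[OF 3(2)] by simp
qed (auto simp: word_arrs_def)

lemma word_diff_add: "\<lbrakk>word_arrs a b c; word_arrs a b c'\<rbrakk> \<Longrightarrow> word_diff a b (\<lambda>v. c v \<boxplus> c' v) w = word_diff a b c w \<boxplus> word_diff a b c' w"
proof (induction w arbitrary: c c')
  case Nil
  then show ?case by (simp add: word_arrs_def)
next
  case (Cons x w)
  note D = word_arrsD[OF Cons(2)] word_arrsD[OF Cons(3)]
  note [simp] = D(1-5) D(7-11) word_diff_arr[OF D(6)] word_diff_arr[OF D(12)]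
  show ?case
  proof (cases x)
    case None
    show ?thesis unfolding None word_diff.simps Cons(1)[OF D(6,12)] by (simp add: add_ac)
  next
    case (Some e)
    show ?thesis unfolding Some word_diff.simps by (rule Cons(1)[OF D(6,12)])
  qed
qed

lemma word_diff_zero: "a \<in> Obj A \<Longrightarrow> b \<in> Obj A \<Longrightarrow> word_diff a b (\<lambda>v. ZeroArr A a b) w = ZeroArr A a b"
proof (induction w)
  case (Cons x w)
  then show ?case by (cases x) auto
qed simp

text \<open>Brings the recursive differential to the shape of the cubical coboundary. The difference
  starts with the end \<open>False\<close> because the first term of \<open>asum\<close> carries a
  minus sign.\<close>

lemma word_diff_asum: "word_arrs a b c \<Longrightarrow>
  word_diff a b c w = asum a b (\<lambda>i. c (star_subst i False w) \<boxminus> c (star_subst i True w)) (stars w)"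
proof (induction w arbitrary: c)
  case (Cons x w)
  note D = word_arrsD[OF Cons(2)]
  note [simp] = D(1-5) word_diff_arr[OF D(6)]
  show ?case
  proof (cases x)
    case None
    define g where "g i = c (star_subst i False (None # w)) \<boxminus> c (star_subst i True (None # w))" for i
    have g: "arrs a b g n" for n by (rule arrsI) (simp_all add: g_def Hom_iff)
    have gs: "asum a b (\<lambda>i. g (Suc i)) (stars w) = word_diff a b (\<lambda>v. c (None # v)) w"
      unfolding Cons(1)[OF D(6)] by (rule asum_cong) (simp add: g_def)
    have "asum a b g (Suc (stars w)) = neg (g 1 \<boxplus> asum a b (\<lambda>i. g (Suc i)) (stars w))"
      by (rule asum_shift[OF g])
    also have "\<dots> = word_diff a b c (None # w)" unfolding gs using word_diff_arr[OF D(6), of None w] by (simp add: g_def add_ac)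
    finally have e: "asum a b g (Suc (stars w)) = word_diff a b c (None # w)" .
    have st: "stars (None # w) = Suc (stars w)" by simp
    show ?thesis unfolding None st by (rule e[unfolded g_def[abs_def], symmetric])
  next
    case (Some e)
    show ?thesis unfolding Some word_diff.simps Cons(1)[OF D(6)] by simp
  qed
qed simp

text \<open>\<open>word_diff\<close> is the differential of the cellular cochain complex of a standard cube, whose cells are the
  words; the cube is contractible.\<close>

lemma word_diff_exact:
  assumes "word_arrs a b c" "\<And>w. \<lbrakk>length w = m; stars w = 0\<rbrakk> \<Longrightarrow> c w = ZeroArr A a b"
    "\<And>w. length w = m \<Longrightarrow> word_diff a b c w = ZeroArr A a b"
  shows "\<exists>k. word_arrs a b k \<and> (\<forall>w. length w = m \<longrightarrow> word_diff a b k w = c w)"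
  using assms
proof (induction m arbitrary: c)
  \<comment> \<open>A point has cohomology in degree 0 only; the assumed vanishing of
    \<open>c\<close> on words without stars excludes it.\<close>
  case 0
  then show ?case by (intro exI[of _ "\<lambda>_. ZeroArr A a b"]) (auto simp: word_arrs_def)
next
  case (Suc m)
  note D = word_arrsD[OF Suc(2)]
  note [simp] = D(1-5)
  \<comment> \<open>Induction on the face where the first coordinate is \<open>False\<close>, to
    which the hypotheses on \<open>c\<close> restrict.\<close>
  have "\<exists>k. word_arrs a b k \<and> (\<forall>w. length w = m \<longrightarrow> word_diff a b k w = c (Some False # w))"
    by (rule Suc(1)[OF D(6)]) (use Suc(3)[of "Some False # _"] Suc(4)[of "Some False # _"] in simp_all)
  then obtain k where k: "word_arrs a b k" "\<And>w. length w = m \<Longrightarrow> word_diff a b k w = c (Some False # w)" by blast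
  note [simp] = word_arrsD(3-5)[OF k(1)]
  \<comment> \<open>The contraction of the first coordinate: the primitive is \<open>k\<close> on
    the face \<open>False\<close>, and on the face \<open>True\<close> it is corrected by the value
    of \<open>c\<close> on the cell swept out in between. On cells that extend in the first
    direction it may be taken to be zero.\<close>
  define l where "l w = (case w of Some False # v \<Rightarrow> k v | Some True # v \<Rightarrow> k v \<boxplus> c (None # v) | _ \<Rightarrow> ZeroArr A a b)" for w
  have l: "l (Some False # v) = k v" "l (Some True # v) = k v \<boxplus> c (None # v)" "l (None # v) = ZeroArr A a b" for v
    by (simp_all add: l_def)
  have la: "word_arrs a b l" unfolding word_arrs_def by (auto simp: l_def split: list.split option.split bool.split)
  have "word_diff a b l w = c w" if w: "length w = Suc m" for w
  proof -
    obtain x v where xv: "w = x # v" "length v = m" using w by (cases w) auto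
    note n = word_diff_arr[OF D(6)[of None], of v]
    consider "x = None" | "x = Some False" | "x = Some True" by (cases x) auto
    then show ?thesis
    proof cases
      case 1
      then show ?thesis by (simp add: xv l word_diff_zero add_ac)
    next
      case 2
      then show ?thesis using k(2)[OF xv(2)] by (simp add: xv l)
    next
      case 3
      have "c (Some True # v) \<boxminus> c (Some False # v) \<boxminus> word_diff a b (\<lambda>v. c (None # v)) v = ZeroArr A a b"
        using Suc(4)[of "None # v"] xv(2) by simp
      then have "c (Some True # v) \<boxminus> c (Some False # v) = word_diff a b (\<lambda>v. c (None # v)) v"
        by - (rule sub_eq_zero, use n in simp_all)
      then have "c (Some False # v) \<boxplus> word_diff a b (\<lambda>v. c (None # v)) v = c (Some False # v) \<boxplus> (c (Some True # v) \<boxminus> c (Some False # v))" by simp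
      also have "\<dots> = c (Some True # v)" by (subst add_comm) (simp_all add: add_assoc)
      finally show ?thesis using 3 word_diff_add[OF k(1) D(6)[of None], of v] k(2)[OF xv(2)] by (simp add: xv l)
    qed
  qed
  then show ?case using la by blast
qed

end

section \<open>Acyclicity of cofree systems\<close>

context cubical_coefficients
begin

lemma cofree_acyclic:
  assumes G [simp]: "is_functor E A G" and c: "cocycle (ndiff (cofree G)) (Suc n) c"
  shows "boundary (ndiff (cofree G)) (Suc n) c"
proof -
  let ?R = "cofree G"
  note R = cofree_functor[OF G]
  define P where "P = Dom A c"
  note c' [simp] = cocycleD[OF c] ndiff(1-3)[OF R]
  have P [simp]: "P \<in> Obj A" by (simp add: P_def)
  define f where "f x = nu ?R (Suc n) x \<cdot> c" for x
  have f: "family ?R P (Suc n) f" "normalized ?R P (Suc n) f"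
    using family_comp[OF nu_family[OF R], of c "Suc n"] normalized_comp_right[OF R nu_family[OF R] nu_normalized[OF R], of c "Suc n"]
    by (simp_all add: f_def[abs_def] P_def)
  have df: "coboundary ?R P (Suc n) f x = ZeroArr A P (FObj ?R (Suc (Suc n), x))" if x: "x \<in> FObj X (Suc (Suc n))" for x
    using nu_ndiff_comp[OF R _ _ x, of c] familyD(2-4)[OF nu_family[OF R], of x "Suc (Suc n)"] x nincl(5)[OF R]
    by (simp add: f_def[abs_def] P_def)
  \<comment> \<open>Components of a normalized family at maps through a degeneracy vanish. Since all
    other maps are faces, such a family is determined by its components at words.\<close>
  have zero: "cube_component G g (\<gamma> \<cdot>\<^bsub>box_cat\<^esub> degeneracy k i) y = ZeroArr A P (FObj G (snd (snd \<gamma>), y))"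
    if g: "family ?R P k g" "normalized ?R P k g" and i: "1 \<le> i" "i \<le> k"
      and ga: "\<gamma> \<in> Arr box_cat" "fst \<gamma> = k - 1" "y \<in> FObj X (snd (snd \<gamma>))" for g \<gamma> k i y
  proof -
    note si = degeneracy_arr[OF i]
    have x: "act X \<gamma> y \<in> FObj X (k - 1)" using act_obj[OF ga(1,3)] ga(2) by simp
    have "cube_component G g (\<gamma> \<cdot>\<^bsub>box_cat\<^esub> degeneracy k i) y = cube_component G (transport ?R (degeneracy k i) g) \<gamma> y"
      by (rule cube_component_transport[OF G _ si(1) ga(1,3), symmetric]) (use si g ga in simp_all)
    also have "\<dots> = ZeroArr A P (FObj G (snd (snd \<gamma>), y))"
      using g(2)[unfolded normalized_def] i x el_arrow_Arr[OF ga(1,3)] ga(2) by (simp add: cube_component_def cofree_sel)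
    finally show ?thesis .
  qed
  \<comment> \<open>For each cube \<open>y\<close> of dimension \<open>m\<close> the family
    \<open>f\<close> is a cellular cochain on words with \<open>Suc n\<close> stars. It is extended
    by zero, as \<open>word_diff_exact\<close> treats all words of a given length together and asks
    for arrows at words of any length.\<close>
  define cw where "cw m y w = (if stars w = Suc n \<and> length w = m then cube_component G f (word_arr w) y else ZeroArr A P (FObj G (m, y)))" for m y w
  have cwa: "word_arrs P (FObj G (m, y)) (cw m y)" if y: "y \<in> FObj X m" for m y
  proof -
    have "cube_component G f (word_arr w) y \<in> Arr A \<and> Dom A (cube_component G f (word_arr w) y) = P \<and> Cod A (cube_component G f (word_arr w) y) = FObj G (m, y)"
      if "stars w = Suc n" "length w = m" for w
      using cube_component_arr[OF G _ word_arr_Arr, of P w f y] f(1) that y by simp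
    then show ?thesis using el_functor_obj[OF G y] by (auto simp: word_arrs_def cw_def)
  qed
  have "\<exists>k. word_arrs P (FObj G (m, y)) k \<and> (\<forall>w. length w = m \<longrightarrow> word_diff P (FObj G (m, y)) k w = cw m y w)"
    if y: "y \<in> FObj X m" for m y
  proof (rule word_diff_exact[OF cwa[OF y]])
    fix w :: "bool option list" assume w: "length w = m"
    have b: "FObj G (m, y) \<in> Obj A" by (rule el_functor_obj[OF G y])
    show "stars w = 0 \<Longrightarrow> cw m y w = ZeroArr A P (FObj G (m, y))" by (simp add: cw_def)
    show "word_diff P (FObj G (m, y)) (cw m y) w = ZeroArr A P (FObj G (m, y))"
    \<comment> \<open>Substitution removes one star, so the differential of \<open>cw\<close> can be
      nonzero only on words with \<open>Suc (Suc n)\<close> stars. There it is a component of the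
      coboundary of \<open>f\<close>, which vanishes.\<close>
    proof (cases "stars w = Suc (Suc n)")
      case True
      have "word_diff P (FObj G (m, y)) (cw m y) w = asum P (FObj G (m, y))
         (\<lambda>i. cube_component G f (word_arr w \<cdot>\<^bsub>box_cat\<^esub> face (Suc (Suc n)) i False) y \<boxminus> cube_component G f (word_arr w \<cdot>\<^bsub>box_cat\<^esub> face (Suc (Suc n)) i True) y) (Suc (Suc n))"
        unfolding word_diff_asum[OF cwa[OF y]] True
      proof (rule asum_cong)
        fix i assume i: "1 \<le> i" "i \<le> Suc (Suc n)"
        have "cw m y (star_subst i e w) = cube_component G f (word_arr w \<cdot>\<^bsub>box_cat\<^esub> face (Suc (Suc n)) i e) y" for e
          using word_arr_face[of i w e] stars_star_subst[of i w e] i True w by (simp add: cw_def)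
        then show "cw m y (star_subst i False w) \<boxminus> cw m y (star_subst i True w) =
          cube_component G f (word_arr w \<cdot>\<^bsub>box_cat\<^esub> face (Suc (Suc n)) i False) y \<boxminus> cube_component G f (word_arr w \<cdot>\<^bsub>box_cat\<^esub> face (Suc (Suc n)) i True) y" by simp
      qed
      also have "\<dots> = cube_component G (coboundary ?R P (Suc n) f) (word_arr w) y"
        using cube_component_coboundary[OF G f(1) word_arr_Arr, of y w] y True w by simp
      also have "\<dots> = ZeroArr A P (FObj G (m, y))"
        using df[of "act X (word_arr w) y"] act_obj[OF word_arr_Arr, of y w] y w True el_arrow_Arr[OF word_arr_Arr, of y w]
        by (simp add: cube_component_def cofree_sel)
      finally show ?thesis .
    next
      case False
      show ?thesis unfolding word_diff_asum[OF cwa[OF y]]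
      proof (rule asum_zero[OF P b])
        fix i assume i: "1 \<le> i" "i \<le> stars w"
        have "cw m y (star_subst i e w) = ZeroArr A P (FObj G (m, y))" for e
          using False stars_star_subst[OF i, of e] i by (auto simp: cw_def)
        then show "cw m y (star_subst i False w) \<boxminus> cw m y (star_subst i True w) = ZeroArr A P (FObj G (m, y))" using b by simp
      qed
    qed
  qed
  note ex = this
  define bw where "bw m y = (SOME k. word_arrs P (FObj G (m, y)) k \<and>
    (\<forall>w. length w = m \<longrightarrow> word_diff P (FObj G (m, y)) k w = cw m y w))" for m y
  have bw: "word_arrs P (FObj G (m, y)) (bw m y)" "length w = m \<Longrightarrow> word_diff P (FObj G (m, y)) (bw m y) w = cw m y w"
    if "y \<in> FObj X m" for m y w
    using someI_ex[OF ex[OF that], folded bw_def] by blast+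
  \<comment> \<open>Zero at maps that are not faces, which is what makes \<open>g\<close>
    normalized. The primitive \<open>bw\<close> may have other values on words whose number of stars
    is not \<open>n\<close>, but these are never read, since only maps out of the
    \<open>n\<close>-cube index the components of \<open>g\<close>.\<close>
  define B where "B \<alpha> y = (if \<alpha> \<in> range word_arr then bw (snd (snd \<alpha>)) y (inv_into UNIV word_arr \<alpha>) else ZeroArr A P (FObj G (snd (snd \<alpha>), y)))" for \<alpha> y
  have inj: "inj word_arr" using word_arr_inj by (rule injI)
  obtain g where g: "family ?R P n g"
    "\<And>\<alpha> y. \<lbrakk>\<alpha> \<in> Arr box_cat; fst \<alpha> = n; y \<in> FObj X (snd (snd \<alpha>))\<rbrakk> \<Longrightarrow> cube_component G g \<alpha> y = B \<alpha> y"
  proof (rule cube_component_realize[OF G P, of n B])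
    fix \<alpha> y assume "\<alpha> \<in> Arr box_cat" "fst \<alpha> = n" "y \<in> FObj X (snd (snd \<alpha>))"
    then show "B \<alpha> y \<in> Hom A P (FObj G (snd (snd \<alpha>), y))"
      using word_arrsD[OF bw(1)[of y "snd (snd \<alpha>)"]] el_functor_obj[OF G] by (auto simp: B_def Hom_iff)
  qed blast
  have gn: "normalized ?R P n g"
    unfolding normalized_def
  proof (intro allI impI)
    fix i x assume i: "1 \<le> i" "i \<le> n" and x: "x \<in> FObj X (n - 1)"
    note si = degeneracy_arr[OF i]
    have zf: "family ?R P (n - 1) (\<lambda>x. ZeroArr A P (FObj ?R (n - 1, x)))"
      by (rule familyI[OF P]) (use el_functor_obj[OF R] in simp)
    have sf: "family ?R P (n - 1) (transport ?R (degeneracy n i) g)" using transport_ds_family(1)[OF R g(1) i] .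
    show "transport ?R (degeneracy n i) g x = ZeroArr A P (FObj ?R (n - 1, x))"
    proof (rule cube_component_ext[OF G sf zf _ x])
      fix \<alpha> y assume a: "\<alpha> \<in> Arr box_cat" "fst \<alpha> = n - 1" "y \<in> FObj X (snd (snd \<alpha>))"
      have m: "fst \<alpha> = snd (snd (degeneracy n i))" using a si by simp
      note as = box_comp_Arr[OF si(1) a(1) m]
      have nw: "\<alpha> \<cdot>\<^bsub>box_cat\<^esub> degeneracy n i \<notin> range word_arr"
      proof
        assume "\<alpha> \<cdot>\<^bsub>box_cat\<^esub> degeneracy n i \<in> range word_arr"
        then obtain w where w: "word_arr w = \<alpha> \<cdot>\<^bsub>box_cat\<^esub> degeneracy n i" by force
        then have "fst (word_arr w) = n" using as(2) si by (simp only:)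
        then show False using word_arr_not_degenerate[of i w \<alpha>] w i by simp
      qed
      have "cube_component G (transport ?R (degeneracy n i) g) \<alpha> y = cube_component G g (\<alpha> \<cdot>\<^bsub>box_cat\<^esub> degeneracy n i) y"
        by (rule cube_component_transport[OF G _ si(1) a(1,3) m]) (use si g in simp)
      also have "\<dots> = ZeroArr A P (FObj G (snd (snd \<alpha>), y))"
        using g(2)[OF as(1)] as si a(3) nw by (simp add: B_def)
      also have "\<dots> = cube_component G (\<lambda>x. ZeroArr A P (FObj ?R (n - 1, x))) \<alpha> y"
        using el_arrow_Arr[OF a(1,3)] act_obj[OF a(1,3)] a(2) by (simp add: cube_component_def cofree_sel)
      finally show "cube_component G (transport ?R (degeneracy n i) g) \<alpha> y = cube_component G (\<lambda>x. ZeroArr A P (FObj ?R (n - 1, x))) \<alpha> y" .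
    qed
  qed
  have dg: "coboundary ?R P n g x = f x" if x: "x \<in> FObj X (Suc n)" for x
  proof (rule cube_component_ext[OF G coboundary_family[OF R g(1)] f(1) _ x])
    fix \<alpha> y assume a: "\<alpha> \<in> Arr box_cat" "fst \<alpha> = Suc n" "y \<in> FObj X (snd (snd \<alpha>))"
    obtain a1 a2 a3 where al: "\<alpha> = (a1, a2, a3)" by (cases \<alpha>)
    have bm: "box_map a1 a3 a2" using a(1) al by simp
    show "cube_component G (coboundary ?R P n g) \<alpha> y = cube_component G f \<alpha> y"
    proof (cases rule: box_map_cases[OF bm])
      case (1 w)
      then have w: "\<alpha> = word_arr w" "stars w = Suc n" "length w = snd (snd \<alpha>)" using al a(2) by auto
      note y = a(3)[folded w(3)]
      have "cube_component G (coboundary ?R P n g) \<alpha> y = asum P (FObj G (length w, y))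
        (\<lambda>i. cube_component G g (word_arr w \<cdot>\<^bsub>box_cat\<^esub> face (Suc n) i False) y \<boxminus> cube_component G g (word_arr w \<cdot>\<^bsub>box_cat\<^esub> face (Suc n) i True) y) (Suc n)"
        unfolding w(1) using cube_component_coboundary[OF G g(1) word_arr_Arr, of y w] y w(2) by simp
      also have "\<dots> = asum P (FObj G (length w, y)) (\<lambda>i. bw (length w) y (star_subst i False w) \<boxminus> bw (length w) y (star_subst i True w)) (Suc n)"
      proof (rule asum_cong)
        fix i assume i: "1 \<le> i" "i \<le> Suc n"
        have "cube_component G g (word_arr w \<cdot>\<^bsub>box_cat\<^esub> face (Suc n) i e) y = bw (length w) y (star_subst i e w)" for e
          using word_arr_face[of i w e] stars_star_subst[of i w e] i w(2) g(2)[OF word_arr_Arr, of "star_subst i e w" y] y inj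
          by (simp add: B_def)
        then show "cube_component G g (word_arr w \<cdot>\<^bsub>box_cat\<^esub> face (Suc n) i False) y \<boxminus> cube_component G g (word_arr w \<cdot>\<^bsub>box_cat\<^esub> face (Suc n) i True) y =
          bw (length w) y (star_subst i False w) \<boxminus> bw (length w) y (star_subst i True w)" by simp
      qed
      also have "\<dots> = cw (length w) y w" using word_diff_asum[OF bw(1)[OF y], of w] bw(2)[OF y, of w] w(2) by simp
      also have "\<dots> = cube_component G f \<alpha> y" unfolding w(1) using w(2) by (simp add: cw_def)
      finally show ?thesis .
    next
      \<comment> \<open>At a map through a degeneracy both sides vanish, because \<open>f\<close>
        and the coboundary of \<open>g\<close> are normalized.\<close>
      case (2 i)
      define \<gamma> where "\<gamma> = \<alpha> \<cdot>\<^bsub>box_cat\<^esub> face (Suc n) i False"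
      have i: "1 \<le> i" "i \<le> Suc n" using 2 al a(2) by auto
      have ag: "\<alpha> = \<gamma> \<cdot>\<^bsub>box_cat\<^esub> degeneracy (Suc n) i" using 2(3) al a(2) by (simp add: \<gamma>_def)
      have "fst \<alpha> = snd (snd (face (Suc n) i False))" using face_arr[OF i] a(2) by simp
      note ga = box_comp_Arr[OF face_arr(1)[OF i] a(1) this, folded \<gamma>_def]
      have ga': "\<gamma> \<in> Arr box_cat" "fst \<gamma> = Suc n - 1" "y \<in> FObj X (snd (snd \<gamma>))" using ga face_arr[OF i] a(3) by simp_all
      have "cube_component G (coboundary ?R P n g) (\<gamma> \<cdot>\<^bsub>box_cat\<^esub> degeneracy (Suc n) i) y = ZeroArr A P (FObj G (snd (snd \<gamma>), y))"
        by (rule zero[OF coboundary_family[OF R g(1)] coboundary_normalized[OF R g(1) gn] i ga'])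
      moreover have "cube_component G f (\<gamma> \<cdot>\<^bsub>box_cat\<^esub> degeneracy (Suc n) i) y = ZeroArr A P (FObj G (snd (snd \<gamma>), y))"
        by (rule zero[OF f i ga'])
      ultimately show ?thesis using ag by simp
    qed
  qed
  obtain h where h: "h \<in> Hom A P (nobj ?R n)" "\<And>x. x \<in> FObj X n \<Longrightarrow> nu ?R n x \<cdot> h = g x"
    using nu_lift[OF R g(1) gn] by blast
  have "ndiff ?R n \<cdot> h = c"
  proof (rule nu_ext[OF R, of _ P "Suc n"])
    fix x assume x: "x \<in> FObj X (Suc n)"
    have "nu ?R (Suc n) x \<cdot> (ndiff ?R n \<cdot> h) = coboundary ?R P n (\<lambda>x. nu ?R n x \<cdot> h) x"
      using nu_ndiff_comp[OF R _ _ x, of h] h(1) by (simp add: Hom_iff)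
    also have "\<dots> = coboundary ?R P n g x" by (rule coboundary_cong[OF x h(2)])
    also have "\<dots> = nu ?R (Suc n) x \<cdot> c" using dg[OF x] by (simp add: f_def)
    finally show "nu ?R (Suc n) x \<cdot> (ndiff ?R n \<cdot> h) = nu ?R (Suc n) x \<cdot> c" .
  qed (use h(1) in \<open>simp_all add: Hom_iff P_def\<close>)
  then show ?thesis using h(1) by (auto simp: boundary_def Hom_iff P_def)
qed

end

section \<open>The cohomology of the normalized complex as the satellites of the limit\<close>

lemma limit_cone:
  assumes "is_limit C D F l \<pi>"
  shows "l \<in> Obj D" "c \<in> Obj C \<Longrightarrow> \<pi> c \<in> Hom D l (FObj F c)"
    "u \<in> Arr C \<Longrightarrow> FArr F u \<cdot>\<^bsub>D\<^esub> \<pi> (Dom C u) = \<pi> (Cod C u)"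
  using assms unfolding is_limit_def Let_def by (auto simp: Hom_iff)

lemma limit_ex1:
  assumes "is_limit C D F l \<pi>" "d \<in> Obj D" "\<And>c. c \<in> Obj C \<Longrightarrow> f c \<in> Hom D d (FObj F c)"
    "\<And>u. u \<in> Arr C \<Longrightarrow> FArr F u \<cdot>\<^bsub>D\<^esub> f (Dom C u) = f (Cod C u)"
  shows "\<exists>!h. h \<in> Hom D d l \<and> (\<forall>c \<in> Obj C. \<pi> c \<cdot>\<^bsub>D\<^esub> h = f c)"
proof -
  have "d \<in> Obj D \<and> (\<forall>c \<in> Obj C. f c \<in> Hom D d (FObj F c)) \<and> (\<forall>a b. \<forall>u \<in> Hom C a b. FArr F u \<cdot>\<^bsub>D\<^esub> f a = f b)"
    using assms(2-) by (auto simp: Hom_def)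
  then show ?thesis using assms(1) unfolding is_limit_def Let_def by blast
qed

lemma limitI:
  assumes "l \<in> Obj D" "\<And>c. c \<in> Obj C \<Longrightarrow> \<pi> c \<in> Hom D l (FObj F c)"
    "\<And>u. u \<in> Arr C \<Longrightarrow> FArr F u \<cdot>\<^bsub>D\<^esub> \<pi> (Dom C u) = \<pi> (Cod C u)"
    "\<And>d f. \<lbrakk>d \<in> Obj D; \<And>c. c \<in> Obj C \<Longrightarrow> f c \<in> Hom D d (FObj F c);
      \<And>u. u \<in> Arr C \<Longrightarrow> FArr F u \<cdot>\<^bsub>D\<^esub> f (Dom C u) = f (Cod C u)\<rbrakk>
      \<Longrightarrow> \<exists>!h. h \<in> Hom D d l \<and> (\<forall>c \<in> Obj C. \<pi> c \<cdot>\<^bsub>D\<^esub> h = f c)"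
  shows "is_limit C D F l \<pi>"
  unfolding is_limit_def Let_def
proof (intro conjI allI impI)
  fix d f assume "d \<in> Obj D \<and> (\<forall>c \<in> Obj C. f c \<in> Hom D d (FObj F c)) \<and> (\<forall>a b. \<forall>u \<in> Hom C a b. FArr F u \<cdot>\<^bsub>D\<^esub> f a = f b)"
  then show "\<exists>!h. h \<in> Hom D d l \<and> (\<forall>c \<in> Obj C. \<pi> c \<cdot>\<^bsub>D\<^esub> h = f c)"
    by (intro assms(4)) (auto simp: Hom_def)
qed (use assms(1-3) in \<open>auto simp: Hom_iff\<close>)

lemma (in functor_category) limit_ext:
  assumes F: "is_functor C A F" and l: "is_limit C A F l \<pi>" and h: "h \<in> Hom A d l" "h' \<in> Hom A d l"
    and eq: "\<And>c. c \<in> Obj C \<Longrightarrow> \<pi> c \<cdot> h = \<pi> c \<cdot> h'"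
  shows "h = h'"
proof -
  note [simp] = h[unfolded Hom_iff] limit_cone(1)[OF l] limit_cone(2)[OF l, unfolded Hom_iff] functorD[OF F]
  have "d \<in> Obj A" using dom_obj[of h] by simp
  then have "\<exists>!k. k \<in> Hom A d l \<and> (\<forall>c \<in> Obj C. \<pi> c \<cdot> k = \<pi> c \<cdot> h)"
  proof (rule limit_ex1[OF l])
    show "FArr F u \<cdot> (\<pi> (Dom C u) \<cdot> h) = \<pi> (Cod C u) \<cdot> h" if "u \<in> Arr C" for u
      using pre_comp[OF limit_cone(3)[OF l that], of h] that by simp
  qed (simp add: Hom_iff)
  then show ?thesis using h eq by metis
qed

text \<open>The comparison arrows between two choices of limits are natural since they commute with
  the projections; \<open>main\<close> is used once in each direction.\<close>

lemma (in functor_category) limit_functors_iso: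
  assumes L: "is_limit_functor C A L" and L': "is_limit_functor C A L'"
  shows "isomorphic (functor_cat FC A) L L'"
proof -
  have main: "\<exists>\<eta>. is_nattrans FC A L L' \<eta> \<and> (\<forall>F c. is_functor C A F \<longrightarrow> c \<in> Obj C \<longrightarrow> \<pi>' F c \<cdot> \<eta> F = \<pi> F c)"
    if L: "is_functor FC A L" "\<And>F. is_functor C A F \<Longrightarrow> is_limit C A F (FObj L F) (\<pi> F)"
      "\<And>F G t c. \<lbrakk>t \<in> Hom FC F G; c \<in> Obj C\<rbrakk> \<Longrightarrow> \<pi> G c \<cdot> FArr L t = component t c \<cdot> \<pi> F c"
      and L': "is_functor FC A L'" "\<And>F. is_functor C A F \<Longrightarrow> is_limit C A F (FObj L' F) (\<pi>' F)"
      "\<And>F G t c. \<lbrakk>t \<in> Hom FC F G; c \<in> Obj C\<rbrakk> \<Longrightarrow> \<pi>' G c \<cdot> FArr L' t = component t c \<cdot> \<pi>' F c"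
    for L L' \<pi> \<pi>'
  proof -
    have "\<exists>h. h \<in> Hom A (FObj L F) (FObj L' F) \<and> (\<forall>c \<in> Obj C. \<pi>' F c \<cdot> h = \<pi> F c)" if F: "is_functor C A F" for F
    proof -
      have "\<exists>!h. h \<in> Hom A (FObj L F) (FObj L' F) \<and> (\<forall>c \<in> Obj C. \<pi>' F c \<cdot> h = \<pi> F c)"
        using limit_cone[OF L(2)[OF F]] by (intro limit_ex1[OF L'(2)[OF F]]) auto
      then show ?thesis by blast
    qed
    then have "\<forall>F \<in> Obj FC. \<exists>h. h \<in> Hom A (FObj L F) (FObj L' F) \<and> (\<forall>c \<in> Obj C. \<pi>' F c \<cdot> h = \<pi> F c)" by simp
    from bchoice[OF this] obtain h where h: "\<And>F. is_functor C A F \<Longrightarrow> h F \<in> Hom A (FObj L F) (FObj L' F)"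
      "\<And>F c. \<lbrakk>is_functor C A F; c \<in> Obj C\<rbrakk> \<Longrightarrow> \<pi>' F c \<cdot> h F = \<pi> F c" by auto
    have "is_nattrans FC A L L' (restrict h (Obj FC))"
    proof (rule nattransI[OF L(1) L'(1)])
      show "restrict h (Obj FC) F \<in> Arr A \<and> Dom A (restrict h (Obj FC) F) = FObj L F \<and> Cod A (restrict h (Obj FC) F) = FObj L' F"
        if "F \<in> Obj FC" for F using that h(1)[of F] by (simp add: Hom_iff)
    next
      fix t assume t: "t \<in> Arr FC"
      define F G where "F = fst t" and "G = snd (snd t)"
      have nt: "is_nattrans C A F G (component t)" and tH: "t \<in> Hom FC F G"
        using t by (auto simp: functor_cat_Arr functor_cat_Hom F_def G_def)
      note F = nattransD(1)[OF nt] and G = nattransD(2)[OF nt]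
      have lt: "FArr L t \<in> Arr A" "Dom A (FArr L t) = FObj L F" "Cod A (FArr L t) = FObj L G"
        "FArr L' t \<in> Arr A" "Dom A (FArr L' t) = FObj L' F" "Cod A (FArr L' t) = FObj L' G"
        using functorD(2-4)[OF L(1) t] functorD(2-4)[OF L'(1) t] by (simp_all add: F_def G_def)
      note [simp] = lt h(1)[OF F, unfolded Hom_iff] h(1)[OF G, unfolded Hom_iff]
      have "h G \<cdot> FArr L t = FArr L' t \<cdot> h F"
      proof (rule limit_ext[OF G L'(2)[OF G]])
        fix c assume c: "c \<in> Obj C"
        note [simp] = limit_cone(2)[OF L(2)[OF F] c, unfolded Hom_iff] limit_cone(2)[OF L(2)[OF G] c, unfolded Hom_iff]
          limit_cone(2)[OF L'(2)[OF F] c, unfolded Hom_iff] limit_cone(2)[OF L'(2)[OF G] c, unfolded Hom_iff]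
          nattransD(4-6)[OF nt c]
        show "\<pi>' G c \<cdot> (h G \<cdot> FArr L t) = \<pi>' G c \<cdot> (FArr L' t \<cdot> h F)"
          using pre_comp[OF h(2)[OF G c], of "FArr L t"] pre_comp[OF L'(3)[OF tH c], of "h F"]
            h(2)[OF F c] L(3)[OF tH c] by simp
      qed (simp_all add: Hom_iff)
      then show "restrict h (Obj FC) (Cod FC t) \<cdot> FArr L t = FArr L' t \<cdot> restrict h (Obj FC) (Dom FC t)"
        using F G by (simp add: F_def G_def)
    qed simp
    then show ?thesis using h(2) by (intro exI[of _ "restrict h (Obj FC)"]) simp
  qed
  obtain \<pi> where p: "is_functor FC A L" "\<And>F. is_functor C A F \<Longrightarrow> is_limit C A F (FObj L F) (\<pi> F)"
    "\<And>F G t c. \<lbrakk>t \<in> Hom FC F G; c \<in> Obj C\<rbrakk> \<Longrightarrow> \<pi> G c \<cdot> FArr L t = component t c \<cdot> \<pi> F c"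
    using L unfolding is_limit_functor_def by blast
  obtain \<pi>' where p': "is_functor FC A L'" "\<And>F. is_functor C A F \<Longrightarrow> is_limit C A F (FObj L' F) (\<pi>' F)"
    "\<And>F G t c. \<lbrakk>t \<in> Hom FC F G; c \<in> Obj C\<rbrakk> \<Longrightarrow> \<pi>' G c \<cdot> FArr L' t = component t c \<cdot> \<pi>' F c"
    using L' unfolding is_limit_functor_def by blast
  obtain \<eta> where e: "is_nattrans FC A L L' \<eta>" "\<And>F c. is_functor C A F \<Longrightarrow> c \<in> Obj C \<Longrightarrow> \<pi>' F c \<cdot> \<eta> F = \<pi> F c"
    using main[OF p p'] by blast
  obtain \<theta> where t: "is_nattrans FC A L' L \<theta>" "\<And>F c. is_functor C A F \<Longrightarrow> c \<in> Obj C \<Longrightarrow> \<pi> F c \<cdot> \<theta> F = \<pi>' F c"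
    using main[OF p' p] by blast
  have inv: "\<theta> F \<cdot> \<eta> F = Ident A (FObj L F)" "\<eta> F \<cdot> \<theta> F = Ident A (FObj L' F)" if F: "is_functor C A F" for F
  proof -
    have o: "F \<in> Obj FC" using F by simp
    note [simp] = nattransD(4-6)[OF e(1) o] nattransD(4-6)[OF t(1) o] limit_cone(1)[OF p(2)[OF F]] limit_cone(1)[OF p'(2)[OF F]]
    note [simp] = limit_cone(2)[OF p(2)[OF F], unfolded Hom_iff] limit_cone(2)[OF p'(2)[OF F], unfolded Hom_iff]
    show "\<theta> F \<cdot> \<eta> F = Ident A (FObj L F)"
    proof (rule limit_ext[OF F p(2)[OF F]])
      fix c assume c [simp]: "c \<in> Obj C"
      show "\<pi> F c \<cdot> (\<theta> F \<cdot> \<eta> F) = \<pi> F c \<cdot> Ident A (FObj L F)"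
        using pre_comp[OF t(2)[OF F c], of "\<eta> F"] e(2)[OF F c] by simp
    qed (simp_all add: Hom_iff)
    show "\<eta> F \<cdot> \<theta> F = Ident A (FObj L' F)"
    proof (rule limit_ext[OF F p'(2)[OF F]])
      fix c assume c [simp]: "c \<in> Obj C"
      show "\<pi>' F c \<cdot> (\<eta> F \<cdot> \<theta> F) = \<pi>' F c \<cdot> Ident A (FObj L' F)"
        using pre_comp[OF e(2)[OF F c], of "\<theta> F"] t(2)[OF F c] by simp
    qed (simp_all add: Hom_iff)
  qed
  have "(L, \<eta>, L') \<in> Hom (functor_cat FC A) L L'" "(L', \<theta>, L) \<in> Hom (functor_cat FC A) L' L"
    using e(1) t(1) by (simp_all add: functor_cat_Hom)
  moreover have "(L', \<theta>, L) \<cdot>\<^bsub>functor_cat FC A\<^esub> (L, \<eta>, L') = Ident (functor_cat FC A) L"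
    "(L, \<eta>, L') \<cdot>\<^bsub>functor_cat FC A\<^esub> (L', \<theta>, L) = Ident (functor_cat FC A) L'"
    using inv by (auto intro!: restrict_ext)
  moreover have "L \<in> Obj (functor_cat FC A)" "L' \<in> Obj (functor_cat FC A)" using p(1) p'(1) by simp_all
  ultimately show ?thesis unfolding isomorphic_def by blast
qed

section \<open>Degree 0: vertices and the limit\<close>

lemma word_arr_Nil: "word_arr [] = Ident box_cat 0"
  by (auto simp: word_arr_def fill_map_def cube_def box_cat_sel(5) intro!: restrict_ext)

text \<open>No degeneracy starts at the 0-cube, so a map out of it must be a face, that is, a
  vertex.\<close>

lemma box_zero_word:
  assumes "\<alpha> \<in> Arr box_cat" "fst \<alpha> = 0"
  obtains w where "\<alpha> = word_arr w" "stars w = 0" "length w = snd (snd \<alpha>)"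
proof -
  obtain f n where a: "\<alpha> = (0, f, n)" using assms(2) by (cases \<alpha>) auto
  have "box_map 0 n f" using assms(1) a by simp
  then show thesis
  proof (cases rule: box_map_cases)
    case (word w)
    then show thesis using that[of w] a by (metis fst_conv snd_conv word_arr_sel)
  qed simp
qed

lemma star_subst_vertex: "stars a = 0 \<Longrightarrow> stars b = 0 \<Longrightarrow> star_subst 1 e (a @ None # b) = a @ Some e # b"
proof (induction a)
  case (Cons x a)
  then show ?case by (cases x) auto
qed simp

context cubical_coefficients
begin

lemma coboundary_zero_iff:
  assumes F: "is_functor E A F" and c: "family F P 0 c" and x: "x \<in> FObj X 1"
    and z: "coboundary F P 0 c x = ZeroArr A P (FObj F (1, x))"
  shows "transport F (face 1 1 False) c x = transport F (face 1 1 True) c x"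
proof -
  note d = face_diff_arr[OF F, of P 1 c 1 x] transport_arr[OF F face_arr(1)[of 1 1], of P _ c x]
  have P: "P \<in> Obj A" by (rule familyD(1)[OF c])
  have b: "FObj F (Suc 0, x) \<in> Obj A" using el_functor_obj[OF F, of x "Suc 0"] x by simp
  have "neg (face_diff F 1 1 c x) = ZeroArr A P (FObj F (Suc 0, x))"
    using z d c x P b by (simp add: coboundary_def)
  then have "face_diff F 1 1 c x = ZeroArr A P (FObj F (Suc 0, x))"
    using d(1-3) c x P b by (metis add_zero(5) diff_self_eq_0 neg_zero order_refl)
  then show ?thesis unfolding face_diff_def
    by - (rule sub_eq_zero, use d(4-6) c x face_arr(2,3)[of 1 1] in simp_all)
qed

text \<open>A walk along edges: coordinates are set to \<open>False\<close> one at a time, those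
  behind the first letter of \<open>w\<close> before that letter. An edge is a word with one star,
  and \<open>flat\<close> says that the values at its two ends agree after transport to it.\<close>

lemma vertex_independent:
  assumes F: "is_functor E A F" and c: "family F P 0 c"
    and flat: "\<And>x. x \<in> FObj X 1 \<Longrightarrow> transport F (face 1 1 False) c x = transport F (face 1 1 True) c x"
  shows "\<lbrakk>stars a = 0; stars w = 0; x \<in> FObj X (length a + length w)\<rbrakk> \<Longrightarrow>
    transport F (word_arr (a @ w)) c x = transport F (word_arr (a @ replicate (length w) (Some False))) c x"
proof (induction w arbitrary: a)
  case (Cons y w)
  then obtain e where y: "y = Some e" by (cases y) auto
  let ?z = "replicate (length w) (Some False)"
  have z: "stars ?z = 0" by (simp add: count_list_0_iff)
  have "transport F (word_arr ((a @ [Some e]) @ w)) c x = transport F (word_arr ((a @ [Some e]) @ ?z)) c x"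
    by (rule Cons(1)) (use Cons(2-) y in simp_all)
  also have "\<dots> = transport F (word_arr (a @ Some False # ?z)) c x"
  proof -
    have "transport F (word_arr (a @ Some e' # ?z)) c x = transport F (word_arr (a @ None # ?z)) (transport F (face 1 1 e') c) x" for e'
    proof -
      have s: "stars (a @ None # ?z) = 1" using Cons(2) z by simp
      have "word_arr (a @ Some e' # ?z) = word_arr (a @ None # ?z) \<cdot>\<^bsub>box_cat\<^esub> face 1 1 e'"
        using word_arr_face[of 1 "a @ None # ?z" e'] s star_subst_vertex[OF Cons(2) z, of e'] by simp
      also have "transport F \<dots> c x = transport F (word_arr (a @ None # ?z)) (transport F (face 1 1 e') c) x"
        by (rule transport_comp[OF F face_arr(1) word_arr_Arr, of 1 1 _ e' P]) (use s c Cons(4) face_arr(2,3)[of 1 1] in simp_all)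
      finally show ?thesis .
    qed
    moreover have "transport F (word_arr (a @ None # ?z)) (transport F (face 1 1 e) c) x = transport F (word_arr (a @ None # ?z)) (transport F (face 1 1 False) c) x"
    proof (rule transport_cong[OF word_arr_Arr])
      fix x' assume "x' \<in> FObj X (fst (word_arr (a @ None # ?z)))"
      then have "x' \<in> FObj X 1" using Cons(2) z by simp
      then show "transport F (face 1 1 e) c x' = transport F (face 1 1 False) c x'" using flat[of x'] by (cases e) simp_all
    qed (use Cons(4) in simp)
    ultimately show ?thesis by simp
  qed
  finally show ?case using y by simp
qed simp

definition vertex_arr :: "nat \<Rightarrow> box_arr" where
  "vertex_arr n = word_arr (replicate n (Some False))"

lemma vertex_arr: "vertex_arr n \<in> Arr box_cat" "fst (vertex_arr n) = 0" "snd (snd (vertex_arr n)) = n"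
  by (simp_all add: vertex_arr_def word_arr_Arr count_list_0_iff)

text \<open>The map \<open>\<beta>\<close> sends the base vertex of its source to some vertex of its
  target, not necessarily the base vertex; the value is the same at all of them.\<close>

lemma vertex_constant:
  assumes F: "is_functor E A F" and c: "family F P 0 c"
    and flat: "\<And>x. x \<in> FObj X 1 \<Longrightarrow> transport F (face 1 1 False) c x = transport F (face 1 1 True) c x"
    and b: "\<beta> \<in> Arr box_cat" and x: "x \<in> FObj X (snd (snd \<beta>))"
  shows "FArr F (el_arrow X \<beta> x) \<cdot> transport F (vertex_arr (fst \<beta>)) c (act X \<beta> x) = transport F (vertex_arr (snd (snd \<beta>))) c x"
proof -
  have m: "fst \<beta> = snd (snd (vertex_arr (fst \<beta>)))" by (simp add: vertex_arr)
  have "FArr F (el_arrow X \<beta> x) \<cdot> transport F (vertex_arr (fst \<beta>)) c (act X \<beta> x) = transport F (\<beta> \<cdot>\<^bsub>box_cat\<^esub> vertex_arr (fst \<beta>)) c x"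
    using transport_comp[OF F vertex_arr(1) b m, of P c x] c x by (simp add: vertex_arr transport_def[of F \<beta>])
  also have "\<dots> = transport F (vertex_arr (snd (snd \<beta>))) c x"
  proof -
    obtain w where w: "\<beta> \<cdot>\<^bsub>box_cat\<^esub> vertex_arr (fst \<beta>) = word_arr w" "stars w = 0" "length w = snd (snd \<beta>)"
    using box_zero_word[OF box_comp_Arr(1)[OF vertex_arr(1) b m]] box_comp_Arr(2,3)[OF vertex_arr(1) b m] vertex_arr by metis
    have "transport F (word_arr w) c x = transport F (vertex_arr (length w)) c x"
      using vertex_independent[OF F c flat, of "[]" w x] w x by (simp add: vertex_arr_def)
    then show ?thesis using w by simp
  qed
  finally show ?thesis .
qed

abbreviation "Z0 F \<equiv> zinc (ndiff F) 0"

lemma Z0: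
  assumes F: "is_functor E A F"
  shows "Z0 F \<in> Arr A" "Dom A (Z0 F) = cohomology A (ndiff F) 0" "Cod A (Z0 F) = nobj F 0"
    "is_kernel A (Z0 F) (ndiff F 0)"
  using zinc_arr[OF normalized_complex[OF F], of 0] ndiff(2)[OF F, of 0] zinc_kernel[OF normalized_complex[OF F], of 0]
  by (simp_all add: zinc_def)

definition vertex_pr :: "('u, 'o, 'm) coefficient_system \<Rightarrow> 'u \<Rightarrow> 'm" where
  "vertex_pr F x = nu F 0 x \<cdot> Z0 F"

lemma vertex_pr:
  assumes F: "is_functor E A F"
  shows "family F (cohomology A (ndiff F) 0) 0 (vertex_pr F)"
    and vertex_pr_flat: "\<And>x. x \<in> FObj X 1 \<Longrightarrow> transport F (face 1 1 False) (vertex_pr F) x = transport F (face 1 1 True) (vertex_pr F) x"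
proof -
  note [simp] = Z0(1-3)[OF F]
  show f: "family F (cohomology A (ndiff F) 0) 0 (vertex_pr F)"
    using family_comp[OF nu_family[OF F, of 0], of "Z0 F"] by (simp add: vertex_pr_def[abs_def] del: cohomology.simps)
  fix x assume x: "x \<in> FObj X 1"
  then have x': "x \<in> FObj X (Suc 0)" by simp
  show "transport F (face 1 1 False) (vertex_pr F) x = transport F (face 1 1 True) (vertex_pr F) x"
  proof (rule coboundary_zero_iff[OF F f x])
    show "coboundary F (cohomology A (ndiff F) 0) 0 (vertex_pr F) x = ZeroArr A (cohomology A (ndiff F) 0) (FObj F (1, x))"
      using nu_ndiff_comp[OF F _ _ x', of "Z0 F"] zinc_arr(3)[OF normalized_complex[OF F], of 0] ndiff(1-3)[OF F]
        familyD(2-4)[OF nu_family[OF F] x'] nincl(5)[OF F] x' cohomology_obj[OF normalized_complex[OF F], of 0]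
      by (simp add: vertex_pr_def[abs_def] del: cohomology.simps)
  qed
qed

text \<open>The universal 0-cocycle evaluated at the vertex of the cube with all coordinates
  \<open>False\<close> and transported to the cube itself.\<close>

definition limit_pr :: "('u, 'o, 'm) coefficient_system \<Rightarrow> nat \<times> 'u \<Rightarrow> 'm" where
  "limit_pr F c = transport F (vertex_arr (fst c)) (vertex_pr F) (snd c)"

lemma limit_pr_arr:
  assumes F: "is_functor E A F" and c: "c \<in> Obj E"
  shows "limit_pr F c \<in> Arr A" "Dom A (limit_pr F c) = cohomology A (ndiff F) 0" "Cod A (limit_pr F c) = FObj F c"
proof -
  obtain n x where nx: "c = (n, x)" by (cases c)
  then have x: "x \<in> FObj X n" using c by simp
  show "limit_pr F c \<in> Arr A" "Dom A (limit_pr F c) = cohomology A (ndiff F) 0" "Cod A (limit_pr F c) = FObj F c"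
    using transport_arr[OF F vertex_arr(1)[of n], of "cohomology A (ndiff F) 0" "vertex_pr F" x] vertex_pr(1)[OF F] x nx
    by (simp_all add: limit_pr_def vertex_arr del: cohomology.simps)
qed

lemma transport_vt0: "\<lbrakk>is_functor E A F; family F P 0 c; x \<in> FObj X 0\<rbrakk> \<Longrightarrow> transport F (vertex_arr 0) c x = c x"
  using transport_ident[of F P 0 c x] by (simp add: vertex_arr_def word_arr_Nil)

lemma limit_pr_limit:
  assumes F: "is_functor E A F"
  shows "is_limit E A F (cohomology A (ndiff F) 0) (limit_pr F)"
proof (rule limitI)
  note Z [simp] = Z0(1-3)[OF F]
  note co [simp] = cohomology_obj[OF normalized_complex[OF F], of 0] and nd [simp] = ndiff(1-3)[OF F] and [simp del] = cohomology.simps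
  show "cohomology A (ndiff F) 0 \<in> Obj A" by simp
  show "limit_pr F c \<in> Hom A (cohomology A (ndiff F) 0) (FObj F c)" if "c \<in> Obj E" for c
    using limit_pr_arr[OF F that] by (simp add: Hom_iff)
  show "FArr F u \<cdot> limit_pr F (Dom E u) = limit_pr F (Cod E u)" if "u \<in> Arr E" for u
  proof -
    from that obtain \<beta> x where "u = el_arrow X \<beta> x" "\<beta> \<in> Arr box_cat" "x \<in> FObj X (snd (snd \<beta>))" by (rule el_ArrE)
    then show ?thesis using vertex_constant[OF F vertex_pr(1)[OF F] vertex_pr_flat[OF F]] by (simp add: limit_pr_def)
  qed
  fix d f assume d [simp]: "d \<in> Obj A" and f: "\<And>c. c \<in> Obj E \<Longrightarrow> f c \<in> Hom A d (FObj F c)"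
    and fc: "\<And>u. u \<in> Arr E \<Longrightarrow> FArr F u \<cdot> f (Dom E u) = f (Cod E u)"
  \<comment> \<open>A cone is recovered from its components at the vertices, by compatibility with
    the vertex inclusions.\<close>
  define c where "c x = f (0, x)" for x
  have cf: "family F d 0 c" by (rule familyI) (use f in \<open>auto simp: c_def Hom_iff\<close>)
  have fopc: "transport F \<beta> c x = f (snd (snd \<beta>), x)" if "\<beta> \<in> Arr box_cat" "fst \<beta> = 0" "x \<in> FObj X (snd (snd \<beta>))" for \<beta> x
    using fc[OF el_arrow_Arr[OF that(1,3)]] that(2) by (simp add: transport_def c_def)
  have "normalized F d 0 c" by (simp add: normalized_def)
  from nu_lift[OF F cf this] obtain h where h: "h \<in> Hom A d (nobj F 0)" "\<And>x. x \<in> FObj X 0 \<Longrightarrow> nu F 0 x \<cdot> h = c x" by blast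
  note [simp] = h(1)[unfolded Hom_iff]
  have "ndiff F 0 \<cdot> h = ZeroArr A d (nobj F (Suc 0))"
  proof (rule nu_ext[OF F, of _ d "Suc 0"])
    fix x assume x: "x \<in> FObj X (Suc 0)"
    have b: "FObj F (Suc 0, x) \<in> Obj A" by (rule el_functor_obj[OF F x])
    have "nu F (Suc 0) x \<cdot> (ndiff F 0 \<cdot> h) = coboundary F d 0 (\<lambda>x. nu F 0 x \<cdot> h) x"
      using nu_ndiff_comp[OF F _ _ x, of h] by simp
    also have "\<dots> = coboundary F d 0 c x" by (rule coboundary_cong[OF x h(2)])
    also have "\<dots> = ZeroArr A d (FObj F (Suc 0, x))"
    proof -
      \<comment> \<open>By compatibility of the cone the values at both ends of an edge transport to
        the component at that edge, so their difference vanishes.\<close>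
      have "transport F (face (Suc 0) (Suc 0) e) c x = f (Suc 0, x)" for e
        using fopc[OF face_arr(1)[of 1 1 e], of x] face_arr(2,3)[of 1 1 e] x by simp
      then show ?thesis using f[of "(Suc 0, x)"] x b by (simp add: coboundary_def face_diff_def Hom_iff)
    qed
    finally show "nu F (Suc 0) x \<cdot> (ndiff F 0 \<cdot> h) = nu F (Suc 0) x \<cdot> ZeroArr A d (nobj F (Suc 0))"
      using familyD(2-4)[OF nu_family[OF F] x] nincl(5)[OF F] by simp
  qed (simp_all add: Hom_iff nincl(5)[OF F])
  then obtain k where k: "k \<in> Arr A" "Dom A k = d" "Cod A k = cohomology A (ndiff F) 0" "Z0 F \<cdot> k = h"
    by - (rule kernel_lift[OF Z0(4)[OF F], of h], simp_all)
  note [simp] = k(1-3)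
  note kf = vertex_pr(1)[OF F]
  have lc: "limit_pr F (n, x) \<cdot> g = transport F (vertex_arr n) (\<lambda>x. vertex_pr F x \<cdot> g) x"
    if "x \<in> FObj X n" "g \<in> Arr A" "Cod A g = cohomology A (ndiff F) 0" for n x g
    using transport_comp_right[OF F vertex_arr(1)[of n] _ _ that(2,3), of "vertex_pr F" x] kf that by (simp add: limit_pr_def vertex_arr)
  have kk: "vertex_pr F x \<cdot> g = nu F 0 x \<cdot> (Z0 F \<cdot> g)" if "x \<in> FObj X 0" "g \<in> Arr A" "Cod A g = cohomology A (ndiff F) 0" for x g
    using that familyD(2-4)[OF nu_family[OF F] that(1)] by (simp add: vertex_pr_def)
  have kk0: "limit_pr F (0, x) \<cdot> g = nu F 0 x \<cdot> (Z0 F \<cdot> g)" if "x \<in> FObj X 0" "g \<in> Arr A" "Cod A g = cohomology A (ndiff F) 0" for x g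
    using lc[OF that] transport_vt0[OF F family_comp[OF kf that(2,3)] that(1)] kk[OF that] by simp
  show "\<exists>!h. h \<in> Hom A d (cohomology A (ndiff F) 0) \<and> (\<forall>c \<in> Obj E. limit_pr F c \<cdot> h = f c)"
  proof (rule ex1I[of _ k], intro conjI ballI)
    show "k \<in> Hom A d (cohomology A (ndiff F) 0)" by (simp add: Hom_iff)
    fix a assume a: "a \<in> Obj E"
    obtain n x where nx: "a = (n, x)" by (cases a)
    then have x: "x \<in> FObj X n" using a by simp
    have "limit_pr F (n, x) \<cdot> k = transport F (vertex_arr n) c x"
      unfolding lc[OF x k(1,3)] by (rule transport_cong[OF vertex_arr(1)]) (use x kk[OF _ k(1,3)] h(2) k(4) in \<open>simp_all add: vertex_arr\<close>)
    also have "\<dots> = f (n, x)" using fopc[OF vertex_arr(1)[of n]] x by (simp add: vertex_arr)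
    finally show "limit_pr F a \<cdot> k = f a" using nx by simp
  next
    fix k' assume k': "k' \<in> Hom A d (cohomology A (ndiff F) 0) \<and> (\<forall>c \<in> Obj E. limit_pr F c \<cdot> k' = f c)"
    then have [simp]: "k' \<in> Arr A" "Dom A k' = d" "Cod A k' = cohomology A (ndiff F) 0" by (auto simp: Hom_iff)
    \<comment> \<open>Uniqueness: in degree 0 a normalized family is just a family over the
      vertices, so the components at the vertices already determine \<open>k'\<close>.\<close>
    have "Z0 F \<cdot> k' = h"
    proof (rule nu_ext[OF F, of _ d 0])
      fix x assume x: "x \<in> FObj X 0"
      then show "nu F 0 x \<cdot> (Z0 F \<cdot> k') = nu F 0 x \<cdot> h" using kk0[OF x, of k'] k' h(2)[OF x] by (simp add: c_def)
    qed (simp_all add: Hom_iff)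
    then show "k' = k" using k(4) by - (rule mono_arrD[OF kernel_mono[OF Z0(4)[OF F]]], simp_all)
  qed
qed

section \<open>Normalized cohomology as a delta functor\<close>

definition normalized_cohomology :: "nat \<Rightarrow> (('u, 'o, 'm) coefficient_system, (nat \<times> 'u, 'u el_arr, 'o, 'm) nattrans, 'o, 'm) ftor" where
  "normalized_cohomology n = \<lparr>FObj = restrict (\<lambda>F. cohomology A (ndiff F) n) (Obj fc.FC),
    FArr = restrict (\<lambda>t. hmap (ndiff (fst t)) (ndiff (snd (snd t))) (nmap (fst t) (snd (snd t)) (component t)) n) (Arr fc.FC)\<rparr>"

definition normalized_connecting :: "nat \<Rightarrow> (nat \<times> 'u, 'u el_arr, 'o, 'm) nattrans \<Rightarrow> (nat \<times> 'u, 'u el_arr, 'o, 'm) nattrans \<Rightarrow> 'm" where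
  "normalized_connecting n f g = short_exact_complexes.connecting A (ndiff (fst f)) (ndiff (fst g)) (ndiff (snd (snd g)))
    (nmap (fst f) (fst g) (component f)) (nmap (fst g) (snd (snd g)) (component g)) n"

lemma FC_nat: "t \<in> Arr fc.FC \<Longrightarrow> is_nattrans E A (fst t) (snd (snd t)) (component t)"
  by (simp add: functor_cat_Arr)

lemma normalized_cohomology_obj: "is_functor E A F \<Longrightarrow> FObj (normalized_cohomology n) F = cohomology A (ndiff F) n"
  by (simp add: normalized_cohomology_def)

lemma normalized_cohomology_arr: "is_nattrans E A F G \<eta> \<Longrightarrow> FArr (normalized_cohomology n) (F, \<eta>, G) = hmap (ndiff F) (ndiff G) (nmap F G \<eta>) n"
  by (simp add: normalized_cohomology_def)

lemma normalized_cohomology_functor: "is_functor fc.FC A (normalized_cohomology n)"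
  unfolding normalized_cohomology_def
proof (rule functorI[OF fc.FC.category_axioms])
  show "cohomology A (ndiff F) n \<in> Obj A" if "F \<in> Obj fc.FC" for F
    using that by (simp add: normalized_complex)
  fix t assume t: "t \<in> Arr fc.FC"
  note h = hmap(1-3)[OF nmap_chain_map[OF FC_nat[OF t]], of n]
  show "hmap (ndiff (fst t)) (ndiff (snd (snd t))) (nmap (fst t) (snd (snd t)) (component t)) n \<in> Arr A \<and>
    Dom A (hmap (ndiff (fst t)) (ndiff (snd (snd t))) (nmap (fst t) (snd (snd t)) (component t)) n) = cohomology A (ndiff (Dom fc.FC t)) n \<and>
    Cod A (hmap (ndiff (fst t)) (ndiff (snd (snd t))) (nmap (fst t) (snd (snd t)) (component t)) n) = cohomology A (ndiff (Cod fc.FC t)) n"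
    using h by simp
next
  fix F assume "F \<in> Obj fc.FC"
  then have F: "is_functor E A F" by simp
  have i: "is_nattrans E A F F (\<lambda>c \<in> Obj E. Ident A (FObj F c))"
    using fc.FC.ident_hom[of F] F by (simp add: functor_cat_Hom)
  have "nmap F F (\<lambda>c \<in> Obj E. Ident A (FObj F c)) = (\<lambda>n. Ident A (Dom A (ndiff F n)))"
    using nmap_ident[OF F i] ndiff(2)[OF F] by (simp add: fun_eq_iff)
  then show "hmap (ndiff (fst (Ident fc.FC F))) (ndiff (snd (snd (Ident fc.FC F))))
     (nmap (fst (Ident fc.FC F)) (snd (snd (Ident fc.FC F))) (component (Ident fc.FC F))) n = Ident A (cohomology A (ndiff F) n)"
    using hmap_ident[OF normalized_complex[OF F], of n] by simp
next
  fix s t assume s: "s \<in> Arr fc.FC" and t: "t \<in> Arr fc.FC" and m: "Dom fc.FC t = Cod fc.FC s"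
  have m': "fst t = snd (snd s)" using m by simp
  note ns = FC_nat[OF s] and nt = FC_nat[OF t, unfolded m']
  have "is_nattrans E A (fst s) (snd (snd t)) (\<lambda>c \<in> Obj E. component t c \<cdot> component s c)"
    using fc.FC.comp_arr(1)[OF s t m] by simp
  then have nc: "nmap (fst s) (snd (snd t)) (\<lambda>c \<in> Obj E. component t c \<cdot> component s c) =
      (\<lambda>n. nmap (snd (snd s)) (snd (snd t)) (component t) n \<cdot> nmap (fst s) (snd (snd s)) (component s) n)"
    using nmap_compose[OF ns nt] by (simp add: fun_eq_iff)
  from hmap_compose[OF nmap_chain_map[OF ns] nmap_chain_map[OF nt], of n]
  show "hmap (ndiff (fst (t \<cdot>\<^bsub>fc.FC\<^esub> s))) (ndiff (snd (snd (t \<cdot>\<^bsub>fc.FC\<^esub> s)))) (nmap (fst (t \<cdot>\<^bsub>fc.FC\<^esub> s)) (snd (snd (t \<cdot>\<^bsub>fc.FC\<^esub> s))) (component (t \<cdot>\<^bsub>fc.FC\<^esub> s))) n =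
    hmap (ndiff (fst t)) (ndiff (snd (snd t))) (nmap (fst t) (snd (snd t)) (component t)) n \<cdot>
    hmap (ndiff (fst s)) (ndiff (snd (snd s))) (nmap (fst s) (snd (snd s)) (component s)) n"
    using m' nc by simp
qed

lemma normalized_cohomology_complexes:
  assumes "short_exact fc.FC (F, \<eta>, G) (G', \<theta>, H)"
  shows "G' = G" "is_nattrans E A F G \<eta>" "is_nattrans E A G H \<theta>"
    "short_exact_complexes A (ndiff F) (ndiff G) (ndiff H) (nmap F G \<eta>) (nmap G H \<theta>)"
proof -
  show 1: "G' = G" "is_nattrans E A F G \<eta>" "is_nattrans E A G H \<theta>"
    using short_exact_arr[OF assms] by auto
  have "short_exact A (\<eta> c) (\<theta> c)" if "c \<in> Obj E" for c
    using fc.short_exactD_pointwise[OF assms that] by simp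
  then show "short_exact_complexes A (ndiff F) (ndiff G) (ndiff H) (nmap F G \<eta>) (nmap G H \<theta>)"
    using nmap_exact[OF 1(2,3)] nmap_chain_map[OF 1(2)] nmap_chain_map[OF 1(3)]
    by unfold_locales auto
qed

lemma nmap_square:
  assumes b: "is_nattrans E A G G' \<beta>" and f: "is_nattrans E A F G \<eta>" and f': "is_nattrans E A F' G' \<eta>'"
    and a: "is_nattrans E A F F' \<alpha>" and sq: "(G, \<beta>, G') \<cdot>\<^bsub>fc.FC\<^esub> (F, \<eta>, G) = (F', \<eta>', G') \<cdot>\<^bsub>fc.FC\<^esub> (F, \<alpha>, F')"
  shows "nmap G G' \<beta> n \<cdot> nmap F G \<eta> n = nmap F' G' \<eta>' n \<cdot> nmap F F' \<alpha> n"
proof -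
  have eq: "(\<lambda>c \<in> Obj E. \<beta> c \<cdot> \<eta> c) = (\<lambda>c \<in> Obj E. \<eta>' c \<cdot> \<alpha> c)" using sq by simp
  have "is_nattrans E A F G' (\<lambda>c \<in> Obj E. \<beta> c \<cdot> \<eta> c)"
    using fc.FC.comp_arr(1)[of "(F, \<eta>, G)" "(G, \<beta>, G')"] f b by simp
  then show ?thesis using nmap_compose[OF f b, of n] nmap_compose[OF a f', of n] eq by simp
qed

lemma normalized_cohomology_delta_functor: "delta_functor fc.FC A normalized_cohomology normalized_connecting"
  unfolding delta_functor_def
proof (intro conjI allI impI)
  fix n
  show "additive_functor fc.FC A (normalized_cohomology n)"
    unfolding additive_functor_def
  proof (intro conjI allI ballI normalized_cohomology_functor)
    fix F G s t assume "s \<in> Hom fc.FC F G" "t \<in> Hom fc.FC F G"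
    then obtain \<eta> \<theta> where st: "s = (F, \<eta>, G)" "t = (F, \<theta>, G)" and n: "is_nattrans E A F G \<eta>" "is_nattrans E A F G \<theta>"
      by (cases s, cases t) (auto simp: functor_cat_Hom)
    have a: "is_nattrans E A F G (\<lambda>c \<in> Obj E. \<eta> c \<boxplus> \<theta> c)" by (rule fc.nat_add[OF n])
    have "nmap F G (\<lambda>c \<in> Obj E. \<eta> c \<boxplus> \<theta> c) = (\<lambda>k. nmap F G \<eta> k \<boxplus> nmap F G \<theta> k)"
      using nmap_add[OF n a] by (simp add: fun_eq_iff)
    then show "FArr (normalized_cohomology n) (AddArr fc.FC s t) = AddArr A (FArr (normalized_cohomology n) s) (FArr (normalized_cohomology n) t)"
      using hmap_add[OF nmap_chain_map[OF n(1)] nmap_chain_map[OF n(2)], of n] a n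
      unfolding st by (simp add: normalized_cohomology_arr)
  qed
next
  fix f g assume se: "short_exact fc.FC f g"
  obtain F \<eta> G G' \<theta> H where fg: "f = (F, \<eta>, G)" "g = (G', \<theta>, H)" by (cases f, cases g)
  note S = normalized_cohomology_complexes[OF se[unfolded fg]]
  have fg': "f = (F, \<eta>, G)" "g = (G, \<theta>, H)" using fg S(1) by auto
  interpret S: short_exact_complexes A "ndiff F" "ndiff G" "ndiff H" "nmap F G \<eta>" "nmap G H \<theta>" by (rule S(4))
  have o: "is_functor E A F" "is_functor E A G" "is_functor E A H" using nattransD(1,2)[OF S(2)] nattransD(2)[OF S(3)] by auto
  show "mono_arr A (FArr (normalized_cohomology 0) f)" using S.hmap_mono S(2) by (simp add: fg' normalized_cohomology_arr)
  fix n
  show "normalized_connecting n f g \<in> Hom A (FObj (normalized_cohomology n) (Cod fc.FC g)) (FObj (normalized_cohomology (Suc n)) (Dom fc.FC f))"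
    using S.connecting(1-3) o by (simp add: fg' normalized_connecting_def normalized_cohomology_obj Hom_iff)
  show "exact_at A (FArr (normalized_cohomology n) f) (FArr (normalized_cohomology n) g)" using S.exact1 S(2,3) by (simp add: fg' normalized_cohomology_arr)
  show "exact_at A (FArr (normalized_cohomology n) g) (normalized_connecting n f g)" using S.exact2 S(2,3) by (simp add: fg' normalized_cohomology_arr normalized_connecting_def)
  show "exact_at A (normalized_connecting n f g) (FArr (normalized_cohomology (Suc n)) f)" using S.exact3 S(2,3) by (simp add: fg' normalized_cohomology_arr normalized_connecting_def)
next
  fix f g f' g' a b c n
  assume se: "short_exact fc.FC f g" "short_exact fc.FC f' g'"
    and a: "a \<in> Hom fc.FC (Dom fc.FC f) (Dom fc.FC f')" and b: "b \<in> Hom fc.FC (Cod fc.FC f) (Cod fc.FC f')"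
    and c: "c \<in> Hom fc.FC (Cod fc.FC g) (Cod fc.FC g')"
    and sq: "b \<cdot>\<^bsub>fc.FC\<^esub> f = f' \<cdot>\<^bsub>fc.FC\<^esub> a" "c \<cdot>\<^bsub>fc.FC\<^esub> g = g' \<cdot>\<^bsub>fc.FC\<^esub> b"
  obtain F \<eta> G G1 \<theta> H where fg: "f = (F, \<eta>, G)" "g = (G1, \<theta>, H)" by (cases f, cases g)
  note S = normalized_cohomology_complexes[OF se(1)[unfolded fg]]
  have fg: "f = (F, \<eta>, G)" "g = (G, \<theta>, H)" using fg S(1) by auto
  obtain F' \<eta>' G' G1' \<theta>' H' where fg': "f' = (F', \<eta>', G')" "g' = (G1', \<theta>', H')" by (cases f', cases g')
  note S' = normalized_cohomology_complexes[OF se(2)[unfolded fg']]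
  have fg': "f' = (F', \<eta>', G')" "g' = (G', \<theta>', H')" using fg' S'(1) by auto
  obtain \<alpha> \<beta> \<gamma> where abc: "a = (F, \<alpha>, F')" "b = (G, \<beta>, G')" "c = (H, \<gamma>, H')"
    using a b c by (cases a, cases b, cases c) (auto simp: functor_cat_Hom fg fg')
  have na: "is_nattrans E A F F' \<alpha>" "is_nattrans E A G G' \<beta>" "is_nattrans E A H H' \<gamma>"
    using a b c by (auto simp: functor_cat_Hom abc)
  note sq1 = nmap_square[OF na(2) S(2) S'(2) na(1) sq(1)[unfolded fg fg' abc]]
  note sq2 = nmap_square[OF na(3) S(3) S'(3) na(2) sq(2)[unfolded fg fg' abc]]
  show "FArr (normalized_cohomology (Suc n)) a \<cdot> normalized_connecting n f g = normalized_connecting n f' g' \<cdot> FArr (normalized_cohomology n) c"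
    using connecting_natural[OF S(4) S'(4) nmap_chain_map[OF na(1)] nmap_chain_map[OF na(2)] nmap_chain_map[OF na(3)] sq1 sq2, of n] na
    by (simp add: fg fg' abc normalized_cohomology_arr normalized_connecting_def)
qed

lemma normalized_cohomology_limit_functor: "is_limit_functor E A (normalized_cohomology 0)"
  unfolding is_limit_functor_def
proof (intro conjI normalized_cohomology_functor exI[of _ limit_pr] allI impI ballI)
  show "is_limit E A F (FObj (normalized_cohomology 0) F) (limit_pr F)" if "is_functor E A F" for F
    using limit_pr_limit[OF that] that by (simp add: normalized_cohomology_obj)
  fix F G t c assume "t \<in> Hom fc.FC F G" and c: "c \<in> Obj E"
  then obtain \<eta> where t: "t = (F, \<eta>, G)" and n: "is_nattrans E A F G \<eta>" by (cases t) (auto simp: functor_cat_Hom)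
  note F = nattransD(1)[OF n] and G = nattransD(2)[OF n]
  obtain k x where kx: "c = (k, x)" by (cases c)
  then have x: "x \<in> FObj X k" using c by simp
  define h where "h = hmap (ndiff F) (ndiff G) (nmap F G \<eta>) 0"
  note cm = nmap_chain_map[OF n]
  note cF = normalized_complex[OF F] and cG = normalized_complex[OF G]
  note [simp del] = cohomology.simps
  note [simp] = Z0(1-3)[OF F] Z0(1-3)[OF G] nmap(1-3)[OF n] cF cG cohomology_obj[OF cF, of 0] cohomology_obj[OF cG, of 0]
  have h [simp]: "h \<in> Arr A" "Dom A h = cohomology A (ndiff F) 0" "Cod A h = cohomology A (ndiff G) 0"
    unfolding h_def by (rule hmap(1-3)[OF cm])+
  have zc: "cocycle (ndiff F) 0 (Z0 F)" using zinc_arr[OF cF, of 0] by (simp add: cocycle_def)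
  have cls0: "zcls d 0 = Ident A (Dom A (zinc d 0))" for d by (simp add: zcls_def)
  have "h \<cdot> cls (ndiff F) 0 (Z0 F) = cls (ndiff G) 0 (nmap F G \<eta> 0 \<cdot> Z0 F)" unfolding h_def by (rule hmap_cls[OF cm zc])
  moreover have "cls (ndiff F) 0 (Z0 F) = Ident A (cohomology A (ndiff F) 0)"
    using cls_zinc[OF cF, of "Ident A (cohomology A (ndiff F) 0)" 0] by (simp add: cls0)
  moreover have "Z0 G \<cdot> cls (ndiff G) 0 (nmap F G \<eta> 0 \<cdot> Z0 F) = nmap F G \<eta> 0 \<cdot> Z0 F"
    using cocycle_lift[OF cG chain_map_cocycle[OF cm zc]] by (simp add: cls_def cls0)
  \<comment> \<open>In degree 0 the class of a cocycle is its lift through the kernel, and the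
    universal cocycle has the identity as class; so the induced map is the restriction of
    \<open>nmap\<close> to the kernels.\<close>
  ultimately have zh: "Z0 G \<cdot> h = nmap F G \<eta> 0 \<cdot> Z0 F" by simp
  have kh: "vertex_pr G y \<cdot> h = \<eta> (0, y) \<cdot> vertex_pr F y" if y: "y \<in> FObj X 0" for y
  proof -
    note [simp] = familyD(2-4)[OF nu_family[OF F] y] familyD(2-4)[OF nu_family[OF G] y] nattransD(4-6)[OF n, of "(0, y)"]
    show ?thesis using zh pre_comp[OF nu_nmap[OF n y], of "Z0 F"] y by (simp add: vertex_pr_def)
  qed
  have "limit_pr G c \<cdot> h = transport G (vertex_arr k) (\<lambda>y. vertex_pr G y \<cdot> h) x"
    using transport_comp_right[OF G vertex_arr(1)[of k] _ _ h(1,3), of "vertex_pr G" x] vertex_pr(1)[OF G] x kx by (simp add: limit_pr_def vertex_arr)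
  also have "\<dots> = transport G (vertex_arr k) (\<lambda>y. \<eta> (0, y) \<cdot> vertex_pr F y) x"
    by (rule transport_cong[OF vertex_arr(1)]) (use x kh in \<open>simp_all add: vertex_arr\<close>)
  also have "\<dots> = \<eta> c \<cdot> limit_pr F c"
    using transport_nat[OF n vertex_arr(1)[of k], of "cohomology A (ndiff F) 0" "vertex_pr F" x] vertex_pr(1)[OF F] x kx by (simp add: limit_pr_def vertex_arr)
  finally show "limit_pr G c \<cdot> FArr (normalized_cohomology 0) t = component t c \<cdot> limit_pr F c"
    using n by (simp add: t normalized_cohomology_arr h_def)
qed

section \<open>Effaceability of normalized cohomology\<close>

lemma FC_zero_comp:
  assumes "t \<in> Hom fc.FC F G" "is_functor E A H"
  shows "ZeroArr fc.FC G H \<cdot>\<^bsub>fc.FC\<^esub> t = ZeroArr fc.FC F H"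
  using assms nattransD(4-6)[of E A F G "component t"] functorD(1)[OF assms(2)]
  by (auto simp: functor_cat_Hom intro!: restrict_ext)

lemma FC_desc:
  assumes se: "short_exact fc.FC f g" and t: "t \<in> Hom fc.FC (Cod fc.FC f) K" "t \<cdot>\<^bsub>fc.FC\<^esub> f = ZeroArr fc.FC (Dom fc.FC f) K"
  obtains s where "s \<in> Hom fc.FC (Cod fc.FC g) K" "s \<cdot>\<^bsub>fc.FC\<^esub> g = t"
proof -
  have "is_cokernel fc.FC g f" using se by (simp add: short_exact_def)
  then have "\<exists>!h. h \<in> Hom fc.FC (Cod fc.FC g) K \<and> h \<cdot>\<^bsub>fc.FC\<^esub> g = t"
    using t unfolding is_cokernel_def by blast
  then show thesis using that by blast
qed

lemma FC_exact_zero: "short_exact fc.FC f g \<Longrightarrow> g \<cdot>\<^bsub>fc.FC\<^esub> f = ZeroArr fc.FC (Dom fc.FC f) (Cod fc.FC g)"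
  unfolding short_exact_def is_kernel_def by blast

definition cofree_embedding where "cofree_embedding F = (F, cofree_unit F, cofree F)"

definition cofree_quotient where "cofree_quotient F = (SOME p. short_exact fc.FC (cofree_embedding F) p)"

lemma cofree_embedding_cofree_quotient:
  assumes F: "is_functor E A F"
  shows "short_exact fc.FC (cofree_embedding F) (cofree_quotient F)" "cofree_embedding F \<in> Hom fc.FC F (cofree F)"
proof -
  have "\<exists>p. short_exact fc.FC (cofree_embedding F) p"
    using fc.mono_short_exact[OF cofree_unit(1)[OF F] cofree_unit_mono[OF F]] unfolding cofree_embedding_def by metis
  from someI_ex[OF this] show "short_exact fc.FC (cofree_embedding F) (cofree_quotient F)" unfolding cofree_quotient_def .
  show "cofree_embedding F \<in> Hom fc.FC F (cofree F)" using cofree_unit(1)[OF F] by (simp add: cofree_embedding_def functor_cat_Hom)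
qed

lemma cofree_embedding_extend:
  assumes t: "t \<in> Hom fc.FC F G"
  obtains r where "r \<in> Hom fc.FC (cofree F) (cofree G)" "r \<cdot>\<^bsub>fc.FC\<^esub> cofree_embedding F = cofree_embedding G \<cdot>\<^bsub>fc.FC\<^esub> t"
proof -
  have n: "is_nattrans E A F G (component t)" and st: "fst t = F" "snd (snd t) = G" using t by (auto simp: functor_cat_Hom)
  obtain \<rho> where r: "is_nattrans E A (cofree F) (cofree G) \<rho>" "\<And>c. c \<in> Obj E \<Longrightarrow> \<rho> c \<cdot> cofree_unit F c = cofree_unit G c \<cdot> component t c"
    by (rule cofree_extend[OF n]) blast
  show thesis
    by (rule that[of "(cofree F, \<rho>, cofree G)"]) (use r st in \<open>auto simp: functor_cat_Hom cofree_embedding_def intro!: restrict_ext\<close>)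
qed

lemma FC_desc_cofree_embedding:
  assumes F: "is_functor E A F" and r: "r \<in> Hom fc.FC (cofree F) G" "g \<in> Hom fc.FC G K"
    and eq: "r \<cdot>\<^bsub>fc.FC\<^esub> cofree_embedding F = f" and z: "g \<cdot>\<^bsub>fc.FC\<^esub> f = ZeroArr fc.FC F K"
  obtains q where "q \<in> Hom fc.FC (Cod fc.FC (cofree_quotient F)) K" "q \<cdot>\<^bsub>fc.FC\<^esub> cofree_quotient F = g \<cdot>\<^bsub>fc.FC\<^esub> r"
proof -
  note e = cofree_embedding_cofree_quotient[OF F]
  have d: "Dom fc.FC (cofree_embedding F) = F" "Cod fc.FC (cofree_embedding F) = cofree F" by (simp_all add: cofree_embedding_def)
  have "(g \<cdot>\<^bsub>fc.FC\<^esub> r) \<cdot>\<^bsub>fc.FC\<^esub> cofree_embedding F = g \<cdot>\<^bsub>fc.FC\<^esub> (r \<cdot>\<^bsub>fc.FC\<^esub> cofree_embedding F)"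
    by (rule fc.FC.comp_assoc[OF e(2) r])
  then have "(g \<cdot>\<^bsub>fc.FC\<^esub> r) \<cdot>\<^bsub>fc.FC\<^esub> cofree_embedding F = ZeroArr fc.FC (Dom fc.FC (cofree_embedding F)) K" unfolding eq z d .
  then show thesis using FC_desc[OF e(1), of "g \<cdot>\<^bsub>fc.FC\<^esub> r" K] fc.FC.comp_hom[OF r] d that by metis
qed

lemma normalized_cohomology_effaceable: "effaceable_delta_functor fc.FC A normalized_cohomology normalized_connecting cofree_embedding cofree_quotient"
proof (intro effaceable_delta_functor.intro effaceable_delta_functor_axioms.intro fc.FC.category_axioms abelian_category_axioms normalized_cohomology_delta_functor)
  fix F assume "F \<in> Obj fc.FC"
  then have F: "is_functor E A F" by simp
  show "short_exact fc.FC (cofree_embedding F) (cofree_quotient F)" by (rule cofree_embedding_cofree_quotient[OF F])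
  show "Dom fc.FC (cofree_embedding F) = F" by (simp add: cofree_embedding_def)
  fix n
  note R = cofree_functor[OF F] and u = cofree_unit(1)[OF F]
  note cm = nmap_chain_map[OF u] and cR = normalized_complex[OF R] and cF = normalized_complex[OF F]
  \<comment> \<open>The zero arrow has the defining property of the induced map: every cocycle of
    positive degree with cofree coefficients is a boundary, so each image class vanishes.\<close>
  have "hmap (ndiff F) (ndiff (cofree F)) (nmap F (cofree F) (cofree_unit F)) (Suc n) =
    ZeroArr A (cohomology A (ndiff F) (Suc n)) (cohomology A (ndiff (cofree F)) (Suc n))"
  proof (rule hmap_unique[OF cm])
    note co = cohomology_obj[OF cR, of "Suc n"] cohomology_obj[OF cF, of "Suc n"]
    fix c assume c: "cocycle (ndiff F) (Suc n) c"
    note c' = chain_map_cocycle[OF cm c]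
    have "cls (ndiff (cofree F)) (Suc n) (nmap F (cofree F) (cofree_unit F) (Suc n) \<cdot> c) =
      ZeroArr A (Dom A c) (cohomology A (ndiff (cofree F)) (Suc n))"
      using cls_boundary[OF cR cofree_acyclic[OF F c'] cocycleD(1,2)[OF c']] cocycleD[OF c] nmap[OF u] ndiff[OF F]
      by (simp del: cohomology.simps)
    then show "ZeroArr A (cohomology A (ndiff F) (Suc n)) (cohomology A (ndiff (cofree F)) (Suc n)) \<cdot> cls (ndiff F) (Suc n) c =
      cls (ndiff (cofree F)) (Suc n) (nmap F (cofree F) (cofree_unit F) (Suc n) \<cdot> c)"
      using cls_arr[OF cF c] co by (simp del: cohomology.simps)
  qed (use cohomology_obj[OF cR, of "Suc n"] cohomology_obj[OF cF, of "Suc n"] in \<open>simp_all del: cohomology.simps\<close>)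
  then show "FArr (normalized_cohomology (Suc n)) (cofree_embedding F) = ZeroArr A (FObj (normalized_cohomology (Suc n)) F) (FObj (normalized_cohomology (Suc n)) (Cod fc.FC (cofree_embedding F)))"
    using u F R by (simp add: cofree_embedding_def normalized_cohomology_arr normalized_cohomology_obj del: cohomology.simps)
next
  fix t assume t: "t \<in> Arr fc.FC"
  define F G where "F = fst t" and "G = snd (snd t)"
  have tH: "t \<in> Hom fc.FC F G" using t by (simp add: F_def G_def functor_cat_Arr functor_cat_Hom)
  have F: "is_functor E A F" and G: "is_functor E A G" using FC_nat[OF t] nattransD(1,2) by (auto simp: F_def G_def)
  obtain r where r: "r \<in> Hom fc.FC (cofree F) (cofree G)" "r \<cdot>\<^bsub>fc.FC\<^esub> cofree_embedding F = cofree_embedding G \<cdot>\<^bsub>fc.FC\<^esub> t"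
    by (rule cofree_embedding_extend[OF tH])
  have d: "Dom fc.FC t = F" "Cod fc.FC t = G" "Cod fc.FC (cofree_embedding F) = cofree F" "Cod fc.FC (cofree_embedding G) = cofree G" "Dom fc.FC (cofree_embedding G) = G"
    by (simp_all add: F_def G_def cofree_embedding_def)
  define K where "K = Cod fc.FC (cofree_quotient G)"
  have q: "cofree_quotient G \<in> Hom fc.FC (cofree G) K"
    using short_exact_arr[OF cofree_embedding_cofree_quotient(1)[OF G]] by (simp add: K_def Hom_iff cofree_embedding_def)
  have K: "is_functor E A K" using fc.FC.cod_obj[of "cofree_quotient G"] short_exact_arr(2)[OF cofree_embedding_cofree_quotient(1)[OF G]] by (simp add: K_def)
  have "cofree_quotient G \<cdot>\<^bsub>fc.FC\<^esub> (cofree_embedding G \<cdot>\<^bsub>fc.FC\<^esub> t) = (cofree_quotient G \<cdot>\<^bsub>fc.FC\<^esub> cofree_embedding G) \<cdot>\<^bsub>fc.FC\<^esub> t"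
    by (rule fc.FC.comp_assoc[OF tH cofree_embedding_cofree_quotient(2)[OF G] q, symmetric])
  also have "\<dots> = ZeroArr fc.FC F K"
    unfolding FC_exact_zero[OF cofree_embedding_cofree_quotient(1)[OF G]] d K_def[symmetric] by (rule FC_zero_comp[OF tH K])
  finally have z: "cofree_quotient G \<cdot>\<^bsub>fc.FC\<^esub> (cofree_embedding G \<cdot>\<^bsub>fc.FC\<^esub> t) = ZeroArr fc.FC F K" .
  obtain s where s: "s \<in> Hom fc.FC (Cod fc.FC (cofree_quotient F)) K" "s \<cdot>\<^bsub>fc.FC\<^esub> cofree_quotient F = cofree_quotient G \<cdot>\<^bsub>fc.FC\<^esub> r"
    by (rule FC_desc_cofree_embedding[OF F r(1) q r(2) z])
  show "\<exists>r s. r \<in> Hom fc.FC (Cod fc.FC (cofree_embedding (Dom fc.FC t))) (Cod fc.FC (cofree_embedding (Cod fc.FC t))) \<and>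
     s \<in> Hom fc.FC (Cod fc.FC (cofree_quotient (Dom fc.FC t))) (Cod fc.FC (cofree_quotient (Cod fc.FC t))) \<and>
     r \<cdot>\<^bsub>fc.FC\<^esub> cofree_embedding (Dom fc.FC t) = cofree_embedding (Cod fc.FC t) \<cdot>\<^bsub>fc.FC\<^esub> t \<and> s \<cdot>\<^bsub>fc.FC\<^esub> cofree_quotient (Dom fc.FC t) = cofree_quotient (Cod fc.FC t) \<cdot>\<^bsub>fc.FC\<^esub> r"
    unfolding d K_def[symmetric] using r s by blast
next
  fix f g assume se: "short_exact fc.FC f g"
  obtain F \<eta> G G' \<theta> H where fg: "f = (F, \<eta>, G)" "g = (G', \<theta>, H)" by (cases f, cases g)
  note S = normalized_cohomology_complexes[OF se[unfolded fg]]
  note F = nattransD(1)[OF S(2)] and G = nattransD(2)[OF S(2)]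
  have fH: "f \<in> Hom fc.FC F G" using S(2) fg by (simp add: functor_cat_Hom)
  have d: "Dom fc.FC f = F" "Cod fc.FC f = G" "Cod fc.FC (cofree_embedding F) = cofree F" "Cod fc.FC (cofree_embedding G) = cofree G" "Cod fc.FC g = H"
    by (simp_all add: fg cofree_embedding_def)
  \<comment> \<open>Followed by the embedding of its target, \<open>f\<close> is still a
    monomorphism at each object and so has a cokernel \<open>g'\<close> completing it to a short
    exact sequence. The arrows \<open>c\<close> and \<open>q\<close> come from the universal
    properties of \<open>g\<close> and of the quotient of \<open>F\<close>, because
    \<open>g'\<close> kills \<open>f'\<close>.\<close>
  define f' where "f' = cofree_embedding G \<cdot>\<^bsub>fc.FC\<^esub> f"
  have f': "f' \<in> Hom fc.FC F (cofree G)" unfolding f'_def by (rule fc.FC.comp_hom[OF fH cofree_embedding_cofree_quotient(2)[OF G]])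
  then have nf': "is_nattrans E A F (cofree G) (component f')" and tf': "f' = (F, component f', cofree G)"
    by (auto simp: functor_cat_Hom component_def prod_eq_iff)
  have "mono_arr A (component f' c)" if c: "c \<in> Obj E" for c
  proof -
    have "component f' c = cofree_unit G c \<cdot> \<eta> c" using c by (simp add: f'_def cofree_embedding_def fg)
    moreover have "mono_arr A \<dots>"
      by (rule mono_comp[OF cofree_unit_mono[OF G c] short_exactD(3)])
        (use fc.short_exactD_pointwise[OF se c] c nattransD(4-6)[OF S(2) c] nattransD(4-6)[OF cofree_unit(1)[OF G] c] in \<open>auto simp: fg\<close>)
    ultimately show ?thesis by simp
  qed
  then obtain K \<kappa> where K: "is_nattrans E A (cofree G) K \<kappa>" "short_exact fc.FC (F, component f', cofree G) (cofree G, \<kappa>, K)"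
    using fc.mono_short_exact[OF nf'] by blast
  define g' where "g' = (cofree G, \<kappa>, K)"
  have se': "short_exact fc.FC f' g'" using K(2) tf' by (simp add: g'_def)
  have g': "g' \<in> Hom fc.FC (cofree G) K" using K(1) by (simp add: g'_def functor_cat_Hom)
  have dg: "Cod fc.FC g' = K" "Dom fc.FC f' = F" using f' by (simp_all add: g'_def functor_cat_Hom)
  have z: "g' \<cdot>\<^bsub>fc.FC\<^esub> f' = ZeroArr fc.FC F K" using FC_exact_zero[OF se'] dg by simp
  have "(g' \<cdot>\<^bsub>fc.FC\<^esub> cofree_embedding G) \<cdot>\<^bsub>fc.FC\<^esub> f = ZeroArr fc.FC (Dom fc.FC f) K"
    unfolding fc.FC.comp_assoc[OF fH cofree_embedding_cofree_quotient(2)[OF G] g'] d using z unfolding f'_def .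
  moreover have "g' \<cdot>\<^bsub>fc.FC\<^esub> cofree_embedding G \<in> Hom fc.FC (Cod fc.FC f) K" unfolding d by (rule fc.FC.comp_hom[OF cofree_embedding_cofree_quotient(2)[OF G] g'])
  ultimately obtain c where c: "c \<in> Hom fc.FC (Cod fc.FC g) K" "c \<cdot>\<^bsub>fc.FC\<^esub> g = g' \<cdot>\<^bsub>fc.FC\<^esub> cofree_embedding G"
    using FC_desc[OF se] by metis
  obtain r where r: "r \<in> Hom fc.FC (cofree F) (cofree G)" "r \<cdot>\<^bsub>fc.FC\<^esub> cofree_embedding F = f'"
    using cofree_embedding_extend[OF fH] unfolding f'_def by metis
  obtain q where q: "q \<in> Hom fc.FC (Cod fc.FC (cofree_quotient F)) K" "q \<cdot>\<^bsub>fc.FC\<^esub> cofree_quotient F = g' \<cdot>\<^bsub>fc.FC\<^esub> r"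
    by (rule FC_desc_cofree_embedding[OF F r(1) g' r(2) z])
  show "\<exists>g' c r q. short_exact fc.FC (cofree_embedding (Cod fc.FC f) \<cdot>\<^bsub>fc.FC\<^esub> f) g' \<and>
      c \<in> Hom fc.FC (Cod fc.FC g) (Cod fc.FC g') \<and> c \<cdot>\<^bsub>fc.FC\<^esub> g = g' \<cdot>\<^bsub>fc.FC\<^esub> cofree_embedding (Cod fc.FC f) \<and>
      r \<in> Hom fc.FC (Cod fc.FC (cofree_embedding (Dom fc.FC f))) (Cod fc.FC (cofree_embedding (Cod fc.FC f))) \<and>
      r \<cdot>\<^bsub>fc.FC\<^esub> cofree_embedding (Dom fc.FC f) = cofree_embedding (Cod fc.FC f) \<cdot>\<^bsub>fc.FC\<^esub> f \<and>
      q \<in> Hom fc.FC (Cod fc.FC (cofree_quotient (Dom fc.FC f))) (Cod fc.FC g') \<and> q \<cdot>\<^bsub>fc.FC\<^esub> cofree_quotient (Dom fc.FC f) = g' \<cdot>\<^bsub>fc.FC\<^esub> r"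
  proof (intro exI conjI)
    show "short_exact fc.FC (cofree_embedding (Cod fc.FC f) \<cdot>\<^bsub>fc.FC\<^esub> f) g'" unfolding d(2) using se' unfolding f'_def .
    show "c \<in> Hom fc.FC (Cod fc.FC g) (Cod fc.FC g')" unfolding dg by (rule c(1))
    show "c \<cdot>\<^bsub>fc.FC\<^esub> g = g' \<cdot>\<^bsub>fc.FC\<^esub> cofree_embedding (Cod fc.FC f)" unfolding d(2) by (rule c(2))
    show "r \<in> Hom fc.FC (Cod fc.FC (cofree_embedding (Dom fc.FC f))) (Cod fc.FC (cofree_embedding (Cod fc.FC f)))" unfolding d by (rule r(1))
    show "r \<cdot>\<^bsub>fc.FC\<^esub> cofree_embedding (Dom fc.FC f) = cofree_embedding (Cod fc.FC f) \<cdot>\<^bsub>fc.FC\<^esub> f" unfolding d r(2) f'_def by (rule refl)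
    show "q \<in> Hom fc.FC (Cod fc.FC (cofree_quotient (Dom fc.FC f))) (Cod fc.FC g')" unfolding d dg by (rule q(1))
    show "q \<cdot>\<^bsub>fc.FC\<^esub> cofree_quotient (Dom fc.FC f) = g' \<cdot>\<^bsub>fc.FC\<^esub> r" unfolding d by (rule q(2))
  qed
qed

lemma normalized_cohomology_universal: "universal_delta_functor fc.FC A normalized_cohomology normalized_connecting"
  by (rule effaceable_delta_functor.universal[OF normalized_cohomology_effaceable])

end

theorem corollary5p2:
  fixes A :: "('o, 'm) abcat"
    and X :: "'u cubical"
    and F :: "(nat \<times> 'u, 'u el_arr, 'o, 'm) ftor"
  assumes "infinite (UNIV :: 'u set)"
    and "ab4star TYPE('u) A"
    and "cubical_set X"
    and "is_functor (el_cat X) A F"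
  shows "(\<exists>L. right_satellites_lim (el_cat X) A L) \<and>
    (\<forall>L. right_satellites_lim (el_cat X) A L \<longrightarrow>
      (\<forall>n. isomorphic A (cohomology A (normalized_diff A X F) n) (FObj (L n) F)))"
proof -
  interpret abelian_category A using assms(2) by (simp add: ab4star_def)
  interpret cubical_coefficients X A
    using assms by unfold_locales (auto simp: ab4star_def)
  have normalized_cohomology: "right_satellites_lim (el_cat X) A normalized_cohomology"
    unfolding right_satellites_lim_def using normalized_cohomology_limit_functor normalized_cohomology_universal by blast
  moreover have "isomorphic A (cohomology A (ndiff F) n) (FObj (L n) F)"
    if L: "right_satellites_lim (el_cat X) A L" for L n
  proof -
    \<comment> \<open>Any two choices of satellites are universal and agree in degree 0 up to
      isomorphism, being limit functors there; so they agree in all degrees.\<close>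
    obtain \<delta> where u: "universal_delta_functor fc.FC A L \<delta>" and l: "is_limit_functor (el_cat X) A (L 0)"
      using L unfolding right_satellites_lim_def by blast
    have "isomorphic A (FObj (normalized_cohomology n) F) (FObj (L n) F)"
      by (rule universal_iso[OF fc.FC.category_axioms category_axioms normalized_cohomology_universal u
            fc.limit_functors_iso[OF normalized_cohomology_limit_functor l]]) (use assms(4) in simp)
    then show ?thesis using normalized_cohomology_obj[OF assms(4)] by simp
  qed
  ultimately show ?thesis by blast
qed

end
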